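(* Let $k$ be an algebraically closed field of arbitrary characteristic. For every integer $d\ge1$, statement ($C_d$) holds for non-degenerate hypersurfaces at the origin: there exists $N_d\in\mathbb N$ depending only on $d$ such that for every non-degenerate polynomial $f\in k[X_0,\dots,X_d]$ with $f(0)=0$, defining a hypersurface $X\subset\mathbb A_k^{d+1}$ which is a variety, there is $m\le N_d$ such that either $s_m(X,0)=\mathrm{mld}_{\mathrm{MJ}}(0;X)\ge0$, or $\mathrm{mld}_{\mathrm{MJ}}(0;X)=-\infty$ and $s_m(X,0)<0$.
   Context: A variety is an equidimensional reduced connected scheme of finite type over $k$. Newton polygon. Let $M=\mathbb Z^{d+1}$ and write $f=\sum_{\mathbf m\in M}a_{\mathbf m}X^{\mathbf m}$. The Newton polygon $\Gamma_+(f)$ is the convex hull in $\mathbb R^{d+1}$ of $\bigcup_{a_{\mathbf m}\ne0}(\mathbf m+\mathbb R_{\ge0}^{d+1})$. The polynomial $f$ is non-degenerate if for every face $\gamma$ of $\Gamma_+(f)$ (compact or not) the equations $\partial f_\gamma/\partial X_i=0$ $(i=0,\dots,d)$ have no common zeros on $(\mathbb A^1_k\setminus\{0\})^{d+1}$, where $f_\gamma=\sum_{\mathbf m\in\gamma}a_{\mathbf m}X^{\mathbf m}$. For a $d$-dimensional variety $X$ and closed point $x$, $X_m$ is the $m$-jet scheme, $X_m(x)$ the fiber over $x$ of the truncation morphism $X_m\to X$, and $s_m(X,x)=(m+1)d-\dim X_m(x)$. The Mather-Jacobian minimal log discrepancy is $\mathrm{mld}_{\mathrm{MJ}}(x;X)=\mathrm{mld}(x;A,I_X^c)$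 for $X\subset A$ of codimension $c$ in a non-singular variety $A$ with ideal $I_X$ (the infimum of $k_E+1-c\cdot\mathrm{val}_E(I_X)$ over prime divisors $E$ over $A$ with center $x$); it equals $\inf_m s_m(X,x)$. *)

theory Defs
  imports
    "HOL-Analysis.Analysis"
    "HOL-Analysis.Finite_Function_Topology"
    "HOL-Computational_Algebra.Computational_Algebra"
    "HOL-Algebra.Algebraic_Closure_Type"
    "HOL-Algebra.Generated_Rings"
    "Jordan_Normal_Form.Determinant"
begin

section \<open>Polynomials and rational functions\<close>

type_synonym ('v, 'k) mpol = "('v \<Rightarrow>\<^sub>0 nat) \<Rightarrow>\<^sub>0 'k"

definition mpol_const :: "'k::comm_ring_1 \<Rightarrow> ('v, 'k) mpol" where
  "mpol_const c = Poly_Mapping.single 0 c"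

definition mpol_var :: "'v \<Rightarrow> ('v, 'k::comm_ring_1) mpol" where
  "mpol_var v = Poly_Mapping.single (Poly_Mapping.single v 1) 1"

definition mpol_in :: "'v set \<Rightarrow> ('v, 'k::comm_ring_1) mpol set" where
  "mpol_in V = {p. \<forall>m\<in>Poly_Mapping.keys p. Poly_Mapping.keys m \<subseteq> V}"

definition mpol_ring :: "'v set \<Rightarrow> ('v, 'k::comm_ring_1) mpol ring" where
  "mpol_ring V = ring_of_type_algebra\<lparr>carrier := mpol_in V\<rparr>"

text \<open>The value of the homomorphism that is \<open>h\<close> on the coefficients and \<open>a\<close> on the variables.\<close>

definition mpol_subst ::
    "('k::comm_ring_1 \<Rightarrow> 'b::comm_ring_1) \<Rightarrow> ('v \<Rightarrow> 'b) \<Rightarrow> ('v, 'k) mpol \<Rightarrow> 'b" where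
  "mpol_subst h a p = (\<Sum>m\<in>Poly_Mapping.keys p. h (Poly_Mapping.lookup p m) *
      (\<Prod>v\<in>Poly_Mapping.keys m. a v ^ Poly_Mapping.lookup m v))"

abbreviation mpol_eval :: "('v \<Rightarrow> 'k::comm_ring_1) \<Rightarrow> ('v, 'k) mpol \<Rightarrow> 'k" where
  "mpol_eval \<equiv> mpol_subst (\<lambda>c. c)"

definition mpol_deriv :: "'v \<Rightarrow> ('v, 'k::comm_ring_1) mpol \<Rightarrow> ('v, 'k) mpol" where
  "mpol_deriv v p = (\<Sum>m\<in>Poly_Mapping.keys p. Poly_Mapping.single (m - Poly_Mapping.single v 1)
      (of_nat (Poly_Mapping.lookup m v) * Poly_Mapping.lookup p m))"

text \<open>Rational functions in countably many variables; \<open>function_field d\<close> is the subfield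
  \<open>k(X\<^sub>0, \<dots>, X\<^sub>d)\<close>, the function field of affine \<open>(d+1)\<close>-space.\<close>

type_synonym 'k ratfun = "(nat, 'k) mpol fract"

definition function_field :: "nat \<Rightarrow> 'k::field ratfun set" where
  "function_field d = {Fract p q | p q. p \<in> mpol_in {..d} \<and> q \<in> mpol_in {..d} \<and> q \<noteq> 0}"


section \<open>Newton polygon and non-degeneracy\<close>

definition real_exponent :: "('v \<Rightarrow>\<^sub>0 nat) \<Rightarrow> ('v \<Rightarrow>\<^sub>0 real)" where
  "real_exponent m = Poly_Mapping.map real m"

definition nonneg_orthant :: "nat \<Rightarrow> (nat \<Rightarrow>\<^sub>0 real) set" where
  "nonneg_orthant d = {u. Poly_Mapping.keys u \<subseteq> {..d} \<and> (\<forall>i. 0 \<le> Poly_Mapping.lookup u i)}"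

definition newton_polygon :: "nat \<Rightarrow> (nat, 'k::field) mpol \<Rightarrow> (nat \<Rightarrow>\<^sub>0 real) set" where
  "newton_polygon d f =
     convex hull (\<Union>m\<in>Poly_Mapping.keys f. {real_exponent m + u | u. u \<in> nonneg_orthant d})"

definition face_part :: "(nat \<Rightarrow>\<^sub>0 real) set \<Rightarrow> (nat, 'k::field) mpol \<Rightarrow> (nat, 'k) mpol" where
  "face_part \<gamma> f = (\<Sum>m | m \<in> Poly_Mapping.keys f \<and> real_exponent m \<in> \<gamma>.
      Poly_Mapping.single m (Poly_Mapping.lookup f m))"

text \<open>\<open>face_of\<close> admits the empty set, which is not a face in the sense meant here; the Newton
  polygon itself is a (non-compact) face.\<close>

definition newton_nondegenerate :: "nat \<Rightarrow> (nat, 'k::field) mpol \<Rightarrow> bool" where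
  "newton_nondegenerate d f \<longleftrightarrow>
     (\<forall>\<gamma>. \<gamma> face_of newton_polygon d f \<and> \<gamma> \<noteq> {} \<longrightarrow>
        \<not> (\<exists>a. (\<forall>i\<le>d. a i \<noteq> 0) \<and> (\<forall>i\<le>d. mpol_eval a (mpol_deriv i (face_part \<gamma> f)) = 0)))"


section \<open>Affine schemes and varieties\<close>

text \<open>An affine scheme is given by its coordinate ring.\<close>

definition Spec :: "('a, 'b) ring_scheme \<Rightarrow> 'a set topology" where
  "Spec A = topology_generated_by {{P. primeideal P A \<and> a \<notin> P} | a. a \<in> carrier A}"

definition krull_dim :: "('a, 'b) ring_scheme \<Rightarrow> enat" where
  "krull_dim A = (SUP n \<in> {n. \<exists>P. (\<forall>i\<le>n. primeideal (P i) A) \<and> (\<forall>i<n. P i \<subset> P (Suc i))}. enat n)"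

definition minimal_prime :: "'a set \<Rightarrow> ('a, 'b) ring_scheme \<Rightarrow> bool" where
  "minimal_prime P A \<longleftrightarrow> primeideal P A \<and> (\<forall>Q. primeideal Q A \<and> Q \<subseteq> P \<longrightarrow> Q = P)"

definition reduced_ring :: "('a, 'b) ring_scheme \<Rightarrow> bool" where
  "reduced_ring A \<longleftrightarrow> (\<forall>a\<in>carrier A. \<forall>n::nat. a [^]\<^bsub>A\<^esub> n = \<zero>\<^bsub>A\<^esub> \<longrightarrow> a = \<zero>\<^bsub>A\<^esub>)"

text \<open>The irreducible components of \<open>Spec A\<close> are the \<open>Spec (A/P)\<close> for the minimal primes \<open>P\<close>.\<close>

definition equidimensional :: "('a, 'b) ring_scheme \<Rightarrow> bool" where
  "equidimensional A \<longleftrightarrow> (\<forall>P Q. minimal_prime P A \<and> minimal_prime Q A \<longrightarrow>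
      krull_dim (A Quot P) = krull_dim (A Quot Q))"

text \<open>For a coordinate ring \<open>A\<close> that is a quotient of a polynomial ring in finitely many variables,
  so that finite type is automatic.\<close>

definition affine_variety :: "('a, 'b) ring_scheme \<Rightarrow> bool" where
  "affine_variety A \<longleftrightarrow> equidimensional A \<and> reduced_ring A \<and> connected_space (Spec A)"

definition hypersurface_ideal :: "nat \<Rightarrow> (nat, 'k::field) mpol \<Rightarrow> (nat, 'k) mpol set" where
  "hypersurface_ideal d f = PIdl\<^bsub>mpol_ring {..d}\<^esub> f"

definition hypersurface_ring :: "nat \<Rightarrow> (nat, 'k::field) mpol \<Rightarrow> (nat, 'k) mpol set ring" where
  "hypersurface_ring d f = mpol_ring {..d} Quot hypersurface_ideal d f"


section \<open>Jet schemes\<close>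

text \<open>The variable \<open>(i, j)\<close> is the coefficient of \<open>t\<^sup>j\<close> in the \<open>i\<close>-th coordinate of the universal
  \<open>m\<close>-jet of affine space.\<close>

definition universal_jet :: "nat \<Rightarrow> nat \<Rightarrow> (nat \<times> nat, 'k::field) mpol poly" where
  "universal_jet m i = (\<Sum>j\<le>m. Polynomial.monom (mpol_var (i, j)) j)"

definition jet_equation :: "nat \<Rightarrow> (nat, 'k::field) mpol \<Rightarrow> nat \<Rightarrow> (nat \<times> nat, 'k) mpol" where
  "jet_equation m f l =
     Polynomial.coeff (mpol_subst (\<lambda>c. [:mpol_const c:]) (universal_jet m) f) l"

text \<open>Coordinate ring of the fiber \<open>X\<^sub>m(x)\<close> for the hypersurface \<open>X = {f = 0}\<close>.\<close>

definition jet_fiber_ring ::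
    "nat \<Rightarrow> (nat, 'k::field) mpol \<Rightarrow> nat \<Rightarrow> (nat \<Rightarrow> 'k) \<Rightarrow> (nat \<times> nat, 'k) mpol set ring" where
  "jet_fiber_ring d f m x =
     (let R = mpol_ring ({..d} \<times> {..m}) in
      R Quot (Idl\<^bsub>R\<^esub> ({jet_equation m f l | l. l \<le> m} \<union>
                     {mpol_var (i, 0) - mpol_const (x i) | i. i \<le> d})))"

definition jet_s :: "nat \<Rightarrow> (nat, 'k::field) mpol \<Rightarrow> nat \<Rightarrow> (nat \<Rightarrow> 'k) \<Rightarrow> ereal" where
  "jet_s d f m x = ereal (real ((m + 1) * d)) - ereal_of_enat (krull_dim (jet_fiber_ring d f m x))"


section \<open>Prime divisors over affine space and minimal log discrepancies\<close>

text \<open>A prime divisor \<open>E\<close> over \<open>A = \<bbbA>\<^sup>d\<^sup>+\<^sup>1\<close>, i.e. on a normal variety \<open>Y\<close> with a (proper) birational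
  morphism to \<open>A\<close>, is represented by an affine chart \<open>U \<subseteq> Y\<close> that meets \<open>E\<close>: \<open>B\<close> is the
  coordinate ring of \<open>U\<close>, a finitely generated normal \<open>k\<close>-subalgebra of the function field of \<open>A\<close>
  that contains the coordinates of \<open>A\<close>, and \<open>P\<close> is the height one prime of \<open>B\<close> that defines
  \<open>E \<inter> U\<close>. Properness imposes no condition on the pair \<open>(B, P)\<close>: the chart \<open>U\<close> can be
  embedded as an open subset in a normal variety that is proper over \<open>A\<close>.\<close>

definition ratfun_coord :: "nat \<Rightarrow> 'k::field ratfun" where
  "ratfun_coord i = to_fract (mpol_var i)"

definition ratfun_const :: "'k::field \<Rightarrow> 'k ratfun" where
  "ratfun_const c = to_fract (mpol_const c)"

definition integrally_closed_in :: "'a::field set \<Rightarrow> 'a set \<Rightarrow> bool" where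
  "integrally_closed_in K B \<longleftrightarrow>
     (\<forall>z\<in>K. (\<exists>p. Polynomial.lead_coeff p = 1 \<and> (\<forall>i. Polynomial.coeff p i \<in> B) \<and> poly p z = 0)
        \<longrightarrow> z \<in> B)"

definition subring_of :: "'a::field set \<Rightarrow> 'a ring" where
  "subring_of B = ring_of_type_algebra\<lparr>carrier := B\<rparr>"

definition height_one_prime :: "'a::field set \<Rightarrow> 'a set \<Rightarrow> bool" where
  "height_one_prime P B \<longleftrightarrow> primeideal P (subring_of B) \<and> P \<noteq> {0} \<and>
     (\<forall>Q. primeideal Q (subring_of B) \<and> Q \<subset> P \<longrightarrow> Q = {0})"

definition prime_divisor_over :: "nat \<Rightarrow> 'k::field ratfun set \<Rightarrow> 'k ratfun set \<Rightarrow> bool" where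
  "prime_divisor_over d B P \<longleftrightarrow>
     (\<exists>S. finite S \<and> S \<subseteq> function_field d \<and>
          B = generate_ring ring_of_type_algebra (range ratfun_const \<union> S)) \<and>
     (\<forall>i\<le>d. ratfun_coord i \<in> B) \<and>
     integrally_closed_in (function_field d) B \<and>
     height_one_prime P B"

text \<open>The prime ideal of the generic point of the image of \<open>E\<close> in affine space is that of \<open>x\<close>.\<close>

definition has_center ::
    "nat \<Rightarrow> 'k::field ratfun set \<Rightarrow> (nat \<Rightarrow> 'k) \<Rightarrow> bool" where
  "has_center d P x \<longleftrightarrow>
     {g \<in> mpol_in {..d}. to_fract g \<in> P} = {g \<in> mpol_in {..d}. mpol_eval x g = 0}"

text \<open>The discrete valuation ring \<open>\<O>\<^bsub>Y,E\<^esub>\<close> and its maximal ideal.\<close>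

definition local_ring :: "'a::field set \<Rightarrow> 'a set \<Rightarrow> 'a set" where
  "local_ring B P = {a / b | a b. a \<in> B \<and> b \<in> B - P}"

definition local_maximal_ideal :: "'a::field set \<Rightarrow> 'a set \<Rightarrow> 'a set" where
  "local_maximal_ideal B P = {a / b | a b. a \<in> P \<and> b \<in> B - P}"

text \<open>Meaningful for \<open>g \<noteq> 0\<close> in the local ring; \<open>\<pi>\<close> is a uniformizer.\<close>

definition ord_along :: "'a::field set \<Rightarrow> 'a set \<Rightarrow> 'a \<Rightarrow> nat" where
  "ord_along B P g = (THE n. \<exists>\<pi> u. local_maximal_ideal B P = (\<lambda>h. \<pi> * h) ` local_ring B P \<and>
      u \<in> local_ring B P - local_maximal_ideal B P \<and> g = u * \<pi> ^ n)"

definition val_ideal :: "'k::field ratfun set \<Rightarrow> 'k ratfun set \<Rightarrow> (nat, 'k) mpol set \<Rightarrow> nat" where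
  "val_ideal B P I = (LEAST n. \<exists>g\<in>I - {0}. ord_along B P (to_fract g) = n)"

definition function_field_derivation :: "nat \<Rightarrow> ('k::field ratfun \<Rightarrow> 'k ratfun) \<Rightarrow> bool" where
  "function_field_derivation d D \<longleftrightarrow>
     (\<forall>g\<in>function_field d. D g \<in> function_field d) \<and>
     (\<forall>c. D (ratfun_const c) = 0) \<and>
     (\<forall>g\<in>function_field d. \<forall>h\<in>function_field d.
        D (g + h) = D g + D h \<and> D (g * h) = g * D h + h * D g)"

text \<open>Local coordinates \<open>y\<^sub>0, \<dots>, y\<^sub>d\<close> of \<open>Y\<close> at the generic point of \<open>E\<close>, that is, functions whose
  differentials are a basis of \<open>\<Omega>\<^bsub>\<O>/k\<^esub>\<close> for \<open>\<O> = \<O>\<^bsub>Y,E\<^esub>\<close>, together with the partial derivatives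
  \<open>D i\<close> with respect to them. As \<open>k\<close> is perfect, \<open>\<O>\<close> is smooth over \<open>k\<close> and \<open>\<Omega>\<^bsub>\<O>/k\<^esub>\<close> is free
  of rank \<open>d+1\<close>; the existence of \<open>k\<close>-derivations \<open>D i\<close> of \<open>\<O>\<close> dual to the \<open>y j\<close> is then the
  same as the \<open>dy\<^sub>j\<close> being a basis.\<close>

definition local_coordinates ::
    "nat \<Rightarrow> 'k::field ratfun set \<Rightarrow> 'k ratfun set \<Rightarrow> (nat \<Rightarrow> 'k ratfun)
      \<Rightarrow> (nat \<Rightarrow> 'k ratfun \<Rightarrow> 'k ratfun) \<Rightarrow> bool" where
  "local_coordinates d B P y D \<longleftrightarrow>
     (\<forall>i\<le>d. y i \<in> local_ring B P) \<and>
     (\<forall>i\<le>d. function_field_derivation d (D i) \<and> (\<forall>g\<in>local_ring B P. D i g \<in> local_ring B P)) \<and>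
     (\<forall>i\<le>d. \<forall>j\<le>d. D i (y j) = of_bool (i = j))"

definition jacobian :: "nat \<Rightarrow> (nat \<Rightarrow> 'k::field ratfun \<Rightarrow> 'k ratfun) \<Rightarrow> 'k ratfun" where
  "jacobian d D = Determinant.det (mat (d + 1) (d + 1) (\<lambda>(i, j). D i (ratfun_coord j)))"

text \<open>The coefficient \<open>k\<^sub>E\<close> of \<open>E\<close> in the relative canonical divisor \<open>K\<^bsub>Y/A\<^esub>\<close>: in local coordinates
  the pullback of \<open>dX\<^sub>0 \<and> \<dots> \<and> dX\<^sub>d\<close> is the Jacobian determinant times \<open>dy\<^sub>0 \<and> \<dots> \<and> dy\<^sub>d\<close>. The order
  does not depend on the coordinates.\<close>

definition canonical_coeff :: "nat \<Rightarrow> 'k::field ratfun set \<Rightarrow> 'k ratfun set \<Rightarrow> nat" where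
  "canonical_coeff d B P =
     (THE n. \<exists>y D. local_coordinates d B P y D \<and> ord_along B P (jacobian d D) = n)"

text \<open>\<open>mld(x; \<bbbA>\<^sup>d\<^sup>+\<^sup>1, I\<^sup>c)\<close> for a nonzero ideal \<open>I\<close>.\<close>

definition mld :: "nat \<Rightarrow> (nat \<Rightarrow> 'k::field) \<Rightarrow> (nat, 'k) mpol set \<Rightarrow> nat \<Rightarrow> ereal" where
  "mld d x I c =
     (INF (B, P) \<in> {(B, P). prime_divisor_over d B P \<and> has_center d P x}.
        ereal (real (canonical_coeff d B P) + 1 - real c * real (val_ideal B P I)))"

text \<open>The hypersurface has codimension \<open>1\<close>.\<close>

definition mld_MJ :: "nat \<Rightarrow> (nat \<Rightarrow> 'k::field) \<Rightarrow> (nat, 'k) mpol \<Rightarrow> ereal" where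
  "mld_MJ d x f = mld d x (hypersurface_ideal d f) 1"

end

theory Submission
  imports Defs "Jordan_Normal_Form.Char_Poly"
begin

text \<open>For a weight vector \<open>w\<close> with entries \<open>w i \<ge> 1\<close> let \<open>l w\<close> be the least weight of a monomial of
  \<open>f\<close> and put \<open>\<phi> w = (\<Sum>i. w i) - l w\<close>. Everything is governed by the minimum of \<open>\<phi>\<close>.

  A prime divisor centered at the origin gives the weights \<open>w i = ord (x i)\<close>, and non-degeneracy,
  applied to the face on which \<open>w\<close> is minimal, bounds its log discrepancy from below by \<open>\<phi> w\<close>; for
  primitive \<open>w\<close> the toric divisor of weight \<open>w\<close> has log discrepancy at most \<open>\<phi> w\<close>. So the minimal log
  discrepancy is the minimum of \<open>\<phi>\<close> if \<open>\<phi>\<close> is nonnegative, and \<open>-\<infinity>\<close> otherwise.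

  The jets of contact order at least \<open>w\<close> with the coordinate hyperplanes are contained in \<open>X\<close> up to
  order \<open>l w - 1\<close>, which bounds \<open>s\<^sub>m\<close> from above for \<open>m = l w - 1\<close>. Conversely, along a prime of the jet
  fiber with contact orders \<open>w\<close>, non-degeneracy lets one solve the jet equations of order at least
  \<open>l w\<close> for the coefficients of one coordinate, whence \<open>s\<^sub>m \<ge> min \<phi>\<close>.

  Finally, \<open>\<phi> w \<le> c\<close> only depends on which exponents have weight at least \<open>(\<Sum>i. w i) - c\<close>. The
  complements of these sets are finite down-sets, and finite down-sets are well-quasi-ordered by
  inclusion, so for each of the finitely many relevant \<open>c\<close> finitely many \<open>w\<close> suffice to test it.\<close>

section \<open>Subrings and prime ideals as sets\<close>

text \<open>Two obstacles shape the argument. The weights are unbounded, whereas \<open>N\<close>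
  may depend on \<open>d\<close> alone; what helps is that only finitely many thresholds matter,
  since the weight with all entries 1 has \<phi> \<le> \<open>d\<close> as \<open>f\<close> has no
  constant term, and negative values all count alike. The characteristic is arbitrary, so a weight
  may vanish in the field. Upper bounds for log discrepancies therefore use that a primitive weight
  has an entry that is nonzero in the field, while lower bounds use Jacobian determinants, in which
  a vanishing weight only raises the order. Primitivity is essential for toric divisors; a
  nonnegative minimum of \<phi> is also taken at a primitive weight because \<phi> is homogeneous,
  and a ray on which \<phi> is negative is approximated by primitive weights. Nondegeneracy speaks
  of points over the field, but valuations and primes of jet fibers have larger residue fields; the
  Nullstellensatz mediates. Krull dimension is bounded above by counting: elements picked along a
  chain of primes are algebraically independent, but their monomials lie in boxes whose dimension
  grows too slowly when the chain is too long.\<close>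

definition subring_set :: "'a::comm_ring_1 set \<Rightarrow> bool" where
  "subring_set A \<longleftrightarrow> 1 \<in> A \<and> (\<forall>x\<in>A. \<forall>y\<in>A. x - y \<in> A \<and> x * y \<in> A)"

definition ideal_of :: "'a::comm_ring_1 set \<Rightarrow> 'a set \<Rightarrow> bool" where
  "ideal_of A J \<longleftrightarrow> J \<subseteq> A \<and> 0 \<in> J \<and> (\<forall>x\<in>J. \<forall>y\<in>J. x + y \<in> J) \<and> (\<forall>a\<in>A. \<forall>x\<in>J. a * x \<in> J)"

definition prime_of :: "'a::comm_ring_1 set \<Rightarrow> 'a set \<Rightarrow> bool" where
  "prime_of A Q \<longleftrightarrow> ideal_of A Q \<and> 1 \<notin> Q \<and> (\<forall>a\<in>A. \<forall>b\<in>A. a * b \<in> Q \<longrightarrow> a \<in> Q \<or> b \<in> Q)"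

context
  fixes A :: "'a::comm_ring_1 set"
  assumes A: "subring_set A"
begin

lemma subring_set_one: "1 \<in> A"
  and subring_set_diff: "x \<in> A \<Longrightarrow> y \<in> A \<Longrightarrow> x - y \<in> A"
  and subring_set_mult: "x \<in> A \<Longrightarrow> y \<in> A \<Longrightarrow> x * y \<in> A"
  using A by (auto simp: subring_set_def)

lemma subring_set_zero: "0 \<in> A"
  using subring_set_diff[OF subring_set_one subring_set_one] by simp

lemma subring_set_uminus: "x \<in> A \<Longrightarrow> - x \<in> A"
  using subring_set_diff[OF subring_set_zero, of x] by simp

lemma subring_set_add: "x \<in> A \<Longrightarrow> y \<in> A \<Longrightarrow> x + y \<in> A"
  using subring_set_diff[of x "- y"] subring_set_uminus[of y] by simp

lemma subring_set_power: "x \<in> A \<Longrightarrow> x ^ n \<in> A"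
  by (induction n) (auto intro: subring_set_one subring_set_mult)

lemma subring_set_sum: "(\<And>i. i \<in> I \<Longrightarrow> f i \<in> A) \<Longrightarrow> sum f I \<in> A"
  by (induction I rule: infinite_finite_induct) (auto intro: subring_set_zero subring_set_add)

lemma subring_set_prod: "(\<And>i. i \<in> I \<Longrightarrow> f i \<in> A) \<Longrightarrow> prod f I \<in> A"
  by (induction I rule: infinite_finite_induct) (auto intro: subring_set_one subring_set_mult)

lemma subring_set_of_nat: "of_nat n \<in> A"
  by (induction n) (auto intro: subring_set_zero subring_set_one subring_set_add)

lemma subring_set_of_int: "of_int n \<in> A"
  by (cases n) (auto intro!: subring_set_uminus subring_set_of_nat subring_set_diff subring_set_one)

lemmas subring_set_closed = subring_set_one subring_set_zero subring_set_diff subring_set_mult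
  subring_set_uminus subring_set_add subring_set_power subring_set_sum subring_set_prod

lemma subring_set_poly: "(\<And>i. Polynomial.coeff p i \<in> A) \<Longrightarrow> x \<in> A \<Longrightarrow> poly p x \<in> A"
  unfolding poly_altdef by (intro subring_set_sum subring_set_mult subring_set_power)

lemma cring_of_subring_set: "cring (ring_of_type_algebra\<lparr>carrier := A\<rparr>)"
proof (rule cringI)
  show "abelian_group (ring_of_type_algebra\<lparr>carrier := A\<rparr>)"
    by (rule abelian_groupI)
       (auto simp: ring_of_type_algebra_def subring_set_closed
         intro!: bexI[where x = "- x" for x])
  show "comm_monoid (ring_of_type_algebra\<lparr>carrier := A\<rparr>)"
    by (rule comm_monoidI) (auto simp: ring_of_type_algebra_def subring_set_closed)
qed (auto simp: ring_of_type_algebra_def algebra_simps)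

end

lemma ideal_of_subset: "ideal_of A J \<Longrightarrow> J \<subseteq> A"
  and ideal_of_zero: "ideal_of A J \<Longrightarrow> 0 \<in> J"
  and ideal_of_add: "ideal_of A J \<Longrightarrow> x \<in> J \<Longrightarrow> y \<in> J \<Longrightarrow> x + y \<in> J"
  and ideal_of_mult: "ideal_of A J \<Longrightarrow> a \<in> A \<Longrightarrow> x \<in> J \<Longrightarrow> a * x \<in> J"
  by (auto simp: ideal_of_def)

lemma ideal_of_mult_right: "ideal_of A J \<Longrightarrow> a \<in> A \<Longrightarrow> x \<in> J \<Longrightarrow> x * a \<in> J"
  using ideal_of_mult[of A J a x] by (simp add: mult.commute)

lemma ideal_of_uminus: "subring_set A \<Longrightarrow> ideal_of A J \<Longrightarrow> x \<in> J \<Longrightarrow> - x \<in> J"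
  using ideal_of_mult[of A J "-1" x] by (simp add: subring_set_uminus subring_set_one)

lemma ideal_of_diff: "subring_set A \<Longrightarrow> ideal_of A J \<Longrightarrow> x \<in> J \<Longrightarrow> y \<in> J \<Longrightarrow> x - y \<in> J"
  using ideal_of_add[of A J x "- y"] ideal_of_uminus[of A J y] by simp

lemma ideal_of_sum: "ideal_of A J \<Longrightarrow> (\<And>i. i \<in> I \<Longrightarrow> f i \<in> J) \<Longrightarrow> sum f I \<in> J"
  by (induction I rule: infinite_finite_induct) (auto intro: ideal_of_zero ideal_of_add)

lemma prime_of_ideal: "prime_of A Q \<Longrightarrow> ideal_of A Q"
  and prime_of_subset: "prime_of A Q \<Longrightarrow> Q \<subseteq> A"
  and prime_of_one: "prime_of A Q \<Longrightarrow> 1 \<notin> Q"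
  and prime_ofD: "prime_of A Q \<Longrightarrow> a \<in> A \<Longrightarrow> b \<in> A \<Longrightarrow> a * b \<in> Q \<Longrightarrow> a \<in> Q \<or> b \<in> Q"
  by (auto simp: prime_of_def ideal_of_def)

lemma prime_of_mult_notin:
  "prime_of A Q \<Longrightarrow> a \<in> A \<Longrightarrow> b \<in> A \<Longrightarrow> a \<notin> Q \<Longrightarrow> b \<notin> Q \<Longrightarrow> a * b \<notin> Q"
  using prime_ofD by blast

lemma prime_of_power_notin:
  "subring_set A \<Longrightarrow> prime_of A Q \<Longrightarrow> a \<in> A \<Longrightarrow> a \<notin> Q \<Longrightarrow> a ^ n \<notin> Q"
  by (induction n) (use prime_ofD[of A Q a] subring_set_power[of A a] prime_of_one in auto)

lemma prime_of_prod_notin: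
  assumes "subring_set A" "prime_of A Q" "\<And>i. i \<in> I \<Longrightarrow> f i \<in> A - Q"
  shows "prod f I \<in> A - Q"
  using assms(3)
proof (induction I rule: infinite_finite_induct)
  case (insert i I)
  have "f i \<in> A - Q" "prod f I \<in> A - Q" using insert by auto
  then show ?case
    using insert.hyps assms(1,2) by (auto simp: subring_set_mult dest: prime_ofD)
qed (use assms in \<open>auto simp: subring_set_one prime_of_one\<close>)

text \<open>Ideals and primes are handled as plain subsets of a type that is already a ring, so that
  the class operations apply. This equivalence and \<open>primeideal_iff_prime_of\<close> are the
  bridge to the record-based notions in which Krull dimension and prime divisors are stated.\<close>

lemma ideal_iff_ideal_of:
  assumes A: "subring_set A"
  shows "ideal J (ring_of_type_algebra\<lparr>carrier := A\<rparr>) \<longleftrightarrow> ideal_of A J"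
proof
  assume J: "ideal J (ring_of_type_algebra\<lparr>carrier := A\<rparr>)"
  interpret J: ideal J "ring_of_type_algebra\<lparr>carrier := A\<rparr>" by fact
  show "ideal_of A J"
    using J.a_subset additive_subgroup.zero_closed[OF J.additive_subgroup_axioms]
      additive_subgroup.a_closed[OF J.additive_subgroup_axioms] J.I_l_closed
    by (auto simp: ideal_of_def ring_of_type_algebra_def)
next
  assume J: "ideal_of A J"
  interpret R: cring "ring_of_type_algebra\<lparr>carrier := A\<rparr>" using cring_of_subring_set[OF A] .
  have inv: "\<ominus>\<^bsub>ring_of_type_algebra\<lparr>carrier := A\<rparr>\<^esub> x = - x" if "x \<in> A" for x
    by (rule R.minus_equality) (use that A in \<open>auto simp: ring_of_type_algebra_def subring_set_uminus\<close>)
  show "ideal J (ring_of_type_algebra\<lparr>carrier := A\<rparr>)"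
  proof (rule idealI)
    show "ring (ring_of_type_algebra\<lparr>carrier := A\<rparr>)" by (rule R.ring_axioms)
    show "subgroup J (add_monoid (ring_of_type_algebra\<lparr>carrier := A\<rparr>))"
    proof (rule group.subgroupI)
      show "group (add_monoid (ring_of_type_algebra\<lparr>carrier := A\<rparr>))"
        by (rule R.add.is_group)
      fix a assume a: "a \<in> J"
      then have "a \<in> A" using J by (auto simp: ideal_of_def)
      then show "inv\<^bsub>add_monoid (ring_of_type_algebra\<lparr>carrier := A\<rparr>)\<^esub> a \<in> J"
        using inv[of a] a J A unfolding a_inv_def by (simp add: ideal_of_uminus)
    qed (use J in \<open>auto simp: ideal_of_def ring_of_type_algebra_def\<close>)
  qed (use J ideal_of_mult_right[OF J] in \<open>auto simp: ideal_of_def ring_of_type_algebra_def\<close>)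
qed

lemma primeideal_iff_prime_of:
  assumes A: "subring_set A"
  shows "primeideal Q (ring_of_type_algebra\<lparr>carrier := A\<rparr>) \<longleftrightarrow> prime_of A Q"
proof
  assume "primeideal Q (ring_of_type_algebra\<lparr>carrier := A\<rparr>)"
  then interpret Q: primeideal Q "ring_of_type_algebra\<lparr>carrier := A\<rparr>" .
  have I: "ideal_of A Q" using Q.is_ideal ideal_iff_ideal_of[OF A] by blast
  have "1 \<notin> Q"
  proof
    assume "1 \<in> Q"
    then have "A \<subseteq> Q" using ideal_of_mult[OF I, of _ 1] by auto
    then show False using Q.I_notcarr I by (auto simp: ring_of_type_algebra_def ideal_of_def)
  qed
  then show "prime_of A Q"
    using Q.I_prime I by (auto simp: prime_of_def ring_of_type_algebra_def)
next
  assume Q: "prime_of A Q"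
  show "primeideal Q (ring_of_type_algebra\<lparr>carrier := A\<rparr>)"
  proof (rule primeidealI)
    show "ideal Q (ring_of_type_algebra\<lparr>carrier := A\<rparr>)"
      using Q ideal_iff_ideal_of[OF A] prime_of_ideal by blast
    show "cring (ring_of_type_algebra\<lparr>carrier := A\<rparr>)" by (rule cring_of_subring_set[OF A])
    show "carrier (ring_of_type_algebra\<lparr>carrier := A\<rparr>) \<noteq> Q"
      using prime_of_one[OF Q] subring_set_one[OF A] by auto
  qed (use Q in \<open>auto simp: prime_of_def ring_of_type_algebra_def\<close>)
qed

lemma prime_of_Int:
  assumes "subring_set B" "subring_set A" "B \<subseteq> A" "prime_of A Q"
  shows "prime_of B (Q \<inter> B)"
  using assms unfolding prime_of_def ideal_of_def
  by (auto simp: subring_set_closed) (use assms(3) in blast)+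

subsection \<open>Chains of primes in a quotient\<close>

text \<open>Preimages under the quotient map turn a chain of primes of the quotient into a chain of
  primes of \<open>A\<close> above \<open>J\<close>; strictness survives because the quotient map is
  onto.\<close>

lemma krull_dim_quot_le:
  assumes A: "subring_set A" and J: "ideal_of A J"
    and le: "\<And>P n. (\<And>i. i \<le> n \<Longrightarrow> prime_of A (P i)) \<Longrightarrow> (\<And>i. i \<le> n \<Longrightarrow> J \<subseteq> P i) \<Longrightarrow>
      (\<And>i. i < n \<Longrightarrow> P i \<subset> P (Suc i)) \<Longrightarrow> n \<le> N"
  shows "krull_dim (ring_of_type_algebra\<lparr>carrier := A\<rparr> Quot J) \<le> enat N"
  unfolding krull_dim_def
proof (rule SUP_least, clarsimp)
  define R where "R = ring_of_type_algebra\<lparr>carrier := A\<rparr>"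
  interpret R: cring R unfolding R_def by (rule cring_of_subring_set[OF A])
  have JR: "ideal J R" using J ideal_iff_ideal_of[OF A] by (simp add: R_def)
  fix n P
  assume P: "\<forall>i\<le>n. primeideal (P i) (ring_of_type_algebra\<lparr>carrier := A\<rparr> Quot J)"
    and mono: "\<forall>i<n. P i \<subset> P (Suc i)"
  have P: "primeideal (P i) (R Quot J)" if "i \<le> n" for i using P that unfolding R_def by blast
  interpret h: ring_hom_cring R "R Quot J" "(+>\<^bsub>R\<^esub>) J"
    by (rule ideal.rcos_ring_hom_cring[OF JR R.is_cring])
  define P' where "P' = (\<lambda>i. {r \<in> A. J +>\<^bsub>R\<^esub> r \<in> P i})"
  have [simp]: "carrier R = A" by (simp add: R_def)
  have mult: "a \<otimes>\<^bsub>R\<^esub> b = a * b" and one: "\<one>\<^bsub>R\<^esub> = 1" for a b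
    by (simp_all add: R_def ring_of_type_algebra_def)
  have onto: "\<exists>r\<in>A. x = J +>\<^bsub>R\<^esub> r" if "x \<in> carrier (R Quot J)" for x
    using that unfolding FactRing_def A_RCOSETS_def' by (simp add: \<open>carrier R = A\<close>)
  have sub: "P i \<subseteq> carrier (R Quot J)" if "i \<le> n" for i
    by (rule additive_subgroup.a_subset[OF ideal.axioms(1)[OF primeideal.axioms(1)[OF P[OF that]]]])
  show "n \<le> N"
  proof (rule le[of n P'])
    fix i assume i: "i \<le> n"
    interpret Pi: primeideal "P i" "R Quot J" by (rule P[OF i])
    have id: "ideal (P' i) R"
      using ring_hom_ring.ideal_vimage[OF ideal.rcos_ring_hom_ring[OF JR] Pi.is_ideal]
      unfolding P'_def \<open>carrier R = A\<close> .
    have "J +>\<^bsub>R\<^esub> 1 = \<one>\<^bsub>R Quot J\<^esub>" by (rule h.hom_one[unfolded one])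
    then have "J +>\<^bsub>R\<^esub> 1 \<notin> P i"
      using Pi.I_notcarr Pi.one_imp_carrier by fastforce
    moreover have "a \<in> P' i \<or> b \<in> P' i" if "a \<in> A" "b \<in> A" "a * b \<in> P' i" for a b
    proof -
      have "J +>\<^bsub>R\<^esub> (a * b) = (J +>\<^bsub>R\<^esub> a) \<otimes>\<^bsub>R Quot J\<^esub> (J +>\<^bsub>R\<^esub> b)"
        unfolding mult[symmetric] by (rule h.hom_mult) (use that in simp_all)
      then have "(J +>\<^bsub>R\<^esub> a) \<otimes>\<^bsub>R Quot J\<^esub> (J +>\<^bsub>R\<^esub> b) \<in> P i"
        using that(3) unfolding P'_def by (metis (no_types, lifting) mem_Collect_eq)
      moreover have "J +>\<^bsub>R\<^esub> a \<in> carrier (R Quot J)" "J +>\<^bsub>R\<^esub> b \<in> carrier (R Quot J)"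
        using that by (auto intro!: h.hom_closed)
      ultimately have "J +>\<^bsub>R\<^esub> a \<in> P i \<or> J +>\<^bsub>R\<^esub> b \<in> P i"
        by (rule Pi.I_prime[rotated 2])
      then show ?thesis using that unfolding P'_def by blast
    qed
    moreover have "ideal_of A (P' i)"
      using id ideal_iff_ideal_of[OF A, of "P' i"] unfolding R_def by blast
    ultimately show "prime_of A (P' i)"
      unfolding prime_of_def by (simp add: P'_def)
    show "J \<subseteq> P' i"
    proof
      fix x assume x: "x \<in> J"
      then have xA: "x \<in> A" using J by (auto simp: ideal_of_def)
      have "J +>\<^bsub>R\<^esub> x = J"
        using R.a_coset_join2[OF _ additive_subgroup.a_subgroup[OF ideal.axioms(1)[OF JR]] x] xA
        by simp
      moreover have "J \<in> P i"
        using additive_subgroup.zero_closed[OF ideal.axioms(1)[OF Pi.is_ideal]]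
        unfolding FactRing_def ring.simps monoid.simps .
      ultimately show "x \<in> P' i" using xA by (simp add: P'_def)
    qed
  next
    fix i assume i: "i < n"
    then have lt: "P i \<subset> P (Suc i)" using mono by blast
    then obtain x where x: "x \<in> P (Suc i)" "x \<notin> P i" by blast
    have "x \<in> carrier (R Quot J)" using x(1) sub[of "Suc i"] i by auto
    then obtain r where r: "r \<in> A" "x = J +>\<^bsub>R\<^esub> r" using onto by blast
    have "P' i \<subseteq> P' (Suc i)" using lt unfolding P'_def by blast
    moreover have "r \<in> P' (Suc i)" "r \<notin> P' i" using r x unfolding P'_def by simp_all
    ultimately show "P' i \<subset> P' (Suc i)" by blast
  qed
qed

lemma le_krull_dim_quot:
  assumes A: "subring_set A" and J: "ideal_of A J"
    and P: "\<And>i. i \<le> n \<Longrightarrow> prime_of A (P i)" "\<And>i. i \<le> n \<Longrightarrow> J \<subseteq> P i"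
      "\<And>i. i < n \<Longrightarrow> P i \<subset> P (Suc i)"
  shows "enat n \<le> krull_dim (ring_of_type_algebra\<lparr>carrier := A\<rparr> Quot J)"
  unfolding krull_dim_def
proof (rule SUP_upper, clarify)
  define R where "R = ring_of_type_algebra\<lparr>carrier := A\<rparr>"
  interpret R: cring R unfolding R_def by (rule cring_of_subring_set[OF A])
  have JR: "ideal J R" using J ideal_iff_ideal_of[OF A] by (simp add: R_def)
  interpret h: ring_hom_cring R "R Quot J" "(+>\<^bsub>R\<^esub>) J"
    by (rule ideal.rcos_ring_hom_cring[OF JR R.is_cring])
  have [simp]: "carrier R = A" by (simp add: R_def)
  have mult: "a \<otimes>\<^bsub>R\<^esub> b = a * b" and one: "\<one>\<^bsub>R\<^esub> = 1" for a b
    by (simp_all add: R_def ring_of_type_algebra_def)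
  have onto: "\<exists>r\<in>A. x = J +>\<^bsub>R\<^esub> r" if "x \<in> carrier (R Quot J)" for x
    using that unfolding FactRing_def A_RCOSETS_def' by (simp add: \<open>carrier R = A\<close>)
  have PR: "ideal (P i) R" if "i \<le> n" for i
    using P(1)[OF that] prime_of_ideal ideal_iff_ideal_of[OF A] by (auto simp: R_def)
  \<comment> \<open>As \<open>J\<close> lies in \<open>P i\<close>, the set \<open>P i\<close> is a
    union of cosets, so membership in its image can be read off from any representative. Primality
    and strictness of the image chain both follow from this.\<close>
  have mem: "J +>\<^bsub>R\<^esub> r \<in> (+>\<^bsub>R\<^esub>) J ` P i \<longleftrightarrow> r \<in> P i" if i: "i \<le> n" and r: "r \<in> A" for i r
  proof
    assume "J +>\<^bsub>R\<^esub> r \<in> (+>\<^bsub>R\<^esub>) J ` P i"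
    then obtain p where p: "p \<in> P i" "J +>\<^bsub>R\<^esub> r = J +>\<^bsub>R\<^esub> p" by auto
    have "\<zero>\<^bsub>R\<^esub> \<oplus>\<^bsub>R\<^esub> r \<in> J +>\<^bsub>R\<^esub> r"
      using additive_subgroup.zero_closed[OF ideal.axioms(1)[OF JR]]
        unfolding a_r_coset_def' by blast
    then have "r \<in> J +>\<^bsub>R\<^esub> p" using p(2) by (simp add: r)
    then obtain j where "j \<in> J" "r = j + p"
      by (auto simp: a_r_coset_def' R_def ring_of_type_algebra_def)
    then show "r \<in> P i"
      using p(1) P(2)[OF i] ideal_of_add[OF prime_of_ideal[OF P(1)[OF i]]] by blast
  qed blast
  have "(\<forall>i\<le>n. primeideal ((+>\<^bsub>R\<^esub>) J ` P i) (R Quot J)) \<and>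
      (\<forall>i<n. (+>\<^bsub>R\<^esub>) J ` P i \<subset> (+>\<^bsub>R\<^esub>) J ` P (Suc i))"
  proof (intro conjI allI impI)
    fix i assume i: "i \<le> n"
    have Q: "prime_of A (P i)" using P(1)[OF i] .
    show "primeideal ((+>\<^bsub>R\<^esub>) J ` P i) (R Quot J)"
    proof (rule primeidealI)
      show "ideal ((+>\<^bsub>R\<^esub>) J ` P i) (R Quot J)"
        using R.ring_ideal_imp_quot_ideal[OF JR PR[OF i]] .
      show "cring (R Quot J)" by (rule h.S.is_cring)
      show "carrier (R Quot J) \<noteq> (+>\<^bsub>R\<^esub>) J ` P i"
        using mem[OF i subring_set_one[OF A]] prime_of_one[OF Q] h.S.one_closed h.hom_one
        unfolding one by metis
    next
      fix a b assume "a \<in> carrier (R Quot J)" "b \<in> carrier (R Quot J)"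
        and ab: "a \<otimes>\<^bsub>R Quot J\<^esub> b \<in> (+>\<^bsub>R\<^esub>) J ` P i"
      then obtain r s where r: "r \<in> A" "a = J +>\<^bsub>R\<^esub> r" and s: "s \<in> A" "b = J +>\<^bsub>R\<^esub> s"
        using onto by meson
      have "r * s \<in> P i"
        using ab h.hom_mult[of r s] mem[OF i subring_set_mult[OF A r(1) s(1)]] r s
        unfolding mult by simp
      then show "a \<in> (+>\<^bsub>R\<^esub>) J ` P i \<or> b \<in> (+>\<^bsub>R\<^esub>) J ` P i"
        using prime_ofD[OF Q r(1) s(1)] unfolding r(2) s(2) by blast
    qed
  next
    fix i assume i: "i < n"
    obtain x where x: "x \<in> P (Suc i)" "x \<notin> P i" using P(3)[OF i] by blast
    have "x \<in> A" using prime_of_subset[OF P(1)[of "Suc i"]] x i by auto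
    then have "J +>\<^bsub>R\<^esub> x \<notin> (+>\<^bsub>R\<^esub>) J ` P i" using mem[of i x] x i by auto
    then show "(+>\<^bsub>R\<^esub>) J ` P i \<subset> (+>\<^bsub>R\<^esub>) J ` P (Suc i)"
      using P(3)[OF i] x(1) by blast
  qed
  then show "\<exists>P. (\<forall>i\<le>n. primeideal (P i) (ring_of_type_algebra\<lparr>carrier := A\<rparr> Quot J)) \<and>
      (\<forall>i<n. P i \<subset> P (Suc i))"
    unfolding R_def by (rule exI[of _ "\<lambda>i. (+>\<^bsub>R\<^esub>) J ` P i", unfolded R_def])
qed

section \<open>Substitution in polynomials\<close>

definition mon_val :: "('v \<Rightarrow> 'b::comm_ring_1) \<Rightarrow> ('v \<Rightarrow>\<^sub>0 nat) \<Rightarrow> 'b" where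
  "mon_val a m = (\<Prod>v\<in>Poly_Mapping.keys m. a v ^ Poly_Mapping.lookup m v)"

lemma mon_val_superset:
  assumes "finite V" "Poly_Mapping.keys m \<subseteq> V"
  shows "mon_val a m = (\<Prod>v\<in>V. a v ^ Poly_Mapping.lookup m v)"
  unfolding mon_val_def using assms
  by (intro prod.mono_neutral_left) (auto simp: in_keys_iff)

lemma mon_val_zero [simp]: "mon_val a 0 = 1"
  by (simp add: mon_val_def)

lemma mon_val_add: "mon_val a (m + n) = mon_val a m * mon_val a n"
proof -
  let ?V = "Poly_Mapping.keys m \<union> Poly_Mapping.keys n"
  have "Poly_Mapping.keys (m + n) \<subseteq> ?V" by (rule keys_add)
  then show ?thesis
    by (simp add: mon_val_superset[of ?V] lookup_add power_add prod.distrib)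
qed

lemma mon_val_single: "mon_val a (Poly_Mapping.single v n) = a v ^ n"
  by (simp add: mon_val_def)

lemma mpol_expand:
  "p = (\<Sum>m\<in>Poly_Mapping.keys p. Poly_Mapping.single m (Poly_Mapping.lookup p m))"
  by (rule poly_mapping_eqI)
     (auto simp: lookup_sum lookup_single when_def sum.delta' in_keys_iff)

lemma mpol_induct [case_names single zero add]:
  fixes p :: "('v, 'k::comm_ring_1) mpol"
  assumes "\<And>m c. m \<in> Poly_Mapping.keys p \<Longrightarrow> P (Poly_Mapping.single m c)" "P 0"
    "\<And>p q. P p \<Longrightarrow> P q \<Longrightarrow> P (p + q)"
  shows "P p"
proof -
  have "P (\<Sum>m\<in>M. Poly_Mapping.single m (Poly_Mapping.lookup p m))"
    if "finite M" "M \<subseteq> Poly_Mapping.keys p" for M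
    using that assms by (induction M) auto
  then show ?thesis using mpol_expand[of p] by (metis finite_keys order_refl)
qed

lemma mpol_subst_superset:
  assumes "comm_ring_hom h" "finite M" "Poly_Mapping.keys p \<subseteq> M"
  shows "mpol_subst h a p = (\<Sum>m\<in>M. h (Poly_Mapping.lookup p m) * mon_val a m)"
proof -
  interpret comm_ring_hom h by fact
  show ?thesis
    unfolding mpol_subst_def mon_val_def[symmetric]
    using assms by (intro sum.mono_neutral_left) (auto simp: in_keys_iff)
qed

context
  fixes h :: "'k::comm_ring_1 \<Rightarrow> 'b::comm_ring_1"
  assumes h: "comm_ring_hom h"
begin

interpretation comm_ring_hom h by (rule h)

lemma mpol_subst_zero: "mpol_subst h a 0 = 0"
  by (simp add: mpol_subst_def)

lemma mpol_subst_single: "mpol_subst h a (Poly_Mapping.single m c) = h c * mon_val a m"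
  by (simp add: mpol_subst_superset[OF h, of "{m}"])

lemma mpol_subst_add: "mpol_subst h a (p + q) = mpol_subst h a p + mpol_subst h a q"
proof -
  let ?M = "Poly_Mapping.keys p \<union> Poly_Mapping.keys q"
  have "Poly_Mapping.keys (p + q) \<subseteq> ?M" by (rule keys_add)
  then show ?thesis
    by (simp add: mpol_subst_superset[OF h, of ?M] lookup_add hom_add distrib_right sum.distrib)
qed

lemma mpol_subst_mult: "mpol_subst h a (p * q) = mpol_subst h a p * mpol_subst h a q"
proof (induction p rule: mpol_induct)
  case (single m c)
  show ?case
  proof (induction q rule: mpol_induct)
    case (single n d)
    then show ?case by (simp add: mult_single mpol_subst_single mon_val_add hom_mult ac_simps)
  qed (simp_all add: mpol_subst_zero mpol_subst_add ring_distribs)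
qed (simp_all add: mpol_subst_zero mpol_subst_add ring_distribs)

lemma comm_ring_hom_mpol_subst: "comm_ring_hom (mpol_subst h a)"
proof
  show "mpol_subst h a 1 = 1"
    using mpol_subst_single[of a 0 1] by simp
qed (auto simp: mpol_subst_zero mpol_subst_add mpol_subst_mult)

lemma mpol_subst_const: "mpol_subst h a (mpol_const c) = h c"
  by (simp add: mpol_const_def mpol_subst_single)

lemma mpol_subst_var: "mpol_subst h a (mpol_var v) = a v"
  by (simp add: mpol_var_def mpol_subst_single mon_val_single)

lemma mpol_subst_cong:
  assumes "p \<in> mpol_in V" "\<And>v. v \<in> V \<Longrightarrow> a v = b v"
  shows "mpol_subst h a p = mpol_subst h b p"
  unfolding mpol_subst_def using assms
  by (intro sum.cong arg_cong2[where f = "(*)"] prod.cong arg_cong2[where f = power])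
     (auto simp: mpol_in_def)

end

lemma comm_ring_hom_id: "comm_ring_hom (\<lambda>c. c)"
  by unfold_locales auto

lemma comm_ring_hom_mpol_const: "comm_ring_hom (mpol_const :: 'k::comm_ring_1 \<Rightarrow> ('v, 'k) mpol)"
  by unfold_locales (auto simp: mpol_const_def single_add mult_single)

lemma comm_ring_hom_pCons_mpol_const:
  "comm_ring_hom (\<lambda>c. [:mpol_const c :: ('v, 'k::comm_ring_1) mpol:])"
proof -
  interpret comm_ring_hom "mpol_const :: 'k \<Rightarrow> ('v, 'k) mpol" by (rule comm_ring_hom_mpol_const)
  show ?thesis by unfold_locales (auto simp: hom_add hom_mult one_pCons)
qed

lemma mon_val_mpol_var:
  "mon_val mpol_var m = (Poly_Mapping.single m 1 :: ('v, 'k::comm_ring_1) mpol)"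
proof -
  have pow: "(Poly_Mapping.single (Poly_Mapping.single v 1) 1 :: ('v, 'k) mpol) ^ n =
      Poly_Mapping.single (Poly_Mapping.single v n) 1" for v n
    by (induction n) (auto simp: mult_single single_add[symmetric])
  have "(\<Prod>v\<in>V. (Poly_Mapping.single (Poly_Mapping.single v (Poly_Mapping.lookup m v)) 1 :: ('v, 'k) mpol)) =
     Poly_Mapping.single (\<Sum>v\<in>V. Poly_Mapping.single v (Poly_Mapping.lookup m v)) 1" if "finite V" for V
    using that by (induction V) (auto simp: mult_single)
  moreover have "(\<Sum>v\<in>Poly_Mapping.keys m. Poly_Mapping.single v (Poly_Mapping.lookup m v)) = m"
    by (rule poly_mapping_eqI) (auto simp: lookup_sum lookup_single when_def sum.delta' in_keys_iff)
  ultimately show ?thesis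
    by (simp add: mon_val_def mpol_var_def pow flip: One_nat_def)
qed

lemma single_eq_const_mult_mon_val:
  "(Poly_Mapping.single m c :: ('v, 'k::comm_ring_1) mpol) = mpol_const c * mon_val mpol_var m"
  by (simp add: mon_val_mpol_var mpol_const_def mult_single)

lemma comm_ring_hom_mon_val: "comm_ring_hom f \<Longrightarrow> f (mon_val a m) = mon_val (\<lambda>v. f (a v)) m"
proof -
  assume "comm_ring_hom f"
  then interpret comm_ring_hom f .
  show ?thesis by (simp add: mon_val_def hom_prod hom_power)
qed

text \<open>The universal property of the polynomial ring: two homomorphisms that agree on constants
  and variables are rewritten to the same \<open>mpol_subst\<close>.\<close>

lemma comm_ring_hom_eq_mpol_subst:
  assumes "comm_ring_hom f"
  shows "f p = mpol_subst (\<lambda>c. f (mpol_const c)) (\<lambda>v. f (mpol_var v)) p"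
proof -
  interpret f: comm_ring_hom f by fact
  interpret c: comm_ring_hom "mpol_const :: 'b \<Rightarrow> ('a, 'b) mpol" by (rule comm_ring_hom_mpol_const)
  have h: "comm_ring_hom (\<lambda>c. f (mpol_const c))"
    by unfold_locales (auto simp: c.hom_add c.hom_mult f.hom_add f.hom_mult)
  show ?thesis
  proof (induction p rule: mpol_induct)
    case (single m c)
    have "f (Poly_Mapping.single m c) = f (mpol_const c) * mon_val (\<lambda>v. f (mpol_var v)) m"
      by (simp only: single_eq_const_mult_mon_val f.hom_mult comm_ring_hom_mon_val[OF assms])
    then show ?case by (simp only: mpol_subst_single[OF h])
  qed (auto simp: mpol_subst_add[OF h] mpol_subst_zero[OF h] f.hom_add)
qed

section \<open>Polynomials in a given set of variables\<close>

lemma subring_set_mpol_in: "subring_set (mpol_in V :: ('v, 'k::comm_ring_1) mpol set)"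
  unfolding subring_set_def
proof (intro conjI ballI)
  show "(1 :: ('v, 'k) mpol) \<in> mpol_in V" by (auto simp: mpol_in_def keys_one)
  fix p q :: "('v, 'k) mpol" assume pq: "p \<in> mpol_in V" "q \<in> mpol_in V"
  have "Poly_Mapping.keys (p - q) \<subseteq> Poly_Mapping.keys p \<union> Poly_Mapping.keys q"
    by (rule keys_diff)
  then show "p - q \<in> mpol_in V" using pq by (auto simp: mpol_in_def)
  show "p * q \<in> mpol_in V"
    unfolding mpol_in_def
  proof (intro CollectI ballI)
    fix m assume "m \<in> Poly_Mapping.keys (p * q)"
    then obtain a b where "a \<in> Poly_Mapping.keys p" "b \<in> Poly_Mapping.keys q" "m = a + b"
      using keys_mult[of p q] by blast
    then show "Poly_Mapping.keys m \<subseteq> V"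
      using pq keys_add[of a b] unfolding mpol_in_def by blast
  qed
qed

lemma mpol_const_in: "mpol_const c \<in> mpol_in V"
  by (auto simp: mpol_in_def mpol_const_def)

lemma mpol_in_var: "v \<in> V \<Longrightarrow> mpol_var v \<in> mpol_in V"
  by (auto simp: mpol_in_def mpol_var_def)

lemma single_in_mpol_in: "Poly_Mapping.keys m \<subseteq> V \<Longrightarrow> Poly_Mapping.single m c \<in> mpol_in V"
  by (auto simp: mpol_in_def)

lemma mpol_in_mono: "V \<subseteq> W \<Longrightarrow> mpol_in V \<subseteq> mpol_in W"
  by (auto simp: mpol_in_def)

lemma mon_val_in_subring: "subring_set A \<Longrightarrow> (\<And>v. v \<in> Poly_Mapping.keys m \<Longrightarrow> a v \<in> A) \<Longrightarrow> mon_val a m \<in> A"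
  unfolding mon_val_def by (intro subring_set_prod subring_set_power) auto

lemma mpol_subst_in_subring:
  assumes "subring_set A" "\<And>c. h c \<in> A" "\<And>v. v \<in> V \<Longrightarrow> a v \<in> A" "p \<in> mpol_in V"
  shows "mpol_subst h a p \<in> A"
  unfolding mpol_subst_def mon_val_def[symmetric]
  using assms by (intro subring_set_sum subring_set_mult mon_val_in_subring) (auto simp: mpol_in_def)

text \<open>Serves as the induction principle for \<open>mpol_in V\<close>: a property of all these
  polynomials is proved by showing that the set where it holds is a subring with the constants and
  the variables.\<close>

lemma mpol_in_subset_subring:
  assumes "subring_set A" "\<And>c. mpol_const c \<in> A" "\<And>v. v \<in> V \<Longrightarrow> mpol_var v \<in> A"
  shows "mpol_in V \<subseteq> A"
proof
  fix p :: "('a, 'b) mpol" assume p: "p \<in> mpol_in V"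
  have "p = mpol_subst mpol_const mpol_var p"
    by (rule comm_ring_hom_eq_mpol_subst[OF comm_ring_hom_id])
  also have "\<dots> \<in> A" by (rule mpol_subst_in_subring[OF assms p])
  finally show "p \<in> A" .
qed

lemma subring_set_polys:
  assumes A: "subring_set A"
  shows "subring_set {p. \<forall>i. Polynomial.coeff p i \<in> A}"
  unfolding subring_set_def
  by (auto simp: coeff_mult coeff_1 subring_set_closed[OF A]
      intro!: subring_set_sum[OF A] subring_set_mult[OF A] subring_set_diff[OF A])

lemma ideal_of_poly:
  assumes A: "subring_set A" and J: "ideal_of A J" and "\<And>i. Polynomial.coeff p i \<in> J" "x \<in> A"
  shows "poly p x \<in> J"
  unfolding poly_altdef using assms
  by (intro ideal_of_sum[OF J] ideal_of_mult_right[OF J] subring_set_power[OF A])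

section \<open>The Nullstellensatz\<close>

text \<open>Over a finite field the product of all X - a, increased by 1, is not constant but takes
  only the value 1, so it has no root.\<close>

lemma infinite_UNIV_alg_closed: "infinite (UNIV :: 'k::alg_closed_field set)"
proof
  assume fin: "finite (UNIV :: 'k set)"
  define p where "p = (\<Prod>a\<in>UNIV. [:- a, 1 :: 'k:]) + 1"
  have val: "poly p x = 1" for x
    using fin by (auto simp: p_def poly_prod)
  have "Polynomial.degree p > 0"
  proof (rule ccontr)
    assume "\<not> ?thesis"
    then obtain c where c: "p = [:c:]" using degree_eq_zeroE by auto
    then have "(\<Prod>a\<in>UNIV. [:- a, 1 :: 'k:]) = 0" using val[of 0] by (simp add: p_def one_pCons)
    then show False using fin by simp
  qed
  then obtain x where "poly p x = 0" using alg_closed_imp_poly_has_root by blast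
  then show False using val by simp
qed

lemma pseudo_division:
  fixes A :: "'a::comm_ring_1 set"
  assumes A: "subring_set A" and p: "\<And>i. Polynomial.coeff p i \<in> A" "\<And>i. i > e \<Longrightarrow> Polynomial.coeff p i = 0"
    and q: "\<And>i. Polynomial.coeff q i \<in> A" "\<And>i. i \<ge> n \<Longrightarrow> Polynomial.coeff q i = 0"
  shows "\<exists>N h r. (\<forall>i. Polynomial.coeff h i \<in> A) \<and> (\<forall>i. Polynomial.coeff r i \<in> A) \<and>
    Polynomial.smult (Polynomial.coeff p e ^ N) q = p * h + r \<and>
    (\<forall>i\<ge>e. Polynomial.coeff r i = 0) \<and> (\<forall>i. i + e \<ge> n \<longrightarrow> Polynomial.coeff h i = 0)"
  using q
proof (induction n arbitrary: q)
  case 0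
  then have "q = 0" by (simp add: poly_eq_iff)
  then show ?case
    using subring_set_zero[OF A] by (intro exI[of _ 0]) auto
next
  case (Suc n)
  let ?b = "Polynomial.coeff p e"
  show ?case
  proof (cases "n < e")
    case True
    then show ?thesis using Suc.prems subring_set_zero[OF A]
      by (intro exI[of _ 0] exI[of _ q]) auto
  next
    case False
    define m where "m = Polynomial.monom (Polynomial.coeff q n) (n - e)"
    define q' where "q' = Polynomial.smult ?b q - m * p"
    have mA: "Polynomial.coeff m i \<in> A" for i
      using Suc.prems(1) subring_set_zero[OF A] by (simp add: m_def)
    have q'A: "Polynomial.coeff q' i \<in> A" for i
      using Suc.prems(1) p(1) mA unfolding q'_def coeff_diff coeff_smult coeff_mult
      by (intro subring_set_diff[OF A] subring_set_sum[OF A] subring_set_mult[OF A])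
    have "Polynomial.coeff q' i = 0" if "i \<ge> n" for i
      using that False Suc.prems(2)[of i] p(2)[of "i - (n - e)"]
      by (cases "i = n") (auto simp: q'_def m_def coeff_monom_mult)
    from Suc.IH[OF q'A this] obtain N h r where hr: "\<forall>i. Polynomial.coeff h i \<in> A" "\<forall>i. Polynomial.coeff r i \<in> A"
      "Polynomial.smult (?b ^ N) q' = p * h + r" "\<forall>i\<ge>e. Polynomial.coeff r i = 0"
      "\<forall>i. i + e \<ge> n \<longrightarrow> Polynomial.coeff h i = 0" by blast
    define h' where "h' = h + Polynomial.smult (?b ^ N) m"
    have "Polynomial.smult (?b ^ Suc N) q = p * h' + r"
    proof -
      have "Polynomial.smult (?b ^ Suc N) q = Polynomial.smult (?b ^ N) (q' + m * p)"
        by (simp add: q'_def mult.commute)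
      also have "\<dots> = p * h + r + Polynomial.smult (?b ^ N) (m * p)"
        using hr(3) by (simp add: smult_add_right)
      also have "\<dots> = p * h' + r" by (simp add: h'_def algebra_simps)
      finally show ?thesis .
    qed
    moreover have "Polynomial.coeff h' i \<in> A" for i
      unfolding h'_def coeff_add coeff_smult
      using hr(1) mA p(1) by (intro subring_set_add[OF A] subring_set_mult[OF A] subring_set_power[OF A]) auto
    moreover have "Polynomial.coeff h' i = 0" if "i + e \<ge> Suc n" for i
      using that hr(5) False by (auto simp: h'_def m_def)
    ultimately show ?thesis using hr(2,4) by blast
  qed
qed

lemma mpol_in_insert_poly:
  assumes "g \<in> mpol_in (insert s V)"
  shows "\<exists>p. (\<forall>i. Polynomial.coeff p i \<in> mpol_in V) \<and> g = poly p (mpol_var s :: ('v, 'k::comm_ring_1) mpol)"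
proof -
  let ?A = "mpol_in V :: ('v, 'k) mpol set" and ?x = "mpol_var s :: ('v, 'k) mpol"
  have A: "subring_set ?A" by (rule subring_set_mpol_in)
  have P: "subring_set {p. \<forall>i. Polynomial.coeff p i \<in> ?A}" by (rule subring_set_polys[OF A])
  define S where "S = (\<lambda>p. poly p ?x) ` {p. \<forall>i. Polynomial.coeff p i \<in> ?A}"
  have S: "subring_set S"
    unfolding subring_set_def
  proof (intro conjI ballI)
    show "1 \<in> S" unfolding S_def using subring_set_one[OF P] by (intro image_eqI[of _ _ 1]) simp_all
    fix a b assume "a \<in> S" "b \<in> S"
    then obtain p q where pq: "p \<in> {p. \<forall>i. Polynomial.coeff p i \<in> ?A}" "q \<in> {p. \<forall>i. Polynomial.coeff p i \<in> ?A}"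
      "a = poly p ?x" "b = poly q ?x" unfolding S_def by blast
    show "a - b \<in> S" unfolding S_def using subring_set_diff[OF P pq(1,2)] pq(3,4)
      by (intro image_eqI[of _ _ "p - q"]) simp_all
    show "a * b \<in> S" unfolding S_def using subring_set_mult[OF P pq(1,2)] pq(3,4)
      by (intro image_eqI[of _ _ "p * q"]) simp_all
  qed
  have AS: "a \<in> S" if "a \<in> ?A" for a
    unfolding S_def using that subring_set_zero[OF A]
    by (intro image_eqI[of _ _ "[:a:]"]) (auto simp: coeff_pCons split: nat.splits)
  have "mpol_in (insert s V) \<subseteq> S"
  proof (rule mpol_in_subset_subring[OF S])
    show "mpol_const c \<in> S" for c by (intro AS mpol_const_in)
    fix v assume "v \<in> insert s V"
    moreover have "?x \<in> S"
      unfolding S_def using subring_set_zero[OF A] subring_set_one[OF A]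
      by (intro image_eqI[of _ _ "[:0, 1:]"]) (auto simp: coeff_pCons split: nat.splits)
    ultimately show "mpol_var v \<in> S" using AS[OF mpol_in_var] by auto
  qed
  then show ?thesis using assms by (auto simp: S_def)
qed

lemma coeff_trunc: "Polynomial.coeff (\<Sum>i<n. Polynomial.monom (Polynomial.coeff p i) i) j =
    (if j < n then Polynomial.coeff p j else 0)"
  by (simp add: coeff_sum sum.delta)

text \<open>The Nullstellensatz with an open condition on \<open>u\<close>, by induction on the
  variables. If every relation for the new variable x has all its coefficients in \<open>Q\<close>,
  any value outside finitely many roots extends a point of the smaller prime. Otherwise x is
  algebraic modulo \<open>Q\<close>; a point at which neither the top coefficient of a minimal
  relation nor a suitable multiple of \<open>u\<close> vanishes is extended by a root of that
  relation.\<close>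

lemma prime_has_point:
  fixes Q :: "('v, 'k::alg_closed_field) mpol set"
  assumes "finite V" "prime_of (mpol_in V) Q" "u \<in> mpol_in V - Q"
  shows "\<exists>a. (\<forall>g\<in>Q. mpol_eval a g = 0) \<and> mpol_eval a u \<noteq> 0"
  using assms
proof (induction V arbitrary: Q u rule: finite_induct)
  case empty
  have const: "\<exists>c. g = mpol_const c" if "g \<in> mpol_in {}" for g :: "('v, 'k) mpol"
  proof
    have "Poly_Mapping.keys g \<subseteq> {0}" using that by (auto simp: mpol_in_def)
    then show "g = mpol_const (Poly_Mapping.lookup g 0)"
      by (intro poly_mapping_eqI) (auto simp: mpol_const_def lookup_single when_def in_keys_iff)
  qed
  have "g = 0" if g: "g \<in> Q" for g
  proof (rule ccontr)
    assume "g \<noteq> 0"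
    obtain c where c: "g = mpol_const c" using const g prime_of_subset[OF empty.prems(1)] by blast
    interpret comm_ring_hom "mpol_const :: 'k \<Rightarrow> ('v, 'k) mpol" by (rule comm_ring_hom_mpol_const)
    have "mpol_const (inverse c) * g \<in> Q"
      by (rule ideal_of_mult[OF prime_of_ideal[OF empty.prems(1)] mpol_const_in g])
    moreover have "mpol_const (inverse c) * g = 1"
      using c \<open>g \<noteq> 0\<close> by (cases "c = 0") (auto simp: hom_mult[symmetric] simp del: hom_mult)
    ultimately show False using prime_of_one[OF empty.prems(1)] by simp
  qed
  moreover obtain c where c: "u = mpol_const c" using const empty.prems(2) by blast
  moreover have "c \<noteq> 0"
    using c empty.prems ideal_of_zero[OF prime_of_ideal[OF empty.prems(1)]] by (auto simp: mpol_const_def)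
  ultimately have "(\<forall>g\<in>Q. mpol_eval (\<lambda>_. 0) g = 0) \<and> mpol_eval (\<lambda>_. 0) u \<noteq> 0"
    by (metis comm_ring_hom_id mpol_subst_const mpol_subst_zero)
  then show ?case by blast
next
  case (insert s V)
  define A where "A = (mpol_in V :: ('v, 'k) mpol set)"
  define A' where "A' = (mpol_in (insert s V) :: ('v, 'k) mpol set)"
  define x where "x = (mpol_var s :: ('v, 'k) mpol)"
  define PA where "PA = {p. \<forall>i. Polynomial.coeff p i \<in> A}"
  have A: "subring_set A" and A': "subring_set A'" by (auto simp: A_def A'_def subring_set_mpol_in)
  have AA': "A \<subseteq> A'" by (auto simp: A_def A'_def intro: mpol_in_mono[THEN subsetD])
  have xA': "x \<in> A'" by (auto simp: A'_def x_def intro: mpol_in_var)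
  have Q: "prime_of A' Q" using insert.prems by (simp add: A'_def)
  note QI = prime_of_ideal[OF Q]
  have u: "u \<in> A'" "u \<notin> Q" using insert.prems by (auto simp: A'_def)
  have Q0: "prime_of A (Q \<inter> A)" by (rule prime_of_Int[OF A A' AA' Q])
  have rep: "\<exists>p\<in>PA. g = poly p x" if "g \<in> A'" for g
    using mpol_in_insert_poly[of g s V] that by (auto simp: PA_def A_def A'_def x_def)
  have polyA': "poly p x \<in> A'" if "p \<in> PA" for p
    using that AA' xA' by (intro subring_set_poly[OF A']) (auto simp: PA_def)
  have PA: "subring_set PA" unfolding PA_def by (rule subring_set_polys[OF A])
  have IH: "\<exists>a. (\<forall>g\<in>Q \<inter> A. mpol_eval a g = 0) \<and> mpol_eval a v \<noteq> 0" if "v \<in> A - Q" for v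
    using insert.IH[of "Q \<inter> A" v] Q0 that by (auto simp: A_def)
  have ev: "mpol_eval (a(s := \<xi>)) (poly p x) = poly (map_poly (mpol_eval a) p) \<xi>" if p: "p \<in> PA" for a \<xi> p
  proof -
    interpret h: comm_ring_hom "mpol_eval (a(s := \<xi>)) :: ('v, 'k) mpol \<Rightarrow> 'k"
      by (rule comm_ring_hom_mpol_subst[OF comm_ring_hom_id])
    have "mpol_eval (a(s := \<xi>)) (poly p x) = poly (map_poly (mpol_eval (a(s := \<xi>))) p) (mpol_eval (a(s := \<xi>)) x)"
      by simp
    also have "map_poly (mpol_eval (a(s := \<xi>))) p = map_poly (mpol_eval a) p"
    proof (rule poly_eqI)
      fix i
      have "mpol_eval (a(s := \<xi>)) (Polynomial.coeff p i) = mpol_eval a (Polynomial.coeff p i)"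
        using p insert.hyps(2)
        by (intro mpol_subst_cong[OF comm_ring_hom_id, of _ V]) (auto simp: PA_def A_def)
      then show "Polynomial.coeff (map_poly (mpol_eval (a(s := \<xi>))) p) i = Polynomial.coeff (map_poly (mpol_eval a) p) i"
        by (simp add: coeff_map_poly mpol_subst_zero[OF comm_ring_hom_id])
    qed
    finally show ?thesis unfolding x_def mpol_subst_var[OF comm_ring_hom_id] fun_upd_same .
  qed
  have cf: "Polynomial.coeff (map_poly (mpol_eval a) p) i = mpol_eval a (Polynomial.coeff p i)"
    for a and p :: "('v, 'k) mpol poly" and i
    by (simp add: coeff_map_poly mpol_subst_zero[OF comm_ring_hom_id])
  obtain pu where pu: "pu \<in> PA" "u = poly pu x" using rep u by blast
  have coeffs_Q: "poly p x \<in> Q" if "\<And>i. Polynomial.coeff p i \<in> Q" for p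
    by (rule ideal_of_poly[OF A' QI that xA'])
  show ?case
  proof (cases "\<forall>p\<in>PA. poly p x \<in> Q \<longrightarrow> (\<forall>i. Polynomial.coeff p i \<in> Q)")
    case True
    obtain i0 where i0: "Polynomial.coeff pu i0 \<notin> Q" using coeffs_Q[of pu] pu u by blast
    obtain a where a: "\<forall>g\<in>Q \<inter> A. mpol_eval a g = 0" "mpol_eval a (Polynomial.coeff pu i0) \<noteq> 0"
      using IH[of "Polynomial.coeff pu i0"] i0 pu by (auto simp: PA_def)
    have "map_poly (mpol_eval a) pu \<noteq> 0" using a(2) cf[of a pu i0] by auto
    then have "finite {\<xi>. poly (map_poly (mpol_eval a) pu) \<xi> = 0}" by (rule poly_roots_finite)
    then obtain \<xi> where \<xi>: "poly (map_poly (mpol_eval a) pu) \<xi> \<noteq> 0"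
      using infinite_UNIV_alg_closed[where 'k = 'k] by (metis (mono_tags, lifting) UNIV_eq_I mem_Collect_eq)
    have "mpol_eval (a(s := \<xi>)) g = 0" if g: "g \<in> Q" for g
    proof -
      obtain p where p: "p \<in> PA" "g = poly p x" using rep g prime_of_subset[OF Q] by blast
      then have "\<forall>i. Polynomial.coeff p i \<in> Q \<inter> A" using True g by (auto simp: PA_def)
      then have "map_poly (mpol_eval a) p = 0" using a(1) by (simp add: poly_eq_iff cf)
      then show ?thesis using ev[OF p(1)] p(2) by simp
    qed
    moreover have "mpol_eval (a(s := \<xi>)) u \<noteq> 0" using ev[OF pu(1)] \<xi> pu(2) by simp
    ultimately show ?thesis by blast
  next
    case False
    \<comment> \<open>A relation for x modulo \<open>Q\<close> of exact degree \<open>e\<close>: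
      terms above \<open>e\<close> are cut off and the top coefficient lies outside
      \<open>Q\<close>. The least such \<open>e\<close> is the degree of x over the fraction field
      of \<open>A\<close> modulo \<open>Q\<close>.\<close>
    define good where "good = (\<lambda>e p. p \<in> PA \<and> poly p x \<in> Q \<and> Polynomial.coeff p e \<notin> Q \<and>
        (\<forall>i>e. Polynomial.coeff p i = 0))"
    define T where "T = (\<lambda>n p. \<Sum>i<n. Polynomial.monom (Polynomial.coeff p i) i :: ('v, 'k) mpol poly)"
    have Tc: "Polynomial.coeff (T n p) j = (if j < n then Polynomial.coeff p j else 0)" for n p j
      by (simp add: T_def coeff_trunc)
    have T_PA: "T n p \<in> PA" if "p \<in> PA" for n p
      using that subring_set_zero[OF A] by (auto simp: PA_def Tc)
    have T_mod: "poly p x - poly (T n p) x \<in> Q" if "\<And>i. i \<ge> n \<Longrightarrow> Polynomial.coeff p i \<in> Q" for n p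
      using coeffs_Q[of "p - T n p"] that ideal_of_zero[OF QI] by (simp add: Tc)
    have ex_good: "\<exists>e p'. good e p' \<and> e < n" if p: "p \<in> PA" "poly p x \<in> Q" and i: "Polynomial.coeff p i \<notin> Q"
      and n: "\<And>i. i \<ge> n \<Longrightarrow> Polynomial.coeff p i \<in> Q" for p i n
    proof -
      define I where "I = {i. Polynomial.coeff p i \<notin> Q}"
      have fin: "finite I" using n by (intro finite_subset[of I "{..<n}"]) (auto simp: I_def not_less[symmetric])
      define e where "e = Max I"
      have e: "Polynomial.coeff p e \<notin> Q" using Max_in[OF fin] i by (auto simp: e_def I_def)
      have above: "Polynomial.coeff p i \<in> Q" if "i \<ge> Suc e" for i
        using Max_ge[OF fin, of i] that by (force simp: e_def I_def)
      have "poly p x - (poly p x - poly (T (Suc e) p) x) \<in> Q"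
        by (intro ideal_of_diff[OF A' QI] p T_mod above)
      then have "good e (T (Suc e) p)"
        using T_PA[OF p(1)] e by (auto simp: good_def Tc)
      moreover have "e < n" using e n not_less by blast
      ultimately show ?thesis by blast
    qed
    have "\<exists>e. \<exists>p. good e p"
    proof -
      obtain p i where p: "p \<in> PA" "poly p x \<in> Q" "Polynomial.coeff p i \<notin> Q" using False by blast
      have "Polynomial.coeff p j \<in> Q" if "j \<ge> Suc (Polynomial.degree p)" for j
        using that ideal_of_zero[OF QI] by (simp add: coeff_eq_0)
      then show ?thesis using ex_good[OF p] by blast
    qed
    then obtain p where p: "good (LEAST e. \<exists>p. good e p) p" by (rule LeastI_ex[THEN exE])
    define e where "e = (LEAST e. \<exists>p. good e p)"
    define b where "b = Polynomial.coeff p e"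
    have p: "p \<in> PA" "poly p x \<in> Q" "b \<notin> Q" "\<And>i. i > e \<Longrightarrow> Polynomial.coeff p i = 0"
      using p by (auto simp: good_def e_def b_def)
    have bA: "b \<in> A" using p(1) by (simp add: PA_def b_def)
    have small: "Polynomial.coeff r i \<in> Q"
      if r: "r \<in> PA" "poly r x \<in> Q" "\<And>i. i \<ge> e \<Longrightarrow> Polynomial.coeff r i = 0" for r i
    proof (rule ccontr)
      assume "Polynomial.coeff r i \<notin> Q"
      then obtain e' p' where "good e' p'" "e' < e"
        using ex_good[OF r(1,2), of i e] r(3) ideal_of_zero[OF QI] by auto
      then show False using not_less_Least[of e' "\<lambda>e. \<exists>p. good e p"] by (auto simp: e_def)
    qed
    have e_pos: "e > 0"
    proof (rule ccontr)
      assume "\<not> e > 0"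
      then have "p = [:b:]" using p(4) by (auto simp: poly_eq_iff b_def coeff_pCons split: nat.splits)
      then show False using p(2,3) by simp
    qed
    have div: "\<exists>N h r. h \<in> PA \<and> r \<in> PA \<and> Polynomial.smult (b ^ N) q = p * h + r \<and>
        (\<forall>i\<ge>e. Polynomial.coeff r i = 0)" if "q \<in> PA" for q
      using pseudo_division[OF A, of p e q "Suc (Polynomial.degree q)"] p that
      by (auto simp: PA_def b_def coeff_eq_0 Suc_le_eq)
    \<comment> \<open>A multiple of \<open>u\<close> that is, modulo \<open>Q\<close>, a nonzero
      polynomial expression in x of degree at most \<open>f\<close>. Driving the least
      \<open>f\<close> down to 0 produces a multiple of \<open>u\<close> congruent to an element of
      \<open>A\<close> outside \<open>Q\<close>.\<close>
    define hit where "hit = (\<lambda>f q t. q \<in> PA \<and> t \<in> A' \<and> poly q x - u * t \<in> Q \<and> poly q x \<notin> Q \<and>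
        (\<forall>i>f. Polynomial.coeff q i = (0 :: ('v, 'k) mpol)))"
    have "\<exists>f. (\<exists>q t. hit f q t)"
      using pu u subring_set_one[OF A'] ideal_of_zero[OF QI]
      by (intro exI[of _ "Polynomial.degree pu"] exI[of _ pu] exI[of _ 1]) (auto simp: hit_def coeff_eq_0)
    from LeastI_ex[OF this] obtain q t where qt: "hit (LEAST f. \<exists>q t. hit f q t) q t" by blast
    define f where "f = (LEAST f. \<exists>q t. hit f q t)"
    have least: "\<not> hit f' q t" if "f' < f" for f' q t
      using not_less_Least[of f' "\<lambda>f. \<exists>q t. hit f q t"] that by (auto simp: f_def)
    have q: "q \<in> PA" "t \<in> A'" "poly q x - u * t \<in> Q" "poly q x \<notin> Q" "\<And>i. i > f \<Longrightarrow> Polynomial.coeff q i = 0"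
      using qt by (auto simp: hit_def f_def)
    have "f < e"
    proof (rule ccontr)
      assume "\<not> f < e"
      obtain N h r where hr: "h \<in> PA" "r \<in> PA" "Polynomial.smult (b ^ N) q = p * h + r"
        "\<forall>i\<ge>e. Polynomial.coeff r i = 0" using div[OF q(1)] by blast
      have bN: "b ^ N \<in> A'" "b ^ N \<in> A" using subring_set_power[OF A bA] AA' by auto
      have val: "poly r x = b ^ N * poly q x - poly p x * poly h x"
        using arg_cong[OF hr(3), of "\<lambda>p. poly p x"] by simp
      have ph: "poly p x * poly h x \<in> Q" by (rule ideal_of_mult_right[OF QI polyA'[OF hr(1)] p(2)])
      have "poly r x - u * (b ^ N * t) = b ^ N * (poly q x - u * t) - poly p x * poly h x"
        by (simp add: val algebra_simps)
      also have "\<dots> \<in> Q" by (intro ideal_of_diff[OF A' QI] ideal_of_mult[OF QI] bN q ph)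
      finally have "poly r x - u * (b ^ N * t) \<in> Q" .
      moreover have "poly r x \<notin> Q"
      proof
        assume "poly r x \<in> Q"
        then have "poly r x + poly p x * poly h x \<in> Q" by (intro ideal_of_add[OF QI] ph)
        then have "b ^ N * poly q x \<in> Q" by (simp add: val)
        then show False
          using prime_of_mult_notin[OF Q bN(1) polyA'[OF q(1)]] prime_of_power_notin[OF A' Q _ p(3)] bA AA' q(4)
          by blast
      qed
      ultimately have "hit (e - 1) r (b ^ N * t)"
        using hr bN q(2) e_pos by (auto simp: hit_def intro!: subring_set_mult[OF A'])
      then show False using least[of "e - 1"] \<open>\<not> f < e\<close> e_pos by auto
    qed
    have "f = 0"
    proof (rule ccontr)
      assume f: "f \<noteq> 0"
      define c where "c = Polynomial.coeff q f"
      have cA: "c \<in> A" using q(1) by (simp add: PA_def c_def)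
      have cQ: "c \<notin> Q"
      proof
        assume c: "c \<in> Q"
        have "Polynomial.coeff q i \<in> Q" if "i \<ge> f" for i
          using that q(5)[of i] c ideal_of_zero[OF QI] by (cases "i = f") (auto simp: c_def)
        then have d: "poly q x - poly (T f q) x \<in> Q" by (rule T_mod)
        have "(poly q x - u * t) - (poly q x - poly (T f q) x) \<in> Q"
          by (rule ideal_of_diff[OF A' QI q(3) d])
        moreover have "poly (T f q) x \<notin> Q" using ideal_of_add[OF QI d, of "poly (T f q) x"] q(4) by auto
        ultimately have "hit (f - 1) (T f q) t"
          using T_PA[OF q(1)] q(2) f by (auto simp: hit_def Tc)
        then show False using least[of "f - 1"] f by auto
      qed
      \<comment> \<open>The minimal relation \<open>p\<close> is divided by \<open>q\<close>. The
        remainder is again congruent to a multiple of \<open>u\<close> and has smaller degree, so it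
        must lie in \<open>Q\<close>. Then \<open>h\<close> vanishes at x modulo \<open>Q\<close>
        with degree below \<open>e\<close>, so its coefficients lie in \<open>Q\<close>, and the
        coefficient of degree \<open>e\<close> contradicts that \<open>b\<close> and
        \<open>c\<close> are outside \<open>Q\<close>.\<close>
      obtain N h r where hr: "\<forall>i. Polynomial.coeff h i \<in> A" "\<forall>i. Polynomial.coeff r i \<in> A"
        "Polynomial.smult (c ^ N) p = q * h + r" "\<forall>i\<ge>f. Polynomial.coeff r i = 0"
        "\<forall>i. i + f \<ge> Suc e \<longrightarrow> Polynomial.coeff h i = 0"
        using pseudo_division[OF A, of q f p "Suc e"] q(1,5) p(1,4)
        unfolding c_def by (auto simp: PA_def Suc_le_eq)
      have hrPA: "h \<in> PA" "r \<in> PA" using hr by (auto simp: PA_def)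
      have cN: "c ^ N \<in> A'" using subring_set_power[OF A cA] AA' by auto
      have val: "poly r x = c ^ N * poly p x - poly q x * poly h x"
        using arg_cong[OF hr(3), of "\<lambda>p. poly p x"] by simp
      have cp: "c ^ N * poly p x \<in> Q" by (rule ideal_of_mult[OF QI cN p(2)])
      have hx: "poly h x \<in> A'" by (rule polyA'[OF hrPA(1)])
      have rQ: "poly r x \<in> Q"
      proof (rule ccontr)
        assume nQ: "poly r x \<notin> Q"
        have "poly r x - u * (- t * poly h x) = c ^ N * poly p x - (poly q x - u * t) * poly h x"
          by (simp add: val algebra_simps)
        also have "\<dots> \<in> Q" by (intro ideal_of_diff[OF A' QI] cp ideal_of_mult_right[OF QI hx] q)
        finally have "hit (f - 1) r (- t * poly h x)"
          using nQ hr(4) hrPA(2) q(2) hx f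
          by (auto simp: hit_def intro!: subring_set_mult[OF A'] subring_set_uminus[OF A'])
        then show False using least[of "f - 1"] f by auto
      qed
      have "poly q x * poly h x \<in> Q" using ideal_of_diff[OF A' QI cp rQ] by (simp add: val)
      then have "poly h x \<in> Q" using prime_ofD[OF Q polyA'[OF q(1)] hx] q(4) by blast
      moreover have "Polynomial.coeff h i = 0" if "i \<ge> e" for i using hr(5) that f by auto
      ultimately have hQ: "Polynomial.coeff h i \<in> Q" for i using small[OF hrPA(1)] by blast
      have "Polynomial.coeff (q * h + r) e \<in> Q"
        unfolding coeff_add coeff_mult using hr(4) \<open>f < e\<close> q(1) AA'
        by (intro ideal_of_add[OF QI] ideal_of_sum[OF QI] ideal_of_mult[OF QI] hQ)
           (auto simp: PA_def ideal_of_zero[OF QI])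
      then have "c ^ N * b \<in> Q" unfolding hr(3)[symmetric] by (simp add: b_def)
      then show False
        using prime_of_mult_notin[OF Q cN, of b] prime_of_power_notin[OF A' Q _ cQ] cA bA AA' p(3) by blast
    qed
    define b' where "b' = Polynomial.coeff q 0"
    have "q = [:b':]" using q(5) \<open>f = 0\<close> by (auto simp: poly_eq_iff b'_def coeff_pCons split: nat.splits)
    from arg_cong[OF this, of "\<lambda>q. poly q x"] have "poly q x = b'" by simp
    then have b': "b' - u * t \<in> Q" "b' \<notin> Q" "b' \<in> A" using q(1,3,4) by (simp_all add: PA_def b'_def)
    \<comment> \<open>\<open>b\<close> keeps the specialised relation nonconstant, so that it has a
      root; \<open>b'\<close> is a multiple of \<open>u\<close> modulo \<open>Q\<close> and so keeps
      \<open>u\<close> from vanishing.\<close>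
    have "b * b' \<in> A - Q"
      using prime_of_mult_notin[OF Q, of b b'] bA b' p(3) AA' subring_set_mult[OF A bA b'(3)] by blast
    then obtain a where a: "\<forall>g\<in>Q \<inter> A. mpol_eval a g = 0" "mpol_eval a (b * b') \<noteq> 0" using IH by blast
    have ab: "mpol_eval a b \<noteq> 0" "mpol_eval a b' \<noteq> 0"
      using a(2) by (auto simp: mpol_subst_mult[OF comm_ring_hom_id])
    have "Polynomial.degree (map_poly (mpol_eval a) p) \<ge> e"
      using ab(1) by (intro le_degree) (simp add: cf b_def)
    then obtain \<xi> where \<xi>: "poly (map_poly (mpol_eval a) p) \<xi> = 0"
      using e_pos alg_closed_imp_poly_has_root[of "map_poly (mpol_eval a) p"] by auto
    define a' where "a' = a(s := \<xi>)"
    interpret h: comm_ring_hom "mpol_eval a' :: ('v, 'k) mpol \<Rightarrow> 'k"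
      by (rule comm_ring_hom_mpol_subst[OF comm_ring_hom_id])
    have a'A: "mpol_eval a' g = mpol_eval a g" if "g \<in> A" for g
      using that insert.hyps(2) by (intro mpol_subst_cong[OF comm_ring_hom_id, of _ V]) (auto simp: a'_def A_def)
    have zero: "mpol_eval a' g = 0" if g: "g \<in> Q" for g
    proof -
      obtain q where q: "q \<in> PA" "g = poly q x" using rep g prime_of_subset[OF Q] by blast
      obtain N h r where hr: "h \<in> PA" "r \<in> PA" "Polynomial.smult (b ^ N) q = p * h + r"
        "\<forall>i\<ge>e. Polynomial.coeff r i = 0" using div[OF q(1)] by blast
      have val: "b ^ N * g = poly p x * poly h x + poly r x"
        using arg_cong[OF hr(3), of "\<lambda>p. poly p x"] q(2) by simp
      have "b ^ N * g - poly p x * poly h x \<in> Q"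
        using subring_set_power[OF A bA, of N] AA' g polyA'[OF hr(1)] p(2)
        by (intro ideal_of_diff[OF A' QI] ideal_of_mult[OF QI] ideal_of_mult_right[OF QI]) auto
      then have "poly r x \<in> Q" by (simp add: val)
      then have "\<forall>i. Polynomial.coeff r i \<in> Q \<inter> A" using small[OF hr(2)] hr(2,4) by (auto simp: PA_def)
      then have "map_poly (mpol_eval a) r = 0" using a(1) by (simp add: poly_eq_iff cf)
      then have "mpol_eval a' (poly r x) = 0" using ev[OF hr(2), of a \<xi>] by (simp add: a'_def)
      moreover have "mpol_eval a' (poly p x) = 0" using ev[OF p(1), of a \<xi>] \<xi> by (simp add: a'_def)
      ultimately have "mpol_eval a' (b ^ N * g) = 0" unfolding val h.hom_add h.hom_mult by simp
      then have "mpol_eval a b ^ N * mpol_eval a' g = 0"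
        unfolding h.hom_mult h.hom_power a'A[OF bA] .
      then show ?thesis using ab(1) by simp
    qed
    have "mpol_eval a' u \<noteq> 0"
    proof
      assume "mpol_eval a' u = 0"
      then have "mpol_eval a' b' = 0" using zero[OF b'(1)] by (simp add: h.hom_minus h.hom_mult)
      then show False using ab(2) a'A[OF b'(3)] by simp
    qed
    then show ?thesis using zero by blast
  qed
qed

section \<open>Bounding the length of chains of primes\<close>

text \<open>Elements \<open>x j \<in> P j - P (j - 1)\<close> along a chain of primes are algebraically independent modulo
  the smallest one: divide a relation by its lowest power of \<open>x 1\<close> and reduce modulo \<open>x 1\<close>.\<close>

lemma chain_algebraically_independent:
  fixes \<kappa> :: "'k::field \<Rightarrow> 'a::comm_ring_1"
  assumes A: "subring_set A" and \<kappa>: "comm_ring_hom \<kappa>" "\<And>c. \<kappa> c \<in> A"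
    and P: "\<And>i. i \<le> r \<Longrightarrow> prime_of A (P i)" "\<And>i. i < r \<Longrightarrow> P i \<subseteq> P (Suc i)"
    and x: "\<And>i. i < r \<Longrightarrow> x (Suc i) \<in> P (Suc i) - P i"
    and "i \<le> r" "finite F" "F \<noteq> {}"
    and "\<And>\<alpha> \<beta>. \<alpha> \<in> F \<Longrightarrow> \<beta> \<in> F \<Longrightarrow> (\<And>j. j \<in> {i<..r} \<Longrightarrow> \<alpha> j = \<beta> j) \<Longrightarrow> \<alpha> = \<beta>"
    and "\<And>\<alpha>. \<alpha> \<in> F \<Longrightarrow> c \<alpha> \<noteq> 0"
  shows "(\<Sum>\<alpha>\<in>F. \<kappa> (c \<alpha>) * (\<Prod>j\<in>{i<..r}. x j ^ \<alpha> j)) \<notin> P i"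
  using assms(7-)
proof (induction i arbitrary: F rule: inc_induct)
  case base
  interpret comm_ring_hom \<kappa> by (rule \<kappa>)
  obtain \<alpha> where "\<alpha> \<in> F" using base by blast
  have "\<beta> = \<alpha>" if "\<beta> \<in> F" for \<beta> by (rule base(3)[OF that \<open>\<alpha> \<in> F\<close>]) simp
  then have F: "F = {\<alpha>}" using \<open>\<alpha> \<in> F\<close> by blast
  show ?case
  proof
    assume "(\<Sum>\<alpha>\<in>F. \<kappa> (c \<alpha>) * (\<Prod>j\<in>{r<..r}. x j ^ \<alpha> j)) \<in> P r"
    then have "\<kappa> (inverse (c \<alpha>)) * \<kappa> (c \<alpha>) \<in> P r"
      using ideal_of_mult[OF prime_of_ideal[OF P(1)] \<kappa>(2)] by (simp add: F)
    moreover have "c \<alpha> \<noteq> 0" using base(4) F by auto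
    ultimately show False using prime_of_one[OF P(1)[of r]] by (simp add: hom_mult[symmetric] del: hom_mult)
  qed
next
  case (step i)
  define xi where "xi = x (Suc i)"
  define Y where "Y = (\<lambda>\<alpha>. \<Prod>j\<in>{Suc i<..r}. x j ^ \<alpha> j)"
  define e where "e = Min ((\<lambda>\<alpha>. \<alpha> (Suc i)) ` F)"
  define F' where "F' = {\<alpha> \<in> F. \<alpha> (Suc i) = e}"
  have Pi: "prime_of A (P i)" "prime_of A (P (Suc i))" using P step.hyps by auto
  note I = prime_of_ideal[OF Pi(1)] and I' = prime_of_ideal[OF Pi(2)]
  have xA: "x j \<in> A" if "j \<in> {i<..r}" for j
    using x[of "j - 1"] prime_of_subset[OF P(1)[of j]] that by auto
  have XA: "xi \<in> A" and XP: "xi \<in> P (Suc i)" "xi \<notin> P i" using xA[of "Suc i"] x step.hyps by (auto simp: xi_def)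
  have YA: "Y \<alpha> \<in> A" for \<alpha>
    unfolding Y_def by (intro subring_set_prod[OF A] subring_set_power[OF A] xA) auto
  have le: "e \<le> \<alpha> (Suc i)" if "\<alpha> \<in> F" for \<alpha> using that step.prems by (auto simp: e_def)
  have "e \<in> (\<lambda>\<alpha>. \<alpha> (Suc i)) ` F" unfolding e_def using step.prems by (intro Min_in) auto
  then have F': "F' \<noteq> {}" "finite F'" "F' \<subseteq> F" using step.prems by (auto simp: F'_def)
  have dec: "{i<..r} = insert (Suc i) {Suc i<..r}" using step.hyps by auto
  define R where "R = (\<Sum>\<alpha>\<in>F. \<kappa> (c \<alpha>) * xi ^ (\<alpha> (Suc i) - e) * Y \<alpha>)"
  have RA: "R \<in> A"
    unfolding R_def by (intro subring_set_sum[OF A] subring_set_mult[OF A] subring_set_power[OF A] \<kappa> XA YA)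
  have eq: "(\<Sum>\<alpha>\<in>F. \<kappa> (c \<alpha>) * (\<Prod>j\<in>{i<..r}. x j ^ \<alpha> j)) = xi ^ e * R"
    unfolding R_def sum_distrib_left dec
  proof (rule sum.cong[OF refl])
    fix \<alpha> assume "\<alpha> \<in> F"
    then have "xi ^ \<alpha> (Suc i) = xi ^ e * xi ^ (\<alpha> (Suc i) - e)" using le by (simp flip: power_add)
    then show "\<kappa> (c \<alpha>) * (\<Prod>j\<in>insert (Suc i) {Suc i<..r}. x j ^ \<alpha> j) =
        xi ^ e * (\<kappa> (c \<alpha>) * xi ^ (\<alpha> (Suc i) - e) * Y \<alpha>)"
      by (simp add: xi_def Y_def)
  qed
  have split: "R = (\<Sum>\<alpha>\<in>F'. \<kappa> (c \<alpha>) * Y \<alpha>) + (\<Sum>\<alpha>\<in>F - F'. \<kappa> (c \<alpha>) * xi ^ (\<alpha> (Suc i) - e) * Y \<alpha>)"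
    unfolding R_def using sum.subset_diff[OF F'(3), of "\<lambda>\<alpha>. \<kappa> (c \<alpha>) * xi ^ (\<alpha> (Suc i) - e) * Y \<alpha>"] step.prems(1)
    by (simp add: F'_def add.commute)
  have rest: "(\<Sum>\<alpha>\<in>F - F'. \<kappa> (c \<alpha>) * xi ^ (\<alpha> (Suc i) - e) * Y \<alpha>) \<in> P (Suc i)"
  proof (rule ideal_of_sum[OF I'])
    fix \<alpha> assume "\<alpha> \<in> F - F'"
    then have "\<alpha> (Suc i) - e \<noteq> 0" using le[of \<alpha>] by (auto simp: F'_def)
    then obtain n where "\<alpha> (Suc i) - e = Suc n" by (cases "\<alpha> (Suc i) - e") auto
    then have "\<kappa> (c \<alpha>) * xi ^ (\<alpha> (Suc i) - e) * Y \<alpha> = (\<kappa> (c \<alpha>) * xi ^ n * Y \<alpha>) * xi"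
      by (simp add: ac_simps)
    also have "\<dots> \<in> P (Suc i)"
      by (intro ideal_of_mult[OF I'] XP subring_set_mult[OF A] subring_set_power[OF A] \<kappa> XA YA)
    finally show "\<kappa> (c \<alpha>) * xi ^ (\<alpha> (Suc i) - e) * Y \<alpha> \<in> P (Suc i)" .
  qed
  have IH: "(\<Sum>\<alpha>\<in>F'. \<kappa> (c \<alpha>) * Y \<alpha>) \<notin> P (Suc i)"
    unfolding Y_def
  proof (rule step.IH)
    fix \<alpha> \<beta> assume ab: "\<alpha> \<in> F'" "\<beta> \<in> F'" "\<And>j. j \<in> {Suc i<..r} \<Longrightarrow> \<alpha> j = \<beta> j"
    show "\<alpha> = \<beta>"
      by (rule step.prems(3)) (use ab in \<open>auto simp: F'_def dec\<close>)
  qed (use F' step.prems in auto)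
  show ?case
  proof
    assume "(\<Sum>\<alpha>\<in>F. \<kappa> (c \<alpha>) * (\<Prod>j\<in>{i<..r}. x j ^ \<alpha> j)) \<in> P i"
    then have "R \<in> P i"
      using prime_ofD[OF Pi(1) subring_set_power[OF A XA] RA, of e]
        prime_of_power_notin[OF A Pi(1) XA XP(2), of e] by (simp add: eq)
    then have "R \<in> P (Suc i)" using P(2) step.hyps by blast
    then have "R - (\<Sum>\<alpha>\<in>F - F'. \<kappa> (c \<alpha>) * xi ^ (\<alpha> (Suc i) - e) * Y \<alpha>) \<in> P (Suc i)"
      by (rule ideal_of_diff[OF A I' _ rest])
    then show False using IH by (simp add: split)
  qed
qed

text \<open>Gaussian elimination, one equation at a time: the pivot unknown \<open>i0\<close> is
  eliminated, the smaller system is solved, and the value \<open>t\<close> at the pivot is forced by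
  the eliminated equation.\<close>

lemma underdetermined_system:
  fixes c :: "'i \<Rightarrow> 'j \<Rightarrow> 'k::field"
  assumes "finite J" "finite I" "card J < card I"
  shows "\<exists>v. (\<exists>i\<in>I. v i \<noteq> 0) \<and> (\<forall>j\<in>J. (\<Sum>i\<in>I. v i * c i j) = 0)"
  using assms
proof (induction J arbitrary: I c)
  case empty
  then have "I \<noteq> {}" by auto
  then show ?case by (intro exI[of _ "\<lambda>_. 1"]) auto
next
  case (insert j0 J)
  show ?case
  proof (cases "\<forall>i\<in>I. c i j0 = 0")
    case True
    then show ?thesis using insert.IH[of I c] insert by auto
  next
    case False
    then obtain i0 where i0: "i0 \<in> I" "c i0 j0 \<noteq> 0" by blast
    define c' where "c' = (\<lambda>i j. c i j - c i j0 / c i0 j0 * c i0 j)"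
    have "card J < card (I - {i0})" using insert.prems insert.hyps i0(1) by simp
    then obtain v where v: "\<exists>i\<in>I - {i0}. v i \<noteq> 0" "\<forall>j\<in>J. (\<Sum>i\<in>I - {i0}. v i * c' i j) = 0"
      using insert.IH[of "I - {i0}" c'] insert.prems(1) by blast
    define t where "t = - (\<Sum>i\<in>I - {i0}. v i * c i j0) / c i0 j0"
    define v' where "v' = v(i0 := t)"
    have sum: "(\<Sum>i\<in>I. v' i * c i j) = t * c i0 j + (\<Sum>i\<in>I - {i0}. v i * c i j)" for j
      using insert.prems(1) i0(1) by (simp add: sum.remove[of I i0] v'_def)
    have "(\<Sum>i\<in>I. v' i * c i j) = 0" if "j \<in> insert j0 J" for j
    proof (cases "j = j0")
      case True
      then show ?thesis using i0(2) by (simp add: sum t_def)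
    next
      case False
      then have "0 = (\<Sum>i\<in>I - {i0}. v i * c' i j)" using v(2) that by simp
      also have "\<dots> = (\<Sum>i\<in>I - {i0}. v i * c i j) - (\<Sum>i\<in>I - {i0}. v i * c i j0) / c i0 j0 * c i0 j"
        by (simp add: c'_def right_diff_distrib sum_subtractf sum_distrib_right sum_divide_distrib mult.assoc)
      finally show ?thesis by (simp add: sum t_def)
    qed
    moreover have "\<exists>i\<in>I. v' i \<noteq> 0" using v(1) by (auto simp: v'_def)
    ultimately show ?thesis by blast
  qed
qed

text \<open>\<open>bspan r\<close> consists of the combinations, modulo \<open>P\<close>, of the products of a module generator in
  \<open>Z\<close> with a monomial in the \<open>y w\<close> all of whose exponents are at most \<open>r\<close>; its dimension grows like
  \<open>r ^ card W\<close>. Elements satisfying \<open>op\<close> enlarge the box by a bounded amount, and so cannot have more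
  than \<open>card W\<close> algebraically independent elements among their quotients.\<close>

locale box_filtration =
  fixes A P :: "'a::comm_ring_1 set" and \<kappa> :: "'k::field \<Rightarrow> 'a"
    and W :: "'w set" and y :: "'w \<Rightarrow> 'a" and Z :: "'a set"
  assumes A: "subring_set A" and P: "prime_of A P" and \<kappa>: "comm_ring_hom \<kappa>" "\<And>c. \<kappa> c \<in> A"
    and W: "finite W" and y: "\<And>w. w \<in> W \<Longrightarrow> y w \<in> A"
    and Z: "finite Z" "1 \<in> Z" "Z \<subseteq> A"
begin

interpretation \<kappa>: comm_ring_hom \<kappa> by (rule \<kappa>)

lemmas I = prime_of_ideal[OF P]

inductive_set bspan :: "nat \<Rightarrow> 'a set" for r where
  bspan_P: "a \<in> P \<Longrightarrow> a \<in> bspan r"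
| bspan_gen: "(\<And>w. w \<in> W \<Longrightarrow> \<beta> w \<le> r) \<Longrightarrow> \<zeta> \<in> Z \<Longrightarrow> \<kappa> c * (\<Prod>w\<in>W. y w ^ \<beta> w) * \<zeta> \<in> bspan r"
| bspan_add: "a \<in> bspan r \<Longrightarrow> b \<in> bspan r \<Longrightarrow> a + b \<in> bspan r"

lemma yA: "(\<Prod>w\<in>W. y w ^ \<beta> w) \<in> A"
  by (intro subring_set_prod[OF A] subring_set_power[OF A] y)

lemma bspan_mono: "a \<in> bspan r \<Longrightarrow> r \<le> r' \<Longrightarrow> a \<in> bspan r'"
  by (induction rule: bspan.induct) (auto intro: bspan.intros order_trans)

lemma bspan_ymult:
  "a \<in> bspan r \<Longrightarrow> (\<And>w. w \<in> W \<Longrightarrow> \<beta> w \<le> s) \<Longrightarrow> \<kappa> c * (\<Prod>w\<in>W. y w ^ \<beta> w) * a \<in> bspan (r + s)"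
proof (induction rule: bspan.induct)
  case (bspan_P a)
  then show ?case
    by (intro bspan.bspan_P ideal_of_mult[OF I] subring_set_mult[OF A] yA \<kappa>)
next
  case (bspan_gen \<beta>' \<zeta> c')
  have "\<kappa> c * (\<Prod>w\<in>W. y w ^ \<beta> w) * (\<kappa> c' * (\<Prod>w\<in>W. y w ^ \<beta>' w) * \<zeta>) =
      \<kappa> (c * c') * (\<Prod>w\<in>W. y w ^ (\<beta>' w + \<beta> w)) * \<zeta>"
    by (simp add: \<kappa>.hom_mult power_add prod.distrib ac_simps)
  also have "\<dots> \<in> bspan (r + s)"
    using bspan_gen by (intro bspan.bspan_gen) (auto intro: add_mono)
  finally show ?case .
next
  case (bspan_add a b)
  then show ?case by (auto simp: distrib_left intro: bspan.bspan_add)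
qed

definition op :: "'a \<Rightarrow> bool" where
  "op s \<longleftrightarrow> s \<in> A \<and> (\<exists>D. \<forall>r. \<forall>a\<in>bspan r. s * a \<in> bspan (r + D))"

text \<open>Multiplication by \<open>s\<close> commutes with the monomials in the \<open>y w\<close>
  and preserves \<open>P\<close>, so only its effect on the finitely many module generators has to
  be bounded.\<close>

lemma opI:
  assumes s: "s \<in> A" and "\<And>\<zeta>. \<zeta> \<in> Z \<Longrightarrow> \<exists>D. s * \<zeta> \<in> bspan D"
  shows "op s"
proof -
  obtain D where D: "\<And>\<zeta>. \<zeta> \<in> Z \<Longrightarrow> s * \<zeta> \<in> bspan (D \<zeta>)" using assms(2) by metis
  define E where "E = Max (D ` Z)"
  have E: "s * \<zeta> \<in> bspan E" if "\<zeta> \<in> Z" for \<zeta>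
    using bspan_mono[OF D[OF that]] that Z(1) by (simp add: E_def)
  have "s * a \<in> bspan (r + E)" if "a \<in> bspan r" for a r
    using that
  proof (induction rule: bspan.induct)
    case (bspan_P a)
    then show ?case by (intro bspan.bspan_P ideal_of_mult[OF I] s)
  next
    case (bspan_gen \<beta> \<zeta> c)
    have "\<kappa> c * (\<Prod>w\<in>W. y w ^ \<beta> w) * (s * \<zeta>) \<in> bspan (E + r)"
      by (rule bspan_ymult) (use bspan_gen E in auto)
    then show ?case by (simp add: ac_simps)
  next
    case (bspan_add a b)
    then show ?case by (auto simp: distrib_left intro: bspan.bspan_add)
  qed
  then show ?thesis using s by (auto simp: op_def)
qed

lemma op_add: assumes "op s" "op t" shows "op (s + t)"
proof -
  obtain D E where D: "\<forall>r. \<forall>a\<in>bspan r. s * a \<in> bspan (r + D)" and E: "\<forall>r. \<forall>a\<in>bspan r. t * a \<in> bspan (r + E)"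
    using assms by (auto simp: op_def)
  have "(s + t) * a \<in> bspan (r + max D E)" if "a \<in> bspan r" for a r
    unfolding distrib_right
    using bspan_mono[OF D[rule_format, OF that], of "r + max D E"]
      bspan_mono[OF E[rule_format, OF that], of "r + max D E"] by (intro bspan_add) auto
  then show ?thesis using assms by (auto simp: op_def intro: subring_set_add[OF A])
qed

lemma op_mult: assumes "op s" "op t" shows "op (s * t)"
proof -
  obtain D E where D: "\<forall>r. \<forall>a\<in>bspan r. s * a \<in> bspan (r + D)" and E: "\<forall>r. \<forall>a\<in>bspan r. t * a \<in> bspan (r + E)"
    using assms by (auto simp: op_def)
  have "s * t * a \<in> bspan (r + (E + D))" if "a \<in> bspan r" for a r
    using D E that by (simp add: mult.assoc flip: add.assoc)
  then show ?thesis using assms by (auto simp: op_def intro: subring_set_mult[OF A])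
qed

lemma op_P: "s \<in> P \<Longrightarrow> op s"
  using prime_of_subset[OF P] Z
  by (intro opI) (auto intro!: exI[of _ 0] bspan_P ideal_of_mult_right[OF I])

lemma op_monom: "op (\<kappa> c * (\<Prod>w\<in>W. y w ^ \<beta> w))"
proof (rule opI)
  fix \<zeta> assume "\<zeta> \<in> Z"
  then have "\<kappa> c * (\<Prod>w\<in>W. y w ^ \<beta> w) * \<zeta> \<in> bspan (Max (\<beta> ` W))"
    using W by (intro bspan_gen) auto
  then show "\<exists>D. \<kappa> c * (\<Prod>w\<in>W. y w ^ \<beta> w) * \<zeta> \<in> bspan D" ..
qed (intro subring_set_mult[OF A] yA \<kappa>)

lemma op_const: "op (\<kappa> c)"
  using op_monom[of c "\<lambda>_. 0"] by simp

lemma op_one: "op 1"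
  using op_const[of 1] by simp

lemma op_y: assumes "w \<in> W" shows "op (y w)"
proof -
  have "(\<Prod>v\<in>W. y v ^ (if v = w then 1 else 0)) = y w"
    using W assms by (simp add: prod.remove[of W w])
  then show ?thesis using op_monom[of 1 "\<lambda>v. if v = w then 1 else 0"] by simp
qed

definition algebraic_elems :: "'a set" where
  "algebraic_elems = {x \<in> A. \<exists>s\<in>A - P. op s \<and> op (s * x)}"

lemma algebraic_elemsI: "op x \<Longrightarrow> x \<in> algebraic_elems"
  using op_one subring_set_one[OF A] prime_of_one[OF P]
  unfolding algebraic_elems_def by (intro CollectI conjI bexI[of _ 1]) (simp_all add: op_def)

lemma subring_set_algebraic_elems: "subring_set algebraic_elems"
  unfolding subring_set_def
proof (intro conjI ballI)
  show "1 \<in> algebraic_elems" by (rule algebraic_elemsI[OF op_one])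
  fix x x' assume "x \<in> algebraic_elems" "x' \<in> algebraic_elems"
  then obtain s s' where s: "s \<in> A - P" "op s" "op (s * x)" "s' \<in> A - P" "op s'" "op (s' * x')" "x \<in> A" "x' \<in> A"
    by (auto simp: algebraic_elems_def)
  have ss: "s * s' \<in> A - P" using s prime_of_mult_notin[OF P] subring_set_mult[OF A] by auto
  have "op (s' * (s * x) + \<kappa> (-1) * (s * (s' * x')))" by (intro op_add op_mult op_const s)
  also have "s' * (s * x) + \<kappa> (-1) * (s * (s' * x')) = s * s' * (x - x')"
    by (simp add: algebra_simps \<kappa>.hom_uminus)
  finally show "x - x' \<in> algebraic_elems"
    using s ss by (auto simp: algebraic_elems_def intro!: subring_set_diff[OF A] bexI[OF _ ss] op_mult)
  have "op ((s * x) * (s' * x'))" by (intro op_mult s)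
  also have "(s * x) * (s' * x') = s * s' * (x * x')" by (simp add: ac_simps)
  finally show "x * x' \<in> algebraic_elems"
    using s ss by (auto simp: algebraic_elems_def intro!: subring_set_mult[OF A] bexI[OF _ ss] op_mult)
qed

lemma algebraic_elems_div:
  assumes "c \<in> algebraic_elems" "c \<notin> P" "x \<in> A" "c * x \<in> algebraic_elems"
  shows "x \<in> algebraic_elems"
proof -
  obtain s where s: "s \<in> A - P" "op s" "op (s * c)" "c \<in> A" using assms(1) by (auto simp: algebraic_elems_def)
  obtain t where t: "t \<in> A - P" "op t" "op (t * (c * x))" using assms(4) by (auto simp: algebraic_elems_def)
  have "(s * c) * t \<in> A - P"
    using s t assms(2) prime_of_mult_notin[OF P] subring_set_mult[OF A] by auto
  moreover have "op ((s * c) * t)" by (intro op_mult s t)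
  moreover have "op ((s * c) * t * x)"
    using op_mult[OF s(2) t(3)] by (simp add: ac_simps)
  ultimately show ?thesis using assms(3) unfolding algebraic_elems_def by blast
qed

text \<open>Puts all of \<open>bspan r\<close> into the span, modulo \<open>P\<close>, of one finite
  family with card Z * (r + 1) ^ card W members. Exponents are restricted to \<open>W\<close> to
  make the index set finite.\<close>

lemma bspan_repr:
  "a \<in> bspan r \<Longrightarrow> \<exists>c. a - (\<Sum>(\<beta>, \<zeta>)\<in>(W \<rightarrow>\<^sub>E {..r}) \<times> Z. \<kappa> (c (\<beta>, \<zeta>)) * (\<Prod>w\<in>W. y w ^ \<beta> w) * \<zeta>) \<in> P"
proof (induction rule: bspan.induct)
  case (bspan_P a)
  then show ?case by (intro exI[of _ "\<lambda>_. 0"]) simp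
next
  case (bspan_gen \<beta> \<zeta> c)
  let ?\<beta> = "restrict \<beta> W"
  have mem: "(?\<beta>, \<zeta>) \<in> (W \<rightarrow>\<^sub>E {..r}) \<times> Z" using bspan_gen by auto
  have fin: "finite ((W \<rightarrow>\<^sub>E {..r}) \<times> Z)" using W Z by (auto intro: finite_PiE)
  have "(\<Sum>(\<beta>', \<zeta>')\<in>(W \<rightarrow>\<^sub>E {..r}) \<times> Z. \<kappa> (if (\<beta>', \<zeta>') = (?\<beta>, \<zeta>) then c else 0) * (\<Prod>w\<in>W. y w ^ \<beta>' w) * \<zeta>') =
     (\<Sum>p\<in>(W \<rightarrow>\<^sub>E {..r}) \<times> Z. if p = (?\<beta>, \<zeta>) then \<kappa> c * (\<Prod>w\<in>W. y w ^ \<beta> w) * \<zeta> else 0)"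
  proof (rule sum.cong[OF refl])
    fix p assume "p \<in> (W \<rightarrow>\<^sub>E {..r}) \<times> Z"
    show "(case p of (\<beta>', \<zeta>') \<Rightarrow> \<kappa> (if (\<beta>', \<zeta>') = (?\<beta>, \<zeta>) then c else 0) * (\<Prod>w\<in>W. y w ^ \<beta>' w) * \<zeta>') =
        (if p = (?\<beta>, \<zeta>) then \<kappa> c * (\<Prod>w\<in>W. y w ^ \<beta> w) * \<zeta> else 0)"
      by (cases "p = (?\<beta>, \<zeta>)") (auto simp: case_prod_beta prod_eq_iff cong: prod.cong)
  qed
  also have "\<dots> = \<kappa> c * (\<Prod>w\<in>W. y w ^ \<beta> w) * \<zeta>"
    using mem fin by (subst sum.delta) auto
  finally show ?case
    using ideal_of_zero[OF I] by (intro exI[of _ "\<lambda>p. if p = (?\<beta>, \<zeta>) then c else 0"]) simp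
next
  case (bspan_add a b)
  then obtain c c' where c: "a - (\<Sum>(\<beta>, \<zeta>)\<in>(W \<rightarrow>\<^sub>E {..r}) \<times> Z. \<kappa> (c (\<beta>, \<zeta>)) * (\<Prod>w\<in>W. y w ^ \<beta> w) * \<zeta>) \<in> P"
    "b - (\<Sum>(\<beta>, \<zeta>)\<in>(W \<rightarrow>\<^sub>E {..r}) \<times> Z. \<kappa> (c' (\<beta>, \<zeta>)) * (\<Prod>w\<in>W. y w ^ \<beta> w) * \<zeta>) \<in> P" by blast
  show ?case
    using ideal_of_add[OF I c]
    by (intro exI[of _ "\<lambda>p. c p + c' p"])
       (simp add: \<kappa>.hom_add distrib_right case_prod_beta sum.distrib algebra_simps)
qed

text \<open>A dimension count. After multiplication by a power of a common denominator, the
  monomials in card W + 1 elements with exponents below \<open>R\<close> number R ^ (card W + 1),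
  but they lie in a box whose dimension grows only like R ^ card W.\<close>

lemma algebraic_elems_dependent:
  assumes J: "finite J" "card J = Suc (card W)" and x: "\<And>j. j \<in> J \<Longrightarrow> x j \<in> algebraic_elems"
  shows "\<exists>F c. finite F \<and> F \<noteq> {} \<and> F \<subseteq> (J \<rightarrow>\<^sub>E (UNIV :: nat set)) \<and> (\<forall>\<alpha>\<in>F. c \<alpha> \<noteq> 0) \<and>
    (\<Sum>\<alpha>\<in>F. \<kappa> (c \<alpha>) * (\<Prod>j\<in>J. x j ^ \<alpha> j)) \<in> P"
proof -
  have "\<forall>j\<in>J. \<exists>s. s \<in> A - P \<and> op s \<and> op (s * x j)" using x by (auto simp: algebraic_elems_def)
  then obtain s' where s': "\<And>j. j \<in> J \<Longrightarrow> s' j \<in> A - P" "\<And>j. j \<in> J \<Longrightarrow> op (s' j)"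
    "\<And>j. j \<in> J \<Longrightarrow> op (s' j * x j)" by metis
  define s where "s = (\<Prod>j\<in>J. s' j)"
  have sP: "s \<in> A - P" unfolding s_def by (rule prime_of_prod_notin[OF A P s'(1)])
  have op_prod: "op (\<Prod>j\<in>J'. s' j)" if "J' \<subseteq> J" for J'
    using that finite_subset[OF that J(1)] 
    by (induction J' rule: infinite_finite_induct) (auto intro: op_one op_mult s')
  have opsx: "op (s * x j)" if "j \<in> J" for j
  proof -
    have "s * x j = (s' j * x j) * (\<Prod>j\<in>J - {j}. s' j)"
      using J(1) that by (simp add: s_def prod.remove[of J j] ac_simps)
    then show ?thesis using op_mult[OF s'(3)[OF that] op_prod[of "J - {j}"]] by simp
  qed
  have xA: "x j \<in> A" if "j \<in> J" for j using x[OF that] by (simp add: algebraic_elems_def)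
  have "\<forall>j\<in>J. \<exists>D. \<forall>r. \<forall>a\<in>bspan r. s * x j * a \<in> bspan (r + D)" using opsx by (auto simp: op_def)
  then obtain E where E: "\<And>j r a. j \<in> J \<Longrightarrow> a \<in> bspan r \<Longrightarrow> s * x j * a \<in> bspan (r + E j)" by metis
  obtain E0 where E0: "\<And>r a. a \<in> bspan r \<Longrightarrow> s * a \<in> bspan (r + E0)"
    using op_prod[of J] by (auto simp: op_def s_def)
  define D where "D = Max (insert E0 (E ` J))"
  have D: "s * x j * a \<in> bspan (r + D)" if "j \<in> J" "a \<in> bspan r" for j r a
    by (rule bspan_mono[OF E[OF that]]) (use J that in \<open>simp add: D_def Max_ge_iff; blast\<close>)
  have D0: "s * a \<in> bspan (r + D)" if "a \<in> bspan r" for r a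
    by (rule bspan_mono[OF E0[OF that]]) (use J in \<open>simp add: D_def\<close>)
  have s_pow: "s ^ n * a \<in> bspan (r + n * D)" if "a \<in> bspan r" for n r a
    using that
  proof (induction n)
    case (Suc n)
    then show ?case using D0[OF Suc.IH] by (simp add: ac_simps)
  qed simp
  have x_pow: "(s * x j) ^ n * a \<in> bspan (r + n * D)" if "j \<in> J" "a \<in> bspan r" for j n r a
    using that
  proof (induction n)
    case (Suc n)
    then show ?case using D[OF that(1) Suc.IH] by (simp add: ac_simps)
  qed simp
  have x_prod: "(\<Prod>j\<in>J'. (s * x j) ^ \<alpha> j) * a \<in> bspan (r + (\<Sum>j\<in>J'. \<alpha> j) * D)"
    if "J' \<subseteq> J" "a \<in> bspan r" for J' \<alpha> r a
    using finite_subset[OF that(1) J(1)] that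
  proof (induction J' rule: finite_induct)
    case (insert j J')
    then have "(s * x j) ^ \<alpha> j * ((\<Prod>j\<in>J'. (s * x j) ^ \<alpha> j) * a) \<in> bspan (r + (\<Sum>j\<in>J'. \<alpha> j) * D + \<alpha> j * D)"
      by (intro x_pow) auto
    then show ?case using insert.hyps by (simp add: algebra_simps)
  qed simp
  define n where "n = card W"
  \<comment> \<open>With \<open>n = card W\<close> each exponent in the box takes T * D + 1 \<le>
    (Suc n * D + 1) * R values. The box thus has dimension at most (R - 1) * R ^ n, less than the R
    ^ Suc n monomials indexed by \<open>I\<close>.\<close>
  define R where "R = card Z * (Suc n * D + 1) ^ n + 1"
  define T where "T = Suc n * R"
  define I where "I = (J \<rightarrow>\<^sub>E {..<R})"
  have one: "1 \<in> bspan 0" using bspan_gen[of "\<lambda>_. 0" 0 1 1] Z by simp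
  \<comment> \<open>Padding with powers of \<open>s\<close> gives every monomial the same prefactor
    \<open>s ^ T\<close> and places all of them in one box. The prefactor is cancelled at the end,
    as \<open>s\<close> lies outside \<open>P\<close>.\<close>
  have mem: "s ^ T * (\<Prod>j\<in>J. x j ^ \<alpha> j) \<in> bspan (T * D)" if \<alpha>: "\<alpha> \<in> I" for \<alpha>
  proof -
    have "(\<Sum>j\<in>J. \<alpha> j) \<le> (\<Sum>j\<in>J. R)" using \<alpha> by (intro sum_mono) (auto simp: I_def PiE_iff less_imp_le)
    then have le: "(\<Sum>j\<in>J. \<alpha> j) \<le> T" using J by (simp add: T_def n_def)
    have "s ^ (T - (\<Sum>j\<in>J. \<alpha> j)) * ((\<Prod>j\<in>J. (s * x j) ^ \<alpha> j) * 1) \<in>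
        bspan (0 + (\<Sum>j\<in>J. \<alpha> j) * D + (T - (\<Sum>j\<in>J. \<alpha> j)) * D)"
      by (intro s_pow x_prod one) auto
    moreover have "0 + (\<Sum>j\<in>J. \<alpha> j) * D + (T - (\<Sum>j\<in>J. \<alpha> j)) * D = T * D"
      using le by (simp flip: distrib_right)
    moreover have "s ^ (T - (\<Sum>j\<in>J. \<alpha> j)) * ((\<Prod>j\<in>J. (s * x j) ^ \<alpha> j) * 1) = s ^ T * (\<Prod>j\<in>J. x j ^ \<alpha> j)"
      using le by (simp add: power_mult_distrib prod.distrib power_sum[symmetric] mult.assoc[symmetric] flip: power_add)
    ultimately show ?thesis by simp
  qed
  define K where "K = (W \<rightarrow>\<^sub>E {..T * D}) \<times> Z"
  have "\<forall>\<alpha>\<in>I. \<exists>c. s ^ T * (\<Prod>j\<in>J. x j ^ \<alpha> j) - (\<Sum>(\<beta>, \<zeta>)\<in>K. \<kappa> (c (\<beta>, \<zeta>)) * (\<Prod>w\<in>W. y w ^ \<beta> w) * \<zeta>) \<in> P"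
    unfolding K_def using bspan_repr[OF mem] by blast
  from bchoice[OF this] obtain c where c: "\<And>\<alpha>. \<alpha> \<in> I \<Longrightarrow> s ^ T * (\<Prod>j\<in>J. x j ^ \<alpha> j) -
      (\<Sum>(\<beta>, \<zeta>)\<in>K. \<kappa> (c \<alpha> (\<beta>, \<zeta>)) * (\<Prod>w\<in>W. y w ^ \<beta> w) * \<zeta>) \<in> P" by blast
  have fin: "finite I" "finite K" using J W Z by (auto simp: I_def K_def intro: finite_PiE)
  have "card K < card I"
  proof -
    have "card K = card Z * (T * D + 1) ^ n" using W by (simp add: K_def card_PiE card_cartesian_product n_def)
    also have "\<dots> \<le> card Z * ((Suc n * D + 1) * R) ^ n"
      by (intro mult_left_mono power_mono) (auto simp: T_def R_def algebra_simps)
    also have "\<dots> = (card Z * (Suc n * D + 1) ^ n) * R ^ n" unfolding power_mult_distrib by (rule mult.assoc[symmetric])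
    also have "\<dots> < R * R ^ n" by (intro mult_strict_right_mono) (auto simp: R_def)
    also have "\<dots> = card I" using J by (simp add: I_def card_PiE n_def)
    finally show ?thesis .
  qed
  then obtain v where v: "\<exists>\<alpha>\<in>I. v \<alpha> \<noteq> 0" "\<forall>p\<in>K. (\<Sum>\<alpha>\<in>I. v \<alpha> * c \<alpha> p) = 0"
    using underdetermined_system[OF fin(2,1), of c] by blast
  have "(\<Sum>\<alpha>\<in>I. \<kappa> (v \<alpha>) * (s ^ T * (\<Prod>j\<in>J. x j ^ \<alpha> j) -
      (\<Sum>p\<in>K. \<kappa> (c \<alpha> p) * (\<Prod>w\<in>W. y w ^ fst p w) * snd p))) \<in> P"
    using c by (intro ideal_of_sum[OF I] ideal_of_mult[OF I \<kappa>(2)]) (auto simp: case_prod_beta)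
  moreover have "(\<Sum>\<alpha>\<in>I. \<kappa> (v \<alpha>) * (\<Sum>p\<in>K. \<kappa> (c \<alpha> p) * (\<Prod>w\<in>W. y w ^ fst p w) * snd p)) = 0"
  proof -
    have "(\<Sum>\<alpha>\<in>I. \<kappa> (v \<alpha>) * (\<Sum>p\<in>K. \<kappa> (c \<alpha> p) * (\<Prod>w\<in>W. y w ^ fst p w) * snd p)) =
        (\<Sum>\<alpha>\<in>I. \<Sum>p\<in>K. \<kappa> (v \<alpha> * c \<alpha> p) * ((\<Prod>w\<in>W. y w ^ fst p w) * snd p))"
      by (simp add: sum_distrib_left \<kappa>.hom_mult ac_simps)
    also have "\<dots> = (\<Sum>p\<in>K. \<kappa> (\<Sum>\<alpha>\<in>I. v \<alpha> * c \<alpha> p) * ((\<Prod>w\<in>W. y w ^ fst p w) * snd p))"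
      by (subst sum.swap) (simp add: \<kappa>.hom_sum sum_distrib_right)
    also have "\<dots> = 0" using v(2) by (intro sum.neutral) simp
    finally show ?thesis .
  qed
  ultimately have "s ^ T * (\<Sum>\<alpha>\<in>I. \<kappa> (v \<alpha>) * (\<Prod>j\<in>J. x j ^ \<alpha> j)) \<in> P"
    by (simp add: right_diff_distrib sum_subtractf sum_distrib_left ac_simps)
  moreover have "(\<Sum>\<alpha>\<in>I. \<kappa> (v \<alpha>) * (\<Prod>j\<in>J. x j ^ \<alpha> j)) \<in> A"
    by (intro subring_set_sum[OF A] subring_set_mult[OF A] \<kappa> subring_set_prod[OF A] subring_set_power[OF A] xA)
  ultimately have "(\<Sum>\<alpha>\<in>I. \<kappa> (v \<alpha>) * (\<Prod>j\<in>J. x j ^ \<alpha> j)) \<in> P"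
    using prime_ofD[OF P] prime_of_power_notin[OF A P] subring_set_power[OF A] sP by blast
  also have "(\<Sum>\<alpha>\<in>I. \<kappa> (v \<alpha>) * (\<Prod>j\<in>J. x j ^ \<alpha> j)) =
      (\<Sum>\<alpha>\<in>{\<alpha>\<in>I. v \<alpha> \<noteq> 0}. \<kappa> (v \<alpha>) * (\<Prod>j\<in>J. x j ^ \<alpha> j))"
    by (intro sum.mono_neutral_right fin) auto
  finally show ?thesis
  proof (intro exI conjI)
    show "finite {\<alpha>\<in>I. v \<alpha> \<noteq> 0}" using fin(1) by simp
    show "{\<alpha>\<in>I. v \<alpha> \<noteq> 0} \<noteq> {}" using v(1) by blast
    show "{\<alpha>\<in>I. v \<alpha> \<noteq> 0} \<subseteq> J \<rightarrow>\<^sub>E UNIV" unfolding I_def by (auto dest: PiE_mem simp: PiE_def)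
    show "\<forall>\<alpha>\<in>{\<alpha>\<in>I. v \<alpha> \<noteq> 0}. v \<alpha> \<noteq> 0" by blast
  qed
qed

text \<open>A longer chain would supply card W + 1 elements, one from each of its first steps, that
  are independent by \<open>chain_algebraically_independent\<close> and dependent by
  \<open>algebraic_elems_dependent\<close>.\<close>

lemma chain_length_le:
  assumes alg: "A \<subseteq> algebraic_elems"
    and Q: "Q 0 = P" "\<And>i. i \<le> n \<Longrightarrow> prime_of A (Q i)" "\<And>i. i < n \<Longrightarrow> Q i \<subset> Q (Suc i)"
  shows "n \<le> card W"
proof (rule ccontr)
  assume "\<not> ?thesis"
  then have r: "Suc (card W) \<le> n" by simp
  define r where "r = Suc (card W)"
  have "\<forall>i\<in>{..<r}. \<exists>x. x \<in> Q (Suc i) - Q i" using psubset_imp_ex_mem[OF Q(3)] r by (auto simp: r_def)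
  then obtain x' where x': "\<And>i. i < r \<Longrightarrow> x' i \<in> Q (Suc i) - Q i" by (metis lessThan_iff)
  define x where "x = (\<lambda>j. x' (j - 1))"
  have x: "x (Suc i) \<in> Q (Suc i) - Q i" if "i < r" for i using x'[OF that] by (simp add: x_def)
  have "x j \<in> algebraic_elems" if "j \<in> {0<..r}" for j
  proof -
    have "x j \<in> Q j" using x[of "j - 1"] that by auto
    moreover have "Q j \<subseteq> A" using prime_of_subset[OF Q(2)[of j]] that r by (auto simp: r_def)
    ultimately show ?thesis using alg by blast
  qed
  then obtain F c where F: "finite F" "F \<noteq> {}" "F \<subseteq> ({0<..r} \<rightarrow>\<^sub>E (UNIV :: nat set))"
    "\<forall>\<alpha>\<in>F. c \<alpha> \<noteq> 0" "(\<Sum>\<alpha>\<in>F. \<kappa> (c \<alpha>) * (\<Prod>j\<in>{0<..r}. x j ^ \<alpha> j)) \<in> P"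
    using algebraic_elems_dependent[of "{0<..r}" x] by (auto simp: r_def)
  have "(\<Sum>\<alpha>\<in>F. \<kappa> (c \<alpha>) * (\<Prod>j\<in>{0<..r}. x j ^ \<alpha> j)) \<notin> Q 0"
  proof (rule chain_algebraically_independent[OF A \<kappa>])
    fix \<alpha> \<beta> assume "\<alpha> \<in> F" "\<beta> \<in> F" "\<And>j. j \<in> {0<..r} \<Longrightarrow> \<alpha> j = \<beta> j"
    then show "\<alpha> = \<beta>" using F(3) by (intro PiE_ext[of \<alpha> "{0<..r}" "\<lambda>_. UNIV" \<beta>]) auto
  next
    fix i assume i: "i < r"
    show "Q i \<subseteq> Q (Suc i)" "x (Suc i) \<in> Q (Suc i) - Q i" using Q(3)[of i] x[OF i] i r by (auto simp: r_def)
  next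
    fix i assume "i \<le> r"
    then show "prime_of A (Q i)" using Q(2)[of i] r by (simp add: r_def)
  qed (use F in auto)
  then show False using F(5) Q(1) by simp
qed

end

section \<open>Finite down-sets of exponent vectors\<close>

definition down_sets :: "nat set \<Rightarrow> (nat \<Rightarrow> nat) set set" where
  "down_sets V = {D. finite D \<and> (\<forall>m\<in>D. \<forall>i. i \<notin> V \<longrightarrow> m i = 0) \<and>
     (\<forall>m\<in>D. \<forall>m'. (\<forall>i. m' i \<le> m i) \<longrightarrow> m' \<in> D)}"

text \<open>Only finitely many indices have a set contained in no later one, for infinitely many of
  them would form a subsequence violating the hypothesis. Past the last of them a monotone
  subsequence is chosen greedily.\<close>

lemma mono_subseq_of_good:
  fixes f :: "nat \<Rightarrow> 'a set"
  assumes good: "\<And>r :: nat \<Rightarrow> nat. strict_mono r \<Longrightarrow> \<exists>i j. i < j \<and> f (r i) \<subseteq> f (r j)"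
  shows "\<exists>r :: nat \<Rightarrow> nat. strict_mono r \<and> mono (\<lambda>i. f (r i))"
proof -
  define T where "T = {i. \<forall>j>i. \<not> f i \<subseteq> f j}"
  have "finite T"
  proof (rule ccontr)
    assume inf: "infinite T"
    then obtain r :: "nat \<Rightarrow> nat" where r: "strict_mono r" "\<And>n. r n \<in> T"
      by (rule infinite_enumerate[of T, THEN exE]) auto
    obtain i j where "i < j" "f (r i) \<subseteq> f (r j)" using good[OF r(1)] by blast
    then show False using r by (auto simp: T_def strict_mono_def)
  qed
  then obtain N where N: "\<And>i. i \<in> T \<Longrightarrow> i < N"
    unfolding finite_nat_set_iff_bounded by auto
  have step: "\<exists>j>i. N \<le> j \<and> f i \<subseteq> f j" if "N \<le> i" for i
  proof -
    have "i \<notin> T" using N[of i] that by auto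
    then obtain j where "j > i" "f i \<subseteq> f j" unfolding T_def by blast
    then show ?thesis using that by (intro exI[of _ j]) auto
  qed
  obtain r where r: "\<And>n. N \<le> r n" "\<And>n. r n < r (Suc n) \<and> f (r n) \<subseteq> f (r (Suc n))"
    using dependent_nat_choice[of "\<lambda>_ i. N \<le> i" "\<lambda>_ i j. i < j \<and> f i \<subseteq> f j"] step by blast
  show ?thesis
  proof (intro exI conjI)
    show "strict_mono r" using r(2) by (simp add: strict_mono_Suc_iff)
    show "mono (\<lambda>i. f (r i))" using r(2) by (auto simp: mono_iff_le_Suc)
  qed
qed

text \<open>Each member of \<open>T\<close> in turn refines the subsequence found so far;
  monotonicity for the earlier members survives refinement.\<close>

lemma common_mono_subseq:
  fixes S :: "'t \<Rightarrow> nat \<Rightarrow> 'a set"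
  assumes "finite T"
    and "\<And>t r. t \<in> T \<Longrightarrow> strict_mono (r :: nat \<Rightarrow> nat) \<Longrightarrow>
      \<exists>r' :: nat \<Rightarrow> nat. strict_mono r' \<and> mono (\<lambda>i. S t (r (r' i)))"
  shows "\<exists>r :: nat \<Rightarrow> nat. strict_mono r \<and> (\<forall>t\<in>T. mono (\<lambda>i. S t (r i)))"
  using assms
proof (induction T)
  case empty
  then show ?case by (auto intro: exI[of _ id] simp: strict_mono_def)
next
  case (insert t T)
  then obtain r :: "nat \<Rightarrow> nat" where r: "strict_mono r" "\<forall>t\<in>T. mono (\<lambda>i. S t (r i))" by blast
  obtain r' :: "nat \<Rightarrow> nat" where r': "strict_mono r'" "mono (\<lambda>i. S t (r (r' i)))"
    using insert.prems[of t r] r(1) by blast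
  have "mono (\<lambda>i. S t' (r (r' i)))" if "t' \<in> T" for t'
  proof (rule monoI)
    fix i j :: nat assume "i \<le> j"
    then show "S t' (r (r' i)) \<subseteq> S t' (r (r' j))"
      using monoD[of "\<lambda>i. S t' (r i)" "r' i" "r' j"] r(2) that r'(1)
      by (simp add: strict_mono_less_eq)
  qed
  then show ?case
    using r(1) r' by (intro exI[of _ "r \<circ> r'"]) (auto simp: strict_mono_def)
qed

text \<open>If \<open>a \<in> f 0\<close> is missing from a down-set \<open>D\<close>, then \<open>D\<close> is the union of its finitely many
  slices \<open>m i = c\<close> with \<open>c < a i\<close>, which are down-sets in fewer variables.\<close>

lemma down_sets_good:
  assumes "finite V" "\<And>k. f k \<in> down_sets V"
  shows "\<exists>i j :: nat. i < j \<and> f i \<subseteq> f j"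
  using assms
proof (induction "card V" arbitrary: V f rule: less_induct)
  case less
  show ?case
  proof (rule ccontr)
    assume "\<not> ?thesis"
    then have bad: "\<And>i j. i < j \<Longrightarrow> \<not> f i \<subseteq> f j" by blast
    have fin: "finite (f 0)" using less.prems(2)[of 0] by (simp add: down_sets_def)
    have "\<exists>a. 1 \<le> k \<longrightarrow> a \<in> f 0 \<and> a \<notin> f k" for k using bad[of 0 k] by (cases "1 \<le> k") auto
    then obtain ch where ch: "\<And>k. 1 \<le> k \<Longrightarrow> ch k \<in> f 0 \<and> ch k \<notin> f k" by metis
    \<comment> \<open>Each later set misses some element of the finite set \<open>f 0\<close>; by
      the pigeonhole principle one element is missed by infinitely many of them.\<close>
    have "\<exists>a\<in>f 0. infinite {k \<in> {1::nat..}. ch k = a}"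
    proof (rule ccontr)
      assume "\<not> ?thesis"
      then have "finite (\<Union>a\<in>f 0. {k \<in> {1::nat..}. ch k = a})" using fin by blast
      moreover have "(\<Union>a\<in>f 0. {k \<in> {1::nat..}. ch k = a}) = {1..}" using ch by auto
      ultimately show False using infinite_Ici[of "1::nat"] by argo
    qed
    then obtain a where a: "a \<in> f 0" "infinite {k \<in> {1::nat..}. ch k = a}" by blast
    obtain s :: "nat \<Rightarrow> nat" where s: "strict_mono s" "\<And>n. s n \<in> {k \<in> {1::nat..}. ch k = a}"
      using infinite_enumerate[OF a(2)] by auto
    define g where "g = (\<lambda>k. f (s k))"
    have ga: "a \<notin> g k" for k using ch[of "s k"] s(2)[of k] by (auto simp: g_def)
    have gD: "g k \<in> down_sets V" for k using less.prems(2) by (simp add: g_def)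
    have aV: "i \<in> V" if "c < a i" for i c :: nat
      using a(1) less.prems(2)[of 0] that unfolding down_sets_def by (metis (mono_tags, lifting) mem_Collect_eq not_less_zero)
    define T where "T = (SIGMA i:V. {..<a i})"
    define S where "S = (\<lambda>(i, c) k. {m(i := 0) | m. m \<in> g k \<and> m i = c})"
    have "\<exists>r :: nat \<Rightarrow> nat. strict_mono r \<and> (\<forall>t\<in>T. mono (\<lambda>i. S t (r i)))"
    proof (rule common_mono_subseq)
      show "finite T" using less.prems(1) by (simp add: T_def)
      fix t and r :: "nat \<Rightarrow> nat" assume t: "t \<in> T"
      obtain i c where ic: "t = (i, c)" "i \<in> V" using t by (auto simp: T_def)
      have "S t k \<in> down_sets (V - {i})" for k
        unfolding down_sets_def
      proof (intro CollectI conjI)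
        have "S t k \<subseteq> (\<lambda>m. m(i := 0)) ` g k" by (auto simp: S_def ic)
        then show "finite (S t k)"
          by (rule finite_subset) (use gD[of k] in \<open>simp add: down_sets_def\<close>)
        show "\<forall>m\<in>S t k. \<forall>j. j \<notin> V - {i} \<longrightarrow> m j = 0"
          using gD[of k] by (auto simp: S_def ic down_sets_def)
        show "\<forall>m\<in>S t k. \<forall>m'. (\<forall>i. m' i \<le> m i) \<longrightarrow> m' \<in> S t k"
        proof (intro ballI allI impI)
          fix m m' assume m: "m \<in> S t k" and le: "\<forall>i. m' i \<le> m i"
          then obtain n where n: "m = n(i := 0)" "n \<in> g k" "n i = c" by (auto simp: S_def ic)
          have "m'(i := c) \<in> g k"
            using gD[of k] n le unfolding down_sets_def
            by (smt (verit) fun_upd_apply mem_Collect_eq order_refl)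
          moreover have "m' = (m'(i := c))(i := 0)"
            using le n by (auto simp: fun_eq_iff dest: spec[of _ i])
          ultimately show "m' \<in> S t k" unfolding S_def ic
            by (smt (verit) fun_upd_same mem_Collect_eq prod.case)
        qed
      qed
      then have "\<exists>i' j'. i' < j' \<and> S t (r (q i')) \<subseteq> S t (r (q j'))" for q :: "nat \<Rightarrow> nat"
        using less.hyps[of "V - {i}" "\<lambda>k. S t (r (q k))"] ic(2) less.prems(1)
        by (meson card_Diff1_less finite_Diff)
      then show "\<exists>r' :: nat \<Rightarrow> nat. strict_mono r' \<and> mono (\<lambda>i. S t (r (r' i)))"
        using mono_subseq_of_good[of "\<lambda>k. S t (r k)"] by blast
    qed
    then obtain r :: "nat \<Rightarrow> nat" where r: "strict_mono r" "\<forall>t\<in>T. mono (\<lambda>i. S t (r i))" by blast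
    \<comment> \<open>A member of \<open>g (r 0)\<close> does not dominate \<open>a\<close>, hence
      lies in one of the finitely many slices, and all slices grow along \<open>r\<close>.\<close>
    have "g (r 0) \<subseteq> g (r 1)"
    proof
      fix m assume m: "m \<in> g (r 0)"
      have "\<exists>i. m i < a i"
      proof (rule ccontr)
        assume "\<not> ?thesis"
        then have "\<forall>i. a i \<le> m i" by (meson not_less)
        then show False using m gD[of "r 0"] ga[of "r 0"] by (auto simp: down_sets_def)
      qed
      then obtain i where i: "m i < a i" by blast
      then have T: "(i, m i) \<in> T" using aV by (auto simp: T_def)
      have "m(i := 0) \<in> S (i, m i) (r 0)" using m by (auto simp: S_def)
      then have "m(i := 0) \<in> S (i, m i) (r 1)"
        using monoD[of "\<lambda>k. S (i, m i) (r k)" 0 1] r(2) T by auto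
      then obtain n where n: "n \<in> g (r 1)" "n i = m i" "n(i := 0) = m(i := 0)"
        by (auto simp: S_def)
      have "n = m"
      proof
        fix j show "n j = m j" using n(2) fun_cong[OF n(3), of j] by (cases "j = i") auto
      qed
      then show "m \<in> g (r 1)" using n(1) by simp
    qed
    moreover have "s (r 0) < s (r 1)" using s(1) r(1) by (simp add: strict_mono_less)
    ultimately show False using bad by (simp add: g_def)
  qed
qed

text \<open>By the well-quasi-order, only finitely many weights are needed to test whether some weight
  \<open>w\<close> satisfies \<open>\<Sum>i. w i * m i \<ge> (\<Sum>i. w i) - c\<close> on a set of exponents \<open>m\<close>.\<close>

lemma finitely_many_test_weights:
  fixes c :: int
  shows "\<exists>W :: (nat \<Rightarrow> nat) set. finite W \<and> (\<forall>w\<in>W. \<forall>i\<le>d. 1 \<le> w i) \<and>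
    (\<forall>w. (\<forall>i\<le>d. 1 \<le> w i) \<longrightarrow> (\<exists>w'\<in>W. \<forall>m :: nat \<Rightarrow> nat.
       (\<Sum>i\<le>d. int (w i * m i)) \<ge> (\<Sum>i\<le>d. int (w i)) - c \<longrightarrow>
       (\<Sum>i\<le>d. int (w' i * m i)) \<ge> (\<Sum>i\<le>d. int (w' i)) - c))"
proof -
  define D where "D = (\<lambda>w :: nat \<Rightarrow> nat. {m :: nat \<Rightarrow> nat. (\<forall>i. i \<notin> {..d} \<longrightarrow> m i = 0) \<and>
      (\<Sum>i\<le>d. int (w i * m i)) < (\<Sum>i\<le>d. int (w i)) - c})"
  define Pos where "Pos = {w :: nat \<Rightarrow> nat. \<forall>i\<le>d. 1 \<le> w i}"
  have D: "D w \<in> down_sets {..d}" if w: "w \<in> Pos" for w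
    unfolding down_sets_def
  proof (intro CollectI conjI)
    define B where "B = nat ((\<Sum>i\<le>d. int (w i)) - c)"
    have "D w \<subseteq> {m. \<forall>i. (i \<in> {..d} \<longrightarrow> m i \<in> {..B}) \<and> (i \<notin> {..d} \<longrightarrow> m i = 0)}"
    proof (intro subsetI CollectI allI conjI impI)
      fix m i assume m: "m \<in> D w" and i: "i \<in> {..d}"
      have "m i \<le> w i * m i" using w i by (auto simp: Pos_def Suc_le_eq)
      then have "int (m i) \<le> int (w i * m i)" by (simp only: of_nat_le_iff)
      also have "\<dots> \<le> (\<Sum>i\<le>d. int (w i * m i))" using i by (intro member_le_sum) auto
      also have "\<dots> < (\<Sum>i\<le>d. int (w i)) - c" using m by (simp add: D_def)
      finally show "m i \<in> {..B}" by (simp add: B_def)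
    qed (auto simp: D_def)
    then show "finite (D w)"
      by (rule finite_subset) (rule finite_set_of_finite_funs, auto)
    show "\<forall>m\<in>D w. \<forall>m'. (\<forall>i. m' i \<le> m i) \<longrightarrow> m' \<in> D w"
    proof (intro ballI allI impI)
      fix m m' assume m: "m \<in> D w" and le: "\<forall>i. m' i \<le> m i"
      have "(\<Sum>i\<le>d. int (w i * m' i)) \<le> (\<Sum>i\<le>d. int (w i * m i))"
        using le by (intro sum_mono) (simp add: mult_left_mono)
      moreover have "m' i = 0" if "i \<notin> {..d}" for i
        using le m that unfolding D_def by (metis (mono_tags, lifting) le_zero_eq mem_Collect_eq)
      ultimately show "m' \<in> D w" using m by (auto simp: D_def)
    qed
    show "\<forall>m\<in>D w. \<forall>i. i \<notin> {..d} \<longrightarrow> m i = 0" unfolding D_def by blast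
  qed
  \<comment> \<open>\<open>D w\<close> collects the exponents at which the inequality fails for
    \<open>w\<close>, so the inclusion of \<open>D w'\<close> in \<open>D w\<close> is the required
    implication in contraposed form.\<close>
  define le where "le = (\<lambda>w w'. D w \<subseteq> D w')"
  have "\<exists>W. finite W \<and> W \<subseteq> Pos \<and> (\<forall>w\<in>Pos. \<exists>w'\<in>W. le w' w)"
  proof (rule ccontr)
    assume neg: "\<not> ?thesis"
    have ex: "\<exists>w. w \<in> Pos \<and> (\<forall>w'\<in>W. \<not> le w' w)" if "finite W" "W \<subseteq> Pos" for W
    proof (rule ccontr)
      assume "\<not> ?thesis"
      then have "\<forall>w\<in>Pos. \<exists>w'\<in>W. le w' w" by blast
      then have "finite W \<and> W \<subseteq> Pos \<and> (\<forall>w\<in>Pos. \<exists>w'\<in>W. le w' w)" using that by (intro conjI)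
      then show False using neg by (elim notE) (rule exI)
    qed
    \<comment> \<open>If no finite set sufficed, one could choose again and again a weight whose
      down-set contains none of the earlier ones; this sequence would contradict
      \<open>down_sets_good\<close>.\<close>
    define pick where "pick = (\<lambda>W. SOME w. w \<in> Pos \<and> (\<forall>w'\<in>W. \<not> le w' w))"
    have pick: "pick W \<in> Pos \<and> (\<forall>w'\<in>W. \<not> le w' (pick W))" if "finite W" "W \<subseteq> Pos" for W
      unfolding pick_def by (rule someI_ex[OF ex[OF that]])
    define L where "L = rec_nat [] (\<lambda>_ xs. pick (set xs) # xs)"
    have L: "L 0 = []" "L (Suc n) = pick (set (L n)) # L n" for n by (simp_all add: L_def)
    have sub: "set (L n) \<subseteq> Pos" for n by (induction n) (auto simp: L pick)
    define f where "f = (\<lambda>n. pick (set (L n)))"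
    have "f i \<in> set (L j)" if "i < j" for i j
      using that by (induction j) (auto simp: L f_def less_Suc_eq)
    then have "\<not> le (f i) (f j)" if "i < j" for i j
      using pick[of "set (L j)"] sub that by (auto simp: f_def)
    moreover have "D (f k) \<in> down_sets {..d}" for k using pick sub by (auto simp: f_def intro!: D)
    ultimately show False using down_sets_good[of "{..d}" "\<lambda>k. D (f k)"]
      unfolding le_def by blast
  qed
  then obtain W where W: "finite W" "W \<subseteq> Pos" "\<And>w. w \<in> Pos \<Longrightarrow> \<exists>w'\<in>W. le w' w" by blast
  have "\<exists>w'\<in>W. \<forall>m :: nat \<Rightarrow> nat.
       (\<Sum>i\<le>d. int (w i * m i)) \<ge> (\<Sum>i\<le>d. int (w i)) - c \<longrightarrow>
       (\<Sum>i\<le>d. int (w' i * m i)) \<ge> (\<Sum>i\<le>d. int (w' i)) - c" if w: "\<forall>i\<le>d. 1 \<le> w i" for w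
  proof -
    obtain w' where w': "w' \<in> W" "D w' \<subseteq> D w" using W(3)[of w] w unfolding le_def by (auto simp: Pos_def)
    have "(\<Sum>i\<le>d. int (w' i * m i)) \<ge> (\<Sum>i\<le>d. int (w' i)) - c"
      if m: "(\<Sum>i\<le>d. int (w i * m i)) \<ge> (\<Sum>i\<le>d. int (w i)) - c" for m :: "nat \<Rightarrow> nat"
    proof (rule ccontr)
      assume "\<not> ?thesis"
      then have "(\<lambda>i. if i \<le> d then m i else 0) \<in> D w'" by (auto simp: D_def)
      then have "(\<lambda>i. if i \<le> d then m i else 0) \<in> D w" using w'(2) by blast
      then show False using m by (simp add: D_def)
    qed
    then show ?thesis using w'(1) by blast
  qed
  then show ?thesis using W(1,2) by (intro exI[of _ W]) (auto simp: Pos_def)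
qed

section \<open>Hilbert's basis theorem\<close>

definition lin_span :: "'a::comm_ring_1 set \<Rightarrow> 'a set \<Rightarrow> 'a set" where
  "lin_span A G = {\<Sum>g\<in>G. c g * g | c. \<forall>g\<in>G. c g \<in> A}"

definition noetherian :: "'a::comm_ring_1 set \<Rightarrow> bool" where
  "noetherian A \<longleftrightarrow> (\<forall>J. ideal_of A J \<longrightarrow> (\<exists>G. finite G \<and> G \<subseteq> J \<and> J \<subseteq> lin_span A G))"

lemma lin_span_subset_ideal: "ideal_of A J \<Longrightarrow> G \<subseteq> J \<Longrightarrow> lin_span A G \<subseteq> J"
  by (auto simp: lin_span_def intro!: ideal_of_sum ideal_of_mult)

lemma ideal_of_lin_span:
  assumes A: "subring_set A" and "G \<subseteq> A"
  shows "ideal_of A (lin_span A G)"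
  unfolding ideal_of_def
proof (intro conjI ballI)
  show "lin_span A G \<subseteq> A"
    using assms(2) by (auto simp: lin_span_def intro!: subring_set_sum[OF A] subring_set_mult[OF A])
  show "0 \<in> lin_span A G"
    unfolding lin_span_def using subring_set_zero[OF A] by (auto intro!: exI[of _ "\<lambda>_. 0"])
  fix x y assume "x \<in> lin_span A G" "y \<in> lin_span A G"
  then obtain c d where "x = (\<Sum>g\<in>G. c g * g)" "y = (\<Sum>g\<in>G. d g * g)" "\<forall>g\<in>G. c g \<in> A" "\<forall>g\<in>G. d g \<in> A"
    by (auto simp: lin_span_def)
  then show "x + y \<in> lin_span A G"
    unfolding lin_span_def using subring_set_add[OF A]
    by (intro CollectI exI[of _ "\<lambda>g. c g + d g"]) (simp add: distrib_right sum.distrib)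
next
  fix a x assume "a \<in> A" "x \<in> lin_span A G"
  moreover from this obtain c where "x = (\<Sum>g\<in>G. c g * g)" "\<forall>g\<in>G. c g \<in> A"
    by (auto simp: lin_span_def)
  ultimately show "a * x \<in> lin_span A G"
    unfolding lin_span_def using subring_set_mult[OF A]
    by (intro CollectI exI[of _ "\<lambda>g. a * c g"]) (simp add: sum_distrib_left mult.assoc)
qed

lemma subset_lin_span:
  assumes "subring_set A" "finite G"
  shows "G \<subseteq> lin_span A G"
proof
  fix g assume g: "g \<in> G"
  have "(\<Sum>h\<in>G. of_bool (h = g) * h) = (\<Sum>h\<in>G. if h = g then h else 0)"
    by (intro sum.cong) auto
  also have "\<dots> = g" using assms(2) g by simp
  finally show "g \<in> lin_span A G"
    unfolding lin_span_def using subring_set_zero[OF assms(1)] subring_set_one[OF assms(1)]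
    by (intro CollectI exI[of _ "\<lambda>h. of_bool (h = g)"]) auto
qed

definition adjoin :: "'a::comm_ring_1 set \<Rightarrow> 'a \<Rightarrow> 'a set" where
  "adjoin A s = (\<lambda>p. poly p s) ` {p. \<forall>i. Polynomial.coeff p i \<in> A}"

lemma subring_set_adjoin:
  assumes A: "subring_set A"
  shows "subring_set (adjoin A s)"
  unfolding subring_set_def
proof (intro conjI ballI)
  note P = subring_set_polys[OF A]
  show "1 \<in> adjoin A s" unfolding adjoin_def using subring_set_one[OF P] by (intro image_eqI[of _ _ 1]) simp_all
  fix a b assume "a \<in> adjoin A s" "b \<in> adjoin A s"
  then obtain p q where pq: "p \<in> {p. \<forall>i. Polynomial.coeff p i \<in> A}" "q \<in> {p. \<forall>i. Polynomial.coeff p i \<in> A}"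
    "a = poly p s" "b = poly q s" unfolding adjoin_def by blast
  show "a - b \<in> adjoin A s" unfolding adjoin_def using subring_set_diff[OF P pq(1,2)] pq(3,4)
    by (intro image_eqI[of _ _ "p - q"]) simp_all
  show "a * b \<in> adjoin A s" unfolding adjoin_def using subring_set_mult[OF P pq(1,2)] pq(3,4)
    by (intro image_eqI[of _ _ "p * q"]) simp_all
qed

lemma subset_adjoin:
  assumes A: "subring_set A" shows "A \<subseteq> adjoin A s" "s \<in> adjoin A s"
proof
  fix a assume "a \<in> A"
  then show "a \<in> adjoin A s"
    unfolding adjoin_def using subring_set_zero[OF A]
    by (intro image_eqI[of _ _ "[:a:]"]) (auto simp: coeff_pCons split: nat.splits)
next
  show "s \<in> adjoin A s"
    unfolding adjoin_def using subring_set_zero[OF A] subring_set_one[OF A]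
    by (intro image_eqI[of _ _ "[:0, 1:]"]) (auto simp: coeff_pCons split: nat.splits)
qed

text \<open>Hilbert's argument with leading coefficients, for an element \<open>s\<close> that may
  satisfy relations over \<open>A\<close>: it is applied to the preimage of \<open>J\<close> in the
  polynomial ring, that is, to the polynomials whose value at \<open>s\<close> lies in
  \<open>J\<close>.\<close>

lemma noetherian_adjoin:
  assumes A: "subring_set A" and noeth: "noetherian A"
  shows "noetherian (adjoin A s)"
  unfolding noetherian_def
proof (intro allI impI)
  fix J assume J: "ideal_of (adjoin A s) J"
  define B where "B = adjoin A s"
  have B: "subring_set B" unfolding B_def by (rule subring_set_adjoin[OF A])
  have J: "ideal_of B J" using J by (simp add: B_def)
  have AB: "A \<subseteq> B" "s \<in> B" unfolding B_def by (rule subset_adjoin[OF A])+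
  define PA where "PA = {p. \<forall>i. Polynomial.coeff p i \<in> A}"
  have PA: "subring_set PA" unfolding PA_def by (rule subring_set_polys[OF A])
  have polyB: "poly p s \<in> B" if "p \<in> PA" for p using that unfolding B_def adjoin_def PA_def by blast
  have monPA: "Polynomial.monom c n \<in> PA" if "c \<in> A" for c n
    using that subring_set_zero[OF A] by (auto simp: PA_def)
  define J' where "J' = (\<lambda>n. {p \<in> PA. poly p s \<in> J \<and> (\<forall>i>n. Polynomial.coeff p i = 0)})"
  \<comment> \<open>The ideal of coefficients of degree \<open>n\<close>. These ideals increase with
    \<open>n\<close> and become constant at some \<open>N\<close>; generators of \<open>L n\<close>
    for \<open>n \<le> N\<close> are lifted to polynomials.\<close>
  define L where "L = (\<lambda>n. (\<lambda>p. Polynomial.coeff p n) ` J' n)"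
  have J'_lc: "q * p \<in> PA" "poly (q * p) s \<in> J" if "q \<in> PA" "p \<in> PA" "poly p s \<in> J" for p q
    using that polyB[of q] subring_set_mult[OF PA] ideal_of_mult[OF J] by auto
  have shift: "Polynomial.monom c k * p \<in> J' (n + k)" if "p \<in> J' n" "c \<in> A" for p c n k
    using that J'_lc[OF monPA[OF that(2)]] by (auto simp: J'_def coeff_monom_mult)
  have L_ideal: "ideal_of A (L n)" for n
    unfolding ideal_of_def
  proof (intro conjI ballI)
    show "L n \<subseteq> A" by (auto simp: L_def J'_def PA_def)
    have "0 \<in> J' n" using subring_set_zero[OF PA] ideal_of_zero[OF J] by (simp add: J'_def)
    then show "0 \<in> L n" unfolding L_def by (rule rev_image_eqI) simp
    fix x y assume "x \<in> L n" "y \<in> L n"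
    then obtain p q where pq: "p \<in> J' n" "x = Polynomial.coeff p n" "q \<in> J' n" "y = Polynomial.coeff q n"
      by (auto simp: L_def)
    have "p + q \<in> J' n"
      using pq subring_set_add[OF PA] ideal_of_add[OF J] by (auto simp: J'_def)
    then show "x + y \<in> L n" unfolding L_def by (rule rev_image_eqI) (simp add: pq)
  next
    fix a x assume a: "a \<in> A" and "x \<in> L n"
    then obtain p where p: "p \<in> J' n" "x = Polynomial.coeff p n" by (auto simp: L_def)
    have "Polynomial.monom a 0 * p \<in> J' (n + 0)" by (rule shift[OF p(1) a])
    then show "a * x \<in> L n" unfolding L_def by (intro image_eqI[of _ _ "Polynomial.monom a 0 * p"])
        (simp_all add: p coeff_monom_mult)
  qed
  have L_Suc: "L n \<subseteq> L (n + k)" for n k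
  proof
    fix x assume "x \<in> L n"
    then obtain p where p: "p \<in> J' n" "x = Polynomial.coeff p n" by (auto simp: L_def)
    have "Polynomial.monom 1 k * p \<in> J' (n + k)" by (rule shift[OF p(1) subring_set_one[OF A]])
    then show "x \<in> L (n + k)" unfolding L_def by (rule rev_image_eqI) (simp add: p coeff_monom_mult)
  qed
  have L_mono: "L n \<subseteq> L m" if "n \<le> m" for n m using L_Suc[of n "m - n"] that by simp
  have "ideal_of A (\<Union>n. L n)"
    unfolding ideal_of_def
  proof (intro conjI ballI)
    show "(\<Union>n. L n) \<subseteq> A" using ideal_of_subset[OF L_ideal] by blast
    show "0 \<in> (\<Union>n. L n)" using ideal_of_zero[OF L_ideal] by blast
    fix x y assume "x \<in> (\<Union>n. L n)" "y \<in> (\<Union>n. L n)"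
    then obtain m n where "x \<in> L m" "y \<in> L n" by blast
    then have "x \<in> L (max m n)" "y \<in> L (max m n)"
      using L_mono[of m "max m n"] L_mono[of n "max m n"] by auto
    then have "x + y \<in> L (max m n)" by (rule ideal_of_add[OF L_ideal])
    then show "x + y \<in> (\<Union>n. L n)" by blast
  next
    fix a x assume "a \<in> A" "x \<in> (\<Union>n. L n)"
    then show "a * x \<in> (\<Union>n. L n)" using ideal_of_mult[OF L_ideal] by blast
  qed
  then obtain \<Gamma> where \<Gamma>: "finite \<Gamma>" "\<Gamma> \<subseteq> (\<Union>n. L n)" "(\<Union>n. L n) \<subseteq> lin_span A \<Gamma>"
    using noeth unfolding noetherian_def by blast
  have "\<exists>N. \<Gamma> \<subseteq> L N"
    using \<Gamma>(1,2)
  proof (induction \<Gamma>)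
    case (insert x \<Gamma>)
    then obtain m n where "x \<in> L m" "\<Gamma> \<subseteq> L n" by blast
    then have "insert x \<Gamma> \<subseteq> L (max m n)" using L_mono[of m "max m n"] L_mono[of n "max m n"] by auto
    then show ?case ..
  qed simp
  then obtain N where "\<Gamma> \<subseteq> L N" ..
  then have LN: "L n \<subseteq> L N" for n
    using \<Gamma>(3) lin_span_subset_ideal[OF L_ideal] by blast
  have "\<exists>G. finite G \<and> G \<subseteq> J' n \<and> (\<forall>l\<in>L n. \<exists>c. (\<forall>g\<in>G. c g \<in> A) \<and> l = (\<Sum>g\<in>G. c g * Polynomial.coeff g n))" for n
  proof -
    obtain \<Delta> where \<Delta>: "finite \<Delta>" "\<Delta> \<subseteq> L n" "L n \<subseteq> lin_span A \<Delta>"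
      using noeth L_ideal[of n] unfolding noetherian_def by blast
    define lift where "lift = inv_into (J' n) (\<lambda>p. Polynomial.coeff p n)"
    have lift: "lift \<delta> \<in> J' n" "Polynomial.coeff (lift \<delta>) n = \<delta>" if "\<delta> \<in> \<Delta>" for \<delta>
      using inv_into_into[of \<delta> "\<lambda>p. Polynomial.coeff p n" "J' n"]
        f_inv_into_f[of \<delta> "\<lambda>p. Polynomial.coeff p n" "J' n"] that \<Delta>(2) unfolding lift_def L_def by auto
    have inj: "inj_on lift \<Delta>" by (rule inj_onI) (metis lift(2))
    show ?thesis
    proof (intro exI[of _ "lift ` \<Delta>"] conjI ballI)
      fix l assume "l \<in> L n"
      then obtain c where c: "\<forall>\<delta>\<in>\<Delta>. c \<delta> \<in> A" "l = (\<Sum>\<delta>\<in>\<Delta>. c \<delta> * \<delta>)"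
        using \<Delta>(3) by (auto simp: lin_span_def)
      show "\<exists>c. (\<forall>g\<in>lift ` \<Delta>. c g \<in> A) \<and> l = (\<Sum>g\<in>lift ` \<Delta>. c g * Polynomial.coeff g n)"
      proof (intro exI[of _ "\<lambda>g. c (Polynomial.coeff g n)"] conjI)
        show "l = (\<Sum>g\<in>lift ` \<Delta>. c (Polynomial.coeff g n) * Polynomial.coeff g n)"
          unfolding sum.reindex[OF inj] c(2) using lift(2) by (intro sum.cong) auto
      qed (use c lift in auto)
    qed (use \<Delta> lift in auto)
  qed
  then obtain G where G: "\<And>n. finite (G n)" "\<And>n. G n \<subseteq> J' n"
    "\<And>n l. l \<in> L n \<Longrightarrow> \<exists>c. (\<forall>g\<in>G n. c g \<in> A) \<and> l = (\<Sum>g\<in>G n. c g * Polynomial.coeff g n)" by metis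
  define H where "H = (\<lambda>g. poly g s) ` (\<Union>n\<le>N. G n)"
  have HJ: "H \<subseteq> J" using G(2) by (auto simp: H_def J'_def)
  have finH: "finite H" using G(1) by (simp add: H_def)
  have KI: "ideal_of B (lin_span B H)"
    using HJ ideal_of_subset[OF J] by (intro ideal_of_lin_span[OF B]) auto
  have HK: "H \<subseteq> lin_span B H" by (rule subset_lin_span[OF B finH])
  have key: "poly p s \<in> lin_span B H" if "p \<in> PA" "poly p s \<in> J" "\<forall>i\<ge>n. Polynomial.coeff p i = 0" for p n
    using that
  proof (induction n arbitrary: p)
    case 0
    then have "p = 0" by (simp add: poly_eq_iff)
    then show ?case using ideal_of_zero[OF KI] by simp
  next
    case (Suc n)
    \<comment> \<open>Beyond degree \<open>N\<close> nothing new appears in \<open>L n\<close>, so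
      lifted generators of degree min n N, shifted by the missing power of the variable, cancel the
      top coefficient.\<close>
    define k where "k = min n N"
    have "p \<in> J' n" using Suc.prems by (auto simp: J'_def Suc_le_eq)
    then have "Polynomial.coeff p n \<in> L n" by (auto simp: L_def)
    then have "Polynomial.coeff p n \<in> L k" using LN[of n] by (auto simp: k_def min_def)
    then obtain c where c: "\<forall>g\<in>G k. c g \<in> A" "Polynomial.coeff p n = (\<Sum>g\<in>G k. c g * Polynomial.coeff g k)"
      using G(3) by blast
    define S where "S = (\<Sum>g\<in>G k. Polynomial.monom (c g) (n - k) * g)"
    have gJ': "Polynomial.monom (c g) (n - k) * g \<in> J' n" if "g \<in> G k" for g
      using shift[of g k "c g" "n - k"] that G(2) c(1) by (auto simp: k_def)
    have SPA: "S \<in> PA" unfolding S_def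
      by (rule subring_set_sum[OF PA]) (use gJ' in \<open>auto simp: J'_def\<close>)
    have sval: "poly S s = (\<Sum>g\<in>G k. (c g * s ^ (n - k)) * poly g s)"
      by (simp add: S_def poly_sum poly_monom)
    have SK: "poly S s \<in> lin_span B H"
      unfolding sval
    proof (intro ideal_of_sum[OF KI] ideal_of_mult[OF KI] subring_set_mult[OF B] subring_set_power[OF B])
      fix g assume "g \<in> G k"
      then show "c g \<in> B" using c(1) AB by blast
      have "poly g s \<in> H" using \<open>g \<in> G k\<close> unfolding H_def k_def by (intro imageI UN_I[of "min n N"]) auto
      then show "poly g s \<in> lin_span B H" using HK by blast
    qed (rule AB)
    have SJ: "poly S s \<in> J" using SK lin_span_subset_ideal[OF J HJ] by blast
    have "Polynomial.coeff S i = (if i = n then Polynomial.coeff p n else 0)" if "i \<ge> n" for i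
    proof (cases "i = n")
      case True
      then show ?thesis by (simp add: S_def coeff_sum coeff_monom_mult c(2) k_def)
    next
      case False
      then show ?thesis using gJ' that unfolding S_def coeff_sum by (simp add: J'_def)
    qed
    then have "\<forall>i\<ge>n. Polynomial.coeff (p - S) i = 0" using Suc.prems(3) by (auto simp: Suc_le_eq)
    moreover have "p - S \<in> PA" by (rule subring_set_diff[OF PA Suc.prems(1) SPA])
    moreover have "poly (p - S) s \<in> J" using ideal_of_diff[OF B J Suc.prems(2) SJ] by simp
    ultimately have "poly (p - S) s \<in> lin_span B H" by (intro Suc.IH)
    from ideal_of_add[OF KI this SK] show ?case by simp
  qed
  have "J \<subseteq> lin_span B H"
  proof
    fix x assume x: "x \<in> J"
    then obtain p where p: "p \<in> PA" "x = poly p s"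
      using ideal_of_subset[OF J] unfolding B_def adjoin_def PA_def by blast
    then show "x \<in> lin_span B H"
      using key[of p "Suc (Polynomial.degree p)"] x by (auto simp: coeff_eq_0)
  qed
  then show "\<exists>G. finite G \<and> G \<subseteq> J \<and> J \<subseteq> lin_span (adjoin A s) G"
    using finH HJ by (auto simp: B_def)
qed

section \<open>Finitely generated algebras\<close>

lemma generate_ring_type_induct [consumes 1, case_names one incl uminus add mult]:
  assumes "x \<in> generate_ring (ring_of_type_algebra :: 'a::comm_ring_1 ring) H"
    and "P 1" "\<And>h. h \<in> H \<Longrightarrow> P h" "\<And>h. P h \<Longrightarrow> P (- h)"
    "\<And>x y. P x \<Longrightarrow> P y \<Longrightarrow> P (x + y)" "\<And>x y. P x \<Longrightarrow> P y \<Longrightarrow> P (x * y)"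
  shows "P x"
proof -
  interpret R: cring "ring_of_type_algebra :: 'a ring" by (rule cring_from_type_algebra)
  have inv: "\<ominus>\<^bsub>(ring_of_type_algebra :: 'a ring)\<^esub> x = - x" for x :: 'a
    by (rule R.minus_equality) (auto simp: ring_of_type_algebra_def)
  show ?thesis using assms(1)
    by (induction rule: generate_ring.induct) (use assms in \<open>auto simp: inv\<close>, auto simp: ring_of_type_algebra_def assms)
qed

lemma subring_set_generate_ring:
  "subring_set (generate_ring (ring_of_type_algebra :: 'a::comm_ring_1 ring) H)"
proof -
  let ?R = "ring_of_type_algebra :: 'a ring"
  interpret R: cring ?R by (rule cring_from_type_algebra)
  have inv: "\<ominus>\<^bsub>?R\<^esub> x = - x" for x :: 'a
    by (rule R.minus_equality) (auto simp: ring_of_type_algebra_def)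
  have "x - y \<in> generate_ring ?R H" if "x \<in> generate_ring ?R H" "y \<in> generate_ring ?R H" for x y
    using generate_ring.eng_add[OF that(1) generate_ring.a_inv[OF that(2)]] inv[of y]
    by (simp add: ring_of_type_algebra_def)
  moreover have "x * y \<in> generate_ring ?R H" if "x \<in> generate_ring ?R H" "y \<in> generate_ring ?R H" for x y
    using generate_ring.eng_mult[OF that] by (simp add: ring_of_type_algebra_def)
  moreover have "1 \<in> generate_ring ?R H"
    using generate_ring.one[of ?R H] by (simp add: ring_of_type_algebra_def)
  ultimately show ?thesis by (simp add: subring_set_def)
qed

lemma generate_ring_minimal:
  fixes H :: "'a::comm_ring_1 set"
  assumes "subring_set A" "H \<subseteq> A"
  shows "generate_ring ring_of_type_algebra H \<subseteq> A"
proof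
  fix x assume "x \<in> generate_ring (ring_of_type_algebra :: 'a ring) H"
  then show "x \<in> A"
    by (induction rule: generate_ring_type_induct)
       (use assms in \<open>auto intro: subring_set_one subring_set_uminus subring_set_add subring_set_mult\<close>)
qed

lemma generate_ring_insert:
  fixes H :: "'a::comm_ring_1 set"
  shows "generate_ring ring_of_type_algebra (insert s H) = adjoin (generate_ring ring_of_type_algebra H) s"
    (is "?L = adjoin ?G s")
proof
  have G: "subring_set ?G" by (rule subring_set_generate_ring)
  have L: "subring_set ?L" by (rule subring_set_generate_ring)
  show "?L \<subseteq> adjoin ?G s"
  proof (rule generate_ring_minimal[OF subring_set_adjoin[OF G]])
    have "H \<subseteq> ?G" by (rule subsetI) (rule generate_ring.incl)
    then show "insert s H \<subseteq> adjoin ?G s" using subset_adjoin[OF G, of s] by blast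
  qed
  have GL: "?G \<subseteq> ?L" by (rule generate_ring_minimal[OF L]) (auto intro: generate_ring.incl)
  show "adjoin ?G s \<subseteq> ?L"
  proof
    fix x assume "x \<in> adjoin ?G s"
    then obtain p where p: "\<forall>i. Polynomial.coeff p i \<in> ?G" "x = poly p s" unfolding adjoin_def by blast
    have "s \<in> ?L" by (rule generate_ring.incl) simp
    then show "x \<in> ?L" unfolding p(2) using p(1) GL by (intro subring_set_poly[OF L]) auto
  qed
qed

lemma noetherian_field:
  fixes \<kappa> :: "'k::field \<Rightarrow> 'a::comm_ring_1"
  assumes \<kappa>: "comm_ring_hom \<kappa>"
  shows "noetherian (range \<kappa>)"
  unfolding noetherian_def
proof (intro allI impI)
  interpret comm_ring_hom \<kappa> by (rule \<kappa>)
  fix J assume J: "ideal_of (range \<kappa>) J"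
  show "\<exists>G. finite G \<and> G \<subseteq> J \<and> J \<subseteq> lin_span (range \<kappa>) G"
  proof (cases "J \<subseteq> {0}")
    case True
    then show ?thesis by (intro exI[of _ "{}"]) (auto simp: lin_span_def)
  next
    case False
    then obtain x where x: "x \<in> J" "x \<noteq> 0" by blast
    then obtain c where c: "x = \<kappa> c" using ideal_of_subset[OF J] by blast
    have "c \<noteq> 0" using c x by auto
    have "J \<subseteq> lin_span (range \<kappa>) {x}"
    proof
      fix y assume "y \<in> J"
      then obtain b where "y = \<kappa> b" using ideal_of_subset[OF J] by blast
      then have "y = \<kappa> (b / c) * x" using \<open>c \<noteq> 0\<close> by (simp add: c hom_mult[symmetric] del: hom_mult)
      then show "y \<in> lin_span (range \<kappa>) {x}"
        unfolding lin_span_def by (intro CollectI exI[of _ "\<lambda>_. \<kappa> (b / c)"]) auto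
    qed
    then show ?thesis using x by (intro exI[of _ "{x}"]) auto
  qed
qed

lemma subring_set_range: "comm_ring_hom \<kappa> \<Longrightarrow> subring_set (range \<kappa>)"
proof -
  assume "comm_ring_hom \<kappa>"
  then interpret comm_ring_hom \<kappa> .
  have "\<kappa> x - \<kappa> y \<in> range \<kappa>" "\<kappa> x * \<kappa> y \<in> range \<kappa>" for x y
    by (metis hom_minus rangeI) (metis hom_mult rangeI)
  moreover have "1 \<in> range \<kappa>" by (metis hom_one rangeI)
  ultimately show ?thesis by (auto simp: subring_set_def)
qed

theorem noetherian_generate_ring:
  fixes \<kappa> :: "'k::field \<Rightarrow> 'a::comm_ring_1"
  assumes \<kappa>: "comm_ring_hom \<kappa>" and "finite S"
  shows "noetherian (generate_ring ring_of_type_algebra (range \<kappa> \<union> S))"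
  using assms(2)
proof (induction S)
  case empty
  have "generate_ring ring_of_type_algebra (range \<kappa>) = range \<kappa>"
  proof
    show "generate_ring ring_of_type_algebra (range \<kappa>) \<subseteq> range \<kappa>"
      by (rule generate_ring_minimal[OF subring_set_range[OF \<kappa>] order_refl])
    show "range \<kappa> \<subseteq> generate_ring ring_of_type_algebra (range \<kappa>)"
      by (rule subsetI) (rule generate_ring.incl)
  qed
  then show ?case using noetherian_field[OF \<kappa>] by simp
next
  case (insert s S)
  then show ?case
    using noetherian_adjoin[OF subring_set_generate_ring insert.IH] generate_ring_insert[of s "range \<kappa> \<union> S"] by simp
qed

section \<open>Discrete valuation rings\<close>

definition height_one :: "'a::comm_ring_1 set \<Rightarrow> 'a set \<Rightarrow> bool" where
  "height_one B P \<longleftrightarrow> prime_of B P \<and> P \<noteq> {0} \<and> (\<forall>Q. prime_of B Q \<and> Q \<subset> P \<longrightarrow> Q = {0})"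

text \<open>An ideal maximal among those avoiding a multiplicative set is prime: if x and y lay
  outside and their product inside, both enlarged ideals would meet the set, and the product of the
  two elements found there would lie in the ideal.\<close>

lemma maximal_avoiding_ideal:
  assumes B: "subring_set B" and J: "ideal_of B J" "J \<inter> T = {}"
    and T: "1 \<in> T" "T \<subseteq> B" "\<And>x y. x \<in> T \<Longrightarrow> y \<in> T \<Longrightarrow> x * y \<in> T"
  shows "\<exists>Q. prime_of B Q \<and> J \<subseteq> Q \<and> Q \<inter> T = {}"
proof -
  define \<Sigma> where "\<Sigma> = {Q. ideal_of B Q \<and> J \<subseteq> Q \<and> Q \<inter> T = {}}"
  have "\<exists>Q\<in>\<Sigma>. \<forall>Q'\<in>\<Sigma>. Q \<subseteq> Q' \<longrightarrow> Q' = Q"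
  proof (rule subset_Zorn_nonempty)
    show "\<Sigma> \<noteq> {}" using J by (auto simp: \<Sigma>_def)
    fix C assume C: "C \<noteq> {}" "subset.chain \<Sigma> C"
    then have sub: "C \<subseteq> \<Sigma>" and tot: "\<And>x y. x \<in> C \<Longrightarrow> y \<in> C \<Longrightarrow> x \<subseteq> y \<or> y \<subseteq> x"
      by (auto simp: subset.chain_def subset_chain_def)
    have "ideal_of B (\<Union>C)"
      unfolding ideal_of_def
    proof (intro conjI ballI)
      show "\<Union>C \<subseteq> B" using sub by (auto simp: \<Sigma>_def ideal_of_def)
      show "0 \<in> \<Union>C" using C(1) sub by (auto simp: \<Sigma>_def ideal_of_def)
      fix x y assume "x \<in> \<Union>C" "y \<in> \<Union>C"
      then obtain U V where UV: "U \<in> C" "x \<in> U" "V \<in> C" "y \<in> V" by blast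
      then consider "x \<in> V" | "y \<in> U" using tot by blast
      then show "x + y \<in> \<Union>C"
        using UV sub by cases (auto simp: \<Sigma>_def intro: ideal_of_add)
    next
      fix a x assume "a \<in> B" "x \<in> \<Union>C"
      then show "a * x \<in> \<Union>C" using sub by (auto simp: \<Sigma>_def intro: ideal_of_mult)
    qed
    moreover have "J \<subseteq> \<Union>C" using C(1) sub by (auto simp: \<Sigma>_def)
    moreover have "\<Union>C \<inter> T = {}" using sub by (auto simp: \<Sigma>_def)
    ultimately show "\<Union>C \<in> \<Sigma>" by (simp add: \<Sigma>_def)
  qed
  then obtain Q where Q: "Q \<in> \<Sigma>" "\<And>Q'. Q' \<in> \<Sigma> \<Longrightarrow> Q \<subseteq> Q' \<Longrightarrow> Q' = Q" by blast
  have QI: "ideal_of B Q" and JQ: "J \<subseteq> Q" and QT: "Q \<inter> T = {}" using Q(1) by (auto simp: \<Sigma>_def)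
  have hit: "\<exists>q b. q \<in> Q \<and> b \<in> B \<and> q + b * x \<in> T" if x: "x \<in> B" "x \<notin> Q" for x
  proof (rule ccontr)
    assume no: "\<not> ?thesis"
    define Q' where "Q' = {q + b * x | q b. q \<in> Q \<and> b \<in> B}"
    have "ideal_of B Q'"
      unfolding ideal_of_def
    proof (intro conjI ballI)
      show "Q' \<subseteq> B" using ideal_of_subset[OF QI] x(1)
        by (auto simp: Q'_def intro!: subring_set_add[OF B] subring_set_mult[OF B])
      show "0 \<in> Q'" using ideal_of_zero[OF QI] subring_set_zero[OF B] unfolding Q'_def
        by (intro CollectI exI[of _ 0]) simp
      fix y z assume "y \<in> Q'" "z \<in> Q'"
      then obtain q b q' b' where "y = q + b * x" "z = q' + b' * x" "q \<in> Q" "b \<in> B" "q' \<in> Q" "b' \<in> B"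
        by (auto simp: Q'_def)
      then show "y + z \<in> Q'" unfolding Q'_def
        by (intro CollectI exI[of _ "q + q'"] exI[of _ "b + b'"])
           (simp add: algebra_simps ideal_of_add[OF QI] subring_set_add[OF B])
    next
      fix a y assume "a \<in> B" "y \<in> Q'"
      moreover from this obtain q b where "y = q + b * x" "q \<in> Q" "b \<in> B" by (auto simp: Q'_def)
      ultimately show "a * y \<in> Q'" unfolding Q'_def
        by (intro CollectI exI[of _ "a * q"] exI[of _ "a * b"])
           (simp add: algebra_simps ideal_of_mult[OF QI] subring_set_mult[OF B])
    qed
    moreover have "Q \<subseteq> Q'"
    proof
      fix q assume "q \<in> Q"
      then show "q \<in> Q'" unfolding Q'_def using subring_set_zero[OF B]
        by (intro CollectI exI[of _ q] exI[of _ 0]) simp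
    qed
    moreover have "Q' \<inter> T = {}" using no by (auto simp: Q'_def)
    ultimately have "Q' = Q" using JQ by (intro Q(2)) (auto simp: \<Sigma>_def)
    moreover have "x \<in> Q'" unfolding Q'_def using ideal_of_zero[OF QI] subring_set_one[OF B]
      by (intro CollectI exI[of _ 0] exI[of _ 1]) simp
    ultimately show False using x by simp
  qed
  have "prime_of B Q"
    unfolding prime_of_def
  proof (intro conjI ballI impI QI)
    show "1 \<notin> Q" using T(1) QT by blast
    fix x y assume x: "x \<in> B" and y: "y \<in> B" and xy: "x * y \<in> Q"
    show "x \<in> Q \<or> y \<in> Q"
    proof (rule ccontr)
      assume "\<not> ?thesis"
      then obtain q b q' b' where q: "q \<in> Q" "b \<in> B" "q + b * x \<in> T" "q' \<in> Q" "b' \<in> B" "q' + b' * y \<in> T"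
        using hit[OF x] hit[OF y] by blast
      have "(q + b * x) * (q' + b' * y) = (q' + b' * y) * q + (b * x) * q' + (b * b') * (x * y)"
        by (simp add: algebra_simps)
      also have "\<dots> \<in> Q"
        using ideal_of_mult[OF QI _ q(1), of "q' + b' * y"] ideal_of_mult[OF QI _ q(4), of "b * x"]
          ideal_of_mult[OF QI _ xy, of "b * b'"] q x T(2) subring_set_mult[OF B]
        by (intro ideal_of_add[OF QI]) auto
      finally show False using T(3)[OF q(3,6)] QT by blast
    qed
  qed
  then show ?thesis using JQ QT by blast
qed

text \<open>Locally at \<open>P\<close> the only prime containing \<open>a\<close> is
  \<open>P\<close>, so \<open>p\<close> is nilpotent modulo \<open>a\<close>. Otherwise the ideal of
  \<open>a\<close> avoids all products of an element outside \<open>P\<close> with a power of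
  \<open>p\<close>, and a prime above it that still avoids them lies strictly between 0 and
  \<open>P\<close>.\<close>

lemma height_one_radical:
  assumes B: "subring_set B" and P: "height_one B P" and a: "a \<in> P" "a \<noteq> 0" and p: "p \<in> P"
  shows "\<exists>n. \<exists>s\<in>B - P. \<exists>b\<in>B. s * p ^ n = a * b"
proof (rule ccontr)
  assume no: "\<not> ?thesis"
  have PP: "prime_of B P" using P by (simp add: height_one_def)
  note I = prime_of_ideal[OF PP]
  have aB: "a \<in> B" and pB: "p \<in> B" using a p ideal_of_subset[OF I] by auto
  define T where "T = {s * p ^ n | s n. s \<in> B - P}"
  define J where "J = lin_span B {a}"
  have J: "J = {a * b | b. b \<in> B}"
  proof
    show "J \<subseteq> {a * b | b. b \<in> B}" by (auto simp: J_def lin_span_def mult.commute)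
    show "{a * b | b. b \<in> B} \<subseteq> J"
    proof
      fix x assume "x \<in> {a * b | b. b \<in> B}"
      then obtain b where "b \<in> B" "x = b * a" by (auto simp: mult.commute)
      then show "x \<in> J" unfolding J_def lin_span_def by (intro CollectI exI[of _ "\<lambda>_. b"]) simp
    qed
  qed
  have JI: "ideal_of B J" unfolding J_def by (rule ideal_of_lin_span[OF B]) (use aB in auto)
  have "\<exists>Q. prime_of B Q \<and> J \<subseteq> Q \<and> Q \<inter> T = {}"
  proof (rule maximal_avoiding_ideal[OF B JI])
    show "J \<inter> T = {}"
    proof (rule ccontr)
      assume "J \<inter> T \<noteq> {}"
      then obtain z where "z \<in> J" "z \<in> T" by blast
      then obtain b s n where "z = a * b" "b \<in> B" "z = s * p ^ n" "s \<in> B - P" unfolding J T_def by blast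
      then show False using no by metis
    qed
    show "1 \<in> T" unfolding T_def using subring_set_one[OF B] prime_of_one[OF PP]
      by (intro CollectI exI[of _ 1] exI[of _ 0]) simp
    show "T \<subseteq> B" by (auto simp: T_def intro!: subring_set_mult[OF B] subring_set_power[OF B] pB)
    fix x y assume "x \<in> T" "y \<in> T"
    then obtain s m t n where st: "x = s * p ^ m" "y = t * p ^ n" "s \<in> B - P" "t \<in> B - P" by (auto simp: T_def)
    have "s * t \<in> B - P" using st prime_of_mult_notin[OF PP] subring_set_mult[OF B] by auto
    moreover have "x * y = s * t * p ^ (m + n)" by (simp add: st power_add ac_simps)
    ultimately show "x * y \<in> T" unfolding T_def by blast
  qed
  then obtain Q where Q: "prime_of B Q" "J \<subseteq> Q" "Q \<inter> T = {}" by blast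
  have in_T: "s \<in> T" if "s \<in> B - P" for s
    unfolding T_def using that by (intro CollectI exI[of _ s] exI[of _ 0]) simp
  have pT: "p \<in> T" unfolding T_def using subring_set_one[OF B] prime_of_one[OF PP]
    by (intro CollectI exI[of _ 1]) simp
  have "Q \<subseteq> P" using in_T Q(3) prime_of_subset[OF Q(1)] by blast
  moreover have "Q \<noteq> P" using pT p Q(3) by blast
  ultimately have "Q = {0}" using P Q(1) unfolding height_one_def by blast
  moreover have "a \<in> Q" using Q(2) subring_set_one[OF B] by (auto simp: J intro!: subsetD[OF Q(2)] exI[of _ 1])
  ultimately show False using a by simp
qed

lemma char_poly_coeffs_in:
  fixes R :: "'a::field mat"
  assumes B: "subring_set B" and R: "R \<in> carrier_mat n n" "\<And>i j. i < n \<Longrightarrow> j < n \<Longrightarrow> R $$ (i, j) \<in> B"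
  shows "Polynomial.coeff (char_poly R) i \<in> B"
proof -
  let ?PB = "{p. \<forall>i. Polynomial.coeff p i \<in> B}"
  have PB: "subring_set ?PB" by (rule subring_set_polys[OF B])
  have const: "[:b:] \<in> ?PB" if "b \<in> B" for b
    using that subring_set_zero[OF B] by (auto simp: coeff_pCons split: nat.splits)
  have lin: "[:0, 1:] \<in> ?PB"
    using subring_set_zero[OF B] subring_set_one[OF B] by (auto simp: coeff_pCons split: nat.splits)
  have entry: "char_poly_matrix R $$ (i, j) \<in> ?PB" if "i < n" "j < n" for i j
  proof -
    have "char_poly_matrix R $$ (i, j) = (if i = j then [:0, 1:] else 0) - [:R $$ (i, j):]"
      using that R(1) by (auto simp: char_poly_matrix_def)
    then show ?thesis
      using subring_set_diff[OF PB _ const[OF R(2)[OF that]]] lin subring_set_zero[OF PB] by simp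
  qed
  have car: "char_poly_matrix R \<in> carrier_mat n n" using R(1) by simp
  have "char_poly R \<in> ?PB"
    unfolding char_poly_def Determinant.det_def'[OF car]
  proof (intro subring_set_sum[OF PB] subring_set_mult[OF PB] subring_set_prod[OF PB])
    fix p assume p: "p \<in> {p. p permutes {0..<n}}"
    have "signof p = (1 :: 'a poly) \<or> signof p = (- 1 :: 'a poly)" by (auto simp: sign_def)
    then show "signof p \<in> ?PB"
      using subring_set_one[OF PB] subring_set_uminus[OF PB subring_set_one[OF PB]]
      by (elim disjE) (simp_all only:)
    fix i assume "i \<in> {0..<n}"
    then show "char_poly_matrix R $$ (i, p i) \<in> ?PB" using p by (intro entry) (auto simp: permutes_in_image)
  qed
  then show ?thesis by simp
qed

text \<open>The elements of \<open>G\<close> form an eigenvector with eigenvalue \<open>t\<close> of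
  the matrix \<open>r\<close>, so \<open>t\<close> is a root of its characteristic polynomial, which
  is monic with coefficients in \<open>B\<close>.\<close>

lemma det_trick:
  fixes t :: "'a::field"
  assumes B: "subring_set B" and G: "finite G" "\<exists>g\<in>G. g \<noteq> 0"
    and r: "\<And>g h. g \<in> G \<Longrightarrow> h \<in> G \<Longrightarrow> r g h \<in> B" "\<And>g. g \<in> G \<Longrightarrow> t * g = (\<Sum>h\<in>G. r g h * h)"
  shows "\<exists>p. Polynomial.lead_coeff p = 1 \<and> (\<forall>i. Polynomial.coeff p i \<in> B) \<and> poly p t = 0"
proof -
  define n where "n = card G"
  obtain e where e: "bij_betw e {0..<n} G" using G(1) ex_bij_betw_nat_finite n_def by blast
  have eG: "e i \<in> G" if "i < n" for i using e that by (auto simp: bij_betw_def)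
  define R where "R = mat n n (\<lambda>(i, j). r (e i) (e j))"
  define v where "v = vec n e"
  have R: "R \<in> carrier_mat n n" by (simp add: R_def)
  have "R *\<^sub>v v = t \<cdot>\<^sub>v v"
  proof (rule eq_vecI)
    fix i assume "i < dim_vec (t \<cdot>\<^sub>v v)"
    then have i: "i < n" by (simp add: v_def)
    have "(R *\<^sub>v v) $ i = (\<Sum>j\<in>{0..<n}. r (e i) (e j) * e j)"
      using i by (simp add: R_def v_def scalar_prod_def)
    also have "\<dots> = (\<Sum>h\<in>G. r (e i) h * h)" by (rule sum.reindex_bij_betw[OF e])
    also have "\<dots> = (t \<cdot>\<^sub>v v) $ i" using r(2)[OF eG[OF i]] i by (simp add: v_def)
    finally show "(R *\<^sub>v v) $ i = (t \<cdot>\<^sub>v v) $ i" .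
  qed (simp add: R_def v_def)
  moreover have "v \<noteq> 0\<^sub>v n"
  proof
    assume "v = 0\<^sub>v n"
    then have "e i = 0" if "i < n" for i using that by (metis index_vec index_zero_vec(1) v_def)
    then show False using G(2) e by (auto simp: bij_betw_def)
  qed
  ultimately have "eigenvalue R t"
    unfolding eigenvalue_def eigenvector_def using R by (intro exI[of _ v]) (simp add: v_def)
  then have "poly (char_poly R) t = 0" using eigenvalue_root_char_poly[OF R] by simp
  moreover have "Polynomial.lead_coeff (char_poly R) = 1" using degree_monic_char_poly[OF R] by simp
  moreover have "\<forall>i. Polynomial.coeff (char_poly R) i \<in> B"
    using char_poly_coeffs_in[OF B R] r(1) eG by (simp add: R_def)
  ultimately show ?thesis by blast
qed

text \<open>\<open>F\<close> stands for the field in which \<open>B\<close> is integrally closed. It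
  is kept apart from the ambient type, which in the application consists of rational functions in
  infinitely many variables.\<close>

locale dvr_chart =
  fixes B P F :: "'a::field set"
  assumes B: "subring_set B" and noeth: "noetherian B" and h1: "height_one B P"
    and F: "\<And>a b. a \<in> B \<Longrightarrow> b \<in> B \<Longrightarrow> a / b \<in> F" and normal: "integrally_closed_in F B"
begin

definition Ov :: "'a set" where "Ov = local_ring B P"
definition mv :: "'a set" where "mv = local_maximal_ideal B P"

lemma PP: "prime_of B P"
  using h1 by (simp add: height_one_def)

lemmas PI = prime_of_ideal[OF PP]

lemma OvI: "a \<in> B \<Longrightarrow> b \<in> B \<Longrightarrow> b \<notin> P \<Longrightarrow> a / b \<in> Ov"
  unfolding Ov_def local_ring_def by blast

lemma mvI: "a \<in> P \<Longrightarrow> b \<in> B \<Longrightarrow> b \<notin> P \<Longrightarrow> a / b \<in> mv"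
  unfolding mv_def local_maximal_ideal_def by blast

lemma OvE: "x \<in> Ov \<Longrightarrow> (\<And>a b. a \<in> B \<Longrightarrow> b \<in> B \<Longrightarrow> b \<notin> P \<Longrightarrow> b \<noteq> 0 \<Longrightarrow> x = a / b \<Longrightarrow> thesis) \<Longrightarrow> thesis"
  unfolding Ov_def local_ring_def using ideal_of_zero[OF PI] by blast

lemma mvE: "x \<in> mv \<Longrightarrow> (\<And>a b. a \<in> P \<Longrightarrow> b \<in> B \<Longrightarrow> b \<notin> P \<Longrightarrow> b \<noteq> 0 \<Longrightarrow> x = a / b \<Longrightarrow> thesis) \<Longrightarrow> thesis"
  unfolding mv_def local_maximal_ideal_def using ideal_of_zero[OF PI] by blast

lemma B_Ov: "B \<subseteq> Ov"
  using OvI[of _ 1] subring_set_one[OF B] prime_of_one[OF PP] by force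

lemma P_mv: "P \<subseteq> mv"
  using mvI[of _ 1] subring_set_one[OF B] prime_of_one[OF PP] by force

lemma subring_set_Ov: "subring_set Ov"
  unfolding subring_set_def
proof (intro conjI ballI)
  show "1 \<in> Ov" using B_Ov subring_set_one[OF B] by blast
  fix x y assume "x \<in> Ov" "y \<in> Ov"
  then obtain a b c d where x: "a \<in> B" "b \<in> B" "b \<notin> P" "b \<noteq> 0" "x = a / b"
    and y: "c \<in> B" "d \<in> B" "d \<notin> P" "d \<noteq> 0" "y = c / d" by (elim OvE)
  have bd: "b * d \<in> B" "b * d \<notin> P" using x y prime_of_mult_notin[OF PP] subring_set_mult[OF B] by auto
  have "x - y = (a * d - c * b) / (b * d)" using x y by (simp add: field_simps)
  also have "\<dots> \<in> Ov" using x y bd by (intro OvI subring_set_diff[OF B] subring_set_mult[OF B])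
  finally show "x - y \<in> Ov" .
  have "x * y = (a * c) / (b * d)" using x y by simp
  also have "\<dots> \<in> Ov" using x y bd by (intro OvI subring_set_mult[OF B])
  finally show "x * y \<in> Ov" .
qed

lemma mv_mult: assumes "x \<in> Ov" "y \<in> mv" shows "x * y \<in> mv"
proof -
  obtain a b c d where x: "a \<in> B" "b \<in> B" "b \<notin> P" "x = a / b"
    and y: "c \<in> P" "d \<in> B" "d \<notin> P" "y = c / d" using assms by (elim OvE mvE)
  have bd: "b * d \<in> B" "b * d \<notin> P" using x y prime_of_mult_notin[OF PP] subring_set_mult[OF B] by auto
  have "x * y = (a * c) / (b * d)" using x y by simp
  also have "\<dots> \<in> mv" using x y bd by (intro mvI ideal_of_mult[OF PI])
  finally show ?thesis .
qed

lemma mv_Ov: "mv \<subseteq> Ov"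
proof
  fix x assume "x \<in> mv"
  then show "x \<in> Ov" using ideal_of_subset[OF PI] by (elim mvE) (auto intro: OvI)
qed

lemma one_notin_mv: "1 \<notin> mv"
proof
  assume "1 \<in> mv"
  then obtain a b where "a \<in> P" "b \<notin> P" "b \<noteq> 0" "1 = a / b" by (elim mvE)
  then show False by (simp add: field_simps)
qed

lemma zero_in_mv: "0 \<in> mv"
  using P_mv ideal_of_zero[OF PI] by blast

lemma inverse_in_Ov: assumes "x \<in> Ov" "x \<notin> mv" shows "inverse x \<in> Ov"
proof -
  obtain a b where x: "a \<in> B" "b \<in> B" "b \<notin> P" "x = a / b" using assms by (elim OvE)
  then have "a \<notin> P" using mvI[of a b] assms(2) by blast
  then show ?thesis using OvI[of b a] x by simp
qed

lemma Ov_mult_notin: assumes "x \<in> Ov - mv" "y \<in> Ov - mv" shows "x * y \<in> Ov - mv"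
proof -
  have "x * y \<notin> mv"
  proof
    assume "x * y \<in> mv"
    then have "inverse x * (x * y) \<in> mv" using mv_mult inverse_in_Ov assms by blast
    moreover have "x \<noteq> 0" using zero_in_mv assms by blast
    ultimately show False using assms by (simp add: mult.assoc[symmetric])
  qed
  then show ?thesis using subring_set_mult[OF subring_set_Ov] assms by blast
qed

lemma unit_power: "x \<in> Ov - mv \<Longrightarrow> x ^ n \<in> Ov - mv"
proof (induction n)
  case 0
  then show ?case using subring_set_one[OF subring_set_Ov] one_notin_mv by simp
next
  case (Suc n)
  then show ?case using Ov_mult_notin[of x "x ^ n"] by simp
qed

lemma mv_in_B: "x \<in> B \<Longrightarrow> x \<in> mv \<Longrightarrow> x \<in> P"
proof -
  assume x: "x \<in> B" "x \<in> mv"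
  then obtain a b where ab: "a \<in> P" "b \<in> B" "b \<notin> P" "b \<noteq> 0" "x = a / b" by (elim mvE) blast
  then have "x * b \<in> P" by simp
  then show "x \<in> P" using prime_ofD[OF PP x(1) ab(2)] ab by blast
qed

lemma radical_Ov:
  assumes "a \<in> P" "a \<noteq> 0" "p \<in> P"
  shows "\<exists>n. \<exists>h\<in>Ov. p ^ n = a * h"
proof -
  obtain n s b where s: "s \<in> B - P" "b \<in> B" "s * p ^ n = a * b"
    using height_one_radical[OF B h1 assms] by blast
  have "s \<noteq> 0" using s ideal_of_zero[OF PI] by auto
  then have "p ^ n = a * (b / s)" using s(3) by (simp add: field_simps)
  then show ?thesis using OvI[of b s] s by blast
qed

text \<open>If \<open>t\<close> mapped all generators of \<open>P\<close> into the maximal ideal,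
  the determinant trick would make it integral. Normality is given for \<open>B\<close> and not for
  the local ring, so \<open>t\<close> is first multiplied by a common denominator \<open>S\<close>
  outside \<open>P\<close>.\<close>

lemma not_integral:
  assumes t: "t \<notin> Ov" and tF: "\<And>s. s \<in> B - P \<Longrightarrow> s * t \<in> F" and G: "finite G" "G \<subseteq> P" "P \<subseteq> lin_span B G"
  shows "\<exists>g\<in>G. t * g \<notin> mv"
proof (rule ccontr)
  assume "\<not> ?thesis"
  then have all: "t * g \<in> mv" if "g \<in> G" for g using that by blast
  have "\<forall>g\<in>G. \<exists>s c. s \<in> B - P \<and> (\<forall>h\<in>G. c h \<in> B) \<and> s * (t * g) = (\<Sum>h\<in>G. c h * h)"
  proof
    fix g assume g: "g \<in> G"
    obtain a b where ab: "a \<in> P" "b \<in> B" "b \<notin> P" "b \<noteq> 0" "t * g = a / b" using all[OF g] by (elim mvE)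
    obtain c where "\<forall>h\<in>G. c h \<in> B" "a = (\<Sum>h\<in>G. c h * h)" using ab(1) G(3) by (auto simp: lin_span_def)
    then show "\<exists>s c. s \<in> B - P \<and> (\<forall>h\<in>G. c h \<in> B) \<and> s * (t * g) = (\<Sum>h\<in>G. c h * h)"
      using ab by (intro exI[of _ b] exI[of _ c]) auto
  qed
  then obtain s c where sc: "\<And>g. g \<in> G \<Longrightarrow> s g \<in> B - P" "\<And>g h. g \<in> G \<Longrightarrow> h \<in> G \<Longrightarrow> c g h \<in> B"
    "\<And>g. g \<in> G \<Longrightarrow> s g * (t * g) = (\<Sum>h\<in>G. c g h * h)" by metis
  define S where "S = (\<Prod>g\<in>G. s g)"
  have S: "S \<in> B - P" unfolding S_def by (rule prime_of_prod_notin[OF B PP sc(1)])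
  define r where "r = (\<lambda>g h. (\<Prod>g'\<in>G - {g}. s g') * c g h)"
  have "\<exists>p. Polynomial.lead_coeff p = 1 \<and> (\<forall>i. Polynomial.coeff p i \<in> B) \<and> poly p (S * t) = 0"
  proof (rule det_trick[where r = r, OF B G(1)])
    show "\<exists>g\<in>G. g \<noteq> 0"
    proof (rule ccontr)
      assume "\<not> ?thesis"
      then have "lin_span B G \<subseteq> {0}" by (auto simp: lin_span_def intro!: sum.neutral)
      then show False using G(3) h1 ideal_of_zero[OF PI] by (auto simp: height_one_def)
    qed
    show "r g h \<in> B" if "g \<in> G" "h \<in> G" for g h
      unfolding r_def using sc(1,2) that by (intro subring_set_mult[OF B] subring_set_prod[OF B]) auto
    show "S * t * g = (\<Sum>h\<in>G. r g h * h)" if "g \<in> G" for g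
    proof -
      have "S * t * g = (\<Prod>g'\<in>G - {g}. s g') * (s g * (t * g))"
        unfolding S_def using G(1) that by (simp add: prod.remove[of G g] ac_simps)
      then show ?thesis by (simp add: sc(3)[OF that] r_def sum_distrib_left mult.assoc)
    qed
  qed
  then have "S * t \<in> B" using normal tF[OF S] unfolding integrally_closed_in_def by blast
  moreover have "S \<noteq> 0" using S ideal_of_zero[OF PI] by blast
  ultimately show False using OvI[of "S * t" S] S t by simp
qed

text \<open>Take a nonzero \<open>a\<close> in \<open>P\<close> and an element \<open>b\<close>
  outside \<open>aO\<close> that every generator of \<open>P\<close> multiplies into
  \<open>aO\<close>, and put \<open>t = b / a\<close>. Then \<open>t\<close> is not in
  \<open>Ov\<close> but maps the maximal ideal into \<open>Ov\<close>. By
  \<open>not_integral\<close> some generator \<open>\<pi>\<close> makes \<open>t * \<pi>\<close> a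
  unit, and dividing by this unit shows that \<open>\<pi>\<close> generates the maximal
  ideal.\<close>

lemma uniformizer_exists: "\<exists>\<pi>\<in>P. \<pi> \<noteq> 0 \<and> mv = (\<lambda>h. \<pi> * h) ` Ov"
proof -
  obtain G where G: "finite G" "G \<subseteq> P" "P \<subseteq> lin_span B G"
    using noeth PI unfolding noetherian_def by blast
  obtain a where a: "a \<in> P" "a \<noteq> 0" using h1 ideal_of_zero[OF PI] by (auto simp: height_one_def)
  have aB: "a \<in> B" using a ideal_of_subset[OF PI] by blast
  define aO where "aO = (\<lambda>h. a * h) ` Ov"
  have aO_mult: "x * y \<in> aO" if "x \<in> Ov" "y \<in> aO" for x y
    using that subring_set_mult[OF subring_set_Ov, of x] unfolding aO_def by (auto simp: ac_simps)
  have GO: "g \<in> Ov" if "g \<in> G" for g using that G(2) P_mv mv_Ov by blast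
  have "\<forall>g\<in>G. \<exists>n. g ^ n \<in> aO" using radical_Ov[OF a] G(2) unfolding aO_def by blast
  then obtain n where n: "\<And>g. g \<in> G \<Longrightarrow> g ^ n g \<in> aO" by metis
  define N where "N = Max (insert 1 (n ` G))"
  have N: "g ^ m \<in> aO" if "g \<in> G" "m \<ge> N" for g m
  proof -
    have "n g \<le> N" using G(1) that(1) by (simp add: N_def)
    then have "g ^ m = g ^ (m - n g) * g ^ n g" using that(2) by (simp flip: power_add)
    then show ?thesis using aO_mult[OF subring_set_power[OF subring_set_Ov GO[OF that(1)]] n[OF that(1)]] by simp
  qed
  \<comment> \<open>High powers of the generators lie in \<open>aO\<close>, so the monomials outside
    \<open>aO\<close> have bounded exponents. One of maximal total degree among them is the desired
    \<open>b\<close>: any further generator takes it into \<open>aO\<close>.\<close>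
  define mon where "mon = (\<lambda>\<alpha>. \<Prod>g\<in>G. g ^ (\<alpha> g :: nat))"
  define E where "E = {\<alpha> \<in> G \<rightarrow>\<^sub>E {..<N}. mon \<alpha> \<notin> aO}"
  have finE: "finite E" unfolding E_def using G(1) by (simp add: finite_PiE)
  have "1 \<notin> aO"
  proof
    assume "1 \<in> aO"
    then obtain h where "h \<in> Ov" "1 = a * h" unfolding aO_def by blast
    then have "1 \<in> mv" using mv_mult[of h a] a(1) P_mv by (simp add: mult.commute subset_iff)
    then show False using one_notin_mv by simp
  qed
  moreover have "N \<ge> 1" using G(1) by (simp add: N_def)
  ultimately have "(\<lambda>g\<in>G. 0) \<in> E" by (auto simp: E_def mon_def)
  then have "E \<noteq> {}" by blast
  have "Max ((\<lambda>\<alpha>. \<Sum>g\<in>G. \<alpha> g) ` E) \<in> (\<lambda>\<alpha>. \<Sum>g\<in>G. \<alpha> g) ` E"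
    using finE \<open>E \<noteq> {}\<close> by (intro Max_in) auto
  then obtain \<alpha> where \<alpha>: "\<alpha> \<in> E" "Max ((\<lambda>\<alpha>. \<Sum>g\<in>G. \<alpha> g) ` E) = (\<Sum>g\<in>G. \<alpha> g)" by blast
  have max: "(\<Sum>g\<in>G. \<beta> g) \<le> (\<Sum>g\<in>G. \<alpha> g)" if "\<beta> \<in> E" for \<beta>
    unfolding \<alpha>(2)[symmetric] using finE that by (intro Max_ge) auto
  define b where "b = mon \<alpha>"
  have bO: "b \<in> Ov" unfolding b_def mon_def
    by (intro subring_set_prod[OF subring_set_Ov] subring_set_power[OF subring_set_Ov] GO)
  have bB: "b \<in> B" unfolding b_def mon_def
    using G(2) ideal_of_subset[OF PI] by (intro subring_set_prod[OF B] subring_set_power[OF B]) auto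
  have b: "b \<notin> aO" using \<alpha> by (simp add: E_def b_def)
  have bg: "g0 * b \<in> aO" if g0: "g0 \<in> G" for g0
  proof (rule ccontr)
    assume no: "g0 * b \<notin> aO"
    define \<beta> where "\<beta> = \<alpha>(g0 := Suc (\<alpha> g0))"
    have mon\<beta>: "mon \<beta> = g0 * b"
      unfolding mon_def b_def \<beta>_def using G(1) g0 by (simp add: prod.remove[of G g0] ac_simps)
    show False
    proof (cases "Suc (\<alpha> g0) < N")
      case True
      have "\<beta> \<in> G \<rightarrow>\<^sub>E {..<N}"
        using \<alpha> g0 True by (auto simp: E_def \<beta>_def PiE_iff extensional_def)
      then have "\<beta> \<in> E" using no mon\<beta> by (simp add: E_def)
      moreover have "(\<Sum>g\<in>G. \<beta> g) = Suc (\<Sum>g\<in>G. \<alpha> g)"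
        unfolding \<beta>_def using G(1) g0 by (simp add: sum.remove[of G g0])
      ultimately show False using max by fastforce
    next
      case False
      have "mon \<beta> = (\<Prod>g\<in>G - {g0}. g ^ \<beta> g) * g0 ^ Suc (\<alpha> g0)"
        unfolding mon_def \<beta>_def using G(1) g0 by (simp add: prod.remove[of G g0] ac_simps)
      also have "\<dots> \<in> aO"
        using False g0 GO
        by (intro aO_mult N subring_set_prod[OF subring_set_Ov] subring_set_power[OF subring_set_Ov]) auto
      finally show False using no mon\<beta> by simp
    qed
  qed
  define t where "t = b / a"
  have tO: "t \<notin> Ov"
  proof
    assume "t \<in> Ov"
    then have "a * t \<in> aO" unfolding aO_def by blast
    then show False using b a(2) by (simp add: t_def)
  qed
  have tg: "t * g \<in> Ov" if "g \<in> G" for g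
    using bg[OF that] a(2) unfolding aO_def t_def by (auto simp: field_simps)
  have "s * t \<in> F" if "s \<in> B - P" for s
    using F[of "s * b" a] aB bB that subring_set_mult[OF B] by (simp add: t_def)
  from not_integral[OF tO this G] obtain \<pi> where \<pi>: "\<pi> \<in> G" "t * \<pi> \<notin> mv" by blast
  have "\<pi> \<noteq> 0" using \<pi>(2) zero_in_mv by auto
  have "t \<noteq> 0" using \<pi>(2) zero_in_mv by auto
  have tm: "t * x \<in> Ov" if xm: "x \<in> mv" for x
  proof -
    obtain p s where ps: "p \<in> P" "s \<in> B" "s \<notin> P" "s \<noteq> 0" "x = p / s" using xm by (elim mvE)
    obtain c where c: "\<forall>h\<in>G. c h \<in> B" "p = (\<Sum>h\<in>G. c h * h)" using ps(1) G(3) by (auto simp: lin_span_def)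
    have sum: "(\<Sum>h\<in>G. c h * (t * h)) \<in> Ov"
    proof (rule subring_set_sum[OF subring_set_Ov])
      fix h assume "h \<in> G"
      then show "c h * (t * h) \<in> Ov"
        using c(1) B_Ov by (intro subring_set_mult[OF subring_set_Ov _ tg]) auto
    qed
    have "t * x = (\<Sum>h\<in>G. c h * (t * h)) * (1 / s)"
      by (simp add: ps c sum_distrib_left sum_divide_distrib ac_simps)
    also have "\<dots> \<in> Ov"
      by (rule subring_set_mult[OF subring_set_Ov sum OvI[OF subring_set_one[OF B] ps(2,3)]])
    finally show ?thesis .
  qed
  have inv: "inverse (t * \<pi>) \<in> Ov" by (rule inverse_in_Ov[OF tg[OF \<pi>(1)] \<pi>(2)])
  have "mv = (\<lambda>h. \<pi> * h) ` Ov"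
  proof
    show "mv \<subseteq> (\<lambda>h. \<pi> * h) ` Ov"
    proof
      fix x assume "x \<in> mv"
      then have "inverse (t * \<pi>) * (t * x) \<in> Ov" by (intro subring_set_mult[OF subring_set_Ov] inv tm)
      moreover have "x = \<pi> * (inverse (t * \<pi>) * (t * x))" using \<open>\<pi> \<noteq> 0\<close> \<open>t \<noteq> 0\<close> by (simp add: field_simps)
      ultimately show "x \<in> (\<lambda>h. \<pi> * h) ` Ov" by blast
    qed
    show "(\<lambda>h. \<pi> * h) ` Ov \<subseteq> mv"
      using mv_mult[of _ \<pi>] \<pi>(1) G(2) P_mv by (auto simp: mult.commute)
  qed
  then show ?thesis using \<pi>(1) G(2) \<open>\<pi> \<noteq> 0\<close> by blast
qed

definition unif :: "'a" where
  "unif = (SOME \<pi>. \<pi> \<in> P \<and> \<pi> \<noteq> 0 \<and> mv = (\<lambda>h. \<pi> * h) ` Ov)"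

lemma unif: "unif \<in> P" "unif \<noteq> 0" "mv = (\<lambda>h. unif * h) ` Ov"
  using someI_ex[of "\<lambda>\<pi>. \<pi> \<in> P \<and> \<pi> \<noteq> 0 \<and> mv = (\<lambda>h. \<pi> * h) ` Ov"] uniformizer_exists
  unfolding unif_def by blast+

lemma unif_power_bound:
  assumes "x \<in> Ov" "x \<noteq> 0"
  shows "\<exists>n. \<exists>h\<in>Ov. unif ^ n = x * h"
proof -
  obtain a b where x: "a \<in> B" "b \<in> B" "b \<notin> P" "b \<noteq> 0" "x = a / b" using assms(1) by (elim OvE)
  have a0: "a \<noteq> 0" using x assms(2) by auto
  show ?thesis
  proof (cases "a \<in> P")
    case True
    then obtain n h where "h \<in> Ov" "unif ^ n = a * h" using radical_Ov[of a unif] unif(1) a0 by auto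
    then have "unif ^ n = x * (b * h)" using x by simp
    moreover have "b * h \<in> Ov" using \<open>h \<in> Ov\<close> x(2) B_Ov subring_set_mult[OF subring_set_Ov] by blast
    ultimately show ?thesis by blast
  next
    case False
    then have "b / a \<in> Ov" by (intro OvI x)
    moreover have "unif ^ 0 = x * (b / a)" using x(4,5) a0 by simp
    ultimately show ?thesis by blast
  qed
qed

text \<open>The exponent is the largest one for which the power of \<open>unif\<close> divides
  \<open>x\<close>; it is bounded because \<open>x\<close> in turn divides some power of
  \<open>unif\<close>.\<close>

lemma unif_expansion:
  assumes "x \<in> Ov" "x \<noteq> 0"
  obtains n u where "u \<in> Ov - mv" "x = u * unif ^ n"
proof -
  obtain N h where h: "h \<in> Ov" "unif ^ N = x * h" using unif_power_bound[OF assms] by blast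
  define I where "I = {n. x \<in> (\<lambda>h. unif ^ n * h) ` Ov}"
  have bound: "n \<le> N" if nI: "n \<in> I" for n
  proof (rule ccontr)
    assume "\<not> n \<le> N"
    obtain h' where h': "h' \<in> Ov" "x = unif ^ n * h'" using nI unfolding I_def by blast
    have "unif ^ n = unif ^ N * (unif * unif ^ (n - Suc N))"
      using \<open>\<not> n \<le> N\<close> by (simp flip: power_add power_Suc)
    then have "unif ^ N * 1 = unif ^ N * (unif * (unif ^ (n - Suc N) * h' * h))"
      using h(2) h'(2) by (simp add: ac_simps)
    then have "1 = unif * (unif ^ (n - Suc N) * h' * h)"
      using unif(2) by (subst (asm) mult_cancel_left) simp
    moreover have "unif ^ (n - Suc N) * h' * h \<in> Ov"
      using unif(1) P_mv mv_Ov h h'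
      by (intro subring_set_mult[OF subring_set_Ov] subring_set_power[OF subring_set_Ov]) auto
    ultimately have "1 \<in> mv" unfolding unif(3) by blast
    then show False using one_notin_mv by simp
  qed
  have "0 \<in> I" using assms by (auto simp: I_def)
  then have n: "Max I \<in> I" using bound finite_nat_set_iff_bounded_le[of I] by (intro Max_in) auto
  then obtain u where u: "u \<in> Ov" "x = unif ^ Max I * u" by (auto simp: I_def)
  have "u \<notin> mv"
  proof
    assume "u \<in> mv"
    then obtain u' where "u' \<in> Ov" "u = unif * u'" unfolding unif(3) by blast
    then have "x = unif ^ Suc (Max I) * u'" using u(2) by simp
    then have "Suc (Max I) \<in> I" unfolding I_def using \<open>u' \<in> Ov\<close> by blast
    then have "Suc (Max I) \<le> Max I"
      using bound finite_nat_set_iff_bounded_le[of I] by (intro Max_ge) auto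
    then show False by simp
  qed
  then show ?thesis using that[of u "Max I"] u by (simp add: mult.commute)
qed

lemma unif_power_unique:
  assumes "u \<in> Ov - mv" "u' \<in> Ov" "u * unif ^ n = u' * unif ^ m"
  shows "m \<le> n"
proof (rule ccontr)
  assume "\<not> m \<le> n"
  then have "unif ^ m = unif ^ n * (unif * unif ^ (m - Suc n))" by (simp flip: power_add power_Suc)
  then have "unif ^ n * u = unif ^ n * (unif * (unif ^ (m - Suc n) * u'))"
    using assms(3) by (simp add: ac_simps)
  then have "u = unif * (unif ^ (m - Suc n) * u')"
    using unif(2) by (subst (asm) mult_cancel_left) simp
  moreover have "unif ^ (m - Suc n) * u' \<in> Ov"
    using unif(1) P_mv mv_Ov assms(2)
    by (intro subring_set_mult[OF subring_set_Ov] subring_set_power[OF subring_set_Ov]) auto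
  ultimately show False using assms(1) unfolding unif(3) by blast
qed

text \<open>\<open>ord_along\<close> quantifies over all uniformizers. Any two of them differ by a
  unit, which is absorbed into the unit factor.\<close>

lemma ord_along_eq:
  assumes u: "u \<in> Ov - mv"
  shows "ord_along B P (u * unif ^ n) = n"
  unfolding ord_along_def Ov_def[symmetric] mv_def[symmetric]
proof (rule the_equality)
  show "\<exists>\<pi> u'. mv = (\<lambda>h. \<pi> * h) ` Ov \<and> u' \<in> Ov - mv \<and> u * unif ^ n = u' * \<pi> ^ n"
    using unif(3) u by blast
  fix m assume "\<exists>\<pi> u'. mv = (\<lambda>h. \<pi> * h) ` Ov \<and> u' \<in> Ov - mv \<and> u * unif ^ n = u' * \<pi> ^ m"
  then obtain \<pi> u' where \<pi>: "mv = (\<lambda>h. \<pi> * h) ` Ov" and u': "u' \<in> Ov - mv" "u * unif ^ n = u' * \<pi> ^ m" by blast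
  have "\<pi> \<in> mv" unfolding \<pi> using subring_set_one[OF subring_set_Ov] by (intro image_eqI[of _ _ 1]) auto
  then obtain e where e: "e \<in> Ov" "\<pi> = unif * e" unfolding unif(3) by blast
  have "unif \<in> mv" using unif(1) P_mv by blast
  then obtain e' where e': "e' \<in> Ov" "unif = \<pi> * e'" unfolding \<pi> by blast
  have "unif * 1 = unif * (e * e')" using e'(2) e(2) by (simp add: ac_simps)
  then have "e * e' = 1" using unif(2) by (subst (asm) mult_cancel_left) simp
  then have "e \<notin> mv" using mv_mult[OF e'(1), of e] one_notin_mv by (auto simp: mult.commute)
  then have unit: "u' * e ^ m \<in> Ov - mv" using u' e by (intro Ov_mult_notin unit_power) auto
  have eq: "u * unif ^ n = (u' * e ^ m) * unif ^ m" using u'(2) e(2) by (simp add: power_mult_distrib ac_simps)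
  show "m = n"
    using unif_power_unique[OF u _ eq] unif_power_unique[OF unit _ eq[symmetric]] unit u by auto
qed

end

section \<open>Determinants by columns\<close>

lemma det_scale_cols:
  fixes M :: "nat \<Rightarrow> nat \<Rightarrow> 'a::comm_ring_1"
  shows "Determinant.det (mat n n (\<lambda>(i, j). c j * M i j)) = (\<Prod>j<n. c j) * Determinant.det (mat n n (\<lambda>(i, j). M i j))"
proof -
  have "Determinant.det (mat n n (\<lambda>(i, j). c j * M i j)) =
      (\<Sum>p | p permutes {0..<n}. signof p * (\<Prod>j<n. c j * M (p j) j))"
    by (subst det_col[of _ n]) (auto intro!: sum.cong prod.cong simp: permutes_in_image)
  also have "\<dots> = (\<Prod>j<n. c j) * (\<Sum>p | p permutes {0..<n}. signof p * (\<Prod>j<n. M (p j) j))"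
    by (simp add: prod.distrib sum_distrib_left ac_simps)
  also have "(\<Sum>p | p permutes {0..<n}. signof p * (\<Prod>j<n. M (p j) j)) = Determinant.det (mat n n (\<lambda>(i, j). M i j))"
    by (subst det_col[of _ n]) (auto intro!: sum.cong prod.cong simp: permutes_in_image)
  finally show ?thesis .
qed

lemma det_linear_col:
  fixes M :: "nat \<Rightarrow> nat \<Rightarrow> 'a::comm_ring_1"
  assumes k: "k < n"
  shows "Determinant.det (mat n n (\<lambda>(i, j). if j = k then s * a i + t * b i else M i j)) =
    s * Determinant.det (mat n n (\<lambda>(i, j). if j = k then a i else M i j)) +
    t * Determinant.det (mat n n (\<lambda>(i, j). if j = k then b i else M i j))"
proof -
  have expand: "Determinant.det (mat n n (\<lambda>(i, j). if j = k then c i else M i j)) =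
      (\<Sum>p | p permutes {0..<n}. signof p * (c (p k) * (\<Prod>j\<in>{..<n} - {k}. M (p j) j)))" for c
  proof (subst det_col[of _ n], simp, rule sum.cong[OF refl])
    fix p assume "p \<in> {p. p permutes {0..<n}}"
    then have p: "p j < n" if "j < n" for j using that by (auto simp: permutes_in_image)
    have "(\<Prod>j<n. mat n n (\<lambda>(i, j). if j = k then c i else M i j) $$ (p j, j)) =
        (\<Prod>j<n. if j = k then c (p k) else M (p j) j)"
      using p by (intro prod.cong) auto
    also have "\<dots> = c (p k) * (\<Prod>j\<in>{..<n} - {k}. if j = k then c (p k) else M (p j) j)"
      using k by (subst prod.remove[of _ k]) auto
    also have "(\<Prod>j\<in>{..<n} - {k}. if j = k then c (p k) else M (p j) j) = (\<Prod>j\<in>{..<n} - {k}. M (p j) j)"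
      by (intro prod.cong) auto
    finally show "signof p * (\<Prod>j<n. mat n n (\<lambda>(i, j). if j = k then c i else M i j) $$ (p j, j)) =
        signof p * (c (p k) * (\<Prod>j\<in>{..<n} - {k}. M (p j) j))" by simp
  qed
  show ?thesis
    unfolding expand by (simp add: sum_distrib_left sum.distrib[symmetric] algebra_simps)
qed

lemma det_equal_cols:
  fixes M :: "nat \<Rightarrow> nat \<Rightarrow> 'a::comm_ring_1"
  assumes "k < n" "l < n" "k \<noteq> l" "\<And>i. i < n \<Longrightarrow> M i k = M i l"
  shows "Determinant.det (mat n n (\<lambda>(i, j). M i j)) = 0"
proof (rule det_identical_columns)
  show "mat n n (\<lambda>(i, j). M i j) \<in> carrier_mat n n" by simp
  show "k \<noteq> l" "k < n" "l < n" by fact+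
  show "col (mat n n (\<lambda>(i, j). M i j)) k = col (mat n n (\<lambda>(i, j). M i j)) l"
    by (rule eq_vecI) (use assms in simp_all)
qed

text \<open>Cramer's rule for one column. With derivatives of the coordinates as \<open>M\<close>,
  it turns a column that holds the derivatives of another function, expanded by the chain rule, into
  the factor \<open>x k\<close>.\<close>

lemma det_cramer_col:
  fixes M :: "nat \<Rightarrow> nat \<Rightarrow> 'a::comm_ring_1"
  assumes k: "k < n"
  shows "Determinant.det (mat n n (\<lambda>(i, j). if j = k then \<Sum>l<n. M i l * x l else M i j)) =
    x k * Determinant.det (mat n n (\<lambda>(i, j). M i j))"
proof -
  let ?M = "mat n n (\<lambda>(i, j). M i j)"
  have "replace_col ?M (?M *\<^sub>v vec n x) k = mat n n (\<lambda>(i, j). if j = k then \<Sum>l<n. M i l * x l else M i j)"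
    by (rule eq_matI) (auto simp: replace_col_def scalar_prod_def atLeast0LessThan)
  then show ?thesis using cramer_lemma_mat[of ?M n "vec n x" k] k by simp
qed

lemma det_in_subring:
  fixes M :: "nat \<Rightarrow> nat \<Rightarrow> 'a::comm_ring_1"
  assumes A: "subring_set A" and "\<And>i j. i < n \<Longrightarrow> j < n \<Longrightarrow> M i j \<in> A"
  shows "Determinant.det (mat n n (\<lambda>(i, j). M i j)) \<in> A"
  unfolding det_def'[OF mat_carrier]
proof (intro subring_set_sum[OF A] subring_set_mult[OF A] subring_set_prod[OF A])
  fix p assume p: "p \<in> {p. p permutes {0..<n}}"
  have "signof p = (1 :: 'a) \<or> signof p = (- 1 :: 'a)" by (auto simp: sign_def)
  then show "signof p \<in> A"
    using subring_set_one[OF A] subring_set_uminus[OF A subring_set_one[OF A]] by (elim disjE) (simp_all only:)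
  fix i assume "i \<in> {0..<n}"
  then show "mat n n (\<lambda>(i, j). M i j) $$ (i, p i) \<in> A" using p assms(2) by (auto simp: permutes_in_image)
qed

text \<open>All \<open>2 \<times> 2\<close> minors of the rank one part \<open>b i * c j\<close> vanish, so at most one column of the
  expansion lacks the factor \<open>t\<close>.\<close>

lemma det_rank_one_perturbation:
  fixes M :: "nat \<Rightarrow> nat \<Rightarrow> 'a::comm_ring_1"
  assumes A: "subring_set A" and M: "\<And>i j. i < n \<Longrightarrow> j < n \<Longrightarrow> M i j \<in> A"
    and b: "\<And>i. i < n \<Longrightarrow> b i \<in> A" and c: "\<And>j. j < n \<Longrightarrow> c j \<in> A" and t: "t \<in> A"
  shows "\<exists>h\<in>A. Determinant.det (mat n n (\<lambda>(i, j). t * M i j + c j * b i)) = t ^ (n - 1) * h"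
proof -
  \<comment> \<open>Column \<open>k\<close> already is \<open>b\<close>, so adding multiples of
    \<open>b\<close> to further columns changes nothing. \<open>F\<close> below inserts the rank one
    terms column by column, and the insertion in column \<open>l\<close> adds \<open>c l\<close>
    times \<open>G l l\<close>.\<close>
  define G where "G = (\<lambda>l k. Determinant.det (mat n n (\<lambda>(i, j). if j = k then b i
      else if j < l then t * M i j + c j * b i else t * M i j)))"
  have G0: "G 0 k = t ^ (n - 1) * Determinant.det (mat n n (\<lambda>(i, j). if j = k then b i else M i j))" if k: "k < n" for k
  proof -
    have "G 0 k = Determinant.det (mat n n (\<lambda>(i, j). (if j = k then 1 else t) * (if j = k then b i else M i j)))"
      unfolding G_def by (intro arg_cong[of _ _ Determinant.det] cong_mat) auto
    also have "\<dots> = (\<Prod>j<n. if j = k then 1 else t) * Determinant.det (mat n n (\<lambda>(i, j). if j = k then b i else M i j))"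
      by (rule det_scale_cols)
    also have "(\<Prod>j<n. if j = k then 1 else t) = t ^ (n - 1)"
      using k by (subst prod.remove[of _ k]) auto
    finally show ?thesis .
  qed
  have Gstep: "G (Suc l) k = G l k" if k: "k < n" and l: "l < n" for k l
  proof (cases "l = k")
    case True
    then show ?thesis unfolding G_def by (intro arg_cong[of _ _ Determinant.det] cong_mat) auto
  next
    case False
    define N where "N = (\<lambda>i j. if j = k then b i else if j < l then t * M i j + c j * b i else t * M i j)"
    have "G (Suc l) k = Determinant.det (mat n n (\<lambda>(i, j). if j = l then 1 * (t * M i l) + c l * b i else N i j))"
      unfolding G_def N_def using False by (intro arg_cong[of _ _ Determinant.det] cong_mat) auto
    also have "\<dots> = 1 * Determinant.det (mat n n (\<lambda>(i, j). if j = l then t * M i l else N i j)) +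
        c l * Determinant.det (mat n n (\<lambda>(i, j). if j = l then b i else N i j))"
      by (rule det_linear_col[OF l])
    also have "Determinant.det (mat n n (\<lambda>(i, j). if j = l then b i else N i j)) = 0"
      by (rule det_equal_cols[OF k l]) (use False in \<open>auto simp: N_def\<close>)
    also have "Determinant.det (mat n n (\<lambda>(i, j). if j = l then t * M i l else N i j)) = G l k"
      unfolding G_def N_def using False by (intro arg_cong[of _ _ Determinant.det] cong_mat) auto
    finally show ?thesis by simp
  qed
  have G: "\<exists>h\<in>A. G l k = t ^ (n - 1) * h" if k: "k < n" and l: "l \<le> n" for k l
  proof -
    have "G l k = G 0 k" using l by (induction l) (simp_all add: Gstep[OF k])
    moreover have "Determinant.det (mat n n (\<lambda>(i, j). if j = k then b i else M i j)) \<in> A"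
      by (rule det_in_subring[OF A]) (use M b in auto)
    ultimately show ?thesis using G0[OF k] by auto
  qed
  define F where "F = (\<lambda>l. Determinant.det (mat n n (\<lambda>(i, j). if j < l then t * M i j + c j * b i else t * M i j)))"
  have "\<exists>h\<in>A. F l = t ^ (n - 1) * h" if "l \<le> n" for l
    using that
  proof (induction l)
    case 0
    have "F 0 = (\<Prod>j<n. t) * Determinant.det (mat n n (\<lambda>(i, j). M i j))"
      using det_scale_cols[of n "\<lambda>_. t" M] by (simp add: F_def)
    also have "(\<Prod>j<n. t) = t ^ (n - 1) * (if n = 0 then 1 else t)" by (cases n) simp_all
    finally show ?case
      using det_in_subring[OF A, of n M] M t subring_set_mult[OF A] subring_set_one[OF A]
      by (intro bexI[of _ "(if n = 0 then 1 else t) * Determinant.det (mat n n (\<lambda>(i, j). M i j))"]) (auto simp: mult.assoc)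
  next
    case (Suc l)
    then have l: "l < n" by simp
    obtain h where h: "h \<in> A" "F l = t ^ (n - 1) * h" using Suc by auto
    obtain h' where h': "h' \<in> A" "G l l = t ^ (n - 1) * h'" using G[OF l, of l] l by auto
    define N where "N = (\<lambda>i j. if j < l then t * M i j + c j * b i else t * M i j)"
    have "F (Suc l) = Determinant.det (mat n n (\<lambda>(i, j). if j = l then 1 * (t * M i l) + c l * b i else N i j))"
      unfolding F_def N_def by (intro arg_cong[of _ _ Determinant.det] cong_mat) auto
    also have "\<dots> = 1 * Determinant.det (mat n n (\<lambda>(i, j). if j = l then t * M i l else N i j)) +
        c l * Determinant.det (mat n n (\<lambda>(i, j). if j = l then b i else N i j))"
      by (rule det_linear_col[OF l])
    also have "Determinant.det (mat n n (\<lambda>(i, j). if j = l then t * M i l else N i j)) = F l"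
      unfolding F_def N_def by (intro arg_cong[of _ _ Determinant.det] cong_mat) auto
    also have "Determinant.det (mat n n (\<lambda>(i, j). if j = l then b i else N i j)) = G l l"
      unfolding G_def N_def by (intro arg_cong[of _ _ Determinant.det] cong_mat) auto
    finally have "F (Suc l) = t ^ (n - 1) * (h + c l * h')" by (simp add: h h' algebra_simps)
    then show ?case using h h' c[OF l] subring_set_add[OF A] subring_set_mult[OF A] by blast
  qed
  from this[of n] have "\<exists>h\<in>A. F n = t ^ (n - 1) * h" by simp
  moreover have "F n = Determinant.det (mat n n (\<lambda>(i, j). t * M i j + c j * b i))"
    unfolding F_def by (intro arg_cong[of _ _ Determinant.det] cong_mat) auto
  ultimately show ?thesis by simp
qed

section \<open>Derivations of the function field\<close>

lemma mpol_deriv_superset: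
  assumes "finite M" "Poly_Mapping.keys p \<subseteq> M"
  shows "mpol_deriv v p = (\<Sum>m\<in>M. Poly_Mapping.single (m - Poly_Mapping.single v 1)
      (of_nat (Poly_Mapping.lookup m v) * Poly_Mapping.lookup p m))"
  unfolding mpol_deriv_def using assms by (intro sum.mono_neutral_left) (auto simp: in_keys_iff)

lemma mpol_deriv_single:
  "mpol_deriv v (Poly_Mapping.single m c) =
     Poly_Mapping.single (m - Poly_Mapping.single v 1) (of_nat (Poly_Mapping.lookup m v) * c)"
  by (simp add: mpol_deriv_superset[of "{m}"])

lemma mpol_deriv_zero [simp]: "mpol_deriv v 0 = 0"
  by (simp add: mpol_deriv_def)

lemma mpol_deriv_add: "mpol_deriv v (p + q) = mpol_deriv v p + mpol_deriv v q"
proof -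
  let ?M = "Poly_Mapping.keys p \<union> Poly_Mapping.keys q"
  have "Poly_Mapping.keys (p + q) \<subseteq> ?M" by (rule keys_add)
  then show ?thesis
    by (simp add: mpol_deriv_superset[of ?M] lookup_add distrib_left single_add sum.distrib)
qed

lemma mpol_deriv_diff: "mpol_deriv v (p - q) = mpol_deriv v p - mpol_deriv v q"
  using mpol_deriv_add[of v "p - q" q] by (simp add: algebra_simps)

lemma mpol_deriv_mult:
  fixes p q :: "('v, 'k::comm_ring_1) mpol"
  shows "mpol_deriv v (p * q) = p * mpol_deriv v q + q * mpol_deriv v p"
proof (induction p rule: mpol_induct)
  case (single m c)
  show ?case
  proof (induction q rule: mpol_induct)
    case (single n b)
    let ?e = "Poly_Mapping.single v 1 :: 'v \<Rightarrow>\<^sub>0 nat"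
    \<comment> \<open>Truncated subtraction breaks this identity of exponents when \<open>v\<close>
      does not occur in \<open>n\<close>, but then the coefficient is zero.\<close>
    have shift: "Poly_Mapping.single (m + n - ?e) (of_nat (Poly_Mapping.lookup n v) * x) =
        Poly_Mapping.single (m + (n - ?e)) (of_nat (Poly_Mapping.lookup n v) * x)" for m n and x :: 'k
    proof (cases "Poly_Mapping.lookup n v = 0")
      case False
      then have "m + n - ?e = m + (n - ?e)"
        by (intro poly_mapping_eqI) (auto simp: lookup_add lookup_minus lookup_single when_def)
      then show ?thesis by simp
    qed simp
    have coef: "of_nat (Poly_Mapping.lookup (m + n) v) * (c * b) =
        of_nat (Poly_Mapping.lookup n v) * (c * b) + of_nat (Poly_Mapping.lookup m v) * (c * b)"
      by (simp add: lookup_add algebra_simps)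
    have "mpol_deriv v (Poly_Mapping.single m c * Poly_Mapping.single n b) =
        Poly_Mapping.single (m + n - ?e) (of_nat (Poly_Mapping.lookup n v) * (c * b)) +
        Poly_Mapping.single (n + m - ?e) (of_nat (Poly_Mapping.lookup m v) * (c * b))"
      unfolding mult_single mpol_deriv_single coef single_add add.commute[of n m] ..
    also have "\<dots> = Poly_Mapping.single m c * mpol_deriv v (Poly_Mapping.single n b) +
        Poly_Mapping.single n b * mpol_deriv v (Poly_Mapping.single m c)"
      unfolding shift mult_single mpol_deriv_single by (simp only: mult.assoc mult.left_commute mult.commute)
    finally show ?case .
  qed (simp_all add: mpol_deriv_add ring_distribs)
qed (simp_all add: mpol_deriv_add ring_distribs)

lemma mpol_deriv_const [simp]: "mpol_deriv v (mpol_const c) = 0"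
  by (simp add: mpol_const_def mpol_deriv_single)

lemma mpol_deriv_one [simp]: "mpol_deriv v (1 :: ('v, 'k::comm_ring_1) mpol) = 0"
  using mpol_deriv_const[of v "1 :: 'k"] by (simp add: mpol_const_def)

lemma mpol_deriv_var: "mpol_deriv v (mpol_var u) = of_bool (v = u)"
  by (cases "v = u") (simp_all add: mpol_var_def mpol_deriv_single lookup_single_not_eq)

lemma keys_minus_nat: "Poly_Mapping.keys (m - n :: 'v \<Rightarrow>\<^sub>0 nat) \<subseteq> Poly_Mapping.keys m"
  by (rule subsetI) (simp add: in_keys_iff lookup_minus)

lemma mpol_deriv_in:
  assumes "p \<in> mpol_in V" shows "mpol_deriv v p \<in> mpol_in V"
  unfolding mpol_deriv_def
proof (intro subring_set_sum[OF subring_set_mpol_in] single_in_mpol_in)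
  fix m assume "m \<in> Poly_Mapping.keys p"
  then show "Poly_Mapping.keys (m - Poly_Mapping.single v 1) \<subseteq> V"
    using assms keys_minus_nat[of m "Poly_Mapping.single v 1"] unfolding mpol_in_def by blast
qed

section \<open>Rational functions and their partial derivatives\<close>

lemma comm_ring_hom_to_fract: "comm_ring_hom (to_fract :: 'a::idom \<Rightarrow> 'a fract)"
  by unfold_locales auto

lemma comm_ring_hom_ratfun_const: "comm_ring_hom (ratfun_const :: 'k::field \<Rightarrow> 'k ratfun)"
proof -
  interpret c: comm_ring_hom "mpol_const :: 'k \<Rightarrow> (nat, 'k) mpol" by (rule comm_ring_hom_mpol_const)
  show ?thesis by unfold_locales (auto simp: ratfun_const_def c.hom_add c.hom_mult)
qed

lemma function_field_iff:
  "z \<in> function_field d \<longleftrightarrow> (\<exists>p q. p \<in> mpol_in {..d} \<and> q \<in> mpol_in {..d} \<and> q \<noteq> 0 \<and> z = to_fract p / to_fract q)"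
  unfolding function_field_def by (auto simp: Fract_conv_to_fract)

lemma subring_set_function_field: "subring_set (function_field d)"
  unfolding subring_set_def
proof (intro conjI ballI)
  note M = subring_set_mpol_in[of "{..d}"]
  show "1 \<in> function_field d"
    unfolding function_field_iff using subring_set_one[OF M] by (intro exI[of _ 1]) auto
  fix x y :: "'a ratfun" assume "x \<in> function_field d" "y \<in> function_field d"
  then obtain p q r s where pq: "p \<in> mpol_in {..d}" "q \<in> mpol_in {..d}" "q \<noteq> 0" "x = to_fract p / to_fract q"
    "r \<in> mpol_in {..d}" "s \<in> mpol_in {..d}" "s \<noteq> 0" "y = to_fract r / to_fract s"
    unfolding function_field_iff by blast
  show "x - y \<in> function_field d"
    unfolding function_field_iff
  proof (intro exI conjI)
    show "p * s - r * q \<in> mpol_in {..d}" "q * s \<in> mpol_in {..d}"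
      using pq by (auto intro!: subring_set_diff[OF M] subring_set_mult[OF M])
    show "q * s \<noteq> 0" using pq by simp
    show "x - y = to_fract (p * s - r * q) / to_fract (q * s)"
      using pq by (simp add: diff_frac_eq)
  qed
  show "x * y \<in> function_field d"
    unfolding function_field_iff
    using pq subring_set_mult[OF M] by (intro exI[of _ "p * r"] exI[of _ "q * s"]) auto
qed

lemma function_field_inverse: "z \<in> function_field d \<Longrightarrow> inverse z \<in> function_field d"
proof -
  assume "z \<in> function_field d"
  then obtain p q where pq: "p \<in> mpol_in {..d}" "q \<in> mpol_in {..d}" "q \<noteq> 0" "z = to_fract p / to_fract q"
    unfolding function_field_iff by blast
  show ?thesis
  proof (cases "p = 0")
    case True
    then show ?thesis using pq subring_set_zero[OF subring_set_function_field] by simp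
  next
    case False
    then show ?thesis unfolding function_field_iff using pq by (intro exI[of _ q] exI[of _ p]) auto
  qed
qed

lemma function_field_divide: "x \<in> function_field d \<Longrightarrow> y \<in> function_field d \<Longrightarrow> x / y \<in> function_field d"
  unfolding divide_inverse using subring_set_mult[OF subring_set_function_field] function_field_inverse by blast

lemma to_fract_in_function_field: "p \<in> mpol_in {..d} \<Longrightarrow> to_fract p \<in> function_field d"
  unfolding function_field_iff using subring_set_one[OF subring_set_mpol_in]
  by (intro exI[of _ p] exI[of _ 1]) auto

lemma ratfun_coord_in: "i \<le> d \<Longrightarrow> ratfun_coord i \<in> function_field d"
  unfolding ratfun_coord_def by (intro to_fract_in_function_field mpol_in_var) auto

lemma ratfun_const_in: "ratfun_const c \<in> function_field d"
  unfolding ratfun_const_def by (intro to_fract_in_function_field mpol_const_in)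

definition ratfun_deriv :: "nat \<Rightarrow> 'k::field ratfun \<Rightarrow> 'k ratfun" where
  "ratfun_deriv v z = (let (p, q) = (SOME (p, q). q \<noteq> 0 \<and> z = to_fract p / to_fract q) in
     (to_fract q * to_fract (mpol_deriv v p) - to_fract p * to_fract (mpol_deriv v q)) / to_fract q ^ 2)"

text \<open>Independence of the chosen fraction: differentiating \<open>p * q' = p' * q\<close> and
  clearing denominators identifies the two quotient rules.\<close>

lemma ratfun_deriv_divide:
  assumes "q \<noteq> 0"
  shows "ratfun_deriv v (to_fract p / to_fract q) =
     (to_fract q * to_fract (mpol_deriv v p) - to_fract p * to_fract (mpol_deriv v q)) / to_fract q ^ 2"
proof -
  define pq where "pq = (SOME (a, b). b \<noteq> 0 \<and> to_fract p / to_fract q = to_fract a / to_fract b)"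
  obtain p' q' where pq': "pq = (p', q')" by (cases pq)
  have "case pq of (a, b) \<Rightarrow> b \<noteq> 0 \<and> to_fract p / to_fract q = to_fract a / to_fract b"
    unfolding pq_def by (rule someI[of _ "(p, q)"]) (use assms in auto)
  then have q': "q' \<noteq> 0" and eq: "to_fract p / to_fract q = to_fract p' / to_fract q'" by (auto simp: pq')
  have "to_fract (p * q') = to_fract (p' * q)" using eq assms q' by (simp add: field_simps)
  then have e1: "p * q' = p' * q" by (simp only: to_fract_eq_iff)
  have e2: "p * mpol_deriv v q' + q' * mpol_deriv v p = p' * mpol_deriv v q + q * mpol_deriv v p'"
    using arg_cong[OF e1, of "mpol_deriv v"] by (simp add: mpol_deriv_mult)
  have "(q' * mpol_deriv v p' - p' * mpol_deriv v q') * q\<^sup>2 = (q * mpol_deriv v p - p * mpol_deriv v q) * q'\<^sup>2"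
  proof -
    have "(q' * mpol_deriv v p' - p' * mpol_deriv v q') * q\<^sup>2 =
        q * q' * (q * mpol_deriv v p') - q * mpol_deriv v q' * (p' * q)"
      by (simp add: power2_eq_square algebra_simps)
    also have "q * mpol_deriv v p' = p * mpol_deriv v q' + q' * mpol_deriv v p - p' * mpol_deriv v q"
      using e2 by (simp add: algebra_simps)
    also have "q * q' * (p * mpol_deriv v q' + q' * mpol_deriv v p - p' * mpol_deriv v q) - q * mpol_deriv v q' * (p' * q) =
        q * mpol_deriv v q' * (p * q' - p' * q) + q * q'\<^sup>2 * mpol_deriv v p - q' * mpol_deriv v q * (p' * q)"
      by (simp add: power2_eq_square algebra_simps)
    also have "\<dots> = (q * mpol_deriv v p - p * mpol_deriv v q) * q'\<^sup>2"
      unfolding e1[symmetric] by (simp add: power2_eq_square algebra_simps)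
    finally show ?thesis .
  qed
  then have "to_fract ((q' * mpol_deriv v p' - p' * mpol_deriv v q') * q\<^sup>2) =
      to_fract ((q * mpol_deriv v p - p * mpol_deriv v q) * q'\<^sup>2)" by simp
  then have "(to_fract q' * to_fract (mpol_deriv v p') - to_fract p' * to_fract (mpol_deriv v q')) / to_fract q' ^ 2 =
      (to_fract q * to_fract (mpol_deriv v p) - to_fract p * to_fract (mpol_deriv v q)) / to_fract q ^ 2"
    using assms q' by (simp add: frac_eq_eq power2_eq_square)
  then show ?thesis unfolding ratfun_deriv_def pq_def[symmetric] pq' by simp
qed

lemma ratfun_deriv_to_fract: "ratfun_deriv v (to_fract p) = to_fract (mpol_deriv v p)"
  using ratfun_deriv_divide[of 1 v p] by simp

lemma ratfun_deriv_coord: "ratfun_deriv v (ratfun_coord u) = of_bool (v = u)"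
  by (simp add: ratfun_coord_def ratfun_deriv_to_fract mpol_deriv_var)

lemma ratfun_deriv_const: "ratfun_deriv v (ratfun_const c) = 0"
  by (simp add: ratfun_const_def ratfun_deriv_to_fract)

lemma ratfun_cases: obtains p q where "q \<noteq> 0" "z = to_fract p / to_fract q"
proof (cases z)
  case (Fract p q)
  then show ?thesis using that[of q p] by (simp add: Fract_conv_to_fract)
qed

lemma ratfun_deriv_add: "ratfun_deriv v (x + y) = ratfun_deriv v x + ratfun_deriv v y"
proof -
  obtain p q where x: "q \<noteq> 0" "x = to_fract p / to_fract q" by (rule ratfun_cases)
  obtain r s where y: "s \<noteq> 0" "y = to_fract r / to_fract s" by (rule ratfun_cases)
  have sum: "x + y = to_fract (p * s + r * q) / to_fract (q * s)" using x y by (simp add: field_simps)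
  have qs: "q * s \<noteq> 0" using x y by simp
  show ?thesis
    unfolding sum ratfun_deriv_divide[OF qs] unfolding x y ratfun_deriv_divide[OF x(1)] ratfun_deriv_divide[OF y(1)]
    using x(1) y(1) by (simp add: mpol_deriv_mult mpol_deriv_add divide_simps power2_eq_square) (simp add: algebra_simps)
qed

lemma ratfun_deriv_mult: "ratfun_deriv v (x * y) = x * ratfun_deriv v y + y * ratfun_deriv v x"
proof -
  obtain p q where x: "q \<noteq> 0" "x = to_fract p / to_fract q" by (rule ratfun_cases)
  obtain r s where y: "s \<noteq> 0" "y = to_fract r / to_fract s" by (rule ratfun_cases)
  have prd: "x * y = to_fract (p * r) / to_fract (q * s)" using x y by simp
  have qs: "q * s \<noteq> 0" using x y by simp
  show ?thesis
    unfolding prd ratfun_deriv_divide[OF qs] unfolding x y ratfun_deriv_divide[OF x(1)] ratfun_deriv_divide[OF y(1)]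
    using x(1) y(1) by (simp add: mpol_deriv_mult mpol_deriv_add divide_simps power2_eq_square) (simp add: algebra_simps)
qed

lemma ratfun_deriv_in: "z \<in> function_field d \<Longrightarrow> ratfun_deriv v z \<in> function_field d"
proof -
  assume "z \<in> function_field d"
  then obtain p q where pq: "p \<in> mpol_in {..d}" "q \<in> mpol_in {..d}" "q \<noteq> 0" "z = to_fract p / to_fract q"
    unfolding function_field_iff by blast
  note F = subring_set_function_field[of d]
  show ?thesis unfolding pq(4) ratfun_deriv_divide[OF pq(3)]
    using pq by (intro function_field_divide subring_set_diff[OF F] subring_set_mult[OF F] subring_set_power[OF F]
        to_fract_in_function_field mpol_deriv_in)
qed

context
  fixes d :: nat and D :: "'k::field ratfun \<Rightarrow> 'k ratfun"
  assumes D: "function_field_derivation d D"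
begin

lemma derivation_add: "x \<in> function_field d \<Longrightarrow> y \<in> function_field d \<Longrightarrow> D (x + y) = D x + D y"
  and derivation_mult: "x \<in> function_field d \<Longrightarrow> y \<in> function_field d \<Longrightarrow> D (x * y) = x * D y + y * D x"
  and derivation_const: "D (ratfun_const c) = 0"
  using D by (auto simp: function_field_derivation_def)

lemma derivation_zero: "D 0 = 0" and derivation_one: "D 1 = 0"
  using derivation_const[of 0] derivation_const[of 1]
  by (simp_all add: ratfun_const_def mpol_const_def)

lemma derivation_uminus: "x \<in> function_field d \<Longrightarrow> D (- x) = - D x"
  using derivation_add[of x "- x"] subring_set_uminus[OF subring_set_function_field, of x d]
  by (simp add: derivation_zero add_eq_0_iff)

lemma derivation_diff: "x \<in> function_field d \<Longrightarrow> y \<in> function_field d \<Longrightarrow> D (x - y) = D x - D y"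
  using derivation_add[of x "- y"] derivation_uminus[of y] subring_set_uminus[OF subring_set_function_field, of y d] by simp

lemma derivation_power:
  assumes "x \<in> function_field d"
  shows "D (x ^ n) = of_nat n * x ^ (n - 1) * D x"
proof (induction n)
  case (Suc n)
  have "D (x ^ Suc n) = x * D (x ^ n) + x ^ n * D x"
    using derivation_mult[OF assms subring_set_power[OF subring_set_function_field assms]] by simp
  then show ?case unfolding Suc.IH by (cases n) (simp_all add: algebra_simps)
qed (simp add: derivation_one)

lemma derivation_divide:
  assumes "x \<in> function_field d" "y \<in> function_field d" "y \<noteq> 0"
  shows "D (x / y) = (y * D x - x * D y) / y ^ 2"
proof -
  have "D x = D (y * (x / y))" using assms(3) by simp
  also have "\<dots> = y * D (x / y) + x / y * D y"
    using assms by (intro derivation_mult function_field_divide)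
  finally show ?thesis using assms(3) by (simp add: field_simps power2_eq_square)
qed

lemma derivation_to_fract:
  assumes "p \<in> mpol_in {..d}"
  shows "D (to_fract p) = (\<Sum>j\<le>d. to_fract (mpol_deriv j p) * D (ratfun_coord j))"
proof -
  note M = subring_set_mpol_in[of "{..d}"]
  define A where "A = {p \<in> mpol_in {..d}. D (to_fract p) = (\<Sum>j\<le>d. to_fract (mpol_deriv j p) * D (ratfun_coord j))}"
  have "subring_set A"
    unfolding subring_set_def
  proof (intro conjI ballI)
    show "1 \<in> A" unfolding A_def using subring_set_one[OF M] by (simp add: derivation_one)
    fix x y assume "x \<in> A" "y \<in> A"
    then have xy: "x \<in> mpol_in {..d}" "y \<in> mpol_in {..d}"
      "D (to_fract x) = (\<Sum>j\<le>d. to_fract (mpol_deriv j x) * D (ratfun_coord j))"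
      "D (to_fract y) = (\<Sum>j\<le>d. to_fract (mpol_deriv j y) * D (ratfun_coord j))" by (auto simp: A_def)
    show "x - y \<in> A"
      unfolding A_def using xy subring_set_diff[OF M]
      by (simp add: derivation_diff to_fract_in_function_field mpol_deriv_diff sum_subtractf left_diff_distrib)
    show "x * y \<in> A"
      unfolding A_def using xy subring_set_mult[OF M]
      by (simp add: derivation_mult to_fract_in_function_field mpol_deriv_mult sum.distrib sum_distrib_left algebra_simps)
  qed
  then have "mpol_in {..d} \<subseteq> A"
  proof (rule mpol_in_subset_subring)
    show "mpol_const c \<in> A" for c
      using derivation_const[of c] by (simp add: A_def mpol_const_in ratfun_const_def)
    fix v assume v: "v \<in> {..d}"
    have "(\<Sum>j\<le>d. to_fract (mpol_deriv j (mpol_var v)) * D (ratfun_coord j)) = (\<Sum>j\<le>d. if j = v then D (ratfun_coord j) else 0)"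
      by (intro sum.cong) (auto simp: mpol_deriv_var)
    also have "\<dots> = D (ratfun_coord v)" using v by simp
    finally show "mpol_var v \<in> A" using v by (simp add: A_def mpol_in_var ratfun_coord_def)
  qed
  then show ?thesis using assms by (auto simp: A_def)
qed

text \<open>The chain rule: a derivation is determined by its values on the coordinates. The change
  of Jacobians in \<open>jacobian_change\<close> rests on it.\<close>

lemma derivation_expand:
  assumes "z \<in> function_field d"
  shows "D z = (\<Sum>j\<le>d. ratfun_deriv j z * D (ratfun_coord j))"
proof -
  obtain p q where pq: "p \<in> mpol_in {..d}" "q \<in> mpol_in {..d}" "q \<noteq> 0" "z = to_fract p / to_fract q"
    using assms unfolding function_field_iff by blast
  have "D z = (to_fract q * D (to_fract p) - to_fract p * D (to_fract q)) / to_fract q ^ 2"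
    unfolding pq(4) using pq(1-3) by (intro derivation_divide to_fract_in_function_field) auto
  also have "\<dots> = (\<Sum>j\<le>d. ratfun_deriv j z * D (ratfun_coord j))"
    unfolding pq(4) ratfun_deriv_divide[OF pq(3)] derivation_to_fract[OF pq(1)] derivation_to_fract[OF pq(2)]
    by (simp add: sum_distrib_left sum_subtractf[symmetric] sum_divide_distrib algebra_simps)
  finally show ?thesis .
qed

end

lemma ratfun_deriv_derivation: "function_field_derivation d (ratfun_deriv v)"
  by (simp add: function_field_derivation_def ratfun_deriv_in ratfun_deriv_const ratfun_deriv_add ratfun_deriv_mult)

section \<open>Weights and faces of the Newton polygon\<close>

definition weight :: "nat \<Rightarrow> (nat \<Rightarrow> nat) \<Rightarrow> (nat \<Rightarrow>\<^sub>0 nat) \<Rightarrow> nat" where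
  "weight d w m = (\<Sum>i\<le>d. w i * Poly_Mapping.lookup m i)"

definition min_weight :: "nat \<Rightarrow> (nat \<Rightarrow> nat) \<Rightarrow> (nat, 'k::zero) mpol \<Rightarrow> nat" where
  "min_weight d w f = Min (weight d w ` Poly_Mapping.keys f)"

definition init_part :: "nat \<Rightarrow> (nat \<Rightarrow> nat) \<Rightarrow> (nat, 'k::comm_monoid_add) mpol \<Rightarrow> (nat, 'k) mpol" where
  "init_part d w f = (\<Sum>m | m \<in> Poly_Mapping.keys f \<and> weight d w m = min_weight d w f.
     Poly_Mapping.single m (Poly_Mapping.lookup f m))"

lemma min_weight_le: "m \<in> Poly_Mapping.keys f \<Longrightarrow> min_weight d w f \<le> weight d w m"
  by (simp add: min_weight_def)

lemma min_weight_attained: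
  fixes f :: "(nat, 'k::zero) mpol"
  assumes "f \<noteq> 0" obtains m where "m \<in> Poly_Mapping.keys f" "weight d w m = min_weight d w f"
proof -
  have "Poly_Mapping.keys f \<noteq> {}"
  proof
    assume "Poly_Mapping.keys f = {}"
    then have "f = 0" by (intro poly_mapping_eqI) (simp add: in_keys_iff set_eq_iff)
    then show False using assms by simp
  qed
  then have "min_weight d w f \<in> weight d w ` Poly_Mapping.keys f"
    unfolding min_weight_def by (intro Min_in) auto
  then show ?thesis using that by auto
qed

lemma mon_val_at_zero: "mon_val (\<lambda>_. 0) n = (of_bool (n = 0) :: 'b::comm_ring_1)"
proof (cases "n = 0")
  case False
  then obtain i where i: "Poly_Mapping.lookup n i \<noteq> 0" by (metis lookup_zero poly_mapping_eqI)
  have "(\<Prod>v\<in>Poly_Mapping.keys n. (0 :: 'b) ^ Poly_Mapping.lookup n v) = 0"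
  proof (rule prod_zero)
    show "\<exists>v\<in>Poly_Mapping.keys n. (0 :: 'b) ^ Poly_Mapping.lookup n v = 0"
      using i by (intro bexI[of _ i]) (auto simp: in_keys_iff zero_power)
  qed simp
  then show ?thesis using False by (simp add: mon_val_def)
qed simp

lemma min_weight_pos:
  assumes "f \<in> mpol_in {..d}" "f \<noteq> 0" "mpol_eval (\<lambda>_. 0) f = 0" "\<And>i. i \<le> d \<Longrightarrow> 1 \<le> w i"
  shows "1 \<le> min_weight d w f"
proof -
  obtain m where m: "m \<in> Poly_Mapping.keys f" "weight d w m = min_weight d w f"
    using min_weight_attained[OF assms(2)] .
  note zero = mon_val_at_zero
  have "mpol_eval (\<lambda>_. 0) f = (\<Sum>n\<in>Poly_Mapping.keys f. if n = 0 then Poly_Mapping.lookup f n else 0)"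
    unfolding mpol_subst_superset[OF comm_ring_hom_id finite_keys order_refl] zero
    by (intro sum.cong) auto
  then have "Poly_Mapping.lookup f 0 = 0"
    using assms(3) by (cases "0 \<in> Poly_Mapping.keys f") (auto simp: in_keys_iff)
  then have "m \<noteq> 0" using m(1) by (auto simp: in_keys_iff)
  then obtain i where i: "Poly_Mapping.lookup m i \<noteq> 0" by (metis lookup_zero poly_mapping_eqI)
  then have "i \<in> Poly_Mapping.keys m" by (simp add: in_keys_iff)
  moreover have "Poly_Mapping.keys m \<subseteq> {..d}" using m(1) assms(1) unfolding mpol_in_def by blast
  ultimately have "i \<le> d" by blast
  then have "1 \<le> w i * Poly_Mapping.lookup m i" using assms(4)[of i] i by (simp add: Suc_le_eq)
  also have "\<dots> \<le> weight d w m" unfolding weight_def using \<open>i \<le> d\<close> by (intro member_le_sum) auto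
  finally show ?thesis using m(2) by simp
qed

text \<open>The face is the locus where the linear form \<open>w\<close> takes its minimum on the
  Newton polygon. The form is nonnegative on the orthant, so this minimum is already the minimum
  over the exponents of \<open>f\<close>. It may be a noncompact face if some weights are 0.\<close>

lemma init_part_is_face_part:
  fixes f :: "(nat, 'k::field) mpol"
  assumes f: "f \<in> mpol_in {..d}" "f \<noteq> 0"
  shows "\<exists>\<gamma>. \<gamma> face_of newton_polygon d f \<and> \<gamma> \<noteq> {} \<and> face_part \<gamma> f = init_part d w f"
proof -
  define L where "L = (\<lambda>u :: nat \<Rightarrow>\<^sub>0 real. \<Sum>i\<le>d. real (w i) * Poly_Mapping.lookup u i)"
  have L_add: "L (u + v) = L u + L v" for u v by (simp add: L_def lookup_add distrib_left sum.distrib)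
  have L_scale: "L (r *\<^sub>R u) = r * L u" for r u
  proof -
    have fin: "finite {i. r *\<^sub>R Poly_Mapping.lookup u i \<noteq> 0}"
      by (rule finite_subset[OF _ finite_keys[of u]]) (auto simp: in_keys_iff)
    have "Poly_Mapping.lookup (r *\<^sub>R u) i = r * Poly_Mapping.lookup u i" for i
      unfolding scaleR_poly_mapping_def using fin by (simp add: Abs_poly_mapping_inverse)
    then show ?thesis by (simp add: L_def sum_distrib_left ac_simps)
  qed
  have L_exp: "L (real_exponent m) = real (weight d w m)" for m
    by (auto simp: L_def real_exponent_def weight_def Poly_Mapping.map.rep_eq when_def intro!: sum.cong)
  define l where "l = real (min_weight d w f)"
  define \<gamma> where "\<gamma> = {u \<in> newton_polygon d f. L u = l}"
  let ?G = "\<Union>m\<in>Poly_Mapping.keys f. {real_exponent m + u | u. u \<in> nonneg_orthant d}"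
  have NP: "newton_polygon d f = convex hull ?G" by (simp add: newton_polygon_def)
  have "convex {u. l \<le> L u}"
    unfolding convex_def
  proof (intro ballI allI impI CollectI)
    fix x y and u v :: real assume xy: "x \<in> {u. l \<le> L u}" "y \<in> {u. l \<le> L u}" and uv: "0 \<le> u" "0 \<le> v" "u + v = 1"
    have "l = u * l + v * l" using uv(3) by (simp flip: distrib_right)
    also have "\<dots> \<le> u * L x + v * L y" using xy uv by (intro add_mono mult_left_mono) auto
    finally show "l \<le> L (u *\<^sub>R x + v *\<^sub>R y)" by (simp add: L_add L_scale)
  qed
  moreover have "?G \<subseteq> {u. l \<le> L u}"
  proof clarsimp
    fix m u assume m: "m \<in> Poly_Mapping.keys f" and u: "u \<in> nonneg_orthant d"
    have "0 \<le> L u" using u by (auto simp: L_def nonneg_orthant_def intro!: sum_nonneg)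
    moreover have "l \<le> real (weight d w m)" using min_weight_le[OF m] by (simp add: l_def)
    ultimately show "l \<le> L (real_exponent m + u)" by (simp add: L_add L_exp)
  qed
  ultimately have ge: "l \<le> L u" if "u \<in> newton_polygon d f" for u
    using hull_minimal[of ?G "{u. l \<le> L u}" convex] that unfolding NP by blast
  have face: "\<gamma> face_of newton_polygon d f"
    unfolding face_of_def
  proof (intro conjI ballI impI)
    show "\<gamma> \<subseteq> newton_polygon d f" by (auto simp: \<gamma>_def)
    show "convex \<gamma>"
      unfolding convex_def
    proof (intro ballI allI impI)
      fix x y and u v :: real assume xy: "x \<in> \<gamma>" "y \<in> \<gamma>" and uv: "0 \<le> u" "0 \<le> v" "u + v = 1"
      have "u *\<^sub>R x + v *\<^sub>R y \<in> newton_polygon d f"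
        using xy uv convex_convex_hull[of ?G] unfolding \<gamma>_def NP convex_def by blast
      moreover have "u * l + v * l = l" using uv(3) by (simp flip: distrib_right)
      ultimately show "u *\<^sub>R x + v *\<^sub>R y \<in> \<gamma>" using xy by (simp add: \<gamma>_def L_add L_scale)
    qed
    fix a b x assume a: "a \<in> newton_polygon d f" and b: "b \<in> newton_polygon d f" and x: "x \<in> \<gamma>"
      and seg: "x \<in> open_segment a b"
    obtain u where u: "0 < u" "u < 1" "x = (1 - u) *\<^sub>R a + u *\<^sub>R b"
      using seg by (auto simp: in_segment)
    have eq: "l = (1 - u) * L a + u * L b" using x u(3) by (simp add: \<gamma>_def L_add L_scale)
    have "(1 - u) * (L a - l) + u * (L b - l) = 0" using eq by (simp add: algebra_simps)
    moreover have "0 \<le> (1 - u) * (L a - l)" "0 \<le> u * (L b - l)" using ge[OF a] ge[OF b] u by auto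
    ultimately have "(1 - u) * (L a - l) = 0" "u * (L b - l) = 0" by linarith+
    then have "L a = l" "L b = l" using u by auto
    then show "a \<in> \<gamma>" "b \<in> \<gamma>" using a b by (auto simp: \<gamma>_def)
  qed
  have inNP: "real_exponent m \<in> newton_polygon d f" if "m \<in> Poly_Mapping.keys f" for m
  proof -
    have "0 \<in> nonneg_orthant d" by (simp add: nonneg_orthant_def)
    then have "real_exponent m \<in> ?G" using that by (auto intro!: bexI[of _ m] exI[of _ 0])
    then show ?thesis unfolding NP by (rule hull_inc)
  qed
  have mem: "real_exponent m \<in> \<gamma> \<longleftrightarrow> weight d w m = min_weight d w f" if "m \<in> Poly_Mapping.keys f" for m
    using inNP[OF that] by (simp add: \<gamma>_def L_exp l_def)
  obtain m where "m \<in> Poly_Mapping.keys f" "weight d w m = min_weight d w f"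
    using min_weight_attained[OF f(2)] .
  then have "\<gamma> \<noteq> {}" using mem by blast
  moreover have "face_part \<gamma> f = init_part d w f"
    unfolding face_part_def init_part_def by (intro sum.cong) (auto simp: mem)
  ultimately show ?thesis using face by blast
qed

lemma nondegenerate_init_part:
  fixes f :: "(nat, 'k::field) mpol"
  assumes "f \<in> mpol_in {..d}" "f \<noteq> 0" "newton_nondegenerate d f" "\<And>i. i \<le> d \<Longrightarrow> a i \<noteq> 0"
  shows "\<exists>i\<le>d. mpol_eval a (mpol_deriv i (init_part d w f)) \<noteq> 0"
  using init_part_is_face_part[OF assms(1,2), of w] assms(3,4) unfolding newton_nondegenerate_def by metis

section \<open>Local coordinates at a prime divisor\<close>

text \<open>Stated for an arbitrary total preorder, because it will be applied to divisibility of
  Jacobians in the valuation ring.\<close>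

lemma finite_preorder_minimal:
  assumes "finite Y" "Y \<noteq> {}" "\<And>x y. x \<in> Y \<Longrightarrow> y \<in> Y \<Longrightarrow> R x y \<or> R y x"
    "\<And>x y z. x \<in> Y \<Longrightarrow> y \<in> Y \<Longrightarrow> z \<in> Y \<Longrightarrow> R x y \<Longrightarrow> R y z \<Longrightarrow> R x z"
  shows "\<exists>x\<in>Y. \<forall>y\<in>Y. R x y"
  using assms
proof (induction rule: finite_ne_induct)
  case (singleton x)
  then show ?case by blast
next
  case (insert x Y)
  have "\<exists>z\<in>Y. \<forall>y\<in>Y. R z y"
  proof (rule insert.IH)
    show "R a b \<or> R b a" if "a \<in> Y" "b \<in> Y" for a b using insert.prems(1) that by blast
    show "R a c" if "a \<in> Y" "b \<in> Y" "c \<in> Y" "R a b" "R b c" for a b c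
      by (rule insert.prems(2)[of a b c]) (use that in auto)
  qed
  then obtain z where z: "z \<in> Y" "\<forall>y\<in>Y. R z y" by blast
  consider "R x z" | "R z x" using insert.prems(1)[of x z] z by blast
  then show ?case
  proof cases
    case 1
    have "R x y" if "y \<in> insert x Y" for y
    proof (cases "y = x")
      case True
      then show ?thesis using insert.prems(1)[of x x] by blast
    next
      case False
      show ?thesis by (rule insert.prems(2)[of x z y]) (use that False z 1 in auto)
    qed
    then show ?thesis by blast
  next
    case 2
    then show ?thesis using z by blast
  qed
qed

locale prime_divisor =
  fixes d :: nat and B P :: "'k::field ratfun set"
  assumes div: "prime_divisor_over d B P"
begin

lemma subring_B: "subring_set B"
proof -
  obtain S where "B = generate_ring ring_of_type_algebra (range ratfun_const \<union> S)"
    using div unfolding prime_divisor_over_def by blast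
  then show ?thesis using subring_set_generate_ring by simp
qed

lemma B_function_field: "B \<subseteq> function_field d"
proof -
  obtain S where S: "S \<subseteq> function_field d" "B = generate_ring ring_of_type_algebra (range ratfun_const \<union> S)"
    using div unfolding prime_divisor_over_def by blast
  have "range ratfun_const \<union> S \<subseteq> function_field d" using S(1) ratfun_const_in by auto
  then show ?thesis unfolding S(2) by (rule generate_ring_minimal[OF subring_set_function_field])
qed

lemma noetherian_B: "noetherian B"
proof -
  obtain S where "finite S" "B = generate_ring ring_of_type_algebra (range ratfun_const \<union> S)"
    using div unfolding prime_divisor_over_def by blast
  then show ?thesis using noetherian_generate_ring[OF comm_ring_hom_ratfun_const] by simp
qed

lemma height_one_P: "height_one B P"
  using div primeideal_iff_prime_of[OF subring_B]
  unfolding prime_divisor_over_def height_one_prime_def height_one_def subring_of_def by simp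

sublocale dvr_chart B P "function_field d"
proof
  show "a / b \<in> function_field d" if "a \<in> B" "b \<in> B" for a b
    using that B_function_field function_field_divide by blast
  show "integrally_closed_in (function_field d) B" using div unfolding prime_divisor_over_def by blast
qed (rule subring_B noetherian_B height_one_P)+

lemma coord_in_B: "i \<le> d \<Longrightarrow> ratfun_coord i \<in> B"
  using div unfolding prime_divisor_over_def by blast

lemma const_in_B: "ratfun_const c \<in> B"
proof -
  obtain S where B: "B = generate_ring ring_of_type_algebra (range ratfun_const \<union> S)"
    using div unfolding prime_divisor_over_def by blast
  show ?thesis unfolding B by (rule generate_ring.incl) simp
qed

lemma Ov_function_field: "Ov \<subseteq> function_field d"
  using B_function_field function_field_divide by (fastforce elim: OvE)

lemma to_fract_in_B: "p \<in> mpol_in {..d} \<Longrightarrow> to_fract p \<in> B"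
proof -
  have "subring_set {p. to_fract p \<in> B}"
    using subring_B by (auto simp: subring_set_def)
  then have "mpol_in {..d} \<subseteq> {p. to_fract p \<in> B}"
    using const_in_B coord_in_B by (intro mpol_in_subset_subring) (auto simp: ratfun_const_def ratfun_coord_def)
  then show "p \<in> mpol_in {..d} \<Longrightarrow> to_fract p \<in> B" by blast
qed

lemma valuation_ring:
  assumes "z \<in> function_field d" "z \<noteq> 0"
  shows "z \<in> Ov \<or> inverse z \<in> Ov"
proof -
  obtain p q where pq: "p \<in> mpol_in {..d}" "q \<in> mpol_in {..d}" "q \<noteq> 0" "z = to_fract p / to_fract q"
    using assms(1) unfolding function_field_iff by blast
  have "to_fract p \<in> Ov" "to_fract q \<in> Ov" using pq to_fract_in_B B_Ov by auto
  moreover have "to_fract p \<noteq> 0" "to_fract q \<noteq> 0" using pq assms(2) by auto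
  ultimately obtain u m v n where u: "u \<in> Ov - mv" "to_fract p = u * unif ^ m"
    and v: "v \<in> Ov - mv" "to_fract q = v * unif ^ n"
    using unif_expansion by metis
  have uO: "unif \<in> Ov" using unif(1) P_mv mv_Ov by blast
  have iu: "inverse u \<in> Ov" "inverse v \<in> Ov" using u v inverse_in_Ov by auto
  have nz: "u \<noteq> 0" "v \<noteq> 0" using u v zero_in_mv by auto
  show ?thesis
  proof (cases "n \<le> m")
    case True
    then have "unif ^ m = unif ^ n * unif ^ (m - n)" by (simp flip: power_add)
    then have "z = u * inverse v * unif ^ (m - n)"
      using pq(4) u(2) v(2) nz unif(2) by (simp add: field_simps)
    then show ?thesis
      using u iu uO by (auto intro!: subring_set_mult[OF subring_set_Ov] subring_set_power[OF subring_set_Ov])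
  next
    case False
    then have "unif ^ n = unif ^ m * unif ^ (n - m)" by (simp flip: power_add)
    then have "z * (v * inverse u * unif ^ (n - m)) = 1"
      using pq(4) u(2) v(2) nz unif(2) by (simp add: field_simps)
    then have "inverse z = v * inverse u * unif ^ (n - m)" by (rule inverse_unique)
    then show ?thesis
      using v iu uO by (auto intro!: subring_set_mult[OF subring_set_Ov] subring_set_power[OF subring_set_Ov])
  qed
qed

text \<open>By the Leibniz and quotient rules, integrality has to be checked only on algebra
  generators. This reduces the construction of local coordinates to finitely many
  conditions.\<close>

lemma derivation_preserves_Ov:
  assumes D: "function_field_derivation d D"
    and S: "B = generate_ring ring_of_type_algebra (range ratfun_const \<union> S)" "\<And>s. s \<in> S \<Longrightarrow> D s \<in> Ov"
    and g: "g \<in> Ov"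
  shows "D g \<in> Ov"
proof -
  note O = subring_set_Ov
  define A where "A = {b \<in> B. D b \<in> Ov}"
  have "subring_set A"
    unfolding subring_set_def
  proof (intro conjI ballI)
    show "1 \<in> A" unfolding A_def
      using subring_set_one[OF subring_B] subring_set_zero[OF O] derivation_one[OF D] by simp
    fix x y assume "x \<in> A" "y \<in> A"
    then have xy: "x \<in> B" "y \<in> B" "D x \<in> Ov" "D y \<in> Ov" by (auto simp: A_def)
    have f: "x \<in> function_field d" "y \<in> function_field d" using xy B_function_field by auto
    have O': "x \<in> Ov" "y \<in> Ov" using xy B_Ov by auto
    show "x - y \<in> A" unfolding A_def
      using xy by (simp add: derivation_diff[OF D f] subring_set_diff[OF subring_B] subring_set_diff[OF O])
    show "x * y \<in> A" unfolding A_def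
      using xy O' by (simp add: derivation_mult[OF D f] subring_set_mult[OF subring_B] subring_set_mult[OF O] subring_set_add[OF O])
  qed
  moreover have "range ratfun_const \<union> S \<subseteq> A"
  proof
    fix x assume x: "x \<in> range ratfun_const \<union> S"
    then have "x \<in> B" unfolding S(1) by (rule generate_ring.incl)
    moreover have "D x \<in> Ov"
      using x S(2) derivation_const[OF D] subring_set_zero[OF O] by auto
    ultimately show "x \<in> A" by (simp add: A_def)
  qed
  ultimately have "B \<subseteq> A" using generate_ring_minimal S(1) by blast
  then have DB: "D b \<in> Ov" if "b \<in> B" for b using that by (auto simp: A_def)
  obtain a b where ab: "a \<in> B" "b \<in> B" "b \<notin> P" "b \<noteq> 0" "g = a / b" using g by (elim OvE)
  have inv: "inverse b \<in> Ov" using inverse_in_Ov[of b] ab mv_in_B B_Ov by blast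
  have "D g = (b * D a - a * D b) * (inverse b) ^ 2"
    unfolding ab(5) using ab B_function_field
    by (subst derivation_divide[OF D]) (auto simp: divide_inverse power_inverse)
  also have "\<dots> \<in> Ov"
    using ab B_Ov DB inv
    by (intro subring_set_mult[OF O] subring_set_diff[OF O] subring_set_power[OF O]) auto
  finally show ?thesis .
qed

text \<open>Among the tuples of d + 1 algebra generators with nonzero Jacobian, one of least order
  is taken. By Cramer's rule its dual derivations send a generator s to a quotient of two Jacobians,
  where the numerator has one entry replaced by s; minimality puts the quotient into
  \<open>Ov\<close>. Candidates exist because the coordinates, with Jacobian 1, are added to the
  generators.\<close>

lemma local_coordinates_exist: "\<exists>y D. local_coordinates d B P y D"
proof -
  define n where "n = Suc d"
  obtain S0 where S0: "finite S0" "S0 \<subseteq> function_field d"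
    "B = generate_ring ring_of_type_algebra (range ratfun_const \<union> S0)"
    using div unfolding prime_divisor_over_def by blast
  define S where "S = S0 \<union> ratfun_coord ` {..d}"
  have S: "finite S" "S \<subseteq> function_field d" using S0 ratfun_coord_in by (auto simp: S_def)
  have SB: "S \<subseteq> B" using S0(3) coord_in_B generate_ring.incl[of _ "range ratfun_const \<union> S0"]
    by (auto simp: S_def)
  have gen: "B = generate_ring ring_of_type_algebra (range ratfun_const \<union> S)"
  proof
    show "B \<subseteq> generate_ring ring_of_type_algebra (range ratfun_const \<union> S)"
      unfolding S0(3) by (rule generate_ring_minimal[OF subring_set_generate_ring])
        (auto simp: S_def intro: generate_ring.incl)
    show "generate_ring ring_of_type_algebra (range ratfun_const \<union> S) \<subseteq> B"
      by (rule generate_ring_minimal[OF subring_B]) (use const_in_B SB in auto)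
  qed
  define J where "J = (\<lambda>y. Determinant.det (mat n n (\<lambda>(j, a). ratfun_deriv j (y a :: 'k ratfun))))"
  have J_in: "J y \<in> function_field d" if "\<And>a. a < n \<Longrightarrow> y a \<in> function_field d" for y
    unfolding J_def using that by (intro det_in_subring[OF subring_set_function_field] ratfun_deriv_in)
  define Y where "Y = {y \<in> {..<n} \<rightarrow>\<^sub>E S. J y \<noteq> 0}"
  have finY: "finite Y" unfolding Y_def using S(1) by (simp add: finite_PiE)
  have "J (restrict ratfun_coord {..<n}) = Determinant.det (1\<^sub>m n :: 'k ratfun mat)"
    unfolding J_def by (intro arg_cong[of _ _ Determinant.det] eq_matI) (auto simp: ratfun_deriv_coord)
  then have "restrict ratfun_coord {..<n} \<in> Y"
    by (auto simp: Y_def S_def n_def less_Suc_eq_le)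
  then have neY: "Y \<noteq> {}" by blast
  have Jff: "J y \<in> function_field d" "J y \<noteq> 0" if "y \<in> Y" for y
    using that S(2) by (auto simp: Y_def PiE_iff intro!: J_in)
  have "\<exists>y\<in>Y. \<forall>y'\<in>Y. J y' / J y \<in> Ov"
  proof (rule finite_preorder_minimal[OF finY neY])
    fix x y assume "x \<in> Y" "y \<in> Y"
    then have "J y / J x \<in> function_field d" "J y / J x \<noteq> 0" by (auto intro: function_field_divide Jff simp: Jff)
    from valuation_ring[OF this] show "J y / J x \<in> Ov \<or> J x / J y \<in> Ov" by simp
  next
    fix x y z assume "x \<in> Y" "y \<in> Y" "z \<in> Y" "J y / J x \<in> Ov" "J z / J y \<in> Ov"
    then have "(J z / J y) * (J y / J x) \<in> Ov" by (intro subring_set_mult[OF subring_set_Ov])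
    moreover have "(J z / J y) * (J y / J x) = J z / J x" using Jff(2)[OF \<open>y \<in> Y\<close>] by simp
    ultimately show "J z / J x \<in> Ov" by (simp only:)
  qed
  then obtain y where y: "y \<in> Y" "\<forall>y'\<in>Y. J y' / J y \<in> Ov" by (rule bexE)
  have yPi: "y \<in> {..<n} \<rightarrow>\<^sub>E S" using y(1) by (simp add: Y_def)
  have yS: "y a \<in> S" if "a \<le> d" for a using PiE_mem[OF yPi, of a] that by (simp add: n_def)
  \<comment> \<open>\<open>N i z / J y\<close> is Cramer's solution for the partial derivative of
    \<open>z\<close> with respect to \<open>y i\<close>.\<close>
  define N where "N = (\<lambda>i z. Determinant.det (mat n n (\<lambda>(j, a). if a = i then ratfun_deriv j z else ratfun_deriv j (y a))))"
  define D where "D = (\<lambda>i z. N i z / J y)"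
  have Jy: "J y \<noteq> 0" "J y \<in> function_field d" using Jff[OF y(1)] by auto
  have deriv: "function_field_derivation d (D i)" if i: "i \<le> d" for i
  proof -
    have i: "i < n" using i by (simp add: n_def)
    have lin: "N i z = s * N i g + t * N i h"
      if "\<And>j. ratfun_deriv j z = s * ratfun_deriv j g + t * ratfun_deriv j h" for z s g t h
      unfolding N_def that by (rule det_linear_col[OF i])
    have "N i g \<in> function_field d" if "g \<in> function_field d" for g
    proof -
      have "y a \<in> function_field d" if "a < n" for a using yS[of a] S(2) that by (auto simp: n_def)
      then show ?thesis unfolding N_def using that
        by (intro det_in_subring[OF subring_set_function_field]) (auto intro: ratfun_deriv_in)
    qed
    moreover have "N i (ratfun_const c) = 0" for c
      using lin[of "ratfun_const c" 0 0 0 0] by (simp add: ratfun_deriv_const)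
    moreover have "N i (g + h) = N i g + N i h" for g h
      using lin[of "g + h" 1 g 1 h] by (simp add: ratfun_deriv_add)
    moreover have "N i (g * h) = g * N i h + h * N i g" for g h
      using lin[of "g * h" g h h g] by (simp add: ratfun_deriv_mult)
    ultimately show ?thesis
      using Jy unfolding function_field_derivation_def D_def
      by (auto intro: function_field_divide simp: add_divide_distrib)
  qed
  have upd: "N i s = J (y(i := s))" if "i \<le> d" for i s
    unfolding N_def J_def by (intro arg_cong[of _ _ Determinant.det] cong_mat) auto
  have DS: "D i s \<in> Ov" if "i \<le> d" "s \<in> S" for i s
  proof (cases "N i s = 0")
    case True
    then show ?thesis using subring_set_zero[OF subring_set_Ov] by (simp add: D_def)
  next
    case False
    have "y(i := s) \<in> {..<n} \<rightarrow>\<^sub>E S"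
      using yPi that by (auto simp: n_def PiE_iff extensional_def)
    then have "y(i := s) \<in> Y" using False upd[OF that(1), of s] by (simp add: Y_def)
    then show ?thesis using y(2) upd[OF that(1), of s] by (simp add: D_def)
  qed
  have "D i (y j) = of_bool (i = j)" if "i \<le> d" "j \<le> d" for i j
  proof (cases "i = j")
    case True
    have "N i (y i) = J y" using upd[OF that(1), of "y i"] by simp
    then show ?thesis using True Jy by (simp add: D_def)
  next
    case False
    have "N i (y j) = 0"
      unfolding N_def by (rule det_equal_cols[of i n j]) (use that False in \<open>auto simp: n_def\<close>)
    then show ?thesis using False by (simp add: D_def)
  qed
  then have "local_coordinates d B P y D"
    unfolding local_coordinates_def Ov_def[symmetric]
    using yS SB B_Ov deriv derivation_preserves_Ov[OF deriv gen DS] by blast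
  then show ?thesis by blast
qed

text \<open>By the chain rule the matrix of partial derivatives of the \<open>y j\<close> is inverse
  to the Jacobian matrix of \<open>D\<close>. Hence the Jacobian matrix of \<open>E\<close> is the
  matrix of the \<open>E i (y j)\<close> times that of \<open>D\<close>.\<close>

lemma jacobian_change:
  assumes y: "local_coordinates d B P y D" and E: "\<And>i. i \<le> d \<Longrightarrow> function_field_derivation d (E i)"
  shows "jacobian d E = Determinant.det (mat (d + 1) (d + 1) (\<lambda>(i, j). E i (y j))) * jacobian d D"
    "jacobian d D \<noteq> 0"
proof -
  define n where "n = d + 1"
  have yf: "y i \<in> function_field d" if "i \<le> d" for i
    using y that Ov_function_field unfolding local_coordinates_def Ov_def[symmetric] by blast
  have D: "function_field_derivation d (D i)" if "i \<le> d" for i using y that by (simp add: local_coordinates_def)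
  define JD where "JD = mat n n (\<lambda>(i, j). D i (ratfun_coord j))"
  define JE where "JE = mat n n (\<lambda>(i, j). E i (ratfun_coord j))"
  define C where "C = mat n n (\<lambda>(i, j). E i (y j))"
  define G where "G = mat n n (\<lambda>(l, j). ratfun_deriv l (y j))"
  have carr: "JD \<in> carrier_mat n n" "JE \<in> carrier_mat n n" "C \<in> carrier_mat n n" "G \<in> carrier_mat n n"
    by (simp_all add: JD_def JE_def C_def G_def)
  have chain: "mat n n (\<lambda>(i, j). F i (ratfun_coord j)) * G = mat n n (\<lambda>(i, j). F i (y j))"
    if F: "\<And>i. i \<le> d \<Longrightarrow> function_field_derivation d (F i)" for F
  proof (rule eq_matI)
    fix i j assume "i < dim_row (mat n n (\<lambda>(i, j). F i (y j)))" "j < dim_col (mat n n (\<lambda>(i, j). F i (y j)))"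
    then have ij: "i < n" "j < n" by auto
    have "(mat n n (\<lambda>(i, j). F i (ratfun_coord j)) * G) $$ (i, j) =
        (\<Sum>l\<in>{0..<n}. F i (ratfun_coord l) * ratfun_deriv l (y j))"
      using ij by (simp add: G_def scalar_prod_def)
    also have "\<dots> = (\<Sum>l\<le>d. ratfun_deriv l (y j) * F i (ratfun_coord l))"
      by (intro sum.cong) (auto simp: n_def mult.commute)
    also have "\<dots> = F i (y j)"
      using derivation_expand[OF F yf] ij by (simp add: n_def)
    finally show "(mat n n (\<lambda>(i, j). F i (ratfun_coord j)) * G) $$ (i, j) = mat n n (\<lambda>(i, j). F i (y j)) $$ (i, j)"
      using ij by simp
  qed (simp_all add: G_def)
  have "JD * G = mat n n (\<lambda>(i, j). D i (y j))" unfolding JD_def by (rule chain[OF D])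
  also have "\<dots> = 1\<^sub>m n"
    using y by (intro eq_matI) (auto simp: local_coordinates_def n_def)
  finally have JDG: "JD * G = 1\<^sub>m n" .
  then have GJD: "G * JD = 1\<^sub>m n" using carr mat_mult_left_right_inverse by blast
  have JEG: "JE * G = C" unfolding JE_def C_def by (rule chain[OF E])
  have "JE = JE * (G * JD)" using carr GJD by simp
  also have "\<dots> = C * JD" using carr JEG by (simp flip: assoc_mult_mat)
  finally have "Determinant.det JE = Determinant.det C * Determinant.det JD" using det_mult[OF carr(3,1)] by simp
  then show "jacobian d E = Determinant.det (mat (d + 1) (d + 1) (\<lambda>(i, j). E i (y j))) * jacobian d D"
    by (simp add: jacobian_def JE_def JD_def C_def n_def)
  have "Determinant.det JD * Determinant.det G = 1" using det_mult[OF carr(1,4)] JDG by simp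
  then show "jacobian d D \<noteq> 0" by (auto simp: jacobian_def JD_def n_def)
qed

lemma jacobian_divides:
  assumes y: "local_coordinates d B P y D" and E: "\<And>i. i \<le> d \<Longrightarrow> function_field_derivation d (E i)"
    "\<And>i g. i \<le> d \<Longrightarrow> g \<in> Ov \<Longrightarrow> E i g \<in> Ov"
  shows "\<exists>c\<in>Ov. jacobian d E = c * jacobian d D"
proof -
  have yO: "y i \<in> Ov" if "i \<le> d" for i using y that unfolding local_coordinates_def Ov_def[symmetric] by blast
  have "Determinant.det (mat (d + 1) (d + 1) (\<lambda>(i, j). E i (y j))) \<in> Ov"
    using E(2) yO by (intro det_in_subring[OF subring_set_Ov]) auto
  then show ?thesis using jacobian_change(1)[OF y, of E] E(1) by blast
qed

lemma local_coordinates_derivations: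
  assumes "local_coordinates d B P y D"
  shows "i \<le> d \<Longrightarrow> function_field_derivation d (D i)" "i \<le> d \<Longrightarrow> g \<in> Ov \<Longrightarrow> D i g \<in> Ov"
  using assms unfolding local_coordinates_def Ov_def[symmetric] by blast+

text \<open>The Jacobians of two systems of local coordinates divide each other in
  \<open>Ov\<close>, so their orders agree and the description in \<open>canonical_coeff\<close> has
  exactly one solution.\<close>

lemma jacobian_expansion:
  assumes y: "local_coordinates d B P y D"
  obtains u where "u \<in> Ov - mv" "jacobian d D = u * unif ^ canonical_coeff d B P"
proof -
  have JO: "jacobian d D \<in> Ov" if "local_coordinates d B P y D" for y D
    unfolding jacobian_def using local_coordinates_derivations[OF that] subsetD[OF B_Ov coord_in_B]
    by (intro det_in_subring[OF subring_set_Ov]) auto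
  have dvd: "\<exists>c\<in>Ov. jacobian d D' = c * jacobian d D"
    if "local_coordinates d B P y D" "local_coordinates d B P y' D'" for y D y' D'
    using that by (intro jacobian_divides[OF that(1)] local_coordinates_derivations[OF that(2)])
  obtain n u where u: "u \<in> Ov - mv" "jacobian d D = u * unif ^ n"
    using unif_expansion[OF JO[OF y]] jacobian_change(2)[OF y ratfun_deriv_derivation] by metis
  have "canonical_coeff d B P = n"
    unfolding canonical_coeff_def
  proof (rule the_equality)
    show "\<exists>y D. local_coordinates d B P y D \<and> ord_along B P (jacobian d D) = n"
      by (intro exI[of _ y] exI[of _ D] conjI y) (simp add: u(2) ord_along_eq[OF u(1)])
    fix m assume "\<exists>y D. local_coordinates d B P y D \<and> ord_along B P (jacobian d D) = m"
    then obtain y' D' where y': "local_coordinates d B P y' D'" "ord_along B P (jacobian d D') = m" by blast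
    obtain n' u' where u': "u' \<in> Ov - mv" "jacobian d D' = u' * unif ^ n'"
      using unif_expansion[OF JO[OF y'(1)]] jacobian_change(2)[OF y'(1) ratfun_deriv_derivation] by metis
    obtain c where c: "c \<in> Ov" "jacobian d D' = c * jacobian d D" using dvd[OF y y'(1)] by blast
    obtain c' where c': "c' \<in> Ov" "jacobian d D = c' * jacobian d D'" using dvd[OF y'(1) y] by blast
    have "u' * unif ^ n' = (c * u) * unif ^ n" "u * unif ^ n = (c' * u') * unif ^ n'"
      using c c' u(2) u'(2) by (simp_all add: mult.assoc)
    then have "n \<le> n'" "n' \<le> n"
      using unif_power_unique[OF u'(1), of "c * u"] unif_power_unique[OF u(1), of "c' * u'"] u u' c c'
        subring_set_mult[OF subring_set_Ov] by blast+
    then show "m = n" using y'(2) ord_along_eq[OF u'(1)] u'(2) by simp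
  qed
  then show ?thesis using that u by simp
qed

end

section \<open>A lower bound for log discrepancies\<close>

lemma mpol_subst_init_part:
  assumes "comm_ring_hom h"
  shows "mpol_subst h a (init_part d w f) =
    (\<Sum>m | m \<in> Poly_Mapping.keys f \<and> weight d w m = min_weight d w f. h (Poly_Mapping.lookup f m) * mon_val a m)"
proof -
  interpret comm_ring_hom "mpol_subst h a" by (rule comm_ring_hom_mpol_subst[OF assms])
  show ?thesis by (simp add: init_part_def hom_sum mpol_subst_single[OF assms])
qed

text \<open>Multiplying the derivative by its variable makes it diagonal on monomials. The valuation
  estimates use this operator because it respects the grading by weight, whereas the bare derivative
  shifts it.\<close>

lemma var_times_deriv_single:
  "mpol_var v * mpol_deriv v (Poly_Mapping.single m c) =
    Poly_Mapping.single m (of_nat (Poly_Mapping.lookup m v) * c :: 'k::comm_ring_1)"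
proof (cases "Poly_Mapping.lookup m v = 0")
  case False
  then have "Poly_Mapping.single v 1 + (m - Poly_Mapping.single v 1) = m"
    by (intro poly_mapping_eqI) (auto simp: lookup_add lookup_minus lookup_single when_def)
  then show ?thesis by (simp add: mpol_var_def mpol_deriv_single mult_single)
qed (simp add: mpol_deriv_single)

lemma mpol_deriv_sum: "mpol_deriv v (sum g I) = (\<Sum>i\<in>I. mpol_deriv v (g i))"
  by (induction I rule: infinite_finite_induct) (simp_all add: mpol_deriv_add)

lemma var_times_deriv:
  "mpol_var v * mpol_deriv v f =
    (\<Sum>m\<in>Poly_Mapping.keys f. Poly_Mapping.single m (of_nat (Poly_Mapping.lookup m v) * Poly_Mapping.lookup f m))"
proof -
  have "mpol_deriv v f = (\<Sum>m\<in>Poly_Mapping.keys f. mpol_deriv v (Poly_Mapping.single m (Poly_Mapping.lookup f m)))"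
    unfolding mpol_deriv_single by (simp only: mpol_deriv_def)
  then show ?thesis by (simp add: sum_distrib_left var_times_deriv_single)
qed

lemma var_times_deriv_init_part:
  "mpol_var v * mpol_deriv v (init_part d w f) =
    (\<Sum>m | m \<in> Poly_Mapping.keys f \<and> weight d w m = min_weight d w f.
       Poly_Mapping.single m (of_nat (Poly_Mapping.lookup m v) * Poly_Mapping.lookup f m))"
  by (simp add: init_part_def mpol_deriv_sum sum_distrib_left var_times_deriv_single)

lemma init_part_in: "f \<in> mpol_in V \<Longrightarrow> init_part d w f \<in> mpol_in V"
  unfolding init_part_def
  by (intro subring_set_sum[OF subring_set_mpol_in] single_in_mpol_in) (auto simp: mpol_in_def)

lemma mpol_var_nonzero: "mpol_var v \<noteq> (0 :: ('v, 'k::field) mpol)"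
proof
  assume "mpol_var v = (0 :: ('v, 'k) mpol)"
  then have "mpol_eval (\<lambda>_. 1) (mpol_var v) = mpol_eval (\<lambda>_. 1) (0 :: ('v, 'k) mpol)" by simp
  then show False by (simp add: mpol_subst_var[OF comm_ring_hom_id] mpol_subst_zero[OF comm_ring_hom_id])
qed

lemma ratfun_coord_nonzero: "ratfun_coord j \<noteq> (0 :: 'k::field ratfun)"
  by (simp add: ratfun_coord_def mpol_var_nonzero)

lemma hypersurface_ideal_eq:
  assumes "f \<in> mpol_in {..d}"
  shows "hypersurface_ideal d f = {h * f | h. h \<in> mpol_in {..d}}"
  by (simp add: hypersurface_ideal_def cgenideal_def mpol_ring_def ring_of_type_algebra_def)

lemma to_fract_single: "to_fract (Poly_Mapping.single m c) = ratfun_const c * mon_val ratfun_coord m"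
proof -
  have eq: "(\<lambda>v. to_fract (mpol_var v)) = ratfun_coord" by (rule ext) (simp add: ratfun_coord_def)
  have "to_fract (mon_val mpol_var m :: (nat, 'a) mpol) = mon_val (\<lambda>v. to_fract (mpol_var v)) m"
    by (rule comm_ring_hom_mon_val[OF comm_ring_hom_to_fract])
  then show ?thesis
    unfolding single_eq_const_mult_mon_val eq to_fract_mult ratfun_const_def by (simp only:)
qed

lemma mon_val_scaled:
  assumes u: "\<And>j. j \<le> d \<Longrightarrow> a j = u j * t ^ w j" and m: "Poly_Mapping.keys m \<subseteq> {..d}"
  shows "mon_val a m = mon_val u m * t ^ weight d w m"
proof -
  have "mon_val a m = (\<Prod>j\<le>d. (u j * t ^ w j) ^ Poly_Mapping.lookup m j)"
    unfolding mon_val_superset[OF finite_atMost m] by (intro prod.cong) (simp_all add: u)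
  also have "\<dots> = mon_val u m * (\<Prod>j\<le>d. t ^ (w j * Poly_Mapping.lookup m j))"
    using mon_val_superset[OF finite_atMost m, of u] by (simp add: power_mult_distrib prod.distrib power_mult)
  finally show ?thesis by (simp add: weight_def power_sum)
qed

context prime_divisor
begin

lemma unif_Ov: "unif \<in> Ov"
  using unif(1) P_mv mv_Ov by blast

lemma unif_mv: "unif \<in> mv"
  using unif(1) P_mv by blast

lemma mv_add: assumes "x \<in> mv" "y \<in> mv" shows "x + y \<in> mv"
proof -
  obtain a b where "a \<in> Ov" "b \<in> Ov" "x = unif * a" "y = unif * b" using assms unfolding unif(3) by blast
  then have "x + y = unif * (a + b)" "a + b \<in> Ov" by (auto simp: distrib_left intro: subring_set_add[OF subring_set_Ov])
  then show ?thesis unfolding unif(3) by blast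
qed

lemma mv_uminus: "x \<in> mv \<Longrightarrow> - x \<in> mv"
  using mv_mult[of "- 1" x] subring_set_uminus[OF subring_set_Ov subring_set_one[OF subring_set_Ov]] by simp

lemma val_ideal_hypersurface:
  assumes f: "f \<in> mpol_in {..d}" "f \<noteq> 0" and v: "v \<in> Ov - mv" "to_fract f = v * unif ^ n"
  shows "val_ideal B P (hypersurface_ideal d f) = n"
  unfolding val_ideal_def hypersurface_ideal_eq[OF f(1)]
proof (rule Least_equality)
  show "\<exists>g\<in>{h * f | h. h \<in> mpol_in {..d}} - {0}. ord_along B P (to_fract g) = n"
    using f v ord_along_eq[OF v(1)] subring_set_one[OF subring_set_mpol_in]
    by (intro bexI[of _ f]) (auto intro!: exI[of _ 1])
  fix m assume "\<exists>g\<in>{h * f | h. h \<in> mpol_in {..d}} - {0}. ord_along B P (to_fract g) = m"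
  then obtain g where g: "g \<in> {h * f | h. h \<in> mpol_in {..d}} - {0}" "ord_along B P (to_fract g) = m" by blast
  then obtain h where h: "h \<in> mpol_in {..d}" "h * f \<noteq> 0" "ord_along B P (to_fract (h * f)) = m" by blast
  have "to_fract h \<in> Ov" "to_fract h \<noteq> 0" using h to_fract_in_B B_Ov by auto
  then obtain u k where u: "u \<in> Ov - mv" "to_fract h = u * unif ^ k" using unif_expansion by blast
  have "to_fract (h * f) = (u * v) * unif ^ (k + n)" using u v by (simp add: power_add ac_simps)
  then have "m = k + n" using ord_along_eq[OF Ov_mult_notin[OF u(1) v(1)], of "k + n"] h(3) by simp
  then show "n \<le> m" by simp
qed

text \<open>In terms of derivations preserving the valuation ring, every column \<open>D i (u * \<pi> ^ n)\<close> of the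
  Jacobian matrix is divisible by \<open>\<pi> ^ (n - 1)\<close>, and the quotient is \<open>D i \<pi>\<close> times a constant
  modulo \<open>\<pi>\<close>.\<close>

lemma det_derivation_columns:
  assumes D: "\<And>i. i \<le> d \<Longrightarrow> function_field_derivation d (D i)" "\<And>i g. i \<le> d \<Longrightarrow> g \<in> Ov \<Longrightarrow> D i g \<in> Ov"
    and u: "\<And>j. j \<le> d \<Longrightarrow> u j \<in> Ov" and e: "\<And>j. j \<le> d \<Longrightarrow> 1 \<le> e j"
  shows "\<exists>h\<in>Ov. Determinant.det (mat (Suc d) (Suc d) (\<lambda>(i, j). D i (u j * unif ^ e j))) * unif =
    unif ^ (\<Sum>j\<le>d. e j) * h"
proof -
  note O = subring_set_Ov
  have ff: "u j \<in> function_field d" "unif \<in> function_field d" if "j \<le> d" for j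
    using that u unif_Ov Ov_function_field by auto
  have entry: "D i (u j * unif ^ e j) = unif ^ (e j - 1) * (unif * D i (u j) + of_nat (e j) * u j * D i unif)"
    if "i \<le> d" "j \<le> d" for i j
  proof -
    have "D i (u j * unif ^ e j) = u j * (of_nat (e j) * unif ^ (e j - 1) * D i unif) + unif ^ e j * D i (u j)"
      using derivation_mult[OF D(1)[OF that(1)] ff(1)[OF that(2)] subring_set_power[OF subring_set_function_field ff(2)[OF that(2)]]]
        derivation_power[OF D(1)[OF that(1)] ff(2)[OF that(2)]] by simp
    also have "\<dots> = unif ^ (e j - 1) * (unif * D i (u j) + of_nat (e j) * u j * D i unif)"
    proof -
      have "unif ^ e j = unif ^ (e j - 1) * unif" using e[OF that(2)] by (simp flip: power_Suc2)
      then show ?thesis by (simp only: ring_distribs ac_simps)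
    qed
    finally show ?thesis .
  qed
  obtain h where h: "h \<in> Ov" "Determinant.det (mat (Suc d) (Suc d) (\<lambda>(i, j). unif * D i (u j) + of_nat (e j) * u j * D i unif)) =
      unif ^ (Suc d - 1) * h"
    using det_rank_one_perturbation[OF O, of "Suc d" "\<lambda>i j. D i (u j)" "\<lambda>i. D i unif" "\<lambda>j. of_nat (e j) * u j" unif]
      D(2) u unif_Ov subring_set_of_nat[OF O] subring_set_mult[OF O] by (auto simp: less_Suc_eq_le)
  have "mat (Suc d) (Suc d) (\<lambda>(i, j). D i (u j * unif ^ e j)) =
      mat (Suc d) (Suc d) (\<lambda>(i, j). unif ^ (e j - 1) * (unif * D i (u j) + of_nat (e j) * u j * D i unif))"
    by (rule cong_mat) (auto simp: entry)
  then have "Determinant.det (mat (Suc d) (Suc d) (\<lambda>(i, j). D i (u j * unif ^ e j))) =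
      (\<Prod>j<Suc d. unif ^ (e j - 1)) * (unif ^ d * h)"
    using det_scale_cols[of "Suc d" "\<lambda>j. unif ^ (e j - 1)" "\<lambda>i j. unif * D i (u j) + of_nat (e j) * u j * D i unif"] h(2)
    by simp
  also have "(\<Prod>j<Suc d. unif ^ (e j - 1)) = unif ^ (\<Sum>j\<le>d. e j - 1)"
    by (simp add: power_sum lessThan_Suc_atMost)
  \<comment> \<open>The columns contribute the sum of the \<open>e j - 1\<close> and the rank one
    perturbation another \<open>d\<close>. The total is one short of the sum of the
    \<open>e j\<close>; the extra factor \<open>unif\<close> makes up for it and becomes the 1 in
    the log discrepancy.\<close>
  finally have "Determinant.det (mat (Suc d) (Suc d) (\<lambda>(i, j). D i (u j * unif ^ e j))) * unif =
      unif ^ ((\<Sum>j\<le>d. e j - 1) + Suc d) * h"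
    by (simp add: power_add ac_simps)
  also have "(\<Sum>j\<le>d. e j - 1) + Suc d = (\<Sum>j\<le>d. (e j - 1) + 1)" by (simp only: sum.distrib) simp
  also have "\<dots> = (\<Sum>j\<le>d. e j)" 
  proof (intro sum.cong refl)
    fix j assume "j \<in> {..d}"
    then show "e j - 1 + 1 = e j" using e[of j] by simp
  qed
  finally show ?thesis using h(1) by blast
qed

text \<open>A monomial whose weight exceeds the minimum carries at least one more factor
  \<open>unif\<close>. So the initial part, evaluated at the units \<open>u\<close>, decides whether
  the order is exactly the minimal weight.\<close>

lemma to_fract_initial_expansion:
  assumes f: "f \<in> mpol_in {..d}"
    and u: "\<And>j. j \<le> d \<Longrightarrow> u j \<in> Ov" "\<And>j. j \<le> d \<Longrightarrow> ratfun_coord j = u j * unif ^ w j"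
  shows "\<exists>h\<in>Ov. to_fract (mpol_var v * mpol_deriv v f) =
    unif ^ min_weight d w f * (mpol_subst ratfun_const u (mpol_var v * mpol_deriv v (init_part d w f)) + unif * h)"
proof -
  note O = subring_set_Ov
  define K where "K = Poly_Mapping.keys f"
  define l where "l = min_weight d w f"
  define K0 where "K0 = {m \<in> K. weight d w m = l}"
  define c where "c = (\<lambda>m. of_nat (Poly_Mapping.lookup m v) * Poly_Mapping.lookup f m)"
  define t where "t = (\<lambda>m. ratfun_const (c m) * mon_val u m)"
  have keys: "Poly_Mapping.keys m \<subseteq> {..d}" if "m \<in> K" for m using f that by (auto simp: mpol_in_def K_def)
  have tO: "t m \<in> Ov" if "m \<in> K" for m
    unfolding t_def using keys[OF that] u(1) const_in_B B_Ov
    by (intro subring_set_mult[OF O] mon_val_in_subring[OF O]) auto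
  have "to_fract (mpol_var v * mpol_deriv v f) = (\<Sum>m\<in>K. t m * unif ^ weight d w m)"
    unfolding var_times_deriv
    using mon_val_scaled[of d ratfun_coord u unif w] u(2) keys
    by (simp add: to_fract_single K_def t_def c_def mult.assoc)
  also have "\<dots> = (\<Sum>m\<in>K. unif ^ l * (t m * unif ^ (weight d w m - l)))"
  proof (rule sum.cong[OF refl])
    fix m assume "m \<in> K"
    then have "l \<le> weight d w m" unfolding l_def K_def by (rule min_weight_le)
    then have "unif ^ weight d w m = unif ^ l * unif ^ (weight d w m - l)" by (simp flip: power_add)
    then show "t m * unif ^ weight d w m = unif ^ l * (t m * unif ^ (weight d w m - l))" by simp
  qed
  also have "\<dots> = unif ^ l * (\<Sum>m\<in>K. t m * unif ^ (weight d w m - l))" by (simp add: sum_distrib_left)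
  also have "(\<Sum>m\<in>K. t m * unif ^ (weight d w m - l)) =
      (\<Sum>m\<in>K0. t m * unif ^ (weight d w m - l)) + (\<Sum>m\<in>K - K0. t m * unif ^ (weight d w m - l))"
    using sum.subset_diff[of K0 K "\<lambda>m. t m * unif ^ (weight d w m - l)"] by (simp add: K0_def K_def add.commute)
  also have "(\<Sum>m\<in>K0. t m * unif ^ (weight d w m - l)) = (\<Sum>m\<in>K0. t m)"
    by (intro sum.cong) (auto simp: K0_def)
  also have "(\<Sum>m\<in>K0. t m) = mpol_subst ratfun_const u (mpol_var v * mpol_deriv v (init_part d w f))"
  proof -
    interpret h: comm_ring_hom "mpol_subst ratfun_const u" by (rule comm_ring_hom_mpol_subst[OF comm_ring_hom_ratfun_const])
    show ?thesis
      unfolding var_times_deriv_init_part h.hom_sum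
      by (intro sum.cong) (auto simp: mpol_subst_single[OF comm_ring_hom_ratfun_const] t_def c_def K0_def K_def l_def)
  qed
  also have "(\<Sum>m\<in>K - K0. t m * unif ^ (weight d w m - l)) = unif * (\<Sum>m\<in>K - K0. t m * unif ^ (weight d w m - l - 1))"
    unfolding sum_distrib_left
  proof (rule sum.cong[OF refl])
    fix m assume "m \<in> K - K0"
    then have "l < weight d w m" using min_weight_le[of m f d w] by (auto simp: K0_def K_def l_def)
    then have "weight d w m - l = Suc (weight d w m - l - 1)" by simp
    then have "unif ^ (weight d w m - l) = unif * unif ^ (weight d w m - l - 1)" by (metis power_Suc)
    then show "t m * unif ^ (weight d w m - l) = unif * (t m * unif ^ (weight d w m - l - 1))" by simp
  qed
  finally show ?thesis
    unfolding l_def[symmetric] using tO unif_Ov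
    by (intro bexI[of _ "\<Sum>m\<in>K - K0. t m * unif ^ (weight d w m - l - 1)"])
       (auto intro!: subring_set_sum[OF O] subring_set_mult[OF O] subring_set_power[OF O])
qed

end

text \<open>The residues of the \<open>u j\<close> lie in an extension of the field, while
  nondegeneracy speaks of points over the field itself. The polynomials whose value at
  \<open>u\<close> lies in the maximal ideal form a prime that contains no variable; by
  \<open>prime_has_point\<close> it has a point with nonzero coordinates, and there all derivatives
  of the initial part would vanish.\<close>

lemma nondegenerate_residues:
  fixes B P :: "'k::alg_closed_field ratfun set"
  assumes div: "prime_divisor d B P" and f: "f \<in> mpol_in {..d}" "f \<noteq> 0" "newton_nondegenerate d f"
    and u: "\<And>j. j \<le> d \<Longrightarrow> u j \<in> dvr_chart.Ov B P - dvr_chart.mv B P"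
  shows "\<exists>j\<le>d. mpol_subst ratfun_const u (mpol_var j * mpol_deriv j (init_part d w f)) \<notin> dvr_chart.mv B P"
proof (rule ccontr)
  interpret prime_divisor d B P by (rule div)
  interpret h: comm_ring_hom "mpol_subst ratfun_const u :: (nat, 'k) mpol \<Rightarrow> _"
    by (rule comm_ring_hom_mpol_subst[OF comm_ring_hom_ratfun_const])
  let ?U = "mpol_subst ratfun_const u"
  let ?A = "mpol_in {..d} :: (nat, 'k) mpol set"
  assume "\<not> ?thesis"
  then have all: "?U (mpol_var j * mpol_deriv j (init_part d w f)) \<in> mv" if "j \<le> d" for j using that by blast
  have UO: "?U g \<in> Ov" if "g \<in> ?A" for g
    using that u const_in_B B_Ov by (intro mpol_subst_in_subring[OF subring_set_Ov _ _ that]) auto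
  note A = subring_set_mpol_in[of "{..d}"]
  define Q where "Q = {g \<in> ?A. ?U g \<in> mv}"
  have Q: "prime_of ?A Q"
    unfolding prime_of_def ideal_of_def
  proof (intro conjI ballI impI)
    show "Q \<subseteq> ?A" by (auto simp: Q_def)
    show "0 \<in> Q" using subring_set_zero[OF A] zero_in_mv by (simp add: Q_def)
    show "x + y \<in> Q" if "x \<in> Q" "y \<in> Q" for x y
      using that by (auto simp: Q_def h.hom_add intro: subring_set_add[OF A] mv_add)
    show "a * x \<in> Q" if "a \<in> ?A" "x \<in> Q" for a x
      using that UO by (auto simp: Q_def h.hom_mult intro: subring_set_mult[OF A] mv_mult)
    show "1 \<notin> Q" using one_notin_mv by (simp add: Q_def)
    show "a \<in> Q \<or> b \<in> Q" if "a \<in> ?A" "b \<in> ?A" "a * b \<in> Q" for a b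
      using that UO Ov_mult_notin[of "?U a" "?U b"] by (auto simp: Q_def h.hom_mult)
  qed
  have varQ: "mpol_var j \<in> ?A - Q" if "j \<le> d" for j
    using that u[OF that] by (auto simp: Q_def mpol_in_var mpol_subst_var[OF comm_ring_hom_ratfun_const])
  have "(\<Prod>j\<le>d. mpol_var j) \<in> ?A - Q"
    by (rule prime_of_prod_notin[OF A Q]) (use varQ in auto)
  then obtain a where a: "\<forall>g\<in>Q. mpol_eval a g = 0" "mpol_eval a (\<Prod>j\<le>d. mpol_var j) \<noteq> 0"
    using prime_has_point[OF _ Q] by blast
  interpret e: comm_ring_hom "mpol_eval a :: (nat, 'k) mpol \<Rightarrow> 'k"
    by (rule comm_ring_hom_mpol_subst[OF comm_ring_hom_id])
  have a0: "a j \<noteq> 0" if "j \<le> d" for j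
    using a(2) that by (auto simp: e.hom_prod mpol_subst_var[OF comm_ring_hom_id])
  have dA: "mpol_deriv j (init_part d w f) \<in> ?A" for j by (intro mpol_deriv_in init_part_in f)
  have "mpol_deriv j (init_part d w f) \<in> Q" if j: "j \<le> d" for j
  proof -
    have "mpol_var j * mpol_deriv j (init_part d w f) \<in> Q"
      using all[OF j] j dA by (auto simp: Q_def intro!: subring_set_mult[OF A] mpol_in_var)
    then show ?thesis using prime_ofD[OF Q _ dA] varQ[OF j] by blast
  qed
  then have "\<forall>j\<le>d. mpol_eval a (mpol_deriv j (init_part d w f)) = 0" using a(1) by blast
  then show False using nondegenerate_init_part[OF f, of a w] a0 by blast
qed

text \<open>In the Jacobian matrix the coordinate \<open>j0\<close> is replaced by \<open>f\<close>.
  The determinant becomes the derivative of \<open>f\<close> by this coordinate times the Jacobian,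
  and \<open>det_derivation_columns\<close> bounds its order below by the sum of the orders of the
  entries minus 1. Multiplying by the coordinate restores \<open>w j0\<close> on one side and gives,
  on the other, a logarithmic derivative of \<open>f\<close> whose order is exactly the minimal
  weight for the right choice of \<open>j0\<close>.\<close>

theorem log_discrepancy_ge:
  fixes B P :: "'k::alg_closed_field ratfun set"
  assumes div: "prime_divisor_over d B P" and cen: "has_center d P (\<lambda>_. 0)"
    and f: "f \<in> mpol_in {..d}" "f \<noteq> 0" "newton_nondegenerate d f" "mpol_eval (\<lambda>_. 0) f = 0"
  shows "\<exists>w. (\<forall>i\<le>d. 1 \<le> w i) \<and>
    (\<Sum>i\<le>d. w i) + val_ideal B P (hypersurface_ideal d f) \<le> canonical_coeff d B P + 1 + min_weight d w f"
proof -
  interpret prime_divisor d B P by unfold_locales (rule div)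
  note O = subring_set_Ov
  have center: "to_fract g \<in> P \<longleftrightarrow> mpol_eval (\<lambda>_. 0) g = 0" if "g \<in> mpol_in {..d}" for g
    using cen that unfolding has_center_def by blast
  have "\<exists>u w. u \<in> Ov - mv \<and> ratfun_coord j = u * unif ^ w" if "j \<le> d" for j
  proof -
    have "ratfun_coord j \<in> Ov" using coord_in_B[OF that] B_Ov by blast
    from unif_expansion[OF this ratfun_coord_nonzero] show ?thesis by blast
  qed
  then obtain u w where uw: "\<And>j. j \<le> d \<Longrightarrow> u j \<in> Ov - mv" "\<And>j. j \<le> d \<Longrightarrow> ratfun_coord j = u j * unif ^ w j"
    by metis
  have w1: "1 \<le> w j" if j: "j \<le> d" for j
  proof (rule ccontr)
    assume "\<not> 1 \<le> w j"
    then have "w j = 0" by simp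
    then have "ratfun_coord j = u j" using uw(2)[OF j] by simp
    moreover have "ratfun_coord j \<in> P"
      using center[of "mpol_var j"] j by (simp add: ratfun_coord_def mpol_in_var mpol_subst_var[OF comm_ring_hom_id])
    ultimately show False using uw(1)[OF j] P_mv by auto
  qed
  have fO: "to_fract f \<in> Ov" "to_fract f \<noteq> 0" using to_fract_in_B[OF f(1)] B_Ov f(2) by auto
  obtain v n where v: "v \<in> Ov - mv" "to_fract f = v * unif ^ n" using unif_expansion[OF fO] by blast
  have n1: "1 \<le> n"
  proof (rule ccontr)
    assume "\<not> 1 \<le> n"
    then have "n = 0" by simp
    then have "to_fract f = v" using v(2) by simp
    moreover have "to_fract f \<in> P" using center[OF f(1)] f(4) by simp
    ultimately show False using v(1) P_mv by auto
  qed
  define l where "l = min_weight d w f"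
  obtain j0 where j0: "j0 \<le> d"
    "mpol_subst ratfun_const u (mpol_var j0 * mpol_deriv j0 (init_part d w f)) \<notin> mv" (is "?i \<notin> mv")
    using nondegenerate_residues[OF prime_divisor_axioms f(1-3), of u w] uw(1) by blast
  obtain h where h: "h \<in> Ov" "to_fract (mpol_var j0 * mpol_deriv j0 f) = unif ^ l * (?i + unif * h)"
    using to_fract_initial_expansion[OF f(1), of u w j0] uw unfolding l_def by blast
  define e where "e = ?i + unif * h"
  have iO: "?i \<in> Ov"
    using uw(1) const_in_B B_Ov f(1) j0(1)
    by (intro mpol_subst_in_subring[OF O, of _ "{..d}"])
       (auto intro!: subring_set_mult[OF subring_set_mpol_in] mpol_in_var mpol_deriv_in init_part_in)
  have "e \<notin> mv"
  proof
    assume "e \<in> mv"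
    moreover have "- (unif * h) \<in> mv" using mv_mult[OF h(1) unif_mv] by (simp add: mult.commute mv_uminus)
    ultimately have "e + - (unif * h) \<in> mv" by (rule mv_add)
    then show False using j0(2) by (simp add: e_def)
  qed
  then have e: "e \<in> Ov - mv" using iO h(1) unif_Ov
    by (auto simp: e_def intro!: subring_set_add[OF O] subring_set_mult[OF O])
  obtain y D where yD: "local_coordinates d B P y D" using local_coordinates_exist by blast
  note D = local_coordinates_derivations[OF yD]
  obtain u' where u': "u' \<in> Ov - mv" "jacobian d D = u' * unif ^ canonical_coeff d B P"
    using jacobian_expansion[OF yD] by blast
  \<comment> \<open>Units and exponents of the coordinate tuple with entry \<open>j0\<close>
    replaced by \<open>f\<close>.\<close>
  define U where "U = u(j0 := v)"
  define E where "E = w(j0 := n)"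
  have UO: "U j \<in> Ov" and E1: "1 \<le> E j" if "j \<le> d" for j
    using that uw(1) v(1) w1 n1 by (auto simp: U_def E_def)
  obtain H where H: "H \<in> Ov" "Determinant.det (mat (Suc d) (Suc d) (\<lambda>(i, j). D i (U j * unif ^ E j))) * unif =
      unif ^ (\<Sum>j\<le>d. E j) * H"
    using det_derivation_columns[of D U E] D UO E1 by blast
  have "mat (Suc d) (Suc d) (\<lambda>(i, j). D i (U j * unif ^ E j)) =
      mat (Suc d) (Suc d) (\<lambda>(i, j). if j = j0 then \<Sum>l<Suc d. D i (ratfun_coord l) * to_fract (mpol_deriv l f) else D i (ratfun_coord j))"
  proof (rule cong_mat)
    fix i j assume ij: "i < Suc d" "j < Suc d"
    have "D i (to_fract f) = (\<Sum>l<Suc d. D i (ratfun_coord l) * to_fract (mpol_deriv l f))"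
      using derivation_to_fract[OF D(1) f(1), of i] ij by (simp add: lessThan_Suc_atMost mult.commute)
    then show "(case (i, j) of (i, j) \<Rightarrow> D i (U j * unif ^ E j)) =
        (case (i, j) of (i, j) \<Rightarrow> if j = j0 then \<Sum>l<Suc d. D i (ratfun_coord l) * to_fract (mpol_deriv l f) else D i (ratfun_coord j))"
      using ij uw(2)[of j] v(2) by (simp add: U_def E_def)
  qed simp_all
  then have "Determinant.det (mat (Suc d) (Suc d) (\<lambda>(i, j). D i (U j * unif ^ E j))) =
      to_fract (mpol_deriv j0 f) * jacobian d D"
    using det_cramer_col[of j0 "Suc d" "\<lambda>i j. D i (ratfun_coord j)" "\<lambda>l. to_fract (mpol_deriv l f)"] j0(1)
    by (simp add: jacobian_def)
  then have "to_fract (mpol_deriv j0 f) * jacobian d D * unif = unif ^ (\<Sum>j\<le>d. E j) * H" using H(2) by simp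
  then have "ratfun_coord j0 * (to_fract (mpol_deriv j0 f) * jacobian d D * unif) =
      (u j0 * unif ^ w j0) * (unif ^ (\<Sum>j\<le>d. E j) * H)" using uw(2)[OF j0(1)] by simp
  then have "to_fract (mpol_var j0 * mpol_deriv j0 f) * jacobian d D * unif =
      (u j0 * H) * unif ^ (w j0 + (\<Sum>j\<le>d. E j))" by (simp add: ratfun_coord_def power_add ac_simps)
  also have "w j0 + (\<Sum>j\<le>d. E j) = (\<Sum>j\<le>d. w j) + n"
  proof -
    have "(\<Sum>j\<le>d. E j) = n + (\<Sum>j\<in>{..d} - {j0}. E j)" using j0(1) by (simp add: sum.remove[of _ j0] E_def)
    also have "(\<Sum>j\<in>{..d} - {j0}. E j) = (\<Sum>j\<in>{..d} - {j0}. w j)" by (intro sum.cong) (auto simp: E_def)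
    finally show ?thesis using j0(1) by (simp add: sum.remove[of _ j0 w])
  qed
  finally have fin: "to_fract (mpol_var j0 * mpol_deriv j0 f) * jacobian d D * unif =
      (u j0 * H) * unif ^ ((\<Sum>j\<le>d. w j) + n)" .
  have th: "to_fract (mpol_var j0 * mpol_deriv j0 f) = unif ^ l * e" using h(2) by (simp only: e_def)
  have "(e * u') * unif ^ (l + canonical_coeff d B P + 1) = unif ^ l * e * (u' * unif ^ canonical_coeff d B P) * unif"
    by (simp add: power_add ac_simps)
  also have "\<dots> = (u j0 * H) * unif ^ ((\<Sum>j\<le>d. w j) + n)"
    using fin unfolding th u'(2) .
  finally have "(e * u') * unif ^ (l + canonical_coeff d B P + 1) = (u j0 * H) * unif ^ ((\<Sum>j\<le>d. w j) + n)" .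
  then have "(\<Sum>j\<le>d. w j) + n \<le> l + canonical_coeff d B P + 1"
    using Ov_mult_notin[OF e u'(1)] uw(1)[OF j0(1)] H(1) by (intro unif_power_unique) (auto intro: subring_set_mult[OF O])
  then show ?thesis
    using w1 val_ideal_hypersurface[OF f(1,2) v] by (intro exI[of _ w]) (auto simp: l_def)
qed

section \<open>Normality of polynomial rings\<close>

definition lead_mon :: "('v::linorder, 'k::zero) mpol \<Rightarrow> ('v \<Rightarrow>\<^sub>0 nat)" where
  "lead_mon p = Max (Poly_Mapping.keys p)"

lemma keys_nonempty: "p \<noteq> 0 \<Longrightarrow> Poly_Mapping.keys p \<noteq> {}"
  by (metis lookup_zero not_in_keys_iff_lookup_eq_zero poly_mapping_eqI empty_iff)

lemma lead_mon_in: "p \<noteq> 0 \<Longrightarrow> lead_mon p \<in> Poly_Mapping.keys p"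
  unfolding lead_mon_def using keys_nonempty by (intro Max_in) auto

lemma le_lead_mon: "m \<in> Poly_Mapping.keys p \<Longrightarrow> m \<le> lead_mon p"
  unfolding lead_mon_def by (intro Max_ge) auto

lemma lead_mon_eqI: "m \<in> Poly_Mapping.keys p \<Longrightarrow> (\<And>n. n \<in> Poly_Mapping.keys p \<Longrightarrow> n \<le> m) \<Longrightarrow> lead_mon p = m"
  unfolding lead_mon_def by (intro Max_eqI) auto

lemma lookup_mult_lead:
  fixes p q :: "('v::linorder, 'k::comm_ring_1) mpol"
  shows "Poly_Mapping.lookup (p * q) (lead_mon p + lead_mon q) =
    Poly_Mapping.lookup p (lead_mon p) * Poly_Mapping.lookup q (lead_mon q)"
proof -
  define a where "a = lead_mon p"
  define b where "b = lead_mon q"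
  define p' where "p' = p - Poly_Mapping.single a (Poly_Mapping.lookup p a)"
  define q' where "q' = q - Poly_Mapping.single b (Poly_Mapping.lookup q b)"
  have p': "m < a" if "m \<in> Poly_Mapping.keys p'" for m
  proof -
    have "m \<noteq> a" "m \<in> Poly_Mapping.keys p"
      using that by (auto simp: p'_def in_keys_iff lookup_minus lookup_single when_def split: if_splits)
    then show ?thesis using le_lead_mon[of m p] by (simp add: a_def)
  qed
  have q': "m < b" if "m \<in> Poly_Mapping.keys q'" for m
  proof -
    have "m \<noteq> b" "m \<in> Poly_Mapping.keys q"
      using that by (auto simp: q'_def in_keys_iff lookup_minus lookup_single when_def split: if_splits)
    then show ?thesis using le_lead_mon[of m q] by (simp add: b_def)
  qed
  have zero: "Poly_Mapping.lookup (r * s) (a + b) = 0"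
    if "\<And>m n. m \<in> Poly_Mapping.keys r \<Longrightarrow> n \<in> Poly_Mapping.keys s \<Longrightarrow> m + n < a + b" for r s :: "('v, 'k) mpol"
  proof (rule ccontr)
    assume "\<not> ?thesis"
    then have "a + b \<in> Poly_Mapping.keys (r * s)" by (simp add: in_keys_iff)
    then obtain m n where "m \<in> Poly_Mapping.keys r" "n \<in> Poly_Mapping.keys s" "a + b = m + n"
      using keys_mult[of r s] by blast
    then show False using that by fastforce
  qed
  have "p * q = Poly_Mapping.single (a + b) (Poly_Mapping.lookup p a * Poly_Mapping.lookup q b) +
      (Poly_Mapping.single a (Poly_Mapping.lookup p a) * q' + p' * q)"
    by (simp add: p'_def q'_def mult_single[symmetric] algebra_simps)
  moreover have "Poly_Mapping.lookup (Poly_Mapping.single a (Poly_Mapping.lookup p a) * q') (a + b) = 0"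
    by (rule zero) (auto dest!: q' split: if_splits intro: add_strict_left_mono)
  moreover have "Poly_Mapping.lookup (p' * q) (a + b) = 0"
  proof (rule zero)
    fix m n assume "m \<in> Poly_Mapping.keys p'" "n \<in> Poly_Mapping.keys q"
    then show "m + n < a + b" unfolding b_def by (intro add_less_le_mono p' le_lead_mon)
  qed
  ultimately show ?thesis unfolding a_def[symmetric] b_def[symmetric] by (simp add: lookup_add)
qed

lemma lead_mon_mult:
  fixes p q :: "('v::linorder, 'k::idom) mpol"
  assumes "p \<noteq> 0" "q \<noteq> 0"
  shows "lead_mon (p * q) = lead_mon p + lead_mon q"
proof (rule lead_mon_eqI)
  show "lead_mon p + lead_mon q \<in> Poly_Mapping.keys (p * q)"
    using lead_mon_in[OF assms(1)] lead_mon_in[OF assms(2)] by (simp add: in_keys_iff lookup_mult_lead)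
  fix n assume "n \<in> Poly_Mapping.keys (p * q)"
  then obtain a b where "a \<in> Poly_Mapping.keys p" "b \<in> Poly_Mapping.keys q" "n = a + b"
    using keys_mult[of p q] by blast
  then show "n \<le> lead_mon p + lead_mon q" by (auto intro: add_mono le_lead_mon)
qed

lemma lead_mon_power:
  fixes p :: "('v::linorder, 'k::idom) mpol"
  assumes "p \<noteq> 0"
  shows "Poly_Mapping.lookup (lead_mon (p ^ n)) i = n * Poly_Mapping.lookup (lead_mon p) i"
proof (induction n)
  case 0
  have "lead_mon (1 :: ('v, 'k) mpol) = 0" by (rule lead_mon_eqI) auto
  then show ?case by simp
next
  case (Suc n)
  have "lead_mon (p ^ Suc n) = lead_mon p + lead_mon (p ^ n)"
    using assms by (simp add: lead_mon_mult)
  then show ?case using Suc by (simp add: lookup_add)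
qed

text \<open>The restriction to finitely many variables matters: in this lexicographic order the
  variables themselves form a strictly decreasing sequence. With variables up to \<open>d\<close>
  the order embeds into lists of fixed length.\<close>

lemma wf_monomials: "wf {(m, n :: nat \<Rightarrow>\<^sub>0 nat). m < n \<and> Poly_Mapping.keys m \<subseteq> {..d} \<and> Poly_Mapping.keys n \<subseteq> {..d}}"
proof (rule wf_subset)
  define L where "L = (\<lambda>m :: nat \<Rightarrow>\<^sub>0 nat. map (Poly_Mapping.lookup m) [0..<Suc d])"
  show "wf (inv_image (lexn less_than (Suc d)) L)" by (intro wf_inv_image wf_lexn wf_less_than)
  show "{(m, n :: nat \<Rightarrow>\<^sub>0 nat). m < n \<and> Poly_Mapping.keys m \<subseteq> {..d} \<and> Poly_Mapping.keys n \<subseteq> {..d}} \<subseteq>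
      inv_image (lexn less_than (Suc d)) L"
  proof (rule subrelI)
    fix m n :: "nat \<Rightarrow>\<^sub>0 nat"
    assume "(m, n) \<in> {(m, n). m < n \<and> Poly_Mapping.keys m \<subseteq> {..d} \<and> Poly_Mapping.keys n \<subseteq> {..d}}"
    then have lt: "m < n" and n: "Poly_Mapping.keys n \<subseteq> {..d}" by auto
    obtain k where k: "Poly_Mapping.lookup m k < Poly_Mapping.lookup n k" "\<And>j. j < k \<Longrightarrow> Poly_Mapping.lookup m j = Poly_Mapping.lookup n j"
      using lt unfolding less_poly_mapping.rep_eq less_fun_def by blast
    have kd: "k \<le> d" using k(1) n by (metis atMost_iff in_keys_iff less_nat_zero_code subsetD)
    have split: "[0..<Suc d] = [0..<k] @ k # [Suc k..<Suc d]"
      using upt_add_eq_append[of 0 k "Suc d - k"] upt_conv_Cons[of k "Suc d"] kd by simp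
    have len: "length (L m) = Suc d" "length (L n) = Suc d" by (simp_all add: L_def)
    have "L m = map (Poly_Mapping.lookup n) [0..<k] @ Poly_Mapping.lookup m k # map (Poly_Mapping.lookup m) [Suc k..<Suc d]"
      unfolding L_def split using k(2) by simp
    moreover have "L n = map (Poly_Mapping.lookup n) [0..<k] @ Poly_Mapping.lookup n k # map (Poly_Mapping.lookup n) [Suc k..<Suc d]"
      unfolding L_def split by simp
    moreover have "(Poly_Mapping.lookup m k, Poly_Mapping.lookup n k) \<in> less_than" using k(1) by simp
    ultimately have "(L m, L n) \<in> lexn less_than (Suc d)"
      unfolding lexn_conv using len by blast
    then show "(m, n) \<in> inv_image (lexn less_than (Suc d)) L" by simp
  qed
qed

text \<open>If all powers of \<open>p / q\<close> have the common denominator \<open>c\<close>, then comparing leading monomials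
  shows that the leading monomial of \<open>q\<close> divides that of \<open>p\<close>, and one step of division reduces \<open>p\<close>.\<close>

lemma almost_integral_dvd:
  fixes p q c :: "(nat, 'k::field) mpol"
  assumes q: "q \<in> mpol_in {..d}" "q \<noteq> 0" and c: "c \<noteq> 0"
    and p: "p \<in> mpol_in {..d}" "\<And>n. \<exists>h. c * p ^ n = h * q ^ n"
  shows "\<exists>a\<in>mpol_in {..d}. p = a * q"
  using p
proof (induction "lead_mon p" arbitrary: p rule: wf_induct_rule[OF wf_monomials[of d]])
  case (1 p)
  note A = subring_set_mpol_in[of "{..d}"]
  show ?case
  proof (cases "p = 0")
    case True
    then show ?thesis using subring_set_zero[OF A] by (intro bexI[of _ 0]) auto
  next
    case False
    have le: "Poly_Mapping.lookup (lead_mon q) i \<le> Poly_Mapping.lookup (lead_mon p) i" for i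
    proof (rule ccontr)
      assume "\<not> ?thesis"
      then have lt: "Poly_Mapping.lookup (lead_mon q) i \<ge> Suc (Poly_Mapping.lookup (lead_mon p) i)" by simp
      \<comment> \<open>One more than the exponent of \<open>i\<close> in \<open>lead_mon c\<close>,
        so that \<open>c\<close> cannot supply the factors that \<open>p ^ n\<close> is
        missing.\<close>
      define n where "n = Suc (Poly_Mapping.lookup (lead_mon c) i)"
      obtain h where h: "c * p ^ n = h * q ^ n" using "1.prems"(2) by blast
      have "h \<noteq> 0" using h c False by auto
      have "lead_mon c + lead_mon (p ^ n) = lead_mon h + lead_mon (q ^ n)"
        using arg_cong[OF h, of lead_mon] c False \<open>h \<noteq> 0\<close> q(2) by (simp add: lead_mon_mult)
      from arg_cong[OF this, of "\<lambda>m. Poly_Mapping.lookup m i"]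
      have eq: "Poly_Mapping.lookup (lead_mon c) i + n * Poly_Mapping.lookup (lead_mon p) i =
          Poly_Mapping.lookup (lead_mon h) i + n * Poly_Mapping.lookup (lead_mon q) i"
        using False q(2) by (simp add: lookup_add lead_mon_power)
      have "n * Suc (Poly_Mapping.lookup (lead_mon p) i) \<le> n * Poly_Mapping.lookup (lead_mon q) i"
        using lt by (rule mult_left_mono) simp
      then show False using eq by (simp add: n_def)
    qed
    define \<mu> where "\<mu> = lead_mon p - lead_mon q"
    have \<mu>: "\<mu> + lead_mon q = lead_mon p"
      unfolding \<mu>_def using le by (intro poly_mapping_eqI) (simp add: lookup_add lookup_minus)
    define s where "s = Poly_Mapping.single \<mu> (Poly_Mapping.lookup p (lead_mon p) / Poly_Mapping.lookup q (lead_mon q))"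
    have lcq: "Poly_Mapping.lookup q (lead_mon q) \<noteq> 0" using lead_mon_in[OF q(2)] by (simp add: in_keys_iff)
    have lcp: "Poly_Mapping.lookup p (lead_mon p) \<noteq> 0" using lead_mon_in[OF False] by (simp add: in_keys_iff)
    have keys_lp: "Poly_Mapping.keys (lead_mon p) \<subseteq> {..d}"
      using lead_mon_in[OF False] "1.prems"(1) by (auto simp: mpol_in_def)
    have sA: "s \<in> mpol_in {..d}"
      unfolding s_def
    proof (rule single_in_mpol_in)
      show "Poly_Mapping.keys \<mu> \<subseteq> {..d}"
        using keys_lp unfolding \<mu>_def by (auto simp: in_keys_iff lookup_minus subset_iff)
    qed
    have s0: "s \<noteq> 0"
    proof
      assume "s = 0"
      then have "Poly_Mapping.lookup s \<mu> = 0" by simp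
      then show False using lcp lcq by (simp add: s_def)
    qed
    have ls: "lead_mon s = \<mu>" unfolding s_def using lcp lcq by (intro lead_mon_eqI) auto
    define p' where "p' = p - s * q"
    have p'A: "p' \<in> mpol_in {..d}"
      unfolding p'_def by (intro subring_set_diff[OF A] subring_set_mult[OF A] "1.prems" sA q)
    \<comment> \<open>The reduced polynomial keeps the same denominator \<open>c\<close>: in the
      binomial expansion every \<open>p ^ k\<close> comes with the factor
      \<open>q ^ (n - k)\<close>.\<close>
    have "\<exists>h. c * p' ^ n = h * q ^ n" for n
    proof -
      obtain h where h: "\<And>k. c * p ^ k = h k * q ^ k" using "1.prems"(2) by metis
      have "c * p' ^ n = (\<Sum>k\<le>n. of_nat (n choose k) * (c * p ^ k) * (- (s * q)) ^ (n - k))"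
        unfolding p'_def diff_conv_add_uminus[of p] binomial_ring sum_distrib_left by (simp add: ac_simps)
      also have "\<dots> = (\<Sum>k\<le>n. of_nat (n choose k) * h k * (- s) ^ (n - k) * q ^ n)"
      proof (rule sum.cong[OF refl])
        fix k assume "k \<in> {..n}"
        then have "q ^ n = q ^ k * q ^ (n - k)" by (simp flip: power_add)
        moreover have "(- (s * q)) ^ (n - k) = (- s) ^ (n - k) * q ^ (n - k)"
          by (simp flip: power_mult_distrib)
        ultimately show "of_nat (n choose k) * (c * p ^ k) * (- (s * q)) ^ (n - k) = of_nat (n choose k) * h k * (- s) ^ (n - k) * q ^ n"
          by (simp only: h ac_simps)
      qed
      finally show ?thesis by (auto simp: sum_distrib_right[symmetric])
    qed
    note alm = this
    have keys_le: "m \<le> lead_mon p" if "m \<in> Poly_Mapping.keys p'" for m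
    proof -
      have "m \<in> Poly_Mapping.keys p \<union> Poly_Mapping.keys (s * q)"
        using that keys_diff[of p "s * q"] by (auto simp: p'_def)
      then show ?thesis
        using le_lead_mon[of m p] le_lead_mon[of m "s * q"] lead_mon_mult[OF s0 q(2)] ls \<mu> by auto
    qed
    have "Poly_Mapping.lookup (s * q) (lead_mon p) = Poly_Mapping.lookup s \<mu> * Poly_Mapping.lookup q (lead_mon q)"
      using lookup_mult_lead[of s q] ls \<mu> by simp
    then have zero: "Poly_Mapping.lookup p' (lead_mon p) = 0"
      using lcq by (simp add: p'_def lookup_minus s_def)
    have "\<exists>a\<in>mpol_in {..d}. p' = a * q"
    proof (cases "p' = 0")
      case True
      then show ?thesis using subring_set_zero[OF A] by (intro bexI[of _ 0]) auto
    next
      case p'0: False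
      have "lead_mon p' \<noteq> lead_mon p" using zero lead_mon_in[OF p'0] by (auto simp: in_keys_iff)
      then have "lead_mon p' < lead_mon p" using keys_le[OF lead_mon_in[OF p'0]] by simp
      moreover have "Poly_Mapping.keys (lead_mon p') \<subseteq> {..d}"
        using lead_mon_in[OF p'0] p'A by (auto simp: mpol_in_def)
      ultimately show ?thesis using keys_lp by (intro "1.hyps" p'A alm) auto
    qed
    then obtain a where "a \<in> mpol_in {..d}" "p' = a * q" by blast
    then show ?thesis
      using sA by (intro bexI[of _ "a + s"]) (auto simp: p'_def algebra_simps intro: subring_set_add[OF A])
  qed
qed

text \<open>\<open>b ^ N\<close> clears the denominators of the powers below the degree
  \<open>N\<close> of the monic relation, and the relation reduces all higher powers to
  these.\<close>

lemma integral_powers_common_denominator: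
  fixes z :: "'a::field"
  assumes R: "subring_set R" and p: "Polynomial.lead_coeff p = 1" "\<And>i. Polynomial.coeff p i \<in> R" "poly p z = 0"
    and z: "a \<in> R" "b \<in> R" "b \<noteq> 0" "z = a / b"
  shows "\<exists>N. \<forall>n. b ^ N * z ^ n \<in> R"
proof -
  define N where "N = Polynomial.degree p"
  have top: "z ^ N = - (\<Sum>i<N. Polynomial.coeff p i * z ^ i)"
  proof -
    have "0 = (\<Sum>i\<le>N. Polynomial.coeff p i * z ^ i)" using p(3) by (simp add: poly_altdef N_def)
    also have "\<dots> = (\<Sum>i<N. Polynomial.coeff p i * z ^ i) + z ^ N"
      using p(1) by (simp add: N_def flip: lessThan_Suc_atMost)
    finally show ?thesis by (simp add: eq_neg_iff_add_eq_0 add.commute)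
  qed
  have low: "b ^ N * z ^ i \<in> R" if "i < N" for i
  proof -
    have "b ^ N = b ^ (N - i) * b ^ i" using that by (simp flip: power_add)
    then have "b ^ N * z ^ i = b ^ (N - i) * a ^ i" using z by (simp add: power_divide)
    then show ?thesis using z by (simp add: subring_set_mult[OF R] subring_set_power[OF R])
  qed
  have "b ^ N * z ^ n \<in> R" for n
  proof (induction n rule: less_induct)
    case (less n)
    show ?case
    proof (cases "n < N")
      case False
      have "b ^ N * z ^ n = b ^ N * (z ^ (n - N) * z ^ N)" using False by (simp flip: power_add)
      also have "\<dots> = (\<Sum>i<N. - Polynomial.coeff p i * (b ^ N * z ^ (n - N + i)))"
        unfolding top by (simp add: sum_distrib_left power_add ac_simps sum_negf)
      also have "\<dots> \<in> R"
        using False by (intro subring_set_sum[OF R] subring_set_mult[OF R] subring_set_uminus[OF R] p less) auto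
      finally show ?thesis .
    qed (rule low)
  qed
  then show ?thesis by blast
qed

lemma mpol_in_normal:
  fixes z :: "'k::field ratfun"
  assumes p: "Polynomial.lead_coeff p = 1" "\<And>i. Polynomial.coeff p i \<in> to_fract ` mpol_in {..d}" "poly p z = 0"
    and z: "a \<in> mpol_in {..d}" "b \<in> mpol_in {..d}" "b \<noteq> 0" "z = to_fract a / to_fract b"
  shows "z \<in> to_fract ` mpol_in {..d}"
proof -
  note A = subring_set_mpol_in[of "{..d}"]
  have R: "subring_set (to_fract ` mpol_in {..d} :: 'k ratfun set)"
    unfolding subring_set_def
  proof (intro conjI ballI)
    show "1 \<in> to_fract ` (mpol_in {..d} :: (nat, 'k) mpol set)"
      using subring_set_one[OF A] by (intro image_eqI[of _ _ 1]) auto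
    fix x y assume "x \<in> to_fract ` (mpol_in {..d} :: (nat, 'k) mpol set)" "y \<in> to_fract ` (mpol_in {..d} :: (nat, 'k) mpol set)"
    then obtain r s where rs: "r \<in> mpol_in {..d}" "s \<in> mpol_in {..d}" "x = to_fract r" "y = to_fract s" by blast
    show "x - y \<in> to_fract ` mpol_in {..d}"
      using subring_set_diff[OF A rs(1,2)] rs by (intro image_eqI[of _ _ "r - s"]) auto
    show "x * y \<in> to_fract ` mpol_in {..d}"
      using subring_set_mult[OF A rs(1,2)] rs by (intro image_eqI[of _ _ "r * s"]) auto
  qed
  obtain N where N: "\<And>n. to_fract b ^ N * z ^ n \<in> to_fract ` mpol_in {..d}"
    using integral_powers_common_denominator[OF R p, of "to_fract a" "to_fract b"] z by auto
  have pow: "to_fract (x ^ n) = to_fract x ^ n" for x :: "(nat, 'k) mpol" and n by (induction n) auto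
  have "\<exists>h. b ^ N * a ^ n = h * b ^ n" for n
  proof -
    obtain h where h: "to_fract b ^ N * z ^ n = to_fract h" using N by blast
    then have "to_fract b ^ N * to_fract a ^ n = to_fract h * to_fract b ^ n"
      using z by (simp add: power_divide field_simps)
    then have "to_fract (b ^ N * a ^ n) = to_fract (h * b ^ n)" by (simp add: pow)
    then show ?thesis by (auto simp only: to_fract_eq_iff)
  qed
  then obtain e where e: "e \<in> mpol_in {..d}" "a = e * b"
    using almost_integral_dvd[OF z(2,3), of "b ^ N" a] z(1,3) by auto
  then have "z = to_fract e" using z by simp
  then show ?thesis using e(1) by blast
qed

section \<open>Toric divisors\<close>

text \<open>The integers \<open>v\<close> certify that \<open>w\<close> is primitive; the Laurent
  monomial with exponents \<open>v\<close> has weight 1 and will be the uniformizer. The parameter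
  \<open>ty\<close> fixes the coefficient field.\<close>

locale toric_weight =
  fixes d :: nat and w :: "nat \<Rightarrow> nat" and v :: "nat \<Rightarrow> int" and ty :: "'k::field itself"
  assumes w_pos: "\<And>i. i \<le> d \<Longrightarrow> 1 \<le> w i"
    and bezout: "(\<Sum>i\<le>d. int (w i) * v i) = 1"
begin

text \<open>The substitution \<open>x i \<mapsto> x i * t ^ w i\<close>; its order in \<open>t\<close> is the monomial valuation of
  weight \<open>w\<close>.\<close>

definition graded :: "(nat, 'k) mpol \<Rightarrow> (nat, 'k) mpol poly" where
  "graded = mpol_subst (\<lambda>c. [:mpol_const c:]) (\<lambda>i. Polynomial.monom (mpol_var i) (w i))"

lemma comm_ring_hom_graded: "comm_ring_hom graded"
  unfolding graded_def by (rule comm_ring_hom_mpol_subst[OF comm_ring_hom_pCons_mpol_const])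

interpretation graded: comm_ring_hom graded
  by (rule comm_ring_hom_graded)

lemma graded_at_one: "poly (graded p) 1 = p"
proof -
  have hom: "comm_ring_hom (\<lambda>p. poly (graded p) 1)"
    by unfold_locales (auto simp: graded.hom_add graded.hom_mult)
  have "poly (graded p) 1 = mpol_subst mpol_const mpol_var p"
    unfolding comm_ring_hom_eq_mpol_subst[OF hom, of p]
    by (simp add: graded_def mpol_subst_const[OF comm_ring_hom_pCons_mpol_const]
        mpol_subst_var[OF comm_ring_hom_pCons_mpol_const] poly_monom)
  also have "\<dots> = p" by (rule comm_ring_hom_eq_mpol_subst[OF comm_ring_hom_id, symmetric])
  finally show ?thesis .
qed

lemma graded_nonzero: "p \<noteq> 0 \<Longrightarrow> graded p \<noteq> 0"
  using graded_at_one[of p] by auto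

lemma graded_single:
  assumes "Poly_Mapping.keys m \<subseteq> {..d}"
  shows "graded (Poly_Mapping.single m c) = Polynomial.monom (Poly_Mapping.single m c) (weight d w m)"
proof -
  have mon_prod: "(\<Prod>i\<in>I. Polynomial.monom (a i) (b i)) = Polynomial.monom (\<Prod>i\<in>I. a i) (\<Sum>i\<in>I. b i)"
    if "finite I" for I and a :: "nat \<Rightarrow> (nat, 'k) mpol" and b
    using that by (induction I) (auto simp: mult_monom one_pCons monom_0)
  have "graded (Poly_Mapping.single m c) = [:mpol_const c:] * mon_val (\<lambda>i. Polynomial.monom (mpol_var i) (w i)) m"
    unfolding graded_def by (rule mpol_subst_single[OF comm_ring_hom_pCons_mpol_const])
  also have "mon_val (\<lambda>i. Polynomial.monom (mpol_var i :: (nat, 'k) mpol) (w i)) m =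
      Polynomial.monom (mon_val mpol_var m) (weight d w m)"
    unfolding mon_val_superset[OF finite_atMost assms] weight_def
    by (simp add: monom_power mon_prod mult.commute)
  finally show ?thesis
    unfolding single_eq_const_mult_mon_val by (simp add: smult_monom)
qed

section \<open>The monomial valuation of a weight\<close>

definition wt :: "(nat, 'k) mpol \<Rightarrow> nat" where "wt p = Polynomial.order 0 (graded p)"

lemma wt_mult: "p \<noteq> 0 \<Longrightarrow> q \<noteq> 0 \<Longrightarrow> wt (p * q) = wt p + wt q"
  unfolding wt_def graded.hom_mult by (rule order_mult) (simp add: graded_nonzero)

lemma wt_ge_iff: "p \<noteq> 0 \<Longrightarrow> n \<le> wt p \<longleftrightarrow> (\<forall>k<n. Polynomial.coeff (graded p) k = 0)"
  using monom_1_dvd_iff[OF graded_nonzero, of p n] monom_1_dvd_iff'[of n "graded p"] by (simp add: wt_def)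

lemma wt_add: "p \<noteq> 0 \<Longrightarrow> q \<noteq> 0 \<Longrightarrow> p + q \<noteq> 0 \<Longrightarrow> n \<le> wt p \<Longrightarrow> n \<le> wt q \<Longrightarrow> n \<le> wt (p + q)"
  by (simp add: wt_ge_iff graded.hom_add)

lemma graded_expand:
  assumes "p \<in> mpol_in {..d}"
  shows "graded p = (\<Sum>m\<in>Poly_Mapping.keys p. Polynomial.monom (Poly_Mapping.single m (Poly_Mapping.lookup p m)) (weight d w m))"
proof -
  have "graded p = (\<Sum>m\<in>Poly_Mapping.keys p. graded (Poly_Mapping.single m (Poly_Mapping.lookup p m)))"
    by (subst mpol_expand[of p]) (simp add: graded.hom_sum)
  also have "\<dots> = (\<Sum>m\<in>Poly_Mapping.keys p. Polynomial.monom (Poly_Mapping.single m (Poly_Mapping.lookup p m)) (weight d w m))"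
    using assms by (intro sum.cong graded_single) (auto simp: mpol_in_def)
  finally show ?thesis .
qed

text \<open>Distinct monomials cannot cancel, so the coefficient of \<open>graded p\<close> at the
  weight of \<open>m\<close> still contains \<open>m\<close>. Together with
  \<open>min_weight_le_wt\<close> this identifies \<open>wt\<close> with the minimal weight.\<close>

lemma wt_le_weight:
  assumes p: "p \<in> mpol_in {..d}" "m \<in> Poly_Mapping.keys p"
  shows "wt p \<le> weight d w m"
proof (rule ccontr)
  assume "\<not> ?thesis"
  then have lt: "weight d w m < wt p" by simp
  have p0: "p \<noteq> 0" using p(2) by auto
  have "Polynomial.coeff (graded p) (weight d w m) = 0" using wt_ge_iff[OF p0, of "wt p"] lt by simp
  then have "Poly_Mapping.lookup (Polynomial.coeff (graded p) (weight d w m)) m = 0" by simp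
  moreover have "Poly_Mapping.lookup (Polynomial.coeff (graded p) (weight d w m)) m =
      (\<Sum>n\<in>Poly_Mapping.keys p. if n = m then Poly_Mapping.lookup p m else 0)"
    unfolding graded_expand[OF p(1)] coeff_sum lookup_sum
    by (intro sum.cong) (auto simp: lookup_single when_def)
  ultimately have "Poly_Mapping.lookup p m = 0" using p(2) by simp
  then show False using p(2) by (simp add: in_keys_iff)
qed

lemma min_weight_le_wt:
  assumes p: "p \<in> mpol_in {..d}" "p \<noteq> 0"
  shows "min_weight d w p \<le> wt p"
  unfolding wt_ge_iff[OF p(2)] graded_expand[OF p(1)] coeff_sum
proof (intro allI impI sum.neutral ballI)
  fix k m assume "k < min_weight d w p" "m \<in> Poly_Mapping.keys p"
  then have "weight d w m \<noteq> k" using min_weight_le[of m p d w] by auto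
  then show "Polynomial.coeff (Polynomial.monom (Poly_Mapping.single m (Poly_Mapping.lookup p m)) (weight d w m)) k = 0" by simp
qed

lemma wt_single: "Poly_Mapping.keys m \<subseteq> {..d} \<Longrightarrow> c \<noteq> 0 \<Longrightarrow> wt (Poly_Mapping.single m c) = weight d w m"
proof (rule antisym)
  assume m: "Poly_Mapping.keys m \<subseteq> {..d}" and c: "c \<noteq> 0"
  then have A: "Poly_Mapping.single m c \<in> mpol_in {..d}" by (intro single_in_mpol_in)
  show "wt (Poly_Mapping.single m c) \<le> weight d w m" by (rule wt_le_weight[OF A]) (use c in simp)
  have "Poly_Mapping.single m c \<noteq> 0" using c by (metis keys_single keys_zero insert_not_empty)
  then show "weight d w m \<le> wt (Poly_Mapping.single m c)"
    by (simp add: wt_ge_iff graded_single[OF m])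
qed

definition wval :: "'k ratfun \<Rightarrow> int" where
  "wval z = (let (p, q) = (SOME (p, q). q \<noteq> 0 \<and> z = to_fract p / to_fract q) in int (wt p) - int (wt q))"

lemma wval_divide:
  assumes "p \<noteq> 0" "q \<noteq> 0"
  shows "wval (to_fract p / to_fract q) = int (wt p) - int (wt q)"
proof -
  define pq where "pq = (SOME (a, b). b \<noteq> 0 \<and> to_fract p / to_fract q = to_fract a / to_fract b)"
  obtain p' q' where pq': "pq = (p', q')" by (cases pq)
  have "case pq of (a, b) \<Rightarrow> b \<noteq> 0 \<and> to_fract p / to_fract q = to_fract a / to_fract b"
    unfolding pq_def by (rule someI[of _ "(p, q)"]) (use assms in auto)
  then have q': "q' \<noteq> 0" and eq: "to_fract p / to_fract q = to_fract p' / to_fract q'" by (auto simp: pq')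
  then have p': "p' \<noteq> 0" using assms by auto
  have "to_fract (p * q') = to_fract (p' * q)" using eq assms q' by (simp add: field_simps)
  then have "p * q' = p' * q" by (simp only: to_fract_eq_iff)
  then have "wt p + wt q' = wt p' + wt q" using wt_mult assms p' q' by metis
  then show ?thesis unfolding wval_def pq_def[symmetric] pq' by simp
qed

lemma nonzero_cases:
  assumes "z \<noteq> 0" obtains p q where "p \<noteq> 0" "q \<noteq> 0" "z = to_fract p / to_fract q"
  using ratfun_cases[of z] assms by (metis div_0 to_fract_0)

lemma wval_to_fract: "p \<noteq> 0 \<Longrightarrow> wval (to_fract p) = int (wt p)"
proof -
  assume p: "p \<noteq> 0"
  have "wt 1 = 0" unfolding wt_def by simp
  then show ?thesis using wval_divide[OF p, of 1] by simp
qed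

lemma wval_mult:
  assumes "x \<noteq> 0" "y \<noteq> 0" shows "wval (x * y) = wval x + wval y"
proof -
  obtain p q where x: "p \<noteq> 0" "q \<noteq> 0" "x = to_fract p / to_fract q" using nonzero_cases[OF assms(1)] .
  obtain r s where y: "r \<noteq> 0" "s \<noteq> 0" "y = to_fract r / to_fract s" using nonzero_cases[OF assms(2)] .
  have "x * y = to_fract (p * r) / to_fract (q * s)" using x y by simp
  then have "wval (x * y) = int (wt (p * r)) - int (wt (q * s))" using wval_divide[of "p * r" "q * s"] x y by simp
  then show ?thesis using x y by (simp add: wval_divide wt_mult)
qed

lemma wval_one: "wval 1 = 0"
  using wval_mult[of 1 1] by simp

lemma wval_inverse: "x \<noteq> 0 \<Longrightarrow> wval (inverse x) = - wval x"
  using wval_mult[of x "inverse x"] wval_one by simp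

lemma wval_power: "x \<noteq> 0 \<Longrightarrow> wval (x ^ n) = int n * wval x"
  by (induction n) (simp_all add: wval_one wval_mult algebra_simps)

lemma wval_powi: "x \<noteq> 0 \<Longrightarrow> wval (x powi n) = n * wval x"
  by (cases n rule: int_cases2) (simp_all add: wval_power power_int_minus wval_inverse)

lemma wval_prod: "(\<And>i. i \<in> I \<Longrightarrow> f i \<noteq> 0) \<Longrightarrow> wval (prod f I) = (\<Sum>i\<in>I. wval (f i))"
  by (induction I rule: infinite_finite_induct) (auto simp: wval_one wval_mult)

definition vge :: "int \<Rightarrow> 'k ratfun set" where "vge n = {z. z = 0 \<or> n \<le> wval z}"

lemma vge_add: assumes "x \<in> vge n" "y \<in> vge n" shows "x + y \<in> vge n"
proof (cases "x = 0 \<or> y = 0 \<or> x + y = 0")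
  case True
  then show ?thesis using assms by (auto simp: vge_def)
next
  case False
  obtain p q where x: "p \<noteq> 0" "q \<noteq> 0" "x = to_fract p / to_fract q" using nonzero_cases[of x] False by auto
  obtain r s where y: "r \<noteq> 0" "s \<noteq> 0" "y = to_fract r / to_fract s" using nonzero_cases[of y] False by auto
  have sum: "x + y = to_fract (p * s + r * q) / to_fract (q * s)" using x y by (simp add: add_frac_eq)
  have nz: "p * s + r * q \<noteq> 0"
  proof
    assume "p * s + r * q = 0"
    then have "x + y = 0" unfolding sum by (simp only: to_fract_0 div_0)
    then show False using False by blast
  qed
  have n: "n \<le> int (wt p) - int (wt q)" "n \<le> int (wt r) - int (wt s)"
    using assms False x y by (auto simp: vge_def wval_divide)
  define k where "k = nat (n + int (wt q) + int (wt s))"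
  have "k \<le> wt (p * s + r * q)"
    using n x y nz by (intro wt_add) (auto simp: k_def wt_mult)
  then have "n \<le> int (wt (p * s + r * q)) - int (wt (q * s))"
    using x y by (simp add: k_def wt_mult)
  then show ?thesis unfolding vge_def sum using wval_divide[OF nz, of "q * s"] x y by simp
qed

lemma vge_mult: "x \<in> vge m \<Longrightarrow> y \<in> vge n \<Longrightarrow> x * y \<in> vge (m + n)"
  by (cases "x = 0 \<or> y = 0") (auto simp: vge_def wval_mult)

lemma vge_sum: "(\<And>i. i \<in> I \<Longrightarrow> f i \<in> vge n) \<Longrightarrow> sum f I \<in> vge n"
proof (induction I rule: infinite_finite_induct)
  case (insert x I)
  then show ?case by (simp add: vge_add)
qed (simp_all add: vge_def)

lemma wval_const: "c \<noteq> 0 \<Longrightarrow> wval (ratfun_const c) = 0"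
  using wt_single[of 0 c] wval_to_fract[of "mpol_const c"]
  by (simp add: ratfun_const_def mpol_const_def weight_def) (metis keys_single keys_zero insert_not_empty)

lemma wval_coord: assumes "i \<le> d" shows "wval (ratfun_coord i) = int (w i)"
proof -
  have "wval (ratfun_coord i) = int (wt (mpol_var i))"
    unfolding ratfun_coord_def by (rule wval_to_fract) (rule mpol_var_nonzero)
  also have "wt (mpol_var i) = weight d w (Poly_Mapping.single i 1)"
    unfolding mpol_var_def using assms by (intro wt_single) auto
  also have "\<dots> = (\<Sum>j\<le>d. if j = i then w i else 0)"
    unfolding weight_def by (intro sum.cong) (auto simp: lookup_single when_def)
  finally show ?thesis using assms by simp
qed

section \<open>Laurent polynomials and the chart of the toric divisor\<close>

definition laurent :: "'k ratfun set" where
  "laurent = {to_fract p / mon_val ratfun_coord m | p m. p \<in> mpol_in {..d} \<and> Poly_Mapping.keys m \<subseteq> {..d}}"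

lemma mon_val_coord_to_fract: "mon_val ratfun_coord m = to_fract (Poly_Mapping.single m (1 :: 'k))"
  by (simp add: to_fract_single) (simp add: ratfun_const_def mpol_const_def)

lemma mon_val_coord_nonzero: "mon_val ratfun_coord m \<noteq> (0 :: 'k ratfun)"
  unfolding mon_val_def by (simp add: ratfun_coord_nonzero)

lemma subring_set_laurent: "subring_set laurent"
  unfolding subring_set_def
proof (intro conjI ballI)
  note A = subring_set_mpol_in[of "{..d}"]
  show "1 \<in> laurent" unfolding laurent_def using subring_set_one[OF A]
    by (intro CollectI exI[of _ 1] exI[of _ 0]) simp
  fix x y assume "x \<in> laurent" "y \<in> laurent"
  then obtain p m q n where pq: "p \<in> mpol_in {..d}" "Poly_Mapping.keys m \<subseteq> {..d}" "x = to_fract p / mon_val ratfun_coord m"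
    "q \<in> mpol_in {..d}" "Poly_Mapping.keys n \<subseteq> {..d}" "y = to_fract q / mon_val ratfun_coord n"
    unfolding laurent_def by blast
  have mn: "Poly_Mapping.keys (m + n) \<subseteq> {..d}" using keys_add[of m n] pq by blast
  have "x - y = to_fract (p * Poly_Mapping.single n 1 - q * Poly_Mapping.single m 1) / mon_val ratfun_coord (m + n)"
    unfolding pq(3,6) mon_val_add using mon_val_coord_nonzero[of m] mon_val_coord_nonzero[of n]
    by (simp add: diff_frac_eq mon_val_coord_to_fract)
  moreover have "p * Poly_Mapping.single n 1 - q * Poly_Mapping.single m 1 \<in> mpol_in {..d}"
    by (intro subring_set_diff[OF A] subring_set_mult[OF A] single_in_mpol_in pq)
  ultimately show "x - y \<in> laurent" unfolding laurent_def using mn by blast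
  have "x * y = to_fract (p * q) / mon_val ratfun_coord (m + n)" unfolding pq(3,6) mon_val_add by simp
  then show "x * y \<in> laurent" unfolding laurent_def using mn subring_set_mult[OF A pq(1,4)] by blast
qed

lemma to_fract_laurent: "p \<in> mpol_in {..d} \<Longrightarrow> to_fract p \<in> laurent"
  unfolding laurent_def by (intro CollectI exI[of _ p] exI[of _ 0]) simp

lemma laurent_function_field: "laurent \<subseteq> function_field d"
  unfolding laurent_def mon_val_coord_to_fract
  by (auto intro!: function_field_divide to_fract_in_function_field single_in_mpol_in)

definition emon :: "(nat \<Rightarrow> int) \<Rightarrow> 'k ratfun" where "emon n = (\<Prod>i\<le>d. ratfun_coord i powi n i)"

lemma emon_nonzero: "emon n \<noteq> 0"
  unfolding emon_def by (simp add: ratfun_coord_nonzero)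

lemma emon_add: "emon (\<lambda>i. m i + n i) = emon m * emon n"
  unfolding emon_def by (simp add: power_int_add ratfun_coord_nonzero prod.distrib)

lemma emon_laurent: "emon n \<in> laurent"
  unfolding emon_def
proof (rule subring_set_prod[OF subring_set_laurent])
  fix i assume i: "i \<in> {..d}"
  have x: "ratfun_coord i \<in> laurent" unfolding ratfun_coord_def using i by (intro to_fract_laurent mpol_in_var)
  have "inverse (ratfun_coord i) \<in> laurent"
    unfolding laurent_def using i subring_set_one[OF subring_set_mpol_in]
    by (intro CollectI exI[of _ 1] exI[of _ "Poly_Mapping.single i 1"]) (simp add: mon_val_single divide_inverse)
  then show "ratfun_coord i powi n i \<in> laurent"
    using x by (cases "n i" rule: int_cases2)
      (simp_all add: subring_set_power[OF subring_set_laurent] power_int_minus power_inverse[symmetric])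
qed

lemma wval_emon: "wval (emon n) = (\<Sum>i\<le>d. n i * int (w i))"
  unfolding emon_def by (subst wval_prod) (auto simp: ratfun_coord_nonzero wval_powi wval_coord)

text \<open>The coordinate ring of the affine toric variety of the ray spanned by \<open>w\<close>,
  a torus times a line; \<open>P\<close> is the ideal of its invariant divisor.\<close>

definition B :: "'k ratfun set" where "B = laurent \<inter> vge 0"
definition P :: "'k ratfun set" where "P = laurent \<inter> vge 1"

definition pi :: "'k ratfun" where "pi = emon v"

lemma wval_pi: "wval pi = 1"
  using bezout by (simp add: pi_def wval_emon mult.commute)

lemma pi_power: "pi ^ n = emon (\<lambda>i. int n * v i)"
  unfolding pi_def by (induction n) (simp_all add: emon_add distrib_right, simp add: emon_def)

text \<open>The two monomials are the coordinate \<open>j\<close> divided by the power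
  \<open>w j\<close> of \<open>pi\<close>, and its inverse. They are units of
  \<open>B\<close>.\<close>

lemma wval_unit_coord:
  assumes "j \<le> d"
  shows "wval (emon (\<lambda>i. of_bool (i = j) - int (w j) * v i)) = 0"
    and "wval (emon (\<lambda>i. int (w j) * v i - of_bool (i = j))) = 0"
proof -
  have "(\<Sum>i\<le>d. (of_bool (i = j) - int (w j) * v i) * int (w i)) =
      (\<Sum>i\<le>d. (if i = j then int (w j) else 0) - int (w j) * (int (w i) * v i))"
    by (intro sum.cong) (auto simp: algebra_simps)
  also have "\<dots> = (\<Sum>i\<le>d. if i = j then int (w j) else 0) - int (w j) * (\<Sum>i\<le>d. int (w i) * v i)"
    by (simp only: sum_subtractf sum_distrib_left)
  finally have sum: "(\<Sum>i\<le>d. (of_bool (i = j) - int (w j) * v i) * int (w i)) = 0"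
    using assms bezout by simp
  then show "wval (emon (\<lambda>i. of_bool (i = j) - int (w j) * v i)) = 0" by (simp add: wval_emon)
  show "wval (emon (\<lambda>i. int (w j) * v i - of_bool (i = j))) = 0"
    using sum by (simp add: wval_emon left_diff_distrib sum_subtractf)
qed

lemma pi_nonzero: "pi \<noteq> 0"
  by (simp add: pi_def emon_nonzero)

lemma vge_one: "1 \<in> vge 0" by (simp add: vge_def wval_one)

lemma vge_uminus: "x \<in> vge n \<Longrightarrow> - x \<in> vge n"
proof -
  have "ratfun_const (- 1) = (- 1 :: 'k ratfun)"
    using to_fract_uminus[of "1 :: (nat, 'k) mpol"] by (simp add: ratfun_const_def mpol_const_def single_uminus)
  then have "(- 1 :: 'k ratfun) \<in> vge 0" using wval_const[of "- 1"] by (simp add: vge_def)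
  from vge_mult[OF this, of x n] show "x \<in> vge n \<Longrightarrow> - x \<in> vge n" by simp
qed

lemma subring_set_B: "subring_set B"
  unfolding subring_set_def
proof (intro conjI ballI)
  note L = subring_set_laurent
  show "1 \<in> B" unfolding B_def using subring_set_one[OF L] vge_one by simp
  fix x y assume xy: "x \<in> B" "y \<in> B"
  have "x + - y \<in> vge 0" using xy by (intro vge_add vge_uminus) (auto simp: B_def)
  then show "x - y \<in> B" using xy subring_set_diff[OF L] by (auto simp: B_def)
  have "x * y \<in> vge (0 + 0)" using xy by (intro vge_mult) (auto simp: B_def)
  then show "x * y \<in> B" using xy subring_set_mult[OF L] by (auto simp: B_def)
qed

lemma vge_mono: "x \<in> vge m \<Longrightarrow> n \<le> m \<Longrightarrow> x \<in> vge n"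
  by (auto simp: vge_def)

lemma prime_P: "prime_of B P"
  unfolding prime_of_def ideal_of_def
proof (intro conjI ballI impI)
  note L = subring_set_laurent
  show "P \<subseteq> B" using vge_mono[of _ 1 0] by (auto simp: P_def B_def)
  show "0 \<in> P" using subring_set_zero[OF L] by (simp add: P_def vge_def)
  show "x + y \<in> P" if "x \<in> P" "y \<in> P" for x y
    using that by (auto simp: P_def intro: vge_add subring_set_add[OF L])
  show "a * x \<in> P" if "a \<in> B" "x \<in> P" for a x
    using that vge_mult[of a 0 x 1] by (auto simp: P_def B_def intro: subring_set_mult[OF L])
  show "1 \<notin> P" by (simp add: P_def vge_def wval_one)
  fix a b assume ab: "a \<in> B" "b \<in> B" "a * b \<in> P"
  show "a \<in> P \<or> b \<in> P"
  proof (cases "a = 0 \<or> b = 0")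
    case True
    then show ?thesis using ab by (auto simp: P_def B_def vge_def)
  next
    case False
    then show ?thesis using ab by (auto simp: P_def B_def vge_def wval_mult)
  qed
qed

lemma laurent_shift:
  assumes "x \<in> laurent" "x \<noteq> 0" "0 \<le> wval x"
  shows "x * emon (\<lambda>i. - wval x * v i) \<in> B - P" "x = x * emon (\<lambda>i. - wval x * v i) * pi ^ nat (wval x)"
proof -
  have "wval (emon (\<lambda>i. - wval x * v i)) = (\<Sum>i\<le>d. - wval x * (int (w i) * v i))"
    unfolding wval_emon by (simp add: ac_simps)
  also have "\<dots> = - wval x" unfolding sum_distrib_left[symmetric] bezout by simp
  finally have wv: "wval (emon (\<lambda>i. - wval x * v i)) = - wval x" .
  then have "wval (x * emon (\<lambda>i. - wval x * v i)) = 0" using assms by (simp add: wval_mult emon_nonzero)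
  then show "x * emon (\<lambda>i. - wval x * v i) \<in> B - P"
    using assms emon_laurent emon_nonzero by (auto simp: B_def P_def vge_def intro: subring_set_mult[OF subring_set_laurent])
  have "emon (\<lambda>i. - wval x * v i) * pi ^ nat (wval x) = 1"
    using assms(3) unfolding pi_power emon_add[symmetric] by (simp add: emon_def)
  then show "x = x * emon (\<lambda>i. - wval x * v i) * pi ^ nat (wval x)" by (simp add: mult.assoc)
qed

lemma pi_P: "pi \<in> P"
  using emon_laurent wval_pi by (simp add: P_def vge_def pi_def)

text \<open>By \<open>laurent_shift\<close>, a nonzero element of a smaller prime is a power of
  \<open>pi\<close> times an element outside \<open>P\<close>. So \<open>pi\<close> lies in that
  prime, which then contains all of \<open>P\<close>, since \<open>P\<close> is generated by
  \<open>pi\<close>.\<close>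

lemma height_one_P: "height_one B P"
  unfolding height_one_def
proof (intro conjI allI impI prime_P)
  show "P \<noteq> {0}" using pi_P pi_nonzero by blast
  fix Q assume Q: "prime_of B Q \<and> Q \<subset> P"
  note QP = prime_of_ideal[of B Q]
  show "Q = {0}"
  proof (rule ccontr)
    assume "Q \<noteq> {0}"
    then obtain b where b: "b \<in> Q" "b \<noteq> 0" using ideal_of_zero[OF QP] Q by blast
    then have bP: "b \<in> laurent" "0 \<le> wval b" using Q by (auto simp: P_def vge_def)
    define b' where "b' = b * emon (\<lambda>i. - wval b * v i)"
    have b': "b' \<in> B - P" "b = b' * pi ^ nat (wval b)" using laurent_shift[OF bP(1) b(2) bP(2)] by (auto simp: b'_def)
    have piB: "pi \<in> B" using pi_P prime_of_subset[OF prime_P] by blast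
    have "pi ^ nat (wval b) \<in> Q"
      using prime_ofD[of B Q b' "pi ^ nat (wval b)"] Q b b' piB subring_set_power[OF subring_set_B] by auto
    then have "pi \<in> Q" using prime_of_power_notin[OF subring_set_B _ piB] Q by blast
    have "P \<subseteq> Q"
    proof
      fix x assume x: "x \<in> P"
      have "wval (emon (\<lambda>i. - v i)) = - 1"
        using bezout by (simp add: wval_emon sum_negf mult.commute)
      then have "x * emon (\<lambda>i. - v i) \<in> B"
        using x vge_mult[of x 1 "emon (\<lambda>i. - v i)" "- 1"] emon_laurent
        by (auto simp: P_def B_def vge_def[of "- 1"] intro: subring_set_mult[OF subring_set_laurent])
      then have "x * emon (\<lambda>i. - v i) * pi \<in> Q" using ideal_of_mult[OF QP _ \<open>pi \<in> Q\<close>] Q by blast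
      moreover have "emon (\<lambda>i. - v i) * pi = 1"
        unfolding pi_def emon_add[symmetric] by (simp add: emon_def)
      ultimately show "x \<in> Q" by (simp add: mult.assoc)
    qed
    then show False using Q by blast
  qed
qed

text \<open>If a Laurent polynomial has nonnegative weight, so has each of its monomials, because
  \<open>wt\<close> is a minimum. Such a monomial is a power of \<open>pi\<close> times a product of
  the units of \<open>wval_unit_coord\<close>.\<close>

lemma generators: "B = generate_ring ring_of_type_algebra (range ratfun_const \<union>
    ({pi} \<union> (\<lambda>j. emon (\<lambda>i. of_bool (i = j) - int (w j) * v i)) ` {..d} \<union> (\<lambda>j. emon (\<lambda>i. int (w j) * v i - of_bool (i = j))) ` {..d}))"
  (is "B = generate_ring _ (_ \<union> ?S)")
proof
  let ?G = "generate_ring ring_of_type_algebra (range ratfun_const \<union> ?S)"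
  have G: "subring_set ?G" by (rule subring_set_generate_ring)
  note L = subring_set_laurent
  show "?G \<subseteq> B"
  proof (rule generate_ring_minimal[OF subring_set_B], rule subsetI)
    fix x assume "x \<in> range ratfun_const \<union> ?S"
    then consider c where "x = ratfun_const c" | "x = pi"
      | j where "j \<le> d" "x = emon (\<lambda>i. of_bool (i = j) - int (w j) * v i)"
      | j where "j \<le> d" "x = emon (\<lambda>i. int (w j) * v i - of_bool (i = j))" by auto
    then show "x \<in> B"
    proof cases
      case 1
      then show ?thesis
        using to_fract_laurent[OF mpol_const_in, of c] wval_const[of c]
        by (cases "c = 0") (auto simp: B_def vge_def ratfun_const_def mpol_const_def)
    next
      case 2
      then show ?thesis using pi_P prime_of_subset[OF prime_P] by blast
    qed (use emon_laurent wval_unit_coord in \<open>auto simp: B_def vge_def\<close>)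
  qed
  show "B \<subseteq> ?G"
  proof
    fix z assume "z \<in> B"
    then obtain p M where z: "p \<in> mpol_in {..d}" "Poly_Mapping.keys M \<subseteq> {..d}" "z = to_fract p / mon_val ratfun_coord M"
      and ge: "z \<in> vge 0" by (auto simp: B_def laurent_def)
    define u where "u = (\<lambda>j. emon (\<lambda>i. of_bool (i = j) - int (w j) * v i))"
    define u' where "u' = (\<lambda>j. emon (\<lambda>i. int (w j) * v i - of_bool (i = j)))"
    have inc: "x \<in> ?G" if "x \<in> range ratfun_const \<union> ?S" for x using that by (rule generate_ring.incl)
    have cG: "ratfun_const c \<in> ?G" for c by (rule inc) blast
    have piG: "pi \<in> ?G" by (rule inc) blast
    have uG: "u j \<in> ?G" "u' j \<in> ?G" if "j \<le> d" for j using that unfolding u_def u'_def by (intro inc; blast)+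
    have uu': "u j * u' j = 1" for j unfolding u_def u'_def emon_add[symmetric] by (simp add: emon_def)
    have coord: "ratfun_coord j = u j * pi ^ w j" if "j \<le> d" for j
    proof -
      have "u j * pi ^ w j = emon (\<lambda>i. of_bool (i = j))"
        unfolding u_def pi_power emon_add[symmetric] by simp
      also have "\<dots> = (\<Prod>i\<le>d. if i = j then ratfun_coord j else 1)"
        unfolding emon_def by (intro prod.cong) auto
      finally show ?thesis using that by simp
    qed
    have mon: "mon_val ratfun_coord m = mon_val u m * pi ^ weight d w m" if m: "Poly_Mapping.keys m \<subseteq> {..d}" for m
      by (rule mon_val_scaled[OF coord m])
    have invu: "mon_val u m * mon_val u' m = 1" for m
      unfolding mon_val_def prod.distrib[symmetric] power_mult_distrib[symmetric] uu' by simp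
    have "z = (\<Sum>m\<in>Poly_Mapping.keys p. ratfun_const (Poly_Mapping.lookup p m) * (mon_val ratfun_coord m / mon_val ratfun_coord M))"
      unfolding z(3) by (subst mpol_expand[of p]) (simp add: to_fract_single sum_divide_distrib)
    also have "\<dots> \<in> ?G"
    proof (intro subring_set_sum[OF G] subring_set_mult[OF G] cG)
      fix m assume m: "m \<in> Poly_Mapping.keys p"
      have p0: "p \<noteq> 0" using m by auto
      have keys: "Poly_Mapping.keys m \<subseteq> {..d}" using m z(1) by (auto simp: mpol_in_def)
      have sM: "Poly_Mapping.single M (1 :: 'k) \<noteq> 0" by (metis keys_single keys_zero insert_not_empty zero_neq_one)
      have "wval z = int (wt p) - int (weight d w M)"
        unfolding z(3) mon_val_coord_to_fract using wval_divide[OF p0 sM] wt_single[OF z(2), of 1] by simp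
      moreover have "z \<noteq> 0" using p0 by (simp add: z(3) mon_val_coord_nonzero)
      ultimately have "weight d w M \<le> wt p" using ge by (simp add: vge_def)
      then have le: "weight d w M \<le> weight d w m" using wt_le_weight[OF z(1) m] by simp
      then have "pi ^ weight d w m = pi ^ weight d w M * pi ^ (weight d w m - weight d w M)" by (simp flip: power_add)
      moreover have "mon_val u M \<noteq> 0" using invu[of M] by auto
      moreover have "mon_val u' M = 1 / mon_val u M" using invu[of M] \<open>mon_val u M \<noteq> 0\<close> by (simp add: field_simps)
      ultimately have "mon_val ratfun_coord m / mon_val ratfun_coord M = mon_val u m * mon_val u' M * pi ^ (weight d w m - weight d w M)"
        unfolding mon[OF keys] mon[OF z(2)] using pi_nonzero by simp
      also have "\<dots> \<in> ?G"
        using keys z(2) uG piG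
        by (intro subring_set_mult[OF G] subring_set_power[OF G] mon_val_in_subring[OF G]) auto
      finally show "mon_val ratfun_coord m / mon_val ratfun_coord M \<in> ?G" .
    qed
    finally show "z \<in> ?G" .
  qed
qed

lemma integral_valuation:
  assumes p: "Polynomial.lead_coeff p = 1" "\<And>i. Polynomial.coeff p i \<in> vge 0" "poly p z = 0"
  shows "z \<in> vge 0"
proof (rule ccontr)
  assume "z \<notin> vge 0"
  then have z: "z \<noteq> 0" "wval z \<le> - 1" by (auto simp: vge_def)
  define N where "N = Polynomial.degree p"
  have "0 = (\<Sum>i\<le>N. Polynomial.coeff p i * z ^ i)" using p(3) by (simp add: poly_altdef N_def)
  also have "\<dots> = (\<Sum>i<N. Polynomial.coeff p i * z ^ i) + z ^ N"
    using p(1) by (simp add: N_def flip: lessThan_Suc_atMost)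
  finally have top: "z ^ N = - (\<Sum>i<N. Polynomial.coeff p i * z ^ i)" by (simp add: eq_neg_iff_add_eq_0 add.commute)
  have "(\<Sum>i<N. Polynomial.coeff p i * z ^ i) \<in> vge ((int N - 1) * wval z)"
  proof (rule vge_sum)
    fix i assume "i \<in> {..<N}"
    then have "(int N - 1) * wval z \<le> int i * wval z" using z(2) by (intro mult_right_mono_neg) auto
    moreover have "Polynomial.coeff p i * z ^ i \<in> vge (0 + int i * wval z)"
      by (intro vge_mult p(2)) (simp add: vge_def wval_power z(1))
    ultimately show "Polynomial.coeff p i * z ^ i \<in> vge ((int N - 1) * wval z)" by (auto elim: vge_mono)
  qed
  then have "z ^ N \<in> vge ((int N - 1) * wval z)" unfolding top by (rule vge_uminus)
  then have "(int N - 1) * wval z \<le> int N * wval z" using z(1) by (simp add: vge_def wval_power)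
  then show False using z(2) by (simp add: algebra_simps)
qed

text \<open>One monomial \<open>T\<close> clears the denominators of the coefficients and makes
  \<open>T * z\<close> integral over the polynomial ring. That ring is normal by
  \<open>mpol_in_normal\<close>, so \<open>z\<close> has a monomial denominator.\<close>

lemma integral_laurent:
  assumes p: "Polynomial.lead_coeff p = 1" "\<And>i. Polynomial.coeff p i \<in> laurent" "poly p z = 0"
    and z: "z \<in> function_field d"
  shows "z \<in> laurent"
proof -
  note A = subring_set_mpol_in[of "{..d}"]
  define N where "N = Polynomial.degree p"
  have "\<forall>i. \<exists>q m. q \<in> mpol_in {..d} \<and> Poly_Mapping.keys m \<subseteq> {..d} \<and> Polynomial.coeff p i = to_fract q / mon_val ratfun_coord m"
    using p(2) unfolding laurent_def by blast
  then obtain q m where qm: "\<And>i. q i \<in> mpol_in {..d}" "\<And>i. Poly_Mapping.keys (m i) \<subseteq> {..d}"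
    "\<And>i. Polynomial.coeff p i = to_fract (q i) / mon_val ratfun_coord (m i)" by metis
  define M where "M = (\<Sum>i<N. m i)"
  define T :: "'k ratfun" where "T = mon_val ratfun_coord M"
  have M: "Poly_Mapping.keys M \<subseteq> {..d}"
    unfolding M_def using qm(2) by (induction N) (auto dest!: subsetD[OF keys_add])
  have Tq: "Polynomial.coeff p i * T \<in> to_fract ` mpol_in {..d}" if "i < N" for i
  proof -
    define r where "r = (\<Sum>j\<in>{..<N} - {i}. m j)"
    have "M = m i + r" unfolding M_def r_def using that by (simp add: sum.remove[of _ i])
    then have T: "T = mon_val ratfun_coord (m i) * mon_val ratfun_coord r" by (simp add: T_def mon_val_add)
    have "Poly_Mapping.keys r \<subseteq> Poly_Mapping.keys M" unfolding \<open>M = m i + r\<close> by (auto simp: in_keys_iff lookup_add)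
    then have "q i * Poly_Mapping.single r 1 \<in> mpol_in {..d}"
      using M by (intro subring_set_mult[OF A] qm single_in_mpol_in) auto
    moreover have "Polynomial.coeff p i * T = to_fract (q i * Poly_Mapping.single r 1)"
      unfolding qm(3) T using mon_val_coord_nonzero[of "m i"] by (simp add: mon_val_coord_to_fract[of r])
    ultimately show ?thesis by blast
  qed
  have Tpow: "T ^ k \<in> to_fract ` mpol_in {..d}" for k
  proof -
    have "T ^ k = to_fract (Poly_Mapping.single M 1 ^ k)" unfolding T_def mon_val_coord_to_fract by (induction k) auto
    then show ?thesis using subring_set_power[OF A single_in_mpol_in[OF M]] by blast
  qed
  \<comment> \<open>The monic polynomial whose value at \<open>T * z\<close> is \<open>T ^ N\<close>
    times that of \<open>p\<close> at \<open>z\<close>. Each lower coefficient receives at least one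
    factor \<open>T\<close>, enough to clear its denominator.\<close>
  define p' where "p' = (\<Sum>i<N. Polynomial.monom (Polynomial.coeff p i * T ^ (N - i)) i) + Polynomial.monom 1 N"
  have cf: "Polynomial.coeff p' i = (if i < N then Polynomial.coeff p i * T ^ (N - i) else if i = N then 1 else 0)" for i
    by (auto simp: p'_def coeff_sum sum.delta)
  have deg: "Polynomial.degree p' = N"
    by (rule antisym) (auto intro!: degree_le le_degree simp: cf)
  have "poly p' (T * z) = T ^ N * poly p z"
  proof -
    have "poly p' (T * z) = (\<Sum>i<N. Polynomial.coeff p i * T ^ (N - i) * (T * z) ^ i) + (T * z) ^ N"
      by (simp add: p'_def poly_sum poly_monom)
    also have "(\<Sum>i<N. Polynomial.coeff p i * T ^ (N - i) * (T * z) ^ i) = (\<Sum>i<N. T ^ N * (Polynomial.coeff p i * z ^ i))"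
    proof (rule sum.cong[OF refl])
      fix i assume "i \<in> {..<N}"
      then have "T ^ N = T ^ (N - i) * T ^ i" by (simp flip: power_add)
      then show "Polynomial.coeff p i * T ^ (N - i) * (T * z) ^ i = T ^ N * (Polynomial.coeff p i * z ^ i)"
        by (simp only: power_mult_distrib ac_simps)
    qed
    also have "(\<Sum>i<N. T ^ N * (Polynomial.coeff p i * z ^ i)) + (T * z) ^ N = T ^ N * (\<Sum>i\<le>N. Polynomial.coeff p i * z ^ i)"
      using p(1) by (simp add: N_def sum_distrib_left power_mult_distrib distrib_left flip: lessThan_Suc_atMost)
    finally show ?thesis by (simp add: poly_altdef N_def)
  qed
  then have root: "poly p' (T * z) = 0" using p(3) by simp
  have coeffs: "Polynomial.coeff p' i \<in> to_fract ` mpol_in {..d}" for i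
  proof (cases "i < N")
    case True
    obtain a where a: "a \<in> mpol_in {..d}" "Polynomial.coeff p i * T = to_fract a" using Tq[OF True] by blast
    obtain b where b: "b \<in> mpol_in {..d}" "T ^ (N - i - 1) = to_fract b" using Tpow by blast
    have "N - i = Suc (N - i - 1)" using True by simp
    then have "T ^ (N - i) = T * T ^ (N - i - 1)" by (metis power_Suc)
    then have "Polynomial.coeff p i * T ^ (N - i) = to_fract (a * b)" using a b by (simp add: mult.assoc[symmetric])
    then have "Polynomial.coeff p i * T ^ (N - i) \<in> to_fract ` mpol_in {..d}"
      using subring_set_mult[OF A a(1) b(1)] by (metis imageI)
    then show ?thesis using True by (simp add: cf)
  next
    case False
    have "(0 :: 'k ratfun) = to_fract 0" "(1 :: 'k ratfun) = to_fract 1" by simp_all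
    then show ?thesis using False subring_set_zero[OF A] subring_set_one[OF A] by (auto simp: cf simp del: to_fract_0 to_fract_1)
  qed
  obtain a b where ab: "a \<in> mpol_in {..d}" "b \<in> mpol_in {..d}" "b \<noteq> 0" "z = to_fract a / to_fract b"
    using z unfolding function_field_iff by blast
  have "T * z = to_fract (Poly_Mapping.single M 1 * a) / to_fract b" using ab by (simp add: T_def mon_val_coord_to_fract)
  from mpol_in_normal[OF _ coeffs root _ ab(2,3) this] deg
  have "T * z \<in> to_fract ` mpol_in {..d}"
    using subring_set_mult[OF A single_in_mpol_in[OF M] ab(1)] by (simp add: cf)
  then obtain e where "e \<in> mpol_in {..d}" "z = to_fract e / T"
    using mon_val_coord_nonzero[of M] by (auto simp: T_def field_simps)
  then show ?thesis unfolding laurent_def T_def using M by blast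
qed

lemma prime_divisor_over_BP: "prime_divisor_over d B P"
  unfolding prime_divisor_over_def
proof (intro conjI allI impI)
  let ?S = "{pi} \<union> (\<lambda>j. emon (\<lambda>i. of_bool (i = j) - int (w j) * v i)) ` {..d} \<union> (\<lambda>j. emon (\<lambda>i. int (w j) * v i - of_bool (i = j))) ` {..d}"
  have "?S \<subseteq> function_field d" using emon_laurent laurent_function_field by (auto simp: pi_def)
  then show "\<exists>S. finite S \<and> S \<subseteq> function_field d \<and> B = generate_ring ring_of_type_algebra (range ratfun_const \<union> S)"
    using generators by (intro exI[of _ ?S]) auto
  show "ratfun_coord i \<in> B" if "i \<le> d" for i
    using to_fract_laurent[OF mpol_in_var, of i] wval_coord[OF that] that by (simp add: B_def vge_def ratfun_coord_def)
  show "integrally_closed_in (function_field d) B"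
    unfolding integrally_closed_in_def B_def using integral_laurent integral_valuation by blast
  show "height_one_prime P B"
    using height_one_P primeideal_iff_prime_of[OF subring_set_B]
    unfolding height_one_prime_def height_one_def subring_of_def by simp
qed

text \<open>At t = 0 the substitution behind \<open>graded\<close> becomes evaluation at the origin,
  because all weights are positive; and for a nonzero polynomial the value at t = 0 vanishes exactly
  if its weight is at least 1.\<close>

lemma has_center_P: "has_center d P (\<lambda>_. 0)"
proof -
  have "to_fract g \<in> P \<longleftrightarrow> mpol_eval (\<lambda>_. 0) g = 0" if g: "g \<in> mpol_in {..d}" for g
  proof (cases "g = 0")
    case True
    then show ?thesis using subring_set_zero[OF subring_set_laurent]
      by (simp add: P_def vge_def mpol_subst_zero[OF comm_ring_hom_id])
  next
    case False
    have hom: "comm_ring_hom (\<lambda>p. poly (graded p) 0)"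
      by unfold_locales (auto simp: graded.hom_add graded.hom_mult)
    interpret c: comm_ring_hom "mpol_const :: 'k \<Rightarrow> (nat, 'k) mpol" by (rule comm_ring_hom_mpol_const)
    interpret e: comm_ring_hom "mpol_eval (\<lambda>_. 0) :: (nat, 'k) mpol \<Rightarrow> 'k" by (rule comm_ring_hom_mpol_subst[OF comm_ring_hom_id])
    have hom2: "comm_ring_hom (\<lambda>p :: (nat, 'k) mpol. mpol_const (mpol_eval (\<lambda>_. 0) p) :: (nat, 'k) mpol)"
      by unfold_locales (auto simp: c.hom_add c.hom_mult e.hom_add e.hom_mult)
    have "poly (graded g) 0 = mpol_subst mpol_const (\<lambda>i. poly (graded (mpol_var i)) 0) g"
      unfolding comm_ring_hom_eq_mpol_subst[OF hom, of g]
      by (simp add: graded_def mpol_subst_const[OF comm_ring_hom_pCons_mpol_const])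
    also have "\<dots> = mpol_subst mpol_const (\<lambda>i. 0) g"
      using w_pos by (intro mpol_subst_cong[OF comm_ring_hom_mpol_const g])
        (fastforce simp: graded_def mpol_subst_var[OF comm_ring_hom_pCons_mpol_const] poly_monom)
    also have "\<dots> = mpol_const (mpol_eval (\<lambda>_. 0) g)"
      unfolding comm_ring_hom_eq_mpol_subst[OF hom2, of g]
      by (simp add: mpol_subst_const[OF comm_ring_hom_id] mpol_subst_var[OF comm_ring_hom_id])
    finally have "poly (graded g) 0 = mpol_const (mpol_eval (\<lambda>_. 0) g)" .
    then have "poly (graded g) 0 = 0 \<longleftrightarrow> mpol_eval (\<lambda>_. 0) g = 0"
      by (simp add: mpol_const_def) (metis keys_single keys_zero insert_not_empty single_zero)
    moreover have "poly (graded g) 0 = 0 \<longleftrightarrow> 1 \<le> wt g"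
      using graded_nonzero[OF False] order_root[of "graded g" 0] by (simp add: wt_def Suc_le_eq)
    ultimately show ?thesis
      using False to_fract_laurent[OF g] by (simp add: P_def vge_def wval_to_fract)
  qed
  then show ?thesis unfolding has_center_def by blast
qed

section \<open>Log discrepancy of the toric divisor\<close>

interpretation E: prime_divisor d B P
  by unfold_locales (rule prime_divisor_over_BP)

lemma wval_unit: assumes "u \<in> E.Ov - E.mv" shows "wval u = 0"
proof -
  have zero: "a \<noteq> 0 \<and> wval a = 0" if "a \<in> B" "a \<notin> P" for a
    using that by (auto simp: B_def P_def vge_def)
  obtain a b where u: "a \<in> B" "b \<in> B" "b \<notin> P" "b \<noteq> 0" "u = a / b" using assms by (auto elim: E.OvE)
  have "a \<notin> P" using E.mvI[of a b] u assms by auto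
  then show ?thesis using zero[of a] zero[of b] u by (simp add: divide_inverse wval_mult wval_inverse)
qed

lemma wval_Ov: assumes "u \<in> E.Ov" "u \<noteq> 0" shows "0 \<le> wval u"
proof -
  obtain a b where u: "a \<in> B" "b \<in> B" "b \<notin> P" "b \<noteq> 0" "u = a / b" using assms by (auto elim: E.OvE)
  then have "wval b = 0" "0 \<le> wval a" using assms(2) by (auto simp: B_def P_def vge_def)
  then show ?thesis using u assms(2) by (simp add: divide_inverse wval_mult wval_inverse)
qed

lemma wval_unif: "wval E.unif = 1"
proof -
  obtain h where h: "h \<in> E.Ov" "pi = E.unif * h" using pi_P E.P_mv unfolding E.unif(3) by blast
  then have "h \<noteq> 0" using pi_nonzero by auto
  then have "1 = wval E.unif + wval h" using h(2) E.unif(2) wval_pi by (simp add: wval_mult)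
  moreover have "0 \<le> wval h" using wval_Ov h(1) \<open>h \<noteq> 0\<close> by simp
  moreover have "1 \<le> wval E.unif" using E.unif(1,2) by (simp add: P_def vge_def)
  ultimately show ?thesis by simp
qed

lemma min_weight_le_val_ideal:
  assumes f: "f \<in> mpol_in {..d}" "f \<noteq> 0"
  shows "min_weight d w f \<le> val_ideal B P (hypersurface_ideal d f)"
proof -
  have "to_fract f \<in> E.Ov" "to_fract f \<noteq> 0" using f E.to_fract_in_B E.B_Ov by auto
  then obtain u n where u: "u \<in> E.Ov - E.mv" "to_fract f = u * E.unif ^ n" using E.unif_expansion by blast
  have "u \<noteq> 0" using u(1) E.zero_in_mv by auto
  then have "wval (to_fract f) = int n" unfolding u(2)
    by (simp add: wval_mult wval_power E.unif(2) wval_unit[OF u(1)] wval_unif)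
  then have "wt f = n" using wval_to_fract[OF f(2)] by simp
  then show ?thesis using min_weight_le_wt[OF f] E.val_ideal_hypersurface[OF f u] by simp
qed

text \<open>A derivation that scales every coordinate is diagonal on Laurent monomials; the
  eigenvalue pairs the exponents with the scaling factors.\<close>

lemma derivation_emon:
  assumes D: "function_field_derivation d D" and eig: "\<And>j. j \<le> d \<Longrightarrow> D (ratfun_coord j) = a j * ratfun_coord j"
  shows "D (emon n) = (\<Sum>j\<le>d. of_int (n j) * a j) * emon n"
proof -
  have powi_in: "(ratfun_coord j :: 'k ratfun) powi k \<in> function_field d" if "j \<le> d" for j k
    using ratfun_coord_in[OF that, where 'a = 'k]
    by (cases k rule: int_cases2)
      (auto simp: power_int_minus intro: subring_set_power[OF subring_set_function_field] function_field_inverse)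
  have pw: "D (ratfun_coord j ^ k) = of_nat k * a j * ratfun_coord j ^ k" if "j \<le> d" for j k
    using derivation_power[OF D ratfun_coord_in[OF that], of k] eig[OF that] by (cases k) (simp_all add: algebra_simps)
  have powi: "D (ratfun_coord j powi k) = of_int k * a j * ratfun_coord j powi k" if j: "j \<le> d" for j k
  proof (cases k rule: int_cases2)
    case (nonneg m)
    then show ?thesis using pw[OF j, of m] by simp
  next
    case (nonpos m)
    note F = subring_set_function_field[of d, where 'a = 'k]
    have x0: "ratfun_coord j ^ m \<noteq> (0 :: 'k ratfun)" by (simp add: ratfun_coord_nonzero)
    have "D (1 / ratfun_coord j ^ m) = (ratfun_coord j ^ m * D 1 - 1 * D (ratfun_coord j ^ m)) / (ratfun_coord j ^ m) ^ 2"
      by (rule derivation_divide[OF D subring_set_one[OF F] subring_set_power[OF F ratfun_coord_in[OF j]] x0])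
    also have "\<dots> = - of_nat m * a j * (1 / ratfun_coord j ^ m)"
      unfolding pw[OF j] derivation_one[OF D] using x0 by (simp add: field_simps power2_eq_square)
    finally show ?thesis by (simp add: nonpos power_int_minus divide_inverse)
  qed
  have "D (\<Prod>j\<in>I. ratfun_coord j powi n j) = (\<Sum>j\<in>I. of_int (n j) * a j) * (\<Prod>j\<in>I. ratfun_coord j powi n j)"
    if "finite I" "I \<subseteq> {..d}" for I
    using that
  proof (induction I)
    case empty
    then show ?case by (simp add: derivation_one[OF D])
  next
    case (insert j I)
    then have j: "j \<le> d" and IH: "D (\<Prod>j\<in>I. ratfun_coord j powi n j) =
        (\<Sum>j\<in>I. of_int (n j) * a j) * (\<Prod>j\<in>I. ratfun_coord j powi n j)" by auto
    have I: "(\<Prod>j\<in>I. (ratfun_coord j :: 'k ratfun) powi n j) \<in> function_field d"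
      using insert.prems by (intro subring_set_prod[OF subring_set_function_field] powi_in) auto
    show ?case
      using insert.hyps derivation_mult[OF D powi_in[OF j, of "n j"] I]
      by (simp add: powi[OF j] IH algebra_simps)
  qed
  then show ?thesis unfolding emon_def by blast
qed

text \<open>The derivations that differentiate by one coordinate and multiply by it preserve
  \<open>Ov\<close>, and their Jacobian is the product of the coordinates, of order the sum of the
  weights. One order is gained by replacing one of them with the weighted Euler derivation divided
  by \<open>pi\<close>: it kills the units of weight 0 and sends \<open>pi\<close> to 1, so it still
  preserves \<open>Ov\<close>. The Jacobian of local coordinates divides the result.\<close>

lemma canonical_coeff_less: "canonical_coeff d B P + 1 \<le> (\<Sum>i\<le>d. w i)"
proof -
  note F = subring_set_function_field[of d, where 'a = 'k] and O = E.subring_set_Ov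
  \<comment> \<open>The point where the characteristic enters: by the Bezout relation the weights
    cannot all vanish in the field, and the Euler derivation may replace the derivation at an index
    whose weight is nonzero there.\<close>
  have "\<exists>i0\<le>d. of_nat (w i0) \<noteq> (0 :: 'k)"
  proof (rule ccontr)
    assume "\<not> ?thesis"
    then have "of_int (\<Sum>i\<le>d. int (w i) * v i) = (0 :: 'k)" by simp
    then show False unfolding bezout by simp
  qed
  then obtain i0 where i0: "i0 \<le> d" "of_nat (w i0) \<noteq> (0 :: 'k)" by blast
  have nat_const: "(of_nat n :: 'k ratfun) = ratfun_const (of_nat n)" for n
  proof -
    interpret h: comm_ring_hom "ratfun_const :: 'k \<Rightarrow> 'k ratfun" by (rule comm_ring_hom_ratfun_const)
    show ?thesis by (simp add: h.hom_of_nat)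
  qed
  have pi_in: "inverse pi \<in> function_field d"
    using emon_laurent laurent_function_field by (auto simp: pi_def intro: function_field_inverse)
  define c where "c = (\<lambda>i j. if i = i0 then inverse pi * of_nat (w j) else of_bool (i = j))"
  define E where "E = (\<lambda>i z. \<Sum>j\<le>d. c i j * ratfun_coord j * ratfun_deriv j z)"
  have c_in: "c i j * ratfun_coord j \<in> function_field d" if "j \<le> d" for i j
    using that pi_in ratfun_const_in ratfun_coord_in subring_set_one[OF F] subring_set_zero[OF F]
    by (auto simp: c_def nat_const intro!: subring_set_mult[OF F])
  have E: "function_field_derivation d (E i)" for i
    unfolding function_field_derivation_def
  proof (intro conjI ballI allI)
    show "E i g \<in> function_field d" if "g \<in> function_field d" for g
      unfolding E_def using that
      by (intro subring_set_sum[OF F] subring_set_mult[OF F c_in ratfun_deriv_in]) auto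
  qed (simp_all add: E_def ratfun_deriv_const ratfun_deriv_add ratfun_deriv_mult sum.distrib sum_distrib_left algebra_simps)
  have coord: "E i (ratfun_coord j) = c i j * ratfun_coord j" if "j \<le> d" for i j
    using that by (simp add: E_def ratfun_deriv_coord of_bool_def if_distrib cong: if_cong)
  have emon: "E i (emon n) = (if i = i0 then inverse pi * of_int (wval (emon n)) else of_int (n i)) * emon n" if "i \<le> d" for i n
  proof -
    have "(\<Sum>j\<le>d. of_int (n j) * c i j) = (if i = i0 then inverse pi * of_int (wval (emon n)) else of_int (n i))"
    proof (cases "i = i0")
      case True
      then show ?thesis by (simp add: c_def wval_emon sum_distrib_left algebra_simps)
    next
      case False
      have "(\<Sum>j\<le>d. of_int (n j) * c i j) = (\<Sum>j\<le>d. if i = j then of_int (n i) else 0)"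
        using False by (intro sum.cong) (auto simp: c_def)
      then show ?thesis using that False by simp
    qed
    then show ?thesis using derivation_emon[OF E coord] by simp
  qed
  have Ov: "E i g \<in> E.Ov" if "i \<le> d" "g \<in> E.Ov" for i g
  proof (rule E.derivation_preserves_Ov[OF E generators _ that(2)])
    fix s
    assume s: "s \<in> {pi} \<union> (\<lambda>j. emon (\<lambda>i. of_bool (i = j) - int (w j) * v i)) ` {..d} \<union>
      (\<lambda>j. emon (\<lambda>i. int (w j) * v i - of_bool (i = j))) ` {..d}"
    have "s \<in> B" unfolding generators by (rule generate_ring.incl) (use s in blast)
    then have sO: "s \<in> E.Ov" using E.B_Ov by blast
    have "s = pi \<or> wval s = 0" using s wval_unit_coord by auto
    moreover obtain n where n: "s = emon n" using s by (auto simp: pi_def)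
    ultimately show "E i s \<in> E.Ov"
      using emon[OF that(1), of n] sO wval_pi pi_nonzero subring_set_zero[OF O] subring_set_one[OF O] subring_set_of_int[OF O]
      by (auto intro: subring_set_mult[OF O])
  qed
  obtain y D where y: "local_coordinates d B P y D" using E.local_coordinates_exist by blast
  obtain h where h: "h \<in> E.Ov" "jacobian d E = h * jacobian d D"
    using E.jacobian_divides[OF y, of E] E Ov by blast
  obtain u where u: "u \<in> E.Ov - E.mv" "jacobian d D = u * E.unif ^ canonical_coeff d B P"
    using E.jacobian_expansion[OF y] by blast
  define n where "n = d + 1"
  have "jacobian d E = Determinant.det (mat n n (\<lambda>(i, j). ratfun_coord j * c i j))"
    unfolding jacobian_def n_def
    by (intro arg_cong[of _ _ Determinant.det] eq_matI) (auto simp: coord mult.commute)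
  also have "\<dots> = (\<Prod>j<n. ratfun_coord j) * Determinant.det (mat n n (\<lambda>(i, j). c i j))"
    by (rule det_scale_cols)
  also have "Determinant.det (mat n n (\<lambda>(i, j). c i j)) = Determinant.det (mat n n (\<lambda>(i, j). c j i))"
  proof -
    have "mat n n (\<lambda>(i, j). c j i) = Matrix.transpose_mat (mat n n (\<lambda>(i, j). c i j))" by (rule eq_matI) auto
    then show ?thesis by (simp add: Determinant.det_transpose[of _ n])
  qed
  also have "mat n n (\<lambda>(i, j). c j i) =
      mat n n (\<lambda>(i, j). if j = i0 then \<Sum>l<n. of_bool (i = l) * (inverse pi * of_nat (w l)) else of_bool (i = j))"
    by (rule eq_matI) (auto simp: c_def of_bool_def if_distrib[of "\<lambda>x. x * _"] cong: if_cong)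
  also have "Determinant.det \<dots> = inverse pi * of_nat (w i0) * Determinant.det (mat n n (\<lambda>(i, j). of_bool (i = j)))"
    using i0(1) by (intro det_cramer_col) (simp add: n_def)
  also have "mat n n (\<lambda>(i, j). of_bool (i = j) :: 'k ratfun) = 1\<^sub>m n" by (rule eq_matI) auto
  finally have J: "jacobian d E = (\<Prod>j<n. ratfun_coord j) * (inverse pi * ratfun_const (of_nat (w i0)))"
    by (simp add: nat_const)
  have const_nonzero: "ratfun_const c \<noteq> (0 :: 'k ratfun)" if "c \<noteq> 0" for c
    using that by (simp add: ratfun_const_def mpol_const_def) (metis keys_single keys_zero insert_not_empty)
  then have c0: "ratfun_const (of_nat (w i0)) \<noteq> (0 :: 'k ratfun)" using i0(2) by blast
  have "wval (jacobian d E) = (\<Sum>j<n. wval (ratfun_coord j)) - 1"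
    unfolding J using c0 i0(2)
    by (simp add: wval_mult wval_prod ratfun_coord_nonzero pi_nonzero wval_inverse wval_pi wval_const)
  also have "\<dots> = (\<Sum>j\<le>d. int (w j)) - 1"
    by (simp add: n_def wval_coord lessThan_Suc_atMost)
  finally have wE: "wval (jacobian d E) = (\<Sum>j\<le>d. int (w j)) - 1" .
  have "jacobian d E \<noteq> 0" unfolding J using c0 by (simp add: ratfun_coord_nonzero pi_nonzero)
  then have nz: "h \<noteq> 0" "u \<noteq> 0" using h(2) u(2) by auto
  then have "wval (jacobian d E) = wval h + int (canonical_coeff d B P)"
    unfolding h(2) u(2) using E.unif(2) wval_unit[OF u(1)] by (simp add: wval_mult wval_power wval_unif)
  then have "int (canonical_coeff d B P + 1) \<le> int (\<Sum>j\<le>d. w j)" using wE wval_Ov[OF h(1) nz(1)] by simp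
  then show ?thesis by (simp only: of_nat_le_iff)
qed

end

theorem toric_divisor:
  fixes f :: "(nat, 'k::field) mpol"
  assumes w: "\<And>i. i \<le> d \<Longrightarrow> 1 \<le> w i" and bezout: "(\<Sum>i\<le>d. int (w i) * v i) = 1"
    and f: "f \<in> mpol_in {..d}" "f \<noteq> 0"
  shows "\<exists>B P. prime_divisor_over d B P \<and> has_center d P (\<lambda>_. 0 :: 'k) \<and>
    canonical_coeff d B P + 1 + min_weight d w f \<le> (\<Sum>i\<le>d. w i) + val_ideal B P (hypersurface_ideal d f)"
proof -
  interpret toric_weight d w v "TYPE('k)" by unfold_locales (fact w bezout)+
  show ?thesis
    using prime_divisor_over_BP has_center_P canonical_coeff_less min_weight_le_val_ideal[OF f]
    by (intro exI[of _ B] exI[of _ P]) simp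
qed

section \<open>Jets\<close>

lemma mpol_subst_compose:
  assumes "comm_ring_hom h" "comm_ring_hom g"
  shows "g (mpol_subst h a p) = mpol_subst (\<lambda>c. g (h c)) (\<lambda>v. g (a v)) p"
proof -
  interpret h: comm_ring_hom "mpol_subst h a" by (rule comm_ring_hom_mpol_subst[OF assms(1)])
  interpret g: comm_ring_hom g by (rule assms(2))
  have "comm_ring_hom (\<lambda>p. g (mpol_subst h a p))"
    by unfold_locales (auto simp: h.hom_add h.hom_mult g.hom_add g.hom_mult)
  from comm_ring_hom_eq_mpol_subst[OF this, of p]
  show ?thesis by (simp add: mpol_subst_const[OF assms(1)] mpol_subst_var[OF assms(1)])
qed

lemma comm_ring_hom_pCons: "comm_ring_hom h \<Longrightarrow> comm_ring_hom (\<lambda>c. [:h c:])"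
proof -
  assume "comm_ring_hom h"
  then interpret comm_ring_hom h .
  show ?thesis by unfold_locales (auto simp: hom_add hom_mult one_pCons)
qed

lemma comm_ring_hom_map_poly: "comm_ring_hom g \<Longrightarrow> comm_ring_hom (map_poly g)"
proof -
  assume "comm_ring_hom g"
  then interpret g: map_poly_comm_ring_hom g by (simp add: map_poly_comm_ring_hom_def)
  show ?thesis by unfold_locales
qed

text \<open>The coordinate \<open>i\<close> of a jet divided by t ^ w i, once its coefficients below
  \<open>w i\<close> are zero.\<close>

definition jet_tail :: "nat \<Rightarrow> (nat \<Rightarrow> nat) \<Rightarrow> (nat \<times> nat \<Rightarrow> 'b::comm_ring_1) \<Rightarrow> nat \<Rightarrow> 'b poly" where
  "jet_tail m w \<rho> i = (\<Sum>j\<in>{w i..m}. Polynomial.monom (\<rho> (i, j)) (j - w i))"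

lemma coeff_jet_tail: "Polynomial.coeff (jet_tail m w \<rho> i) s = (if w i + s \<le> m then \<rho> (i, w i + s) else 0)"
proof -
  have "Polynomial.coeff (jet_tail m w \<rho> i) s = (\<Sum>j\<in>{w i..m}. if j = w i + s then \<rho> (i, j) else 0)"
    unfolding jet_tail_def coeff_sum by (intro sum.cong) auto
  then show ?thesis by (simp add: sum.delta)
qed

text \<open>The coordinates become t ^ w i times \<open>jet_tail\<close>, so a monomial of
  \<open>f\<close> contributes its value on the tails, shifted by its weight.\<close>

lemma jet_equation_subst:
  fixes \<rho> :: "nat \<times> nat \<Rightarrow> 'b::comm_ring_1"
  assumes h: "comm_ring_hom h" and f: "f \<in> mpol_in {..d}"
    and \<rho>: "\<And>i j. i \<le> d \<Longrightarrow> j < w i \<Longrightarrow> \<rho> (i, j) = 0"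
  shows "mpol_subst h \<rho> (jet_equation m f l) = (\<Sum>\<mu>\<in>Poly_Mapping.keys f. if weight d w \<mu> \<le> l
      then h (Poly_Mapping.lookup f \<mu>) * Polynomial.coeff (mon_val (jet_tail m w \<rho>) \<mu>) (l - weight d w \<mu>) else 0)"
proof -
  let ?\<Phi> = "mpol_subst h \<rho>"
  have \<Phi>: "comm_ring_hom ?\<Phi>" by (rule comm_ring_hom_mpol_subst[OF h])
  interpret \<Phi>: comm_ring_hom ?\<Phi> by (rule \<Phi>)
  interpret m: comm_ring_hom "map_poly ?\<Phi>" by (rule comm_ring_hom_map_poly[OF \<Phi>])
  note H = comm_ring_hom_pCons[OF h]
  let ?t = "Polynomial.monom 1 1 :: 'b poly"
  have t: "?t ^ n = Polynomial.monom 1 n" for n using monom_power[of 1 1 n] by (simp only: mult_1 power_one)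
  define u where "u = (\<lambda>i. map_poly ?\<Phi> (universal_jet m i))"
  have u: "u i = jet_tail m w \<rho> i * ?t ^ w i" if i: "i \<le> d" for i
  proof -
    have mono: "map_poly ?\<Phi> (Polynomial.monom a n) = Polynomial.monom (?\<Phi> a) n" for a n
      by (rule poly_eqI) (simp add: coeff_map_poly)
    have "u i = (\<Sum>j\<le>m. Polynomial.monom (\<rho> (i, j)) j)"
      unfolding u_def universal_jet_def by (simp add: m.hom_sum mono mpol_subst_var[OF h])
    also have "\<dots> = (\<Sum>j\<in>{w i..m}. Polynomial.monom (\<rho> (i, j)) j)"
      using \<rho>[OF i] by (intro sum.mono_neutral_right) (auto simp: not_le)
    also have "\<dots> = (\<Sum>j\<in>{w i..m}. Polynomial.monom (\<rho> (i, j)) (j - w i) * ?t ^ w i)"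
      unfolding t by (intro sum.cong) (auto simp: mult_monom)
    finally show ?thesis by (simp add: jet_tail_def sum_distrib_right)
  qed
  have cst: "map_poly ?\<Phi> [:a:] = [:?\<Phi> a:]" for a
    by (rule poly_eqI) (simp add: coeff_map_poly coeff_pCons split: nat.split)
  have "map_poly ?\<Phi> (mpol_subst (\<lambda>c. [:mpol_const c:]) (universal_jet m) f) = mpol_subst (\<lambda>c. [:h c:]) u f"
    unfolding mpol_subst_compose[OF comm_ring_hom_pCons_mpol_const comm_ring_hom_map_poly[OF \<Phi>]]
    by (simp add: u_def cst mpol_subst_const[OF h])
  also have "\<dots> = (\<Sum>\<mu>\<in>Poly_Mapping.keys f. [:h (Poly_Mapping.lookup f \<mu>):] * mon_val u \<mu>)"
    by (rule mpol_subst_superset[OF H]) auto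
  also have "\<dots> = (\<Sum>\<mu>\<in>Poly_Mapping.keys f. [:h (Poly_Mapping.lookup f \<mu>):] *
      (mon_val (jet_tail m w \<rho>) \<mu> * ?t ^ weight d w \<mu>))"
    using f by (intro sum.cong refl arg_cong2[where f = "(*)"] mon_val_scaled[OF u]) (auto simp: mpol_in_def)
  finally have eq: "map_poly ?\<Phi> (mpol_subst (\<lambda>c. [:mpol_const c:]) (universal_jet m) f) = \<dots>" .
  have "?\<Phi> (jet_equation m f l) =
      Polynomial.coeff (map_poly ?\<Phi> (mpol_subst (\<lambda>c. [:mpol_const c:]) (universal_jet m) f)) l"
    unfolding jet_equation_def by (simp add: coeff_map_poly)
  then show ?thesis
    unfolding eq t by (auto simp: coeff_sum coeff_monom_mult mult.left_commute mult.commute[of _ "Polynomial.monom _ _"] intro!: sum.cong)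
qed

lemma jet_equation_subst_below:
  assumes "comm_ring_hom h" "f \<in> mpol_in {..d}" "\<And>i j. i \<le> d \<Longrightarrow> j < w i \<Longrightarrow> \<rho> (i, j) = 0"
    and "l < min_weight d w f"
  shows "mpol_subst h \<rho> (jet_equation m f l) = 0"
proof -
  have "\<not> weight d w \<mu> \<le> l" if "\<mu> \<in> Poly_Mapping.keys f" for \<mu>
    using min_weight_le[OF that, of d w] assms(4) by simp
  then show ?thesis
    by (subst jet_equation_subst[where d = d and w = w]) (use assms in \<open>auto intro!: sum.neutral\<close>)
qed

text \<open>At order \<open>r\<close> above the minimal weight, a monomial of larger weight meets
  only tail coefficients of index below \<open>r\<close>, which lie in \<open>A\<close>. Up to
  \<open>A\<close> the equation is therefore a coefficient of the initial part; this makes the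
  system of jet equations triangular.\<close>

lemma jet_equation_subst_split:
  fixes \<rho> :: "nat \<times> nat \<Rightarrow> 'b::comm_ring_1"
  assumes h: "comm_ring_hom h" and f: "f \<in> mpol_in {..d}"
    and \<rho>: "\<And>i j. i \<le> d \<Longrightarrow> j < w i \<Longrightarrow> \<rho> (i, j) = 0"
    and A: "subring_set A" "\<And>c. h c \<in> A" "\<And>i s. i \<le> d \<Longrightarrow> s < r \<Longrightarrow> Polynomial.coeff (jet_tail m w \<rho> i) s \<in> A"
  shows "mpol_subst h \<rho> (jet_equation m f (min_weight d w f + r)) -
    Polynomial.coeff (mpol_subst (\<lambda>c. [:h c:]) (jet_tail m w \<rho>) (init_part d w f)) r \<in> A"
proof -
  let ?l = "min_weight d w f" and ?K = "Poly_Mapping.keys f"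
  define c where "c = (\<lambda>\<mu> s. h (Poly_Mapping.lookup f \<mu>) * Polynomial.coeff (mon_val (jet_tail m w \<rho>) \<mu>) s)"
  note H = comm_ring_hom_pCons[OF h]
  interpret H: comm_ring_hom "mpol_subst (\<lambda>c. [:h c:]) (jet_tail m w \<rho>)" by (rule comm_ring_hom_mpol_subst[OF H])
  have S: "subring_set {p. \<forall>s<r. Polynomial.coeff p s \<in> A}"
    unfolding subring_set_def
    by (auto simp: coeff_mult coeff_1 subring_set_closed[OF A(1)]
      intro!: subring_set_sum[OF A(1)] subring_set_mult[OF A(1)])
  have "Polynomial.coeff (mpol_subst (\<lambda>c. [:h c:]) (jet_tail m w \<rho>) (init_part d w f)) r =
      (\<Sum>\<mu> | \<mu> \<in> ?K \<and> weight d w \<mu> = ?l. c \<mu> r)"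
    unfolding init_part_def c_def by (simp add: H.hom_sum mpol_subst_single[OF H] coeff_sum)
  also have "\<dots> = (\<Sum>\<mu>\<in>?K. if weight d w \<mu> = ?l then c \<mu> r else 0)"
    by (simp add: sum.inter_filter)
  finally have init: "Polynomial.coeff (mpol_subst (\<lambda>c. [:h c:]) (jet_tail m w \<rho>) (init_part d w f)) r =
      (\<Sum>\<mu>\<in>?K. if weight d w \<mu> = ?l then c \<mu> r else 0)" .
  have "(if weight d w \<mu> \<le> ?l + r then c \<mu> (?l + r - weight d w \<mu>) else 0) -
      (if weight d w \<mu> = ?l then c \<mu> r else 0) \<in> A" if \<mu>: "\<mu> \<in> ?K" for \<mu>
  proof -
    have le: "?l \<le> weight d w \<mu>" by (rule min_weight_le[OF \<mu>])
    have "mon_val (jet_tail m w \<rho>) \<mu> \<in> {p. \<forall>s<r. Polynomial.coeff p s \<in> A}"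
      using A(3) f \<mu> by (intro mon_val_in_subring[OF S]) (auto simp: mpol_in_def)
    then have cA: "c \<mu> s \<in> A" if "s < r" for s
      unfolding c_def using that by (intro subring_set_mult[OF A(1)] A(2)) auto
    consider "weight d w \<mu> = ?l" | "?l < weight d w \<mu>" "weight d w \<mu> \<le> ?l + r" | "?l + r < weight d w \<mu>" using le by linarith
    then show ?thesis
      using subring_set_zero[OF A(1)] by cases (auto intro!: cA)
  qed
  moreover have "mpol_subst h \<rho> (jet_equation m f (?l + r)) =
      (\<Sum>\<mu>\<in>?K. if weight d w \<mu> \<le> ?l + r then c \<mu> (?l + r - weight d w \<mu>) else 0)"
    unfolding c_def by (rule jet_equation_subst[OF h f]) (rule \<rho>)
  ultimately show ?thesis
    unfolding init by (simp only: sum_subtractf[symmetric]) (intro subring_set_sum[OF A(1)])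
qed

text \<open>Taylor expansion of \<open>g(U)\<close> with respect to the coefficient of \<open>t\<^sup>r\<close> in \<open>U\<^sub>v\<close>.\<close>

lemma coeff_mpol_subst_linear:
  fixes U :: "nat \<Rightarrow> 'b::comm_ring_1 poly"
  assumes h: "comm_ring_hom h" and A: "subring_set A" "\<And>c. h c \<in> A" and r: "1 \<le> r"
    and low: "\<And>i s. i \<in> V \<Longrightarrow> s < r \<Longrightarrow> Polynomial.coeff (U i) s \<in> A"
    and top: "\<And>i. i \<in> V \<Longrightarrow> i \<noteq> v \<Longrightarrow> Polynomial.coeff (U i) r \<in> A"
    and g: "g \<in> mpol_in V"
  shows "Polynomial.coeff (mpol_subst (\<lambda>c. [:h c:]) U g) r -
    mpol_subst h (\<lambda>i. Polynomial.coeff (U i) 0) (mpol_deriv v g) * Polynomial.coeff (U v) r \<in> A"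
proof -
  note H = comm_ring_hom_pCons[OF h]
  let ?G = "mpol_subst (\<lambda>c. [:h c:]) U" and ?b = "mpol_subst h (\<lambda>i. Polynomial.coeff (U i) 0)"
  let ?z = "Polynomial.coeff (U v) r"
  interpret G: comm_ring_hom ?G by (rule comm_ring_hom_mpol_subst[OF H])
  interpret b: comm_ring_hom ?b by (rule comm_ring_hom_mpol_subst[OF h])
  interpret h: comm_ring_hom h by (rule h)
  \<comment> \<open>The coefficients below \<open>r\<close> are carried along, since they enter the
    coefficient of degree \<open>r\<close> of a product.\<close>
  define T where "T = {g. (\<forall>s<r. Polynomial.coeff (?G g) s \<in> A) \<and> Polynomial.coeff (?G g) r - ?b (mpol_deriv v g) * ?z \<in> A}"
  have zero: "Polynomial.coeff (?G g) 0 = ?b g" for g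
  proof -
    have p0: "comm_ring_hom (\<lambda>p :: 'b poly. poly p 0)" by unfold_locales auto
    show ?thesis
      using mpol_subst_compose[OF H p0, of U g] by (simp add: poly_0_coeff_0)
  qed
  have "subring_set T"
    unfolding subring_set_def
  proof (intro conjI ballI)
    show "1 \<in> T" using r by (auto simp: T_def coeff_1 subring_set_zero[OF A(1)] subring_set_one[OF A(1)])
    fix p q assume p: "p \<in> T" and q: "q \<in> T"
    have "Polynomial.coeff (?G p) r - Polynomial.coeff (?G q) r - ?b (mpol_deriv v p - mpol_deriv v q) * ?z =
        (Polynomial.coeff (?G p) r - ?b (mpol_deriv v p) * ?z) - (Polynomial.coeff (?G q) r - ?b (mpol_deriv v q) * ?z)"
      by (simp add: b.hom_minus algebra_simps)
    also have "\<dots> \<in> A" by (rule subring_set_diff[OF A(1)]) (use p q in \<open>simp_all add: T_def\<close>)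
    finally show "p - q \<in> T"
      using p q by (simp add: T_def G.hom_minus mpol_deriv_diff subring_set_diff[OF A(1)])
    obtain r' where r': "r = Suc r'" using r by (cases r) auto
    have bA: "?b p \<in> A" "?b q \<in> A" using p q r unfolding zero[symmetric] by (auto simp: T_def)
    have "Polynomial.coeff (?G p * ?G q) r =
        ?b p * Polynomial.coeff (?G q) r + ?b q * Polynomial.coeff (?G p) r +
        (\<Sum>i\<in>{1..r'}. Polynomial.coeff (?G p) i * Polynomial.coeff (?G q) (r - i))"
    proof -
      have "{..r} = insert 0 (insert r {1..r'})" using r' by auto
      then show ?thesis using r' by (simp add: coeff_mult zero[symmetric] algebra_simps)
    qed
    then have "Polynomial.coeff (?G (p * q)) r - ?b (mpol_deriv v (p * q)) * ?z =
        ?b p * (Polynomial.coeff (?G q) r - ?b (mpol_deriv v q) * ?z) +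
        ?b q * (Polynomial.coeff (?G p) r - ?b (mpol_deriv v p) * ?z) +
        (\<Sum>i\<in>{1..r'}. Polynomial.coeff (?G p) i * Polynomial.coeff (?G q) (r - i))"
      by (simp add: G.hom_mult mpol_deriv_mult b.hom_add b.hom_mult algebra_simps)
    also have "\<dots> \<in> A"
    proof (intro subring_set_add[OF A(1)] subring_set_sum[OF A(1)])
      show "?b p * (Polynomial.coeff (?G q) r - ?b (mpol_deriv v q) * ?z) \<in> A"
        "?b q * (Polynomial.coeff (?G p) r - ?b (mpol_deriv v p) * ?z) \<in> A"
        using p q by (intro subring_set_mult[OF A(1)] bA; simp add: T_def)+
      show "Polynomial.coeff (?G p) i * Polynomial.coeff (?G q) (r - i) \<in> A" if "i \<in> {1..r'}" for i
        using p q r' that by (intro subring_set_mult[OF A(1)]) (auto simp: T_def)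
    qed
    finally have "Polynomial.coeff (?G (p * q)) r - ?b (mpol_deriv v (p * q)) * ?z \<in> A" .
    moreover have "Polynomial.coeff (?G (p * q)) s \<in> A" if "s < r" for s
      unfolding G.hom_mult coeff_mult using p q that
      by (intro subring_set_sum[OF A(1)] subring_set_mult[OF A(1)]) (auto simp: T_def)
    ultimately show "p * q \<in> T" by (simp add: T_def)
  qed
  moreover have "mpol_const c \<in> T" for c
    using r A(2) subring_set_zero[OF A(1)]
    by (auto simp: T_def mpol_subst_const[OF H] coeff_pCons split: nat.splits)
  moreover have "mpol_var i \<in> T" if "i \<in> V" for i
    using low[OF that] top[OF that] subring_set_zero[OF A(1)]
    by (cases "i = v") (auto simp: T_def mpol_subst_var[OF H] mpol_deriv_var)
  ultimately have "mpol_in V \<subseteq> T" by (intro mpol_in_subset_subring)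
  then show ?thesis using g by (auto simp: T_def)
qed

text \<open>The derivative of a polynomial is read off from its Taylor expansion at \<open>b v\<close>, because
  \<open>pderiv\<close> is not available over rings with zero divisors.\<close>

lemma mpol_subst_univariate:
  fixes b :: "nat \<Rightarrow> 'b::comm_ring_1" and v :: nat
  assumes h: "comm_ring_hom h"
  defines "G \<equiv> mpol_subst (\<lambda>c. [:h c:]) (\<lambda>i. if i = v then [:0, 1:] else [:b i:])"
  shows "poly (G g) (b v) = mpol_subst h b g"
    and "Polynomial.coeff (pcompose (G g) [:b v, 1:]) 1 = mpol_subst h b (mpol_deriv v g)"
proof -
  note H = comm_ring_hom_pCons[OF h]
  interpret G: comm_ring_hom G unfolding G_def by (rule comm_ring_hom_mpol_subst[OF H])
  interpret b: comm_ring_hom "mpol_subst h b" by (rule comm_ring_hom_mpol_subst[OF h])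
  have ev: "poly (G g) (b v) = mpol_subst h b g" for g
  proof -
    have p0: "comm_ring_hom (\<lambda>p :: 'b poly. poly p (b v))" by unfold_locales auto
    have "poly (G g) (b v) = mpol_subst h (\<lambda>i. poly (if i = v then [:0, 1:] else [:b i:]) (b v)) g"
      unfolding G_def using mpol_subst_compose[OF H p0] by simp
    also have "(\<lambda>i. poly (if i = v then [:0, 1:] else [:b i:]) (b v)) = b" by auto
    finally show ?thesis .
  qed
  show "poly (G g) (b v) = mpol_subst h b g" by (rule ev)
  let ?C = "\<lambda>g. pcompose (G g) [:b v, 1:]"
  have c0: "Polynomial.coeff (?C g) 0 = mpol_subst h b g" for g
    unfolding ev[symmetric] poly_0_coeff_0[symmetric] by (simp add: poly_pcompose)
  define T where "T = {g. Polynomial.coeff (?C g) 1 = mpol_subst h b (mpol_deriv v g)}"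
  have "subring_set T"
    unfolding subring_set_def
  proof (intro conjI ballI)
    show "1 \<in> T" by (simp add: T_def pcompose_1)
    fix p q assume pq: "p \<in> T" "q \<in> T"
    then show "p - q \<in> T" by (simp add: T_def G.hom_minus pcompose_diff mpol_deriv_diff b.hom_minus)
    have "Polynomial.coeff (?C p * ?C q) 1 =
        Polynomial.coeff (?C p) 0 * Polynomial.coeff (?C q) 1 + Polynomial.coeff (?C p) 1 * Polynomial.coeff (?C q) 0"
      by (simp add: coeff_mult)
    then show "p * q \<in> T"
      using pq unfolding T_def c0
      by (simp add: G.hom_mult pcompose_mult mpol_deriv_mult b.hom_add b.hom_mult mult.commute)
  qed
  moreover have "mpol_const c \<in> T" for c by (simp add: T_def G_def mpol_subst_const[OF H])
  moreover have "mpol_var i \<in> T" for i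
    by (simp add: T_def G_def mpol_subst_var[OF H] mpol_deriv_var pcompose_pCons)
  ultimately have "mpol_in UNIV \<subseteq> T" by (intro mpol_in_subset_subring)
  then show "Polynomial.coeff (?C g) 1 = mpol_subst h b (mpol_deriv v g)" by (auto simp: T_def mpol_in_def)
qed

text \<open>Used in contraposed form: if the derivative at a point is nonzero modulo a prime, the
  polynomial has a coefficient of positive degree outside that prime, so that
  \<open>algebraic_root\<close> applies.\<close>

lemma pcompose_coeff_1_in_ideal:
  assumes A: "subring_set A" and J: "ideal_of A J" and z: "z \<in> A"
    and G: "\<And>k. 1 \<le> k \<Longrightarrow> Polynomial.coeff G k \<in> J"
  shows "Polynomial.coeff (pcompose G [:z, 1:]) 1 \<in> J"
proof -
  have "pcompose G [:z, 1:] = (\<Sum>i\<le>Polynomial.degree G. [:Polynomial.coeff G i:] * [:z, 1:] ^ i)"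
    unfolding pcompose_altdef poly_altdef by (simp add: coeff_map_poly degree_map_poly)
  then have "Polynomial.coeff (pcompose G [:z, 1:]) 1 =
      (\<Sum>i\<le>Polynomial.degree G. Polynomial.coeff G i * Polynomial.coeff ([:z, 1:] ^ i) 1)"
    by (simp add: coeff_sum)
  also have "\<dots> \<in> J"
  proof (rule ideal_of_sum[OF J])
    fix i
    have "[:z, 1:] \<in> {p. \<forall>k. Polynomial.coeff p k \<in> A}"
      using z subring_set_zero[OF A] subring_set_one[OF A] by (auto simp: coeff_pCons split: nat.splits)
    then have "[:z, 1:] ^ i \<in> {p. \<forall>k. Polynomial.coeff p k \<in> A}"
      by (rule subring_set_power[OF subring_set_polys[OF A]])
    then show "Polynomial.coeff G i * Polynomial.coeff ([:z, 1:] ^ i) 1 \<in> J"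
      using G[of i] ideal_of_zero[OF J] by (cases "i = 0") (auto simp del: power_Suc intro!: ideal_of_mult_right[OF J])
  qed
  finally show ?thesis .
qed

text \<open>A root \<open>z\<close> modulo \<open>P\<close> of a polynomial of degree \<open>e\<close> modulo \<open>P\<close> with coefficients in the
  operator ring: the leading coefficient \<open>q\<close> makes multiplication by \<open>q z\<close> preserve the box
  filtration that has the powers \<open>z\<^sup>k\<close>, \<open>k < e\<close>, as module generators.\<close>

lemma (in box_filtration) algebraic_root:
  assumes Zdef: "Z = (\<lambda>k. z ^ k) ` {..<e}" and z: "z \<in> A"
    and G: "\<And>k. op (Polynomial.coeff G k)" "poly G z \<in> P" "Polynomial.coeff G e \<notin> P"
      "\<And>k. e < k \<Longrightarrow> Polynomial.coeff G k \<in> P"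
  shows "z \<in> algebraic_elems"
proof -
  interpret \<kappa>: comm_ring_hom \<kappa> by (rule \<kappa>)
  define q where "q = Polynomial.coeff G e"
  have zin: "z ^ k \<in> bspan 0" if "k < e" for k
    using bspan_gen[of "\<lambda>_. 0" 0 "z ^ k" 1] that by (simp add: Zdef)
  have opA: "s \<in> A" if "op s" for s using that by (simp add: op_def)
  have op_span: "\<exists>D. s * z ^ k \<in> bspan D" if "op s" "k < e" for s k
    using that(1) zin[OF that(2)] unfolding op_def by blast
  have span_sum: "\<exists>D. (\<Sum>k\<in>K. Polynomial.coeff G k * z ^ k) \<in> bspan D" if "finite K" "K \<subseteq> {..<e}" for K
    using that
  proof (induction K)
    case empty
    then show ?case using bspan_P[OF ideal_of_zero[OF I]] by auto
  next
    case (insert k K)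
    then obtain D E where D: "Polynomial.coeff G k * z ^ k \<in> bspan D" and E: "(\<Sum>k\<in>K. Polynomial.coeff G k * z ^ k) \<in> bspan E"
      using op_span[OF G(1), of k k] by auto
    have "Polynomial.coeff G k * z ^ k + (\<Sum>k\<in>K. Polynomial.coeff G k * z ^ k) \<in> bspan (max D E)"
      by (intro bspan_add) (auto intro: bspan_mono[OF D] bspan_mono[OF E])
    then show ?case using insert.hyps by auto
  qed
  have e: "e \<le> Polynomial.degree G"
    using G(3) ideal_of_zero[OF I] by (intro le_degree) auto
  have top: "\<exists>D. q * z ^ e \<in> bspan D"
  proof -
    let ?R = "\<Sum>k\<in>{e<..Polynomial.degree G}. Polynomial.coeff G k * z ^ k"
    let ?L = "\<Sum>k\<in>{..<e}. Polynomial.coeff G k * z ^ k"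
    \<comment> \<open>The terms above degree \<open>e\<close> lie in \<open>P\<close> and those
      below lie in some box; as the whole sum is in \<open>P\<close>, the term of degree
      \<open>e\<close> lies in a box as well.\<close>
    have "{..Polynomial.degree G} = {..<e} \<union> ({e} \<union> {e<..Polynomial.degree G})" using e by auto
    then have "poly G z = ?L + (q * z ^ e + ?R)"
      unfolding poly_altdef q_def by (simp only: sum.union_disjoint finite_lessThan) (subst sum.union_disjoint; auto)+
    then have "q * z ^ e = (poly G z - ?R) + \<kappa> (- 1) * ?L" by (simp add: \<kappa>.hom_uminus)
    moreover have "?R \<in> P" by (intro ideal_of_sum[OF I] ideal_of_mult_right[OF I] G(4) subring_set_power[OF A z]) auto
    then have "poly G z - ?R \<in> P" using ideal_of_diff[OF A I G(2)] by blast
    moreover obtain D where "?L \<in> bspan D" using span_sum[of "{..<e}"] by auto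
    then obtain D' where "\<kappa> (- 1) * ?L \<in> bspan D'" using op_const[of "- 1"] unfolding op_def by blast
    ultimately show ?thesis using bspan_add[OF bspan_P] by metis
  qed
  have "op (q * z)"
  proof (rule opI)
    show "q * z \<in> A" using opA[OF G(1)] z by (auto simp: q_def intro: subring_set_mult[OF A])
    fix \<zeta> assume "\<zeta> \<in> Z"
    then obtain k where k: "k < e" "\<zeta> = z ^ k" by (auto simp: Zdef)
    show "\<exists>D. q * z * \<zeta> \<in> bspan D"
    proof (cases "Suc k = e")
      case True
      then have "q * z * \<zeta> = q * z ^ e" unfolding k(2) by (simp add: mult.assoc flip: power_Suc)
      then show ?thesis using top by simp
    next
      case False
      then have "Suc k < e" using k(1) by simp
      then show ?thesis using op_span[OF G(1)[of e], of "Suc k"] by (simp add: k(2) q_def mult.assoc)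
    qed
  qed
  moreover have "op q" "q \<in> A - P" using G(1,3) opA by (auto simp: q_def)
  ultimately show ?thesis using z unfolding algebraic_elems_def by blast
qed

section \<open>Dimensions of jet fibers\<close>

lemma jet_equation_subst_init:
  fixes \<rho> :: "nat \<times> nat \<Rightarrow> 'b::comm_ring_1"
  assumes h: "comm_ring_hom h" and f: "f \<in> mpol_in {..d}"
    and \<rho>: "\<And>i j. i \<le> d \<Longrightarrow> j < w i \<Longrightarrow> \<rho> (i, j) = 0"
  shows "mpol_subst h \<rho> (jet_equation m f (min_weight d w f)) =
    mpol_subst h (\<lambda>i. Polynomial.coeff (jet_tail m w \<rho> i) 0) (init_part d w f)"
proof -
  let ?l = "min_weight d w f" and ?K = "Poly_Mapping.keys f"
  have p0: "comm_ring_hom (\<lambda>p :: 'b poly. Polynomial.coeff p 0)"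
    by unfold_locales (auto simp: coeff_mult_0)
  have "mpol_subst h \<rho> (jet_equation m f ?l) = (\<Sum>\<mu>\<in>?K. if weight d w \<mu> \<le> ?l
      then h (Poly_Mapping.lookup f \<mu>) * Polynomial.coeff (mon_val (jet_tail m w \<rho>) \<mu>) (?l - weight d w \<mu>) else 0)"
    by (rule jet_equation_subst[OF h f]) (rule \<rho>)
  also have "\<dots> = (\<Sum>\<mu>\<in>?K. if weight d w \<mu> = ?l then h (Poly_Mapping.lookup f \<mu>) *
      mon_val (\<lambda>i. Polynomial.coeff (jet_tail m w \<rho> i) 0) \<mu> else 0)"
    using comm_ring_hom_mon_val[OF p0, of "jet_tail m w \<rho>"]
    by (intro sum.cong) (auto dest: min_weight_le[of _ f d w])
  also have "\<dots> = mpol_subst h (\<lambda>i. Polynomial.coeff (jet_tail m w \<rho> i) 0) (init_part d w f)"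
    unfolding mpol_subst_init_part[OF h] by (simp add: sum.inter_filter)
  finally show ?thesis .
qed

lemma jet_equation_in:
  assumes "f \<in> mpol_in {..d}"
  shows "jet_equation m f l \<in> mpol_in ({..d} \<times> {..m})"
proof -
  let ?A = "mpol_in ({..d} \<times> {..m}) :: (nat \<times> nat, 'a) mpol set"
  have "mpol_subst (\<lambda>c. [:mpol_const c:]) (universal_jet m) f \<in> {p. \<forall>i. Polynomial.coeff p i \<in> ?A}"
  proof (rule mpol_subst_in_subring[OF subring_set_polys[OF subring_set_mpol_in] _ _ assms])
    show "[:mpol_const c:] \<in> {p. \<forall>i. Polynomial.coeff p i \<in> ?A}" for c
      using subring_set_zero[OF subring_set_mpol_in] by (auto simp: coeff_pCons mpol_const_in split: nat.splits)
    show "universal_jet m i \<in> {p. \<forall>i. Polynomial.coeff p i \<in> ?A}" if "i \<in> {..d}" for i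
      using that subring_set_zero[OF subring_set_mpol_in]
      by (auto simp: universal_jet_def coeff_sum intro!: subring_set_sum[OF subring_set_mpol_in] mpol_in_var)
  qed
  then show ?thesis by (auto simp: jet_equation_def)
qed

text \<open>Replaces the generated ideal by its generators and its minimality, which is all that the
  two dimension estimates use.\<close>

lemma jet_fiber_ring_quot:
  fixes f :: "(nat, 'k::field) mpol" and d m :: nat
  assumes f: "f \<in> mpol_in {..d}"
  defines "A \<equiv> mpol_in ({..d} \<times> {..m}) :: (nat \<times> nat, 'k) mpol set"
  obtains J where "jet_fiber_ring d f m (\<lambda>_. 0) = ring_of_type_algebra\<lparr>carrier := A\<rparr> Quot J" "ideal_of A J"
    "\<And>l. l \<le> m \<Longrightarrow> jet_equation m f l \<in> J" "\<And>i. i \<le> d \<Longrightarrow> mpol_var (i, 0) \<in> J"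
    "\<And>Q. ideal_of A Q \<Longrightarrow> (\<And>l. l \<le> m \<Longrightarrow> jet_equation m f l \<in> Q) \<Longrightarrow> (\<And>i. i \<le> d \<Longrightarrow> mpol_var (i, 0) \<in> Q) \<Longrightarrow> J \<subseteq> Q"
proof -
  define R where "R = (ring_of_type_algebra\<lparr>carrier := A\<rparr> :: (nat \<times> nat, 'k) mpol ring)"
  define S where "S = {jet_equation m f l | l. l \<le> m} \<union> {mpol_var (i, 0) - mpol_const 0 | i. i \<le> d}"
  have A: "subring_set A" unfolding A_def by (rule subring_set_mpol_in)
  interpret R: cring R unfolding R_def by (rule cring_of_subring_set[OF A])
  have c0: "mpol_const 0 = (0 :: (nat \<times> nat, 'k) mpol)" by (simp add: mpol_const_def)
  have "S \<subseteq> A" unfolding S_def A_def c0 using jet_equation_in[OF f] by (auto intro!: mpol_in_var)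
  then have S: "S \<subseteq> carrier R" by (simp add: R_def)
  show ?thesis
  proof (rule that[of "Idl\<^bsub>R\<^esub> S"])
    show "jet_fiber_ring d f m (\<lambda>_. 0) = ring_of_type_algebra\<lparr>carrier := A\<rparr> Quot (Idl\<^bsub>R\<^esub> S)"
      unfolding jet_fiber_ring_def Let_def mpol_ring_def R_def S_def A_def ..
    show "ideal_of A (Idl\<^bsub>R\<^esub> S)"
      using R.genideal_ideal[OF S] ideal_iff_ideal_of[OF A] by (simp add: R_def)
    show "jet_equation m f l \<in> Idl\<^bsub>R\<^esub> S" if "l \<le> m" for l
      using R.genideal_self[OF S] that by (auto simp: S_def)
    show "mpol_var (i, 0) \<in> Idl\<^bsub>R\<^esub> S" if "i \<le> d" for i
      using R.genideal_self[OF S] that by (auto simp: S_def c0)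
    fix Q assume Q: "ideal_of A Q" "\<And>l. l \<le> m \<Longrightarrow> jet_equation m f l \<in> Q" "\<And>i. i \<le> d \<Longrightarrow> mpol_var (i, 0) \<in> Q"
    have "ideal Q R" using Q(1) ideal_iff_ideal_of[OF A] by (simp add: R_def)
    then show "Idl\<^bsub>R\<^esub> S \<subseteq> Q" by (rule R.genideal_minimal) (use Q in \<open>auto simp: S_def c0\<close>)
  qed
qed

lemma prime_of_kernel:
  fixes g :: "'a::comm_ring_1 \<Rightarrow> 'b::idom"
  assumes "comm_ring_hom g" "subring_set A"
  shows "prime_of A {p \<in> A. g p = 0}"
proof -
  interpret comm_ring_hom g by fact
  show ?thesis
    using assms(2) by (auto simp: prime_of_def ideal_of_def hom_add hom_mult subring_set_closed)
qed

text \<open>The jets of contact order at least \<open>w\<close> form a linear space inside the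
  fiber, because all equations up to order \<open>m\<close> are trivial on it. Killing its
  coordinates one after another gives a strict chain of kernels of that length.\<close>

theorem le_krull_dim_jet_fiber:
  fixes f :: "(nat, 'k::field) mpol"
  assumes f: "f \<in> mpol_in {..d}" and w: "\<And>i. i \<le> d \<Longrightarrow> 1 \<le> w i" and m: "m < min_weight d w f"
  shows "enat (\<Sum>i\<le>d. m + 1 - w i) \<le> krull_dim (jet_fiber_ring d f m (\<lambda>_. 0))"
proof -
  let ?A = "mpol_in ({..d} \<times> {..m}) :: (nat \<times> nat, 'k) mpol set"
  obtain J where J: "jet_fiber_ring d f m (\<lambda>_. 0) = ring_of_type_algebra\<lparr>carrier := ?A\<rparr> Quot J" "ideal_of ?A J"
    "\<And>Q. ideal_of ?A Q \<Longrightarrow> (\<And>l. l \<le> m \<Longrightarrow> jet_equation m f l \<in> Q) \<Longrightarrow> (\<And>i. i \<le> d \<Longrightarrow> mpol_var (i, 0) \<in> Q) \<Longrightarrow> J \<subseteq> Q"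
    using jet_fiber_ring_quot[OF f, of m] by metis
  define F where "F = (SIGMA i:{..d}. {w i..m})"
  define n where "n = card F"
  have "finite F" by (auto simp: F_def)
  then obtain e where e: "bij_betw e {..<n} F" using ex_bij_betw_nat_finite[of F] by (auto simp: n_def atLeast0LessThan)
  have eF: "e k \<in> F" if "k < n" for k using e that by (auto simp: bij_betw_def)
  have einj: "e k \<notin> e ` {..<k}" if "k < n" for k
    using e that by (auto simp: bij_betw_def dest!: inj_onD[of e "{..<n}"])
  \<comment> \<open>Stage \<open>k\<close> keeps the free coefficients that are not among the first
    \<open>k\<close> and kills all others. Renumbering by \<open>prod_encode\<close> gives a target
    ring with variables in \<open>nat\<close>, an instance of \<open>idom\<close>, as
    \<open>prime_of_kernel\<close> requires.\<close>
  define \<rho> where "\<rho> = (\<lambda>k v. if v \<in> F \<and> v \<notin> e ` {..<k} then mpol_var (prod_encode v) else (0 :: (nat, 'k) mpol))"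
  define g where "g = (\<lambda>k. mpol_subst mpol_const (\<rho> k))"
  have g: "comm_ring_hom (g k)" for k unfolding g_def by (rule comm_ring_hom_mpol_subst[OF comm_ring_hom_mpol_const])
  define P where "P = (\<lambda>k. {p \<in> ?A. g k p = 0})"
  have PP: "prime_of ?A (P k)" for k unfolding P_def by (rule prime_of_kernel[OF g subring_set_mpol_in])
  have gv: "g k (mpol_var v) = \<rho> k v" for k v unfolding g_def by (rule mpol_subst_var[OF comm_ring_hom_mpol_const])
  have "J \<subseteq> P k" for k
  proof (rule J(3)[OF prime_of_ideal[OF PP]])
    show "jet_equation m f l \<in> P k" if l: "l \<le> m" for l
    proof -
      have "g k (jet_equation m f l) = 0" unfolding g_def
        by (rule jet_equation_subst_below[OF comm_ring_hom_mpol_const f, where w = w])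
          (use l m in \<open>auto simp: \<rho>_def F_def\<close>)
      then show ?thesis by (simp add: P_def jet_equation_in[OF f])
    qed
    show "mpol_var (i, 0) \<in> P k" if "i \<le> d" for i
      using that w[OF that] by (auto simp: P_def gv \<rho>_def F_def intro!: mpol_in_var)
  qed
  moreover have "P k \<subset> P (Suc k)" if k: "k < n" for k
  proof
    define \<sigma> where "\<sigma> = mpol_subst mpol_const (\<lambda>x. if x = prod_encode (e k) then 0 else mpol_var x :: (nat, 'k) mpol)"
    have \<sigma>: "comm_ring_hom \<sigma>" unfolding \<sigma>_def by (rule comm_ring_hom_mpol_subst[OF comm_ring_hom_mpol_const])
    then interpret \<sigma>: comm_ring_hom \<sigma> .
    have "\<sigma> (mpol_const c) = mpol_const c" for c unfolding \<sigma>_def by (rule mpol_subst_const[OF comm_ring_hom_mpol_const])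
    moreover have "\<sigma> (\<rho> k v) = \<rho> (Suc k) v" for v
      by (auto simp: \<rho>_def lessThan_Suc) (auto simp: \<sigma>_def mpol_subst_var[OF comm_ring_hom_mpol_const])
    ultimately have "g (Suc k) p = \<sigma> (g k p)" for p
      unfolding g_def mpol_subst_compose[OF comm_ring_hom_mpol_const \<sigma>] by simp
    then show "P k \<subseteq> P (Suc k)" by (auto simp: P_def)
    have "mpol_var (e k) \<in> P (Suc k)" "mpol_var (e k) \<notin> P k"
      using eF[OF k] einj[OF k] by (auto simp: P_def gv \<rho>_def mpol_var_nonzero F_def intro!: mpol_in_var)
    then show "P k \<noteq> P (Suc k)" by blast
  qed
  ultimately have "enat n \<le> krull_dim (ring_of_type_algebra\<lparr>carrier := ?A\<rparr> Quot J)"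
    using PP by (intro le_krull_dim_quot[OF subring_set_mpol_in J(2), of n P])
  moreover have "n = (\<Sum>i\<le>d. m + 1 - w i)" unfolding n_def F_def by simp
  ultimately show ?thesis unfolding J(1) by simp
qed

lemma weight_ge: "i \<le> d \<Longrightarrow> i \<in> Poly_Mapping.keys \<mu> \<Longrightarrow> w i \<le> weight d w \<mu>"
  unfolding weight_def
  by (rule order_trans[OF _ member_le_sum[of i]]) (auto simp: in_keys_iff)

lemma mpol_deriv_eq_0: "g \<in> mpol_in K \<Longrightarrow> v \<notin> K \<Longrightarrow> mpol_deriv v g = 0"
proof -
  assume "g \<in> mpol_in K" "v \<notin> K"
  then have "Poly_Mapping.lookup m v = 0" if "m \<in> Poly_Mapping.keys g" for m
    using that in_keys_iff[of v m] unfolding mpol_in_def by blast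
  then show ?thesis unfolding mpol_deriv_def by (intro sum.neutral) simp
qed

text \<open>Let \<open>w\<close> be the contact orders along the smallest prime, and l its minimal
  weight. If l exceeds \<open>m\<close>, counting all coefficients from the contact orders on is
  good enough. Otherwise the equations of order l to \<open>m\<close> make m - l + 1 coefficients of
  one coordinate algebraic over the rest. The number of coefficients left is (m + 1) * d + l minus
  the sum of the weights, which the hypothesis on \<open>lam\<close> bounds.\<close>

lemma jet_prime_chain_bound:
  fixes f :: "(nat, 'k::alg_closed_field) mpol" and P :: "nat \<Rightarrow> (nat \<times> nat, 'k) mpol set" and d m :: nat
  defines "A \<equiv> mpol_in ({..d} \<times> {..m})"
  assumes f: "f \<in> mpol_in {..d}" "f \<noteq> 0" "newton_nondegenerate d f"
    and phi: "\<And>w. (\<And>i. i \<le> d \<Longrightarrow> 1 \<le> w i) \<Longrightarrow> lam + min_weight d w f \<le> (\<Sum>i\<le>d. w i)"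
    and chain: "\<And>i. i \<le> n \<Longrightarrow> prime_of A (P i)" "\<And>i. i < n \<Longrightarrow> P i \<subset> P (Suc i)"
    and jet: "\<And>l. l \<le> m \<Longrightarrow> jet_equation m f l \<in> P 0" and origin: "\<And>i. i \<le> d \<Longrightarrow> mpol_var (i, 0) \<in> P 0"
  shows "n + lam \<le> (m + 1) * d"
proof -
  define Q where "Q = P 0"
  have A: "subring_set A" unfolding A_def by (rule subring_set_mpol_in)
  have PQ: "prime_of A Q" unfolding Q_def by (rule chain) simp
  note I = prime_of_ideal[OF PQ]
  note C = comm_ring_hom_mpol_const[where 'k = 'k and 'v = "nat \<times> nat"]
  have constA: "mpol_const c \<in> A" for c unfolding A_def by (rule mpol_const_in)
  have A_min: "A \<subseteq> T" if "subring_set T" "\<And>c. mpol_const c \<in> T" "\<And>x. x \<in> {..d} \<times> {..m} \<Longrightarrow> mpol_var x \<in> T" for T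
    unfolding A_def using that by (rule mpol_in_subset_subring)
  have varA: "mpol_var (i, j) \<in> A" if "i \<le> d" "j \<le> m" for i j unfolding A_def using that by (intro mpol_in_var) auto
  \<comment> \<open>The alternative \<open>m < j\<close> makes \<open>w i = m + 1\<close> when all
    coefficients of the coordinate \<open>i\<close> up to order \<open>m\<close> lie in
    \<open>Q\<close>.\<close>
  define w where "w = (\<lambda>i. LEAST j. m < j \<or> mpol_var (i, j) \<notin> Q)"
  have w_le: "w i \<le> m + 1" for i unfolding w_def by (rule Least_le) simp
  have w_notin: "mpol_var (i, w i) \<notin> Q" if "w i \<le> m" for i
    using that LeastI[of "\<lambda>j. m < j \<or> mpol_var (i, j) \<notin> Q" "m + 1"] unfolding w_def by auto
  have w_below: "mpol_var (i, j) \<in> Q" if "j < w i" for i j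
    using that not_less_Least[of j "\<lambda>j. m < j \<or> mpol_var (i, j) \<notin> Q"] unfolding w_def by auto
  have w_pos: "1 \<le> w i" if "i \<le> d" for i
    using w_notin[of i] origin[OF that] by (cases "w i") (auto simp: Q_def)
  \<comment> \<open>Sets the coefficients below the contact orders to zero. On \<open>A\<close> this
    is the identity modulo \<open>Q\<close>, so the transformed equations still lie in
    \<open>Q\<close>.\<close>
  define \<rho> where "\<rho> = (\<lambda>(i, j). if w i \<le> j \<and> j \<le> m then mpol_var (i, j) else (0 :: (nat \<times> nat, 'k) mpol))"
  have \<rho>: "\<rho> (i, j) = 0" if "i \<le> d" "j < w i" for i j using that by (simp add: \<rho>_def)
  let ?\<Phi> = "mpol_subst mpol_const \<rho>"
  interpret \<Phi>: comm_ring_hom ?\<Phi> by (rule comm_ring_hom_mpol_subst[OF C])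
  have red: "p - ?\<Phi> p \<in> Q" if "p \<in> A" for p
  proof -
    define T where "T = {p \<in> A. ?\<Phi> p \<in> A \<and> p - ?\<Phi> p \<in> Q}"
    have "subring_set T"
      unfolding subring_set_def
    proof (intro conjI ballI)
      show "1 \<in> T" by (simp add: T_def subring_set_one[OF A] ideal_of_zero[OF I])
      fix p q assume pq: "p \<in> T" "q \<in> T"
      have "p - q - ?\<Phi> (p - q) = (p - ?\<Phi> p) - (q - ?\<Phi> q)" by (simp add: \<Phi>.hom_minus)
      also have "\<dots> \<in> Q" by (rule ideal_of_diff[OF A I]) (use pq in \<open>simp_all add: T_def\<close>)
      finally show "p - q \<in> T" using pq by (simp add: T_def \<Phi>.hom_minus subring_set_diff[OF A])
      have "p * q - ?\<Phi> (p * q) = p * (q - ?\<Phi> q) + ?\<Phi> q * (p - ?\<Phi> p)" by (simp add: \<Phi>.hom_mult algebra_simps)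
      also have "\<dots> \<in> Q" using pq by (intro ideal_of_add[OF I] ideal_of_mult[OF I]) (simp_all add: T_def)
      finally show "p * q \<in> T" using pq by (simp add: T_def \<Phi>.hom_mult subring_set_mult[OF A])
    qed
    moreover have "mpol_const c \<in> T" for c
      by (simp add: T_def mpol_subst_const[OF C] constA ideal_of_zero[OF I])
    moreover have "mpol_var v \<in> T" if "v \<in> {..d} \<times> {..m}" for v
      using that w_below ideal_of_zero[OF I] subring_set_zero[OF A]
      by (auto simp: T_def mpol_subst_var[OF C] \<rho>_def varA)
    ultimately have "A \<subseteq> T" unfolding A_def by (intro mpol_in_subset_subring)
    then show ?thesis using that by (auto simp: T_def)
  qed
  have jetQ: "?\<Phi> (jet_equation m f l) \<in> Q" if "l \<le> m" for l
  proof -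
    have "jet_equation m f l \<in> A" unfolding A_def by (rule jet_equation_in[OF f(1)])
    from ideal_of_diff[OF A I jet[OF that, folded Q_def] red[OF this]] show ?thesis by simp
  qed
  let ?l = "min_weight d w f"
  have bound: "lam + ?l \<le> (\<Sum>i\<le>d. w i)" by (rule phi) (rule w_pos)
  have card_sum: "(\<Sum>i\<in>K. m + 1 - w i) + (\<Sum>i\<in>K. w i) = (m + 1) * card K" for K
    using w_le by (simp add: sum.distrib[symmetric])
  show ?thesis
  proof (cases "?l \<le> m")
    case False
    define W where "W = (SIGMA i:{..d}. {w i..m})"
    interpret box_filtration A Q mpol_const W mpol_var "{1}"
      by (rule box_filtration.intro) (use A PQ C constA varA subring_set_one[OF A] in \<open>auto simp: W_def\<close>)
    have "A \<subseteq> algebraic_elems"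
    proof (rule A_min[OF subring_set_algebraic_elems])
      show "mpol_const c \<in> algebraic_elems" for c by (intro algebraic_elemsI op_const)
      show "mpol_var v \<in> algebraic_elems" if "v \<in> {..d} \<times> {..m}" for v
        using that w_below[of "snd v" "fst v"] op_y[of v] op_P
        by (intro algebraic_elemsI) (cases "w (fst v) \<le> snd v"; auto simp: W_def)
    qed
    then have "n \<le> card W"
    proof (rule chain_length_le)
      show "P 0 = Q" by (simp add: Q_def)
    qed (rule chain; assumption)+
    also have "card W = (\<Sum>i\<le>d. m + 1 - w i)" by (simp add: W_def)
    finally show ?thesis using card_sum[of "{..d}"] bound False by simp
  next
    case True
    define K where "K = {i. i \<le> d \<and> w i \<le> ?l}"
    define g where "g = init_part d w f"
    \<comment> \<open>The value 1 is a placeholder for coordinates that vanish up to order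
      \<open>m\<close>: nondegeneracy needs nonzero coordinates, and the initial part does not
      contain these variables.\<close>
    define b where "b = (\<lambda>i. if w i \<le> m then mpol_var (i, w i) else (1 :: (nat \<times> nat, 'k) mpol))"
    have gK: "g \<in> mpol_in K"
      unfolding g_def init_part_def
    proof (intro subring_set_sum[OF subring_set_mpol_in] single_in_mpol_in subsetI)
      fix \<mu> i assume "\<mu> \<in> {\<mu> \<in> Poly_Mapping.keys f. weight d w \<mu> = ?l}" "i \<in> Poly_Mapping.keys \<mu>"
      then show "i \<in> K" using f(1) weight_ge[of i d \<mu> w] by (auto simp: K_def mpol_in_def)
    qed
    have tail0: "Polynomial.coeff (jet_tail m w \<rho> i) 0 = b i" if "i \<in> K" for i
      using that True by (simp add: coeff_jet_tail K_def b_def \<rho>_def)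
    have gQ: "mpol_subst mpol_const b g \<in> Q"
    proof -
      have "?\<Phi> (jet_equation m f ?l) = mpol_subst mpol_const (\<lambda>i. Polynomial.coeff (jet_tail m w \<rho> i) 0) g"
        unfolding g_def by (rule jet_equation_subst_init[OF C f(1)]) (rule \<rho>)
      also have "\<dots> = mpol_subst mpol_const b g" by (rule mpol_subst_cong[OF C gK tail0])
      finally show ?thesis using jetQ[OF True] by simp
    qed
    \<comment> \<open>The leading coefficients are nonzero modulo \<open>Q\<close>, so some point of
      \<open>Q\<close> over the field gives them nonzero values, at which nondegeneracy yields a
      derivative that does not vanish.\<close>
    have "\<exists>i\<le>d. mpol_subst mpol_const b (mpol_deriv i g) \<notin> Q"
    proof -
      define u where "u = (\<Prod>i | i \<le> d \<and> w i \<le> m. mpol_var (i, w i) :: (nat \<times> nat, 'k) mpol)"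
      have "u \<in> A - Q" unfolding u_def using varA w_notin by (intro prime_of_prod_notin[OF A PQ]) auto
      then obtain a where a: "\<And>p. p \<in> Q \<Longrightarrow> mpol_eval a p = 0" "mpol_eval a u \<noteq> 0"
        using prime_has_point[of "{..d} \<times> {..m}" Q u] PQ unfolding A_def by auto
      have ev: "comm_ring_hom (mpol_eval a)" by (rule comm_ring_hom_mpol_subst[OF comm_ring_hom_id])
      then interpret ev: comm_ring_hom "mpol_eval a" .
      define \<alpha> where "\<alpha> = (\<lambda>i. mpol_eval a (b i))"
      have "(\<Prod>i | i \<le> d \<and> w i \<le> m. a (i, w i)) \<noteq> 0"
        using a(2) by (simp add: u_def ev.hom_prod mpol_subst_var[OF comm_ring_hom_id])
      then have "a (i, w i) \<noteq> 0" if "i \<le> d" "w i \<le> m" for i using that by simp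
      then have "\<alpha> i \<noteq> 0" if "i \<le> d" for i
        using that by (simp add: \<alpha>_def b_def mpol_subst_var[OF comm_ring_hom_id])
      then obtain i where i: "i \<le> d" "mpol_eval \<alpha> (mpol_deriv i g) \<noteq> 0"
        using nondegenerate_init_part[OF f, of \<alpha> w] unfolding g_def by blast
      have "mpol_eval a (mpol_subst mpol_const b (mpol_deriv i g)) = mpol_eval \<alpha> (mpol_deriv i g)"
        unfolding mpol_subst_compose[OF C ev] by (simp add: mpol_subst_const[OF comm_ring_hom_id] \<alpha>_def)
      then show ?thesis using i a(1) by metis
    qed
    then obtain v where v: "v \<le> d" "mpol_subst mpol_const b (mpol_deriv v g) \<notin> Q" by blast
    have "v \<in> K"
    proof (rule ccontr)
      assume "v \<notin> K"
      then show False using v(2) mpol_deriv_eq_0[OF gK] ideal_of_zero[OF I] by (simp add: mpol_subst_zero[OF C])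
    qed
    then have wv: "w v \<le> ?l" by (simp add: K_def)
    define z where "z = (mpol_var (v, w v) :: (nat \<times> nat, 'k) mpol)"
    have zA: "z \<in> A" unfolding z_def using v(1) wv True by (intro varA) auto
    have bv: "b v = z" using wv True by (simp add: b_def z_def)
    \<comment> \<open>The first nontrivial equation as a polynomial in the leading coefficient
      \<open>z\<close> of the coordinate \<open>v\<close>. Its derivative at \<open>z\<close> is
      nonzero modulo \<open>Q\<close>, so it is not constant modulo \<open>Q\<close> and makes
      \<open>z\<close> algebraic.\<close>
    define G where "G = mpol_subst (\<lambda>c. [:mpol_const c:]) (\<lambda>i. if i = v then [:0, 1:] else [:b i:]) g"
    have Gz: "poly G z \<in> Q" using gQ mpol_subst_univariate(1)[OF C, of v b g] by (simp add: G_def bv)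
    have "\<exists>k\<ge>1. Polynomial.coeff G k \<notin> Q"
    proof (rule ccontr)
      assume "\<not> ?thesis"
      then have "Polynomial.coeff (pcompose G [:z, 1:]) 1 \<in> Q"
        by (intro pcompose_coeff_1_in_ideal[OF A I zA]) auto
      then show False using v(2) mpol_subst_univariate(2)[OF C, of v b g] by (simp add: G_def bv)
    qed
    then obtain k0 where k0: "1 \<le> k0" "Polynomial.coeff G k0 \<notin> Q" by blast
    define E where "E = {k. Polynomial.coeff G k \<notin> Q}"
    have "E \<subseteq> {..Polynomial.degree G}" using ideal_of_zero[OF I] by (auto simp: E_def intro: le_degree)
    then have finE: "finite E" by (rule finite_subset) simp
    define e where "e = Max E"
    have eE: "e \<in> E" unfolding e_def using finE k0(2) by (intro Max_in) (auto simp: E_def)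
    have e1: "1 \<le> e" using Max_ge[OF finE, of k0] k0 by (simp add: e_def E_def)
    have above: "Polynomial.coeff G k \<in> Q" if "e < k" for k
      using Max_ge[OF finE, of k] that by (auto simp: e_def E_def)
    \<comment> \<open>For the coordinate \<open>v\<close> the coefficients of order
      \<open>w v\<close> to \<open>w v + (m - ?l)\<close> are left out, as many as there are
      equations of order \<open>?l\<close> to \<open>m\<close>.\<close>
    define W where "W = (SIGMA i:{..d} - {v}. {w i..m}) \<union> {v} \<times> {w v + (m - ?l)<..m}"
    define Z where "Z = (\<lambda>k. z ^ k) ` {..<e}"
    interpret box_filtration A Q mpol_const W mpol_var Z
    proof (rule box_filtration.intro)
      show "mpol_var x \<in> A" if "x \<in> W" for x using that v(1) by (auto simp: W_def intro: varA)
      show "1 \<in> Z" using e1 unfolding Z_def by (intro image_eqI[of _ _ 0]) auto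
      show "Z \<subseteq> A" using zA by (auto simp: Z_def intro: subring_set_power[OF A])
      show "finite W" "finite Z" by (auto simp: W_def Z_def)
    qed (rule A PQ C constA)+
    have inW: "mpol_var (i, j) \<in> algebraic_elems \<and> op (mpol_var (i, j))" if "(i, j) \<in> W" for i j
      using op_y[OF that] algebraic_elemsI by blast
    have inQ: "p \<in> algebraic_elems" if "p \<in> Q" for p using that by (intro algebraic_elemsI op_P)
    note alg = subring_set_algebraic_elems
    have "op (Polynomial.coeff G k)" for k
    proof -
      have S: "subring_set {s. op s}"
        unfolding subring_set_def
      proof (intro conjI ballI)
        interpret c: comm_ring_hom "mpol_const :: 'k \<Rightarrow> (nat \<times> nat, 'k) mpol" by (rule C)
        fix s t assume "s \<in> {s. op s}" "t \<in> {s. op s}"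
        then show "s - t \<in> {s. op s}" "s * t \<in> {s. op s}"
          using op_add[of s "mpol_const (- 1) * t"] op_mult[OF op_const[of "- 1"], of t] op_mult[of s t]
          by (simp_all add: c.hom_uminus)
      qed (simp add: op_one)
      have "op 0" using subring_set_zero[OF S] by simp
      have "G \<in> {p. \<forall>k. Polynomial.coeff p k \<in> {s. op s}}"
        unfolding G_def
      proof (rule mpol_subst_in_subring[OF subring_set_polys[OF S] _ _ gK])
        show "[:mpol_const c:] \<in> {p. \<forall>k. Polynomial.coeff p k \<in> {s. op s}}" for c
          using \<open>op 0\<close> op_const by (auto simp: coeff_pCons split: nat.splits)
        fix i assume i: "i \<in> K"
        show "(if i = v then [:0, 1:] else [:b i:]) \<in> {p. \<forall>k. Polynomial.coeff p k \<in> {s. op s}}"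
        proof (cases "i = v")
          case True
          then show ?thesis using \<open>op 0\<close> op_one by (auto simp: coeff_pCons split: nat.splits)
        next
          case False
          then have "op (b i)" using inW[of i "w i"] i True by (auto simp: b_def W_def K_def)
          then show ?thesis using False \<open>op 0\<close> by (auto simp: coeff_pCons split: nat.splits)
        qed
      qed
      then show ?thesis by simp
    qed
    then have zalg: "z \<in> algebraic_elems"
      using eE by (intro algebraic_root[OF Z_def zA _ Gz _ above]) (auto simp: E_def)
    \<comment> \<open>For positive \<open>r\<close>, the equation of order \<open>?l + r\<close> is
      linear in this coefficient, up to terms already known to be algebraic. The linear factor lies
      outside \<open>Q\<close>, so division in \<open>algebraic_elems\<close> solves it.\<close>
    have lin: "mpol_var (v, w v + r) \<in> algebraic_elems" if "r \<le> m - ?l" for r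
      using that
    proof (induction r rule: less_induct)
      case (less r)
      show ?case
      proof (cases "r = 0")
        case True
        then show ?thesis using zalg by (simp add: z_def)
      next
        case False
        let ?x = "mpol_var (v, w v + r) :: (nat \<times> nat, 'k) mpol"
        let ?g = "Polynomial.coeff (mpol_subst (\<lambda>c. [:mpol_const c:]) (jet_tail m w \<rho>) g) r"
        let ?c = "mpol_subst mpol_const b (mpol_deriv v g)"
        have xm: "w v + r \<le> m" "?l + r \<le> m" using less.prems wv True by auto
        have calg: "mpol_const c \<in> algebraic_elems" for c by (intro algebraic_elemsI op_const)
        have other: "Polynomial.coeff (jet_tail m w \<rho> i) s \<in> algebraic_elems" if "i \<le> d" "i \<noteq> v" for i s
          using that inW[of i "w i + s"] subring_set_zero[OF alg] by (auto simp: coeff_jet_tail \<rho>_def W_def)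
        have low: "Polynomial.coeff (jet_tail m w \<rho> i) s \<in> algebraic_elems" if "i \<le> d" "s < r" for i s
          using that other[of i s] less.IH[of s] less.prems subring_set_zero[OF alg]
          by (cases "i = v") (auto simp: coeff_jet_tail \<rho>_def)
        have "?\<Phi> (jet_equation m f (?l + r)) - ?g \<in> algebraic_elems"
          unfolding g_def by (rule jet_equation_subst_split[OF C f(1) _ alg calg low]) (rule \<rho>)
        from subring_set_diff[OF alg inQ[OF jetQ[OF xm(2)]] this] have g_alg: "?g \<in> algebraic_elems" by simp
        have "?g - mpol_subst mpol_const (\<lambda>i. Polynomial.coeff (jet_tail m w \<rho> i) 0) (mpol_deriv v g) *
            Polynomial.coeff (jet_tail m w \<rho> v) r \<in> algebraic_elems"
          using low other False by (intro coeff_mpol_subst_linear[OF C alg calg _ _ _ gK]) (auto simp: K_def)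
        also have "mpol_subst mpol_const (\<lambda>i. Polynomial.coeff (jet_tail m w \<rho> i) 0) (mpol_deriv v g) = ?c"
          by (rule mpol_subst_cong[OF C mpol_deriv_in[OF gK] tail0])
        also have "Polynomial.coeff (jet_tail m w \<rho> v) r = ?x" using xm by (simp add: coeff_jet_tail \<rho>_def)
        finally have "?c * ?x \<in> algebraic_elems" using subring_set_diff[OF alg g_alg] by force
        moreover have "?c \<in> algebraic_elems"
        proof (rule mpol_subst_in_subring[OF alg calg _ mpol_deriv_in[OF gK]])
          fix i assume "i \<in> K"
          then show "b i \<in> algebraic_elems"
            using inW[of i "w i"] zalg bv True by (cases "i = v") (auto simp: b_def W_def K_def)
        qed
        ultimately show ?thesis using v xm by (intro algebraic_elems_div[of ?c ?x] varA) auto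
      qed
    qed
    have "A \<subseteq> algebraic_elems"
    proof (rule A_min[OF alg])
      show "mpol_const c \<in> algebraic_elems" for c by (intro algebraic_elemsI op_const)
      fix x assume "x \<in> {..d} \<times> {..m}"
      then obtain i j where x: "x = (i, j)" "i \<le> d" "j \<le> m" by auto
      consider "j < w i" | "(i, j) \<in> W" | "i = v" "w v \<le> j" "j - w v \<le> m - ?l"
        using x unfolding W_def by fastforce
      then show "mpol_var x \<in> algebraic_elems"
      proof cases
        case 1
        then show ?thesis using inQ w_below x by simp
      next
        case 2
        then show ?thesis using inW x by simp
      next
        case 3
        then show ?thesis using lin[of "j - w v"] x by simp
      qed
    qed
    then have "n \<le> card W"
    proof (rule chain_length_le)
      show "P 0 = Q" by (simp add: Q_def)
    qed (rule chain; assumption)+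
    also have "card W \<le> card (SIGMA i:{..d} - {v}. {w i..m}) + card ({v} \<times> {w v + (m - ?l)<..m})"
      unfolding W_def by (rule card_Un_le)
    also have "\<dots> = (\<Sum>i\<in>{..d} - {v}. m + 1 - w i) + (?l - w v)" using True wv by (simp add: card_cartesian_product)
    finally have n: "n \<le> (\<Sum>i\<in>{..d} - {v}. m + 1 - w i) + (?l - w v)" .
    have "card ({..d} - {v}) = d" using v(1) by simp
    moreover have "(\<Sum>i\<le>d. w i) = w v + (\<Sum>i\<in>{..d} - {v}. w i)" using v(1) by (simp add: sum.remove[of _ v])
    ultimately show ?thesis using n bound card_sum[of "{..d} - {v}"] wv by simp
  qed
qed

theorem krull_dim_jet_fiber_le:
  fixes f :: "(nat, 'k::alg_closed_field) mpol"
  assumes f: "f \<in> mpol_in {..d}" "f \<noteq> 0" "newton_nondegenerate d f"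
    and phi: "\<And>w. (\<And>i. i \<le> d \<Longrightarrow> 1 \<le> w i) \<Longrightarrow> lam + min_weight d w f \<le> (\<Sum>i\<le>d. w i)"
  shows "krull_dim (jet_fiber_ring d f m (\<lambda>_. 0)) \<le> enat ((m + 1) * d - lam)"
proof -
  let ?A = "mpol_in ({..d} \<times> {..m}) :: (nat \<times> nat, 'k) mpol set"
  obtain J where J: "jet_fiber_ring d f m (\<lambda>_. 0) = ring_of_type_algebra\<lparr>carrier := ?A\<rparr> Quot J" "ideal_of ?A J"
    "\<And>l. l \<le> m \<Longrightarrow> jet_equation m f l \<in> J" "\<And>i. i \<le> d \<Longrightarrow> mpol_var (i, 0) \<in> J"
    using jet_fiber_ring_quot[OF f(1), of m] by metis
  show ?thesis
    unfolding J(1)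
  proof (rule krull_dim_quot_le[OF subring_set_mpol_in J(2)])
    fix P n assume P: "\<And>i. i \<le> n \<Longrightarrow> prime_of ?A (P i)" "\<And>i. i \<le> n \<Longrightarrow> J \<subseteq> P i" "\<And>i. i < n \<Longrightarrow> P i \<subset> P (Suc i)"
    have "J \<subseteq> P 0" by (rule P(2)) simp
    have "n + lam \<le> (m + 1) * d"
    proof (rule jet_prime_chain_bound[OF f])
      show "lam + min_weight d w f \<le> (\<Sum>i\<le>d. w i)" if "\<And>i. i \<le> d \<Longrightarrow> 1 \<le> w i" for w
        by (rule phi) (rule that)
      show "prime_of ?A (P i)" if "i \<le> n" for i by (rule P(1)[OF that])
      show "P i \<subset> P (Suc i)" if "i < n" for i by (rule P(3)[OF that])
      show "jet_equation m f l \<in> P 0" if "l \<le> m" for l using J(3)[OF that] \<open>J \<subseteq> P 0\<close> by blast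
      show "mpol_var (i, 0) \<in> P 0" if "i \<le> d" for i using J(4)[OF that] \<open>J \<subseteq> P 0\<close> by blast
    qed
    then show "n \<le> (m + 1) * d - lam" by simp
  qed
qed

section \<open>Weights computing the minimal log discrepancy\<close>

text \<open>The function \<phi> of the overview, with integer values because its sign separates the
  two alternatives.\<close>

definition weight_discrepancy :: "nat \<Rightarrow> (nat, 'k::zero) mpol \<Rightarrow> (nat \<Rightarrow> nat) \<Rightarrow> int" where
  "weight_discrepancy d f w = (\<Sum>i\<le>d. int (w i)) - int (min_weight d w f)"

lemma le_min_weight: "f \<noteq> 0 \<Longrightarrow> (\<And>\<mu>. \<mu> \<in> Poly_Mapping.keys f \<Longrightarrow> n \<le> weight d w \<mu>) \<Longrightarrow> n \<le> min_weight d w f"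
  for f :: "(nat, 'k::zero) mpol"
  by (metis min_weight_attained)

lemma weight_discrepancy_scale:
  fixes f :: "(nat, 'k::zero) mpol"
  assumes "f \<noteq> 0" "\<And>i. i \<le> d \<Longrightarrow> w i = g * w' i"
  shows "int g * weight_discrepancy d f w' \<le> weight_discrepancy d f w"
proof -
  obtain \<mu> where \<mu>: "\<mu> \<in> Poly_Mapping.keys f" "weight d w' \<mu> = min_weight d w' f"
    using min_weight_attained[OF assms(1)] .
  have "weight d w \<mu> = g * weight d w' \<mu>"
    using assms(2) by (simp add: weight_def sum_distrib_left mult.assoc)
  then have "int (min_weight d w f) \<le> int g * int (min_weight d w' f)"
    using min_weight_le[OF \<mu>(1), of d w] \<mu>(2) by (simp flip: of_nat_mult)
  moreover have "(\<Sum>i\<le>d. int (w i)) = int g * (\<Sum>i\<le>d. int (w' i))"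
    using assms(2) by (simp add: sum_distrib_left)
  ultimately show ?thesis by (simp add: weight_discrepancy_def right_diff_distrib)
qed

text \<open>The least positive integer combination of the weights divides each of them, since a
  nonzero remainder would be a smaller one. Dividing its relation by \<open>g\<close> gives the
  Bezout relation for the quotients.\<close>

lemma primitive_weight_exists:
  fixes w :: "nat \<Rightarrow> nat"
  assumes "1 \<le> w 0"
  shows "\<exists>g w' v. 1 \<le> g \<and> (\<forall>i\<le>d. w i = g * w' i) \<and> (\<Sum>i\<le>d. int (w' i) * v i) = 1"
proof -
  define S where "S = (\<lambda>g :: nat. 1 \<le> g \<and> (\<exists>v. (\<Sum>i\<le>d. int (w i) * v i) = int g))"
  have single: "(\<Sum>i\<le>d. int (w i) * of_bool (i = j)) = int (w j)" if "j \<le> d" for j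
  proof -
    have "(\<Sum>i\<le>d. int (w i) * of_bool (i = j)) = (\<Sum>i\<le>d. if i = j then int (w j) else 0)"
      by (intro sum.cong) auto
    then show ?thesis using that by simp
  qed
  have "S (w 0)" unfolding S_def using assms single[of 0]
    by (intro conjI exI[of _ "\<lambda>i. of_bool (i = 0)"]) auto
  define g where "g = (LEAST g. S g)"
  have "S g" unfolding g_def using \<open>S (w 0)\<close> by (rule LeastI)
  then obtain v where g: "1 \<le> g" "(\<Sum>i\<le>d. int (w i) * v i) = int g" by (auto simp: S_def)
  have "w j mod g = 0" if j: "j \<le> d" for j
  proof (rule ccontr)
    assume nz: "w j mod g \<noteq> 0"
    have "(\<Sum>i\<le>d. int (w i) * (of_bool (i = j) - int (w j div g) * v i)) =
        (\<Sum>i\<le>d. int (w i) * of_bool (i = j)) - int (w j div g) * (\<Sum>i\<le>d. int (w i) * v i)"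
      by (simp add: right_diff_distrib sum_subtractf sum_distrib_left mult.left_commute)
    also have "\<dots> = int (w j) - int (w j div g) * int g" unfolding g(2) single[OF j] ..
    also have "\<dots> = int (w j mod g)" by (simp add: zmod_int zdiv_int minus_div_mult_eq_mod)
    finally have "S (w j mod g)" unfolding S_def using nz by (intro conjI exI[of _ "\<lambda>i. of_bool (i = j) - int (w j div g) * v i"]) auto
    then have "g \<le> w j mod g" unfolding g_def by (rule Least_le)
    moreover have "w j mod g < g" using g(1) by (intro mod_less_divisor) simp
    ultimately show False by simp
  qed
  then have dvd: "g dvd w j" if "j \<le> d" for j using that by (simp add: mod_eq_0_iff_dvd)
  define w' where "w' = (\<lambda>i. w i div g)"
  have w: "w i = g * w' i" if "i \<le> d" for i using dvd[OF that] by (simp add: w'_def)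
  have "int g * (\<Sum>i\<le>d. int (w' i) * v i) = (\<Sum>i\<le>d. int (w i) * v i)"
    using w by (simp add: sum_distrib_left mult.assoc)
  then have "(\<Sum>i\<le>d. int (w' i) * v i) = 1" using g by simp
  then show ?thesis using g(1) w by blast
qed

lemma mld_le_weight_discrepancy:
  fixes f :: "(nat, 'k::field) mpol"
  assumes "\<And>i. i \<le> d \<Longrightarrow> 1 \<le> w i" "(\<Sum>i\<le>d. int (w i) * v i) = 1" "f \<in> mpol_in {..d}" "f \<noteq> 0"
  shows "mld_MJ d (\<lambda>_. 0) f \<le> ereal (real_of_int (weight_discrepancy d f w))"
proof -
  obtain B P where BP: "prime_divisor_over d B P" "has_center d P (\<lambda>_. 0 :: 'k)"
    and le: "canonical_coeff d B P + 1 + min_weight d w f \<le> (\<Sum>i\<le>d. w i) + val_ideal B P (hypersurface_ideal d f)"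
    using toric_divisor[OF assms] by blast
  have "mld_MJ d (\<lambda>_. 0) f \<le>
      ereal (real (canonical_coeff d B P) + 1 - real 1 * real (val_ideal B P (hypersurface_ideal d f)))"
    unfolding mld_MJ_def mld_def using BP by (intro INF_lower2[of "(B, P)"]) auto
  also have "int (canonical_coeff d B P) + 1 - int (val_ideal B P (hypersurface_ideal d f)) \<le> weight_discrepancy d f w"
    using le unfolding weight_discrepancy_def by (simp flip: of_nat_sum)
  then have "real (canonical_coeff d B P) + 1 - real 1 * real (val_ideal B P (hypersurface_ideal d f)) \<le>
      real_of_int (weight_discrepancy d f w)" by linarith
  finally show ?thesis by simp
qed

lemma le_mld:
  fixes f :: "(nat, 'k::alg_closed_field) mpol"
  assumes f: "f \<in> mpol_in {..d}" "f \<noteq> 0" "newton_nondegenerate d f" "mpol_eval (\<lambda>_. 0) f = 0"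
    and le: "\<And>w. (\<And>i. i \<le> d \<Longrightarrow> 1 \<le> w i) \<Longrightarrow> int n \<le> weight_discrepancy d f w"
  shows "ereal (real n) \<le> mld_MJ d (\<lambda>_. 0) f"
  unfolding mld_MJ_def mld_def
proof (rule INF_greatest, clarify)
  fix B P assume BP: "prime_divisor_over d B P" "has_center d P (\<lambda>_. 0 :: 'k)"
  obtain w where w: "\<forall>i\<le>d. 1 \<le> w i" "(\<Sum>i\<le>d. w i) + val_ideal B P (hypersurface_ideal d f) \<le>
      canonical_coeff d B P + 1 + min_weight d w f"
    using log_discrepancy_ge[OF BP f] by blast
  have "int n \<le> weight_discrepancy d f w" using w(1) by (intro le) auto
  also have "\<dots> \<le> int (canonical_coeff d B P) + 1 - int (val_ideal B P (hypersurface_ideal d f))"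
    using w(2) unfolding weight_discrepancy_def by (simp flip: of_nat_sum)
  finally have "real n \<le> real (canonical_coeff d B P) + 1 - real (val_ideal B P (hypersurface_ideal d f))"
    by linarith
  then show "ereal (real n) \<le>
      ereal (real (canonical_coeff d B P) + 1 - real 1 * real (val_ideal B P (hypersurface_ideal d f)))"
    by simp
qed

text \<open>Multiples of \<open>w\<close> drive the discrepancy to -\<infinity>, but toric divisors
  come from primitive weights. Adding 1 to the entry of index 1, which exists as
  \<open>d \<ge> 1\<close>, makes the multiple primitive and raises the discrepancy by at most
  1.\<close>

lemma mld_minus_infinity:
  fixes f :: "(nat, 'k::field) mpol"
  assumes d: "d \<ge> 1" and w: "\<And>i. i \<le> d \<Longrightarrow> 1 \<le> w i" and neg: "weight_discrepancy d f w < 0"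
    and f: "f \<in> mpol_in {..d}" "f \<noteq> 0"
  shows "mld_MJ d (\<lambda>_. 0) f = - \<infinity>"
proof (rule ereal_bot)
  fix r :: real
  obtain N0 :: nat where N0: "1 - r \<le> real N0" using real_arch_simple by blast
  define N where "N = N0 + 1"
  define w' where "w' = (\<lambda>i. N * w 0 * w i + (if i = 1 then 1 else 0))"
  \<comment> \<open>a weight on almost the same ray, but primitive\<close>
  define v where "v = (\<lambda>i :: nat. if i = 0 then int N * int (w 1) ^ 2 else if i = 1 then 1 - int N * int (w 0) * int (w 1) else 0 :: int)"
  have w0: "1 \<le> w 0" by (rule w) simp
  have pos: "1 \<le> w' i" if "i \<le> d" for i
    using w[OF that] w0 by (simp add: w'_def N_def)
  \<comment> \<open>With a = N * w 0 * w 1 the two surviving terms are a * a and (1 + a) * (1 - a),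
    whose sum is 1.\<close>
  have "(\<Sum>i\<le>d. int (w' i) * v i) = (\<Sum>i\<in>{0, 1}. int (w' i) * v i)"
    using d by (intro sum.mono_neutral_right) (auto simp: v_def)
  also have "\<dots> = 1" by (simp add: w'_def v_def algebra_simps power2_eq_square)
  finally have bezout: "(\<Sum>i\<le>d. int (w' i) * v i) = 1" .
  have "N * w 0 * min_weight d w f \<le> min_weight d w' f"
  proof (rule le_min_weight[OF f(2)])
    fix \<mu> assume \<mu>: "\<mu> \<in> Poly_Mapping.keys f"
    have "N * w 0 * min_weight d w f \<le> N * w 0 * weight d w \<mu>" using min_weight_le[OF \<mu>] by simp
    also have "\<dots> \<le> weight d w' \<mu>"
      unfolding weight_def sum_distrib_left by (intro sum_mono) (simp add: w'_def distrib_right)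
    finally show "N * w 0 * min_weight d w f \<le> weight d w' \<mu>" .
  qed
  then have "int N * int (w 0) * int (min_weight d w f) \<le> int (min_weight d w' f)"
    by (simp flip: of_nat_mult)
  moreover have "(\<Sum>i\<le>d. int (w' i)) = int N * int (w 0) * (\<Sum>i\<le>d. int (w i)) + 1"
    using d by (simp add: w'_def sum.distrib sum_distrib_left if_distrib[of int] cong: if_cong)
  ultimately have "weight_discrepancy d f w' \<le> int N * int (w 0) * weight_discrepancy d f w + 1"
    by (simp add: weight_discrepancy_def right_diff_distrib)
  also have "int N * int (w 0) * weight_discrepancy d f w \<le> int N * int (w 0) * (- 1)"
    using neg by (intro mult_left_mono) auto
  also have "\<dots> \<le> - int N" using w0 mult_left_mono[of 1 "int (w 0)" "int N"] by simp
  finally have "weight_discrepancy d f w' \<le> 1 - int N" by simp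
  then have "real_of_int (weight_discrepancy d f w') \<le> r" using N0 by (simp add: N_def)
  then have "ereal (real_of_int (weight_discrepancy d f w')) \<le> ereal r" by simp
  with mld_le_weight_discrepancy[OF pos bezout f] show "mld_MJ d (\<lambda>_. 0) f \<le> ereal r" by (rule order_trans)
qed

text \<open>Each of the d + 1 coordinates leaves at least m + 1 - w i free coefficients; subtracting
  them from (m + 1) * d leaves at most the sum of the weights minus m + 1. Truncation at 0 only
  increases the count of free coefficients.\<close>

lemma jet_s_le:
  fixes f :: "(nat, 'k::field) mpol"
  assumes f: "f \<in> mpol_in {..d}" and w: "\<And>i. i \<le> d \<Longrightarrow> 1 \<le> w i" and m: "m < min_weight d w f"
  shows "jet_s d f m (\<lambda>_. 0) \<le> ereal (real (\<Sum>i\<le>d. w i) - real (m + 1))"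
proof -
  have "ereal (real (\<Sum>i\<le>d. m + 1 - w i)) = ereal_of_enat (enat (\<Sum>i\<le>d. m + 1 - w i))" by simp
  also have "\<dots> \<le> ereal_of_enat (krull_dim (jet_fiber_ring d f m (\<lambda>_. 0)))"
    using le_krull_dim_jet_fiber[OF f w m] by (simp only: ereal_of_enat_le_iff)
  finally have "jet_s d f m (\<lambda>_. 0) \<le> ereal (real ((m + 1) * d)) - ereal (real (\<Sum>i\<le>d. m + 1 - w i))"
    unfolding jet_s_def by (intro ereal_minus_mono) auto
  moreover have "(m + 1) * (d + 1) \<le> (\<Sum>i\<le>d. m + 1 - w i) + (\<Sum>i\<le>d. w i)"
  proof -
    have "(\<Sum>i\<le>d. m + 1) \<le> (\<Sum>i\<le>d. (m + 1 - w i) + w i)" by (intro sum_mono) simp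
    then show ?thesis by (simp add: sum.distrib algebra_simps)
  qed
  then have "real ((m + 1) * (d + 1)) \<le> real ((\<Sum>i\<le>d. m + 1 - w i) + (\<Sum>i\<le>d. w i))" by (simp only: of_nat_le_iff)
  ultimately show ?thesis by (elim order_trans) (simp add: algebra_simps)
qed

lemma le_jet_s:
  fixes f :: "(nat, 'k::alg_closed_field) mpol"
  assumes f: "f \<in> mpol_in {..d}" "f \<noteq> 0" "newton_nondegenerate d f"
    and le: "\<And>w. (\<And>i. i \<le> d \<Longrightarrow> 1 \<le> w i) \<Longrightarrow> int n \<le> weight_discrepancy d f w" and "n \<le> d"
  shows "ereal (real n) \<le> jet_s d f m (\<lambda>_. 0)"
proof -
  have "n + min_weight d w f \<le> (\<Sum>i\<le>d. w i)" if "\<And>i. i \<le> d \<Longrightarrow> 1 \<le> w i" for w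
  proof -
    have "int n \<le> weight_discrepancy d f w" by (rule le) (rule that)
    then show ?thesis unfolding weight_discrepancy_def by (simp flip: of_nat_sum)
  qed
  then have "krull_dim (jet_fiber_ring d f m (\<lambda>_. 0)) \<le> enat ((m + 1) * d - n)"
    by (rule krull_dim_jet_fiber_le[OF f])
  then have "ereal_of_enat (krull_dim (jet_fiber_ring d f m (\<lambda>_. 0))) \<le> ereal_of_enat (enat ((m + 1) * d - n))"
    by (simp only: ereal_of_enat_le_iff)
  then have "ereal (real ((m + 1) * d)) - ereal (real ((m + 1) * d - n)) \<le> jet_s d f m (\<lambda>_. 0)"
    unfolding jet_s_def by (intro ereal_minus_mono) auto
  \<comment> \<open>Makes the truncated subtraction in \<open>krull_dim_jet_fiber_le\<close>
    exact.\<close>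
  moreover have "n \<le> (m + 1) * d" using \<open>n \<le> d\<close> by simp
  ultimately show ?thesis by (simp add: of_nat_diff)
qed

text \<open>Discrepancy at most \<open>c\<close> means that every exponent of \<open>f\<close> has
  weight at least the sum of the weights minus \<open>c\<close>. So
  \<open>finitely_many_test_weights\<close> applies to all exponents at once, and \<open>T\<close>
  depends on \<open>d\<close> and \<open>c\<close> but not on \<open>f\<close>.\<close>

lemma test_weights:
  "\<exists>T :: (nat \<Rightarrow> nat) set. finite T \<and> (\<forall>w\<in>T. \<forall>i\<le>d. 1 \<le> w i) \<and>
    (\<forall>f :: (nat, 'k::zero) mpol. \<forall>w. f \<noteq> 0 \<longrightarrow> (\<forall>i\<le>d. 1 \<le> w i) \<longrightarrow> weight_discrepancy d f w \<le> c \<longrightarrow>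
      (\<exists>w'\<in>T. weight_discrepancy d f w' \<le> c))"
proof -
  obtain T where T: "finite T" "\<forall>w\<in>T. \<forall>i\<le>d. 1 \<le> w i"
    "\<forall>w. (\<forall>i\<le>d. 1 \<le> w i) \<longrightarrow> (\<exists>w'\<in>T. \<forall>m :: nat \<Rightarrow> nat. (\<Sum>i\<le>d. int (w i * m i)) \<ge> (\<Sum>i\<le>d. int (w i)) - c \<longrightarrow>
       (\<Sum>i\<le>d. int (w' i * m i)) \<ge> (\<Sum>i\<le>d. int (w' i)) - c)"
    using finitely_many_test_weights[of d c] by (elim exE conjE) (rule that; assumption)
  have "\<exists>w'\<in>T. weight_discrepancy d f w' \<le> c"
    if f: "f \<noteq> 0" and w: "\<forall>i\<le>d. 1 \<le> w i" "weight_discrepancy d f w \<le> c" for f :: "(nat, 'k) mpol" and w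
  proof -
    obtain w' where w': "w' \<in> T" "\<And>m :: nat \<Rightarrow> nat. (\<Sum>i\<le>d. int (w i * m i)) \<ge> (\<Sum>i\<le>d. int (w i)) - c \<Longrightarrow>
       (\<Sum>i\<le>d. int (w' i * m i)) \<ge> (\<Sum>i\<le>d. int (w' i)) - c"
      using T(3)[THEN spec, THEN mp, OF w(1)] by blast
    obtain \<mu> where \<mu>: "\<mu> \<in> Poly_Mapping.keys f" "weight d w' \<mu> = min_weight d w' f" using min_weight_attained[OF f] .
    have "(\<Sum>i\<le>d. int (w i)) - c \<le> int (weight d w \<mu>)"
      using w(2) min_weight_le[OF \<mu>(1), of d w] unfolding weight_discrepancy_def by linarith
    then have "(\<Sum>i\<le>d. int (w' i)) - c \<le> int (weight d w' \<mu>)"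
      using w'(2)[of "Poly_Mapping.lookup \<mu>"] by (simp add: weight_def)
    then show ?thesis using w'(1) \<mu>(2) unfolding weight_discrepancy_def by (intro bexI[of _ w']) auto
  qed
  then show ?thesis using T(1,2) by blast
qed

theorem theorem1p10:
  fixes d :: nat
  assumes "d \<ge> 1"
  shows "\<exists>N::nat. \<forall>f :: (nat, 'k::alg_closed_field) mpol.
    f \<in> mpol_in {..d} \<and> f \<noteq> 0 \<and> newton_nondegenerate d f \<and> mpol_eval (\<lambda>_. 0) f = 0 \<and>
    affine_variety (hypersurface_ring d f) \<longrightarrow>
    (\<exists>m\<le>N.
       (jet_s d f m (\<lambda>_. 0) = mld_MJ d (\<lambda>_. 0) f \<and> mld_MJ d (\<lambda>_. 0) f \<ge> 0) \<or>
       (mld_MJ d (\<lambda>_. 0) f = -\<infinity> \<and> jet_s d f m (\<lambda>_. 0) < 0))"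
proof -
  define testing where "testing = (\<lambda>(c :: int) (T :: (nat \<Rightarrow> nat) set). finite T \<and> (\<forall>w\<in>T. \<forall>i\<le>d. 1 \<le> w i) \<and>
    (\<forall>f :: (nat, 'k) mpol. \<forall>w. f \<noteq> 0 \<longrightarrow> (\<forall>i\<le>d. 1 \<le> w i) \<longrightarrow> weight_discrepancy d f w \<le> c \<longrightarrow>
      (\<exists>w'\<in>T. weight_discrepancy d f w' \<le> c)))"
  have "\<forall>c. \<exists>T. testing c T" unfolding testing_def by (intro allI test_weights)
  then obtain T where T0: "testing c (T c)" for c by metis
  have T: "finite (T c)" "\<And>w i. w \<in> T c \<Longrightarrow> i \<le> d \<Longrightarrow> 1 \<le> w i" for c
    using T0[of c] by (auto simp: testing_def)
  have test: "\<exists>w'\<in>T c. weight_discrepancy d f w' \<le> c"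
    if "f \<noteq> 0" "\<And>i. i \<le> d \<Longrightarrow> 1 \<le> w i" "weight_discrepancy d f w \<le> c" for c w and f :: "(nat, 'k) mpol"
    using T0[of c] that unfolding testing_def by blast
  \<comment> \<open>The threshold -1 detects a negative discrepancy, and \<open>d\<close> is the
    largest value the least discrepancy can have. Every jet order used below is at most the entry
    sum of one test weight, so the total over all of them is a bound.\<close>
  define N where "N = (\<Sum>w\<in>(\<Union>c\<in>{- 1..int d}. T c). \<Sum>i\<le>d. w i)"
  have N: "(\<Sum>i\<le>d. w i) \<le> N" if "c \<in> {- 1..int d}" "w \<in> T c" for c w
    unfolding N_def using that T(1) by (intro member_le_sum[where f = "\<lambda>w. \<Sum>i\<le>d. w i"]) auto
  show ?thesis
  proof (rule exI[of _ N], intro allI impI)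
    fix f :: "(nat, 'k) mpol"
    assume "f \<in> mpol_in {..d} \<and> f \<noteq> 0 \<and> newton_nondegenerate d f \<and> mpol_eval (\<lambda>_. 0) f = 0 \<and>
      affine_variety (hypersurface_ring d f)"
    then have f: "f \<in> mpol_in {..d}" "f \<noteq> 0" "newton_nondegenerate d f" "mpol_eval (\<lambda>_. 0) f = 0" by auto
    show "\<exists>m\<le>N. (jet_s d f m (\<lambda>_. 0) = mld_MJ d (\<lambda>_. 0) f \<and> mld_MJ d (\<lambda>_. 0) f \<ge> 0) \<or>
       (mld_MJ d (\<lambda>_. 0) f = -\<infinity> \<and> jet_s d f m (\<lambda>_. 0) < 0)"
    proof (cases "\<exists>w. (\<forall>i\<le>d. 1 \<le> w i) \<and> weight_discrepancy d f w < 0")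
      case True
      then obtain w where w: "\<And>i. i \<le> d \<Longrightarrow> 1 \<le> w i" "weight_discrepancy d f w < 0" by blast
      have "weight_discrepancy d f w \<le> - 1" using w(2) by simp
      then obtain w' where w': "w' \<in> T (- 1)" "weight_discrepancy d f w' \<le> - 1" using test[where f = f and w = w and c = "- 1"] f(2) w(1) by blast
      \<comment> \<open>As the discrepancy of \<open>w'\<close> is negative, its minimal weight
        exceeds this sum. The jets of contact order \<open>w'\<close> are thus still unobstructed at
        order \<open>m\<close>, and the bound for \<open>jet_s\<close> is -1.\<close>
      define m where "m = (\<Sum>i\<le>d. w' i)"
      have "m < min_weight d w' f" using w'(2) unfolding weight_discrepancy_def m_def by (simp flip: of_nat_sum)
      then have "jet_s d f m (\<lambda>_. 0) \<le> ereal (real (\<Sum>i\<le>d. w' i) - real (m + 1))"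
        by (rule jet_s_le[OF f(1), rotated]) (rule T(2)[OF w'(1)])
      also have "\<dots> < 0" by (simp add: m_def)
      finally show ?thesis
        using mld_minus_infinity[where w = w and d = d, OF assms _ w(2) f(1,2)] w(1) N[OF _ w'(1)]
        by (intro exI[of _ m]) (simp add: m_def)
    next
      case False
      define L where "L = (LEAST n. \<exists>w. (\<forall>i\<le>d. 1 \<le> w i) \<and> weight_discrepancy d f w = int n)"
      have nonneg: "weight_discrepancy d f w = int (nat (weight_discrepancy d f w))" if "\<forall>i\<le>d. 1 \<le> w i" for w
        using False that by (auto simp: not_less)
      have le: "int L \<le> weight_discrepancy d f w" if w: "\<And>i. i \<le> d \<Longrightarrow> 1 \<le> w i" for w
      proof -
        have "L \<le> nat (weight_discrepancy d f w)" unfolding L_def using nonneg[of w] w by (intro Least_le exI[of _ w]) auto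
        moreover have "0 \<le> weight_discrepancy d f w" using False w by (auto simp: not_less)
        ultimately show ?thesis by (simp add: le_nat_iff)
      qed
      have one: "\<forall>i\<le>d. (1 :: nat) \<le> (\<lambda>_. 1) i" by simp
      have "\<exists>w. (\<forall>i\<le>d. 1 \<le> w i) \<and> weight_discrepancy d f w = int L"
        unfolding L_def
        by (rule LeastI_ex[of "\<lambda>n. \<exists>w. (\<forall>i\<le>d. 1 \<le> w i) \<and> weight_discrepancy d f w = int n"])
          (rule exI, rule exI, rule conjI[OF one nonneg[OF one]])
      then obtain w where w: "\<And>i. i \<le> d \<Longrightarrow> 1 \<le> w i" "weight_discrepancy d f w = int L" by blast
      \<comment> \<open>The weight with all entries 1 has discrepancy at most d + 1 - 1, because
        \<open>f\<close> has no constant term; hence no threshold above \<open>d\<close>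
        occurs.\<close>
      have "1 \<le> min_weight d (\<lambda>_. 1) f" using f by (intro min_weight_pos) auto
      then have "L \<le> d" using le[of "\<lambda>_. 1"] by (simp add: weight_discrepancy_def)
      have mld: "mld_MJ d (\<lambda>_. 0) f = ereal (real L)"
      proof (rule antisym)
        show "ereal (real L) \<le> mld_MJ d (\<lambda>_. 0) f" by (rule le_mld[OF f]) (rule le)
        \<comment> \<open>The minimum is also reached at a primitive weight, for which a toric
          divisor exists: dividing the weight by \<open>g\<close> cannot increase a nonnegative
          discrepancy.\<close>
        obtain g w' v where g: "1 \<le> g" "\<And>i. i \<le> d \<Longrightarrow> w i = g * w' i" "(\<Sum>i\<le>d. int (w' i) * v i) = 1"
          using primitive_weight_exists[of w d] w(1) by blast
        have pos: "1 \<le> w' i" if "i \<le> d" for i using w(1)[OF that] g(2)[OF that] by (cases "w' i") auto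
        have "int L \<le> weight_discrepancy d f w'" by (rule le) (rule pos)
        then have "1 * weight_discrepancy d f w' \<le> int g * weight_discrepancy d f w'"
          using g(1) by (intro mult_right_mono) auto
        also have "\<dots> \<le> int L" using weight_discrepancy_scale[where w = w and w' = w' and d = d and g = g, OF f(2)] g(2) w(2) by simp
        finally have "real_of_int (weight_discrepancy d f w') \<le> real L" by simp
        then have "ereal (real_of_int (weight_discrepancy d f w')) \<le> ereal (real L)" by simp
        with mld_le_weight_discrepancy[OF _ g(3) f(1,2)] pos show "mld_MJ d (\<lambda>_. 0) f \<le> ereal (real L)"
          by (meson order_trans)
      qed
      obtain w' where w': "w' \<in> T (int L)" "weight_discrepancy d f w' \<le> int L"
        using test[where f = f and w = w and c = "int L"] f(2) w by auto
      \<comment> \<open>The largest order up to which contact order \<open>w'\<close> alone makes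
        all jet equations trivial; there the bound of \<open>jet_s_le\<close> is exactly the
        discrepancy of \<open>w'\<close>.\<close>
      define m where "m = min_weight d w' f - 1"
      have "1 \<le> min_weight d w' f" by (rule min_weight_pos[OF f(1,2,4) T(2)[OF w'(1)]])
      then have m: "m < min_weight d w' f" "m + 1 = min_weight d w' f" by (auto simp: m_def)
      have "jet_s d f m (\<lambda>_. 0) \<le> ereal (real (\<Sum>i\<le>d. w' i) - real (m + 1))"
        by (rule jet_s_le[OF f(1) _ m(1)]) (rule T(2)[OF w'(1)])
      also have "\<dots> \<le> ereal (real L)"
        using w'(2) unfolding m(2) weight_discrepancy_def by (simp flip: of_nat_sum)
      finally have "jet_s d f m (\<lambda>_. 0) = ereal (real L)"
        by (intro antisym le_jet_s[OF f(1-3)] le \<open>L \<le> d\<close>)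
      moreover have "m \<le> N"
      proof -
        have "int L \<le> weight_discrepancy d f w'" by (rule le) (rule T(2)[OF w'(1)])
        then have "m \<le> (\<Sum>i\<le>d. w' i)" using m(2) unfolding weight_discrepancy_def by (simp flip: of_nat_sum)
        also have "\<dots> \<le> N" using \<open>L \<le> d\<close> by (intro N[OF _ w'(1)]) auto
        finally show ?thesis .
      qed
      ultimately show ?thesis using mld by (intro exI[of _ m]) simp
    qed
  qed
qed

end
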